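(* Let $\theta\in\mathbb{R}$, $A_\theta:=(\theta-\tfrac{\pi}{2},\theta+\tfrac{\pi}{2})$, let $X\subset\mathbb{C}_x$ be a domain and $S\subset\mathbb{C}_\hbar$ a sectorial domain at the origin with opening $A_\theta$. Consider the Riccati equation $$\hbar\,\partial_xf=af^2+bf+c$$ whose coefficients $a,b,c$ are holomorphic functions of $(x,\hbar)\in X\times S$ admitting locally uniform asymptotic expansions $\hat a=\sum a_k\hbar^k$, $\hat b=\sum b_k\hbar^k$, $\hat c=\sum c_k\hbar^k$ with coefficients holomorphic on $X$, as $\hbar\to0$ along $A_\theta$. Assume that $D_0=b_0^2-4a_0c_0$ is not identically zero. Fix $x_0\in X$ with $D_0(x_0)\ne0$, a square-root branch $\sqrt{D_0}$ near $x_0$, and a sign $\alpha\in\{+,-\}$. Assume: (1) there is a WKB $(\theta,\alpha)$-halfstrip domain $W\subset X$ containing $x_0$; if $\alpha=-$, assume in addition that $a_0$ is nonvanishing on $W$; (if $\alpha=+$, the branch $\sqrt{D_0}$ is the one for which $f_0^+$ is holomorphic on $W$, see the context); (2) the asymptotic expansions of $a,b,c$ are valid with Gevrey bounds as $\hbar\to0$ along $\bar A_\theta=[\theta-\tfrac{\pi}{2},\theta+\tfrac{\pi}{2}]$, with respect to the asymptotic scale $\sqrt{D_0}$, uniformly for all $x\in W$. Then the local formal solution $\hat f_\alpha$ is Borel summable in the direction $\theta$ uniformly near $x_0$, and the canonical local exact solution is its Borel resummation. Namely, for any compactly contained domain $U_0\Subset W$ there is a sectorial domain $S_0\subset S$ with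 opening $A_\theta$ such that the unique holomorphic solution $f_\alpha^\theta$ on $U_0\times S_0$ which is Gevrey asymptotic to $\hat f_\alpha$ as $\hbar\to0$ along $\bar A_\theta$ uniformly for $x\in U_0$ exists and is the uniform Borel resummation of $\hat f_\alpha$ in the direction $\theta$: for all $\hbar\in S_0$ and uniformly for all $x\in U_0$, $$f_\alpha^\theta(x,\hbar)=\mathcal{S}_\theta\big[\hat f_\alpha\big](x,\hbar).$$
   Context: Sectorial domains. Let $[\mathbb{C}_\hbar:0]=[0,\infty)\times(\mathbb{R}/2\pi\mathbb{Z})$ be the real-oriented blowup of $\mathbb{C}_\hbar$ at $0$. A sectorial domain with opening $A$ is a simply connected domain $S\subset\mathbb{C}_\hbar\setminus\{0\}$ whose closure in $[\mathbb{C}_\hbar:0]$ meets the circle $\{0\}\times\mathbb{R}/2\pi\mathbb{Z}$ in the closed arc $\bar A$, of nonzero length. Locally uniform asymptotics along $A$. $g\sim\hat g=\sum g_k\hbar^k$ means: every point of $X$ has a neighbourhood $V$ such that for every $n\ge0$ and every subarc $A_0$ compactly contained in $A$ there are a sectorial domain $S'\subset S$ with opening $A_0$ and a constant $C>0$ with $|g-\sum_{k<n}g_k\hbar^k|\le C|\hbar|^n$ on $V\times S'$. Gevrey asymptotics along $\bar A$. $g\simeq\hat g$ along $\bar A$ with respect to a scale $\chi(x)$, uniformly for $x\in W$, means: there are $C,M>0$ such that $|g(x,\hbar)-\sum_{k=0}^{n-1}g_k(x)\hbar^k|\le|\chi(x)|\,CM^nn!\,|\hbar|^n$ for all $n\ge0$,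 all $x\in W$, and all sufficiently small $\hbar$ in the sectorial domain (with opening $A$) where $g$ is defined. If no scale is mentioned, $\chi=1$. WKB halfstrips. Put $\Phi(x)=\int_{x_0}^x\sqrt{D_0(t)}\,dt$. A WKB $(\theta,\pm)$-halfstrip domain containing $x_0$ is a domain $W=\Psi(H)\subset X$, where $H=\{z:\operatorname{dist}(z,z_1+e^{i\theta}\mathbb{R}_\pm)<r\}$ for some $z_1\in\mathbb{C}$, $r>0$ with $0\in H$ (here $\mathbb{R}_+=[0,\infty)$, $\mathbb{R}_-=(-\infty,0]$), and $\Psi:H\to X$ is a holomorphic map which is the analytic continuation to $H$ of the local inverse of $\Phi$ at $0=\Phi(x_0)$, $\Psi(0)=x_0$. Then $\Psi$ is a local biholomorphism, $D_0$ has no zeros on $W$, and $\sqrt{D_0}$ extends to a univalued function on $W$. Leading-order and formal solutions. If $a_0\not\equiv0$, $f_0^\pm:=\frac{-b_0\pm\sqrt{D_0}}{2a_0}$; if $a_0\equiv0$, then $\sqrt{D_0}:=b_0$ and $f_0^+:=-c_0/b_0$ (only the sign $+$ is considered). Convention: the branch $\sqrt{D_0}$ is labelled so that $f_0^+$ is holomorphic (automatic where $a_0$ is nonvanishing). The formal solution $\hat f_\alpha=\sum_{k\ge0}f_k^\alpha(x)\hbar^k$ is the unique formal power series with holomorphic coefficients on $W$ solving $\hbar\partial_x\hat f=\hat a\hat f^2+\hat b\hat f+\hat c$ with leading term $f_0^\alpha$. Uniform Borel summability. $\hat f=\sum f_k(x)\hbar^k$ is Borel summable in the direction $\theta$ uniformly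 on $U_0$ if its formal Borel transform $\hat\phi(x,\xi)=\sum_{k\ge0}\frac{1}{k!}f_{k+1}(x)\xi^k$ converges uniformly for $x\in U_0$ and $\xi$ in some disc around $0$, and continues analytically to a holomorphic function $\phi$ on $U_0\times\Xi_\theta$, for some $\Xi_\theta=\{\xi:\operatorname{dist}(\xi,e^{i\theta}\mathbb{R}_+)<\epsilon\}$, $\epsilon>0$, with $|\phi(x,\xi)|\le Ke^{L|\xi|}$ on $U_0\times\Xi_\theta$ for some constants $K,L>0$. Its Borel resummation is $\mathcal{S}_\theta[\hat f](x,\hbar):=f_0(x)+\int_{e^{i\theta}\mathbb{R}_+}e^{-\xi/\hbar}\phi(x,\xi)\,d\xi$, the integral converging uniformly for $x\in U_0$.
   Formalization: A sectorial domain is additionally required to contain, near 0, everything between two sides leaving the end points of its arc with finite slope in the blowup (for opening A_θ: S contains a Borel disc); without this the claim fails, e.g. for S = {Re(1/ħ) > 1+2√(1+|Im(1/ħ)|)}. *)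

theory Defs
  imports "HOL-Complex_Analysis.Complex_Analysis" "HOL-Computational_Algebra.Formal_Power_Series"
begin

text \<open>
  Functions of \<open>(x, h)\<close> are curried. A formal power series in \<open>h\<close> whose coefficients are functions
  of \<open>x\<close> is given by its coefficients, \<open>gh :: nat \<Rightarrow> complex \<Rightarrow> complex\<close>.
\<close>

definition domain :: "complex set \<Rightarrow> bool" where
  "domain U \<longleftrightarrow> open U \<and> connected U \<and> U \<noteq> {}"

definition compactly_contained :: "complex set \<Rightarrow> complex set \<Rightarrow> bool" where
  "compactly_contained U W \<longleftrightarrow> compact (closure U) \<and> closure U \<subseteq> W"

text \<open>Complex differentiability of a function of two complex variables; only used on open sets.\<close>

definition holomorphic2_on :: "(complex \<Rightarrow> complex \<Rightarrow> complex) \<Rightarrow> (complex \<times> complex) set \<Rightarrow> bool" where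
  "holomorphic2_on F U \<longleftrightarrow>
     (\<forall>p\<in>U. \<exists>A B. ((\<lambda>(x, h). F x h) has_derivative (\<lambda>(u, v). A * u + B * v)) (at p))"


subsection \<open>Sectorial domains\<close>

text \<open>
  The real-oriented blowup of the plane at \<open>0\<close> is identified with the closed subset
  \<open>{(r, u). 0 \<le> r \<and> cmod u = 1}\<close> of \<open>real \<times> complex\<close>, the class of the angle \<open>t\<close> modulo \<open>2 * pi\<close> being
  represented by \<open>cis t\<close>. The punctured plane sits in it by the following map, and the boundary
  circle is \<open>r = 0\<close>.
\<close>

definition blowup_embed :: "complex \<Rightarrow> real \<times> complex" where
  "blowup_embed h = (cmod h, sgn h)"

text \<open>
  The opening is the open arc \<open>(\<alpha>, \<beta>)\<close>. The last clause makes explicit that \<open>S\<close> is really attached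
  to the boundary circle along its opening: near \<open>0\<close> it contains everything between two sides that
  leave the end points of the arc with finite slope in the blowup. Straight sectors and the Borel
  discs \<open>{h. Re (cis \<theta> / h) > R}\<close> satisfy it. Without it, a neighbourhood of a curve that oscillates
  in angle while tending to \<open>0\<close> would be a sectorial domain, and so would
  \<open>{h. Re (1 / h) > 1 + sqrt \<bar>Im (1 / h)\<bar>}\<close> with opening \<open>(- pi / 2, pi / 2)\<close>; Gevrey asymptotics on
  such sets do not imply Borel summability.
\<close>

definition sectorial_domain :: "real \<Rightarrow> real \<Rightarrow> complex set \<Rightarrow> bool" where
  "sectorial_domain \<alpha> \<beta> S \<longleftrightarrow>
     \<alpha> < \<beta> \<and> \<beta> \<le> \<alpha> + 2 * pi \<and>
     domain S \<and> simply_connected S \<and> 0 \<notin> S \<and>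
     {u. (0, u) \<in> closure (blowup_embed ` S)} = cis ` {\<alpha>..\<beta>} \<and>
     (\<exists>\<epsilon>>0. \<exists>K\<ge>0. \<forall>r t. 0 < r \<and> r < \<epsilon> \<and> \<alpha> + K * r < t \<and> t < \<beta> - K * r
        \<longrightarrow> of_real r * cis t \<in> S)"


subsection \<open>Asymptotic expansions\<close>

definition asym_remainder ::
  "(complex \<Rightarrow> complex \<Rightarrow> complex) \<Rightarrow> (nat \<Rightarrow> complex \<Rightarrow> complex) \<Rightarrow> nat \<Rightarrow> complex \<Rightarrow> complex \<Rightarrow> complex" where
  "asym_remainder g gh n x h = g x h - (\<Sum>k<n. gh k x * h ^ k)"

definition locally_uniform_asymptotics ::
  "complex set \<Rightarrow> real \<Rightarrow> real \<Rightarrow> complex set \<Rightarrow> (complex \<Rightarrow> complex \<Rightarrow> complex) \<Rightarrow>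
   (nat \<Rightarrow> complex \<Rightarrow> complex) \<Rightarrow> bool" where
  "locally_uniform_asymptotics X \<alpha> \<beta> S g gh \<longleftrightarrow>
     (\<forall>p\<in>X. \<exists>V. open V \<and> p \<in> V \<and> V \<subseteq> X \<and>
        (\<forall>n \<alpha>' \<beta>'. \<alpha> < \<alpha>' \<and> \<alpha>' < \<beta>' \<and> \<beta>' < \<beta> \<longrightarrow>
           (\<exists>S' C. sectorial_domain \<alpha>' \<beta>' S' \<and> S' \<subseteq> S \<and> C > 0 \<and>
              (\<forall>x\<in>V. \<forall>h\<in>S'. cmod (asym_remainder g gh n x h) \<le> C * cmod h ^ n))))"

definition gevrey_asymptotics ::
  "complex set \<Rightarrow> complex set \<Rightarrow> (complex \<Rightarrow> complex) \<Rightarrow> (complex \<Rightarrow> complex \<Rightarrow> complex) \<Rightarrow>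
   (nat \<Rightarrow> complex \<Rightarrow> complex) \<Rightarrow> bool" where
  "gevrey_asymptotics W S \<omega> g gh \<longleftrightarrow>
     (\<exists>C>0. \<exists>M>0. \<exists>\<delta>>0. \<forall>n. \<forall>x\<in>W. \<forall>h\<in>S. cmod h < \<delta> \<longrightarrow>
        cmod (asym_remainder g gh n x h) \<le> cmod (\<omega> x) * C * M ^ n * fact n * cmod h ^ n)"


subsection \<open>WKB halfstrips\<close>

definition sqrt_branch :: "complex set \<Rightarrow> (complex \<Rightarrow> complex) \<Rightarrow> (complex \<Rightarrow> complex) \<Rightarrow> bool" where
  "sqrt_branch U D q \<longleftrightarrow> q holomorphic_on U \<and> (\<forall>x\<in>U. (q x)\<^sup>2 = D x)"

definition halfstrip :: "real \<Rightarrow> real \<Rightarrow> complex \<Rightarrow> real \<Rightarrow> complex set" where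
  "halfstrip \<theta> \<sigma> z1 r = {z. infdist z {z1 + cis \<theta> * of_real (\<sigma> * t) |t. 0 \<le> t} < r}"

text \<open>
  Here \<open>q\<close> is the square root of the discriminant near \<open>x0\<close>, and the sign \<open>\<sigma>\<close> is \<open>1\<close> or \<open>-1\<close>.
  The integral is only used for \<open>x\<close> near \<open>x0\<close>.
\<close>

definition wkb_halfstrip ::
  "complex set \<Rightarrow> complex \<Rightarrow> (complex \<Rightarrow> complex) \<Rightarrow> real \<Rightarrow> real \<Rightarrow> complex set \<Rightarrow> bool" where
  "wkb_halfstrip X x0 q \<theta> \<sigma> W \<longleftrightarrow>
     (\<exists>z1 r \<Psi>. r > 0 \<and> 0 \<in> halfstrip \<theta> \<sigma> z1 r \<and>
        \<Psi> holomorphic_on halfstrip \<theta> \<sigma> z1 r \<and> \<Psi> 0 = x0 \<and>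
        (\<forall>\<^sub>F x in nhds x0. \<Psi> (contour_integral (linepath x0 x) q) = x) \<and>
        W = \<Psi> ` halfstrip \<theta> \<sigma> z1 r \<and> W \<subseteq> X)"


subsection \<open>The Riccati equation\<close>

definition leading_discriminant ::
  "(nat \<Rightarrow> complex \<Rightarrow> complex) \<Rightarrow> (nat \<Rightarrow> complex \<Rightarrow> complex) \<Rightarrow> (nat \<Rightarrow> complex \<Rightarrow> complex) \<Rightarrow>
   complex \<Rightarrow> complex" where
  "leading_discriminant ah bh ch x = (bh 0 x)\<^sup>2 - 4 * ah 0 x * ch 0 x"

text \<open>
  \<open>f0\<close> is the leading-order solution of sign \<open>\<sigma>\<close> and is holomorphic on \<open>W\<close>. At zeros of \<open>a0\<close> its
  value is the removable-singularity value, fixed by holomorphy.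
\<close>

definition leading_order_solution ::
  "complex set \<Rightarrow> complex set \<Rightarrow> (complex \<Rightarrow> complex) \<Rightarrow> (complex \<Rightarrow> complex) \<Rightarrow> (complex \<Rightarrow> complex) \<Rightarrow>
   (complex \<Rightarrow> complex) \<Rightarrow> real \<Rightarrow> (complex \<Rightarrow> complex) \<Rightarrow> bool" where
  "leading_order_solution X W a0 b0 c0 Q \<sigma> f0 \<longleftrightarrow>
     f0 holomorphic_on W \<and>
     (if \<forall>x\<in>X. a0 x = 0
      then \<sigma> = 1 \<and> (\<forall>x\<in>W. Q x = b0 x \<and> f0 x = - c0 x / b0 x)
      else \<forall>x\<in>W. a0 x \<noteq> 0 \<longrightarrow> f0 x = (- b0 x + of_real \<sigma> * Q x) / (2 * a0 x))"

definition series_at :: "(nat \<Rightarrow> complex \<Rightarrow> complex) \<Rightarrow> complex \<Rightarrow> complex fps" where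
  "series_at gh x = Abs_fps (\<lambda>k. gh k x)"

definition formal_riccati_solution ::
  "complex set \<Rightarrow> (nat \<Rightarrow> complex \<Rightarrow> complex) \<Rightarrow> (nat \<Rightarrow> complex \<Rightarrow> complex) \<Rightarrow>
   (nat \<Rightarrow> complex \<Rightarrow> complex) \<Rightarrow> (nat \<Rightarrow> complex \<Rightarrow> complex) \<Rightarrow> bool" where
  "formal_riccati_solution W ah bh ch fh \<longleftrightarrow>
     (\<forall>k. fh k holomorphic_on W) \<and>
     (\<forall>x\<in>W. fps_X * series_at (\<lambda>k. deriv (fh k)) x =
        series_at ah x * (series_at fh x)\<^sup>2 + series_at bh x * series_at fh x + series_at ch x)"

definition riccati_solution ::
  "complex set \<Rightarrow> complex set \<Rightarrow> (complex \<Rightarrow> complex \<Rightarrow> complex) \<Rightarrow> (complex \<Rightarrow> complex \<Rightarrow> complex) \<Rightarrow>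
   (complex \<Rightarrow> complex \<Rightarrow> complex) \<Rightarrow> (complex \<Rightarrow> complex \<Rightarrow> complex) \<Rightarrow> bool" where
  "riccati_solution U S a b c f \<longleftrightarrow>
     holomorphic2_on f (U \<times> S) \<and>
     (\<forall>x\<in>U. \<forall>h\<in>S. h * deriv (\<lambda>y. f y h) x = a x h * (f x h)\<^sup>2 + b x h * f x h + c x h)"


subsection \<open>Borel resummation\<close>

definition ray_nbhd :: "real \<Rightarrow> real \<Rightarrow> complex set" where
  "ray_nbhd \<theta> \<epsilon> = {\<xi>. infdist \<xi> {cis \<theta> * of_real t |t. 0 \<le> t} < \<epsilon>}"

text \<open>
  \<open>\<phi>\<close> is the analytic continuation of the Borel transform. Since \<open>ray_nbhd \<theta> \<epsilon>\<close> is connected, its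
  values there, in particular on the ray itself, are determined by the series.
\<close>

definition borel_continuation ::
  "real \<Rightarrow> complex set \<Rightarrow> (nat \<Rightarrow> complex \<Rightarrow> complex) \<Rightarrow> (complex \<Rightarrow> complex \<Rightarrow> complex) \<Rightarrow> bool" where
  "borel_continuation \<theta> U fh \<phi> \<longleftrightarrow>
     (\<exists>\<rho>>0. \<exists>\<epsilon>>0. \<exists>K>0. \<exists>L>0.
        uniformly_convergent_on (U \<times> ball 0 \<rho>)
          (\<lambda>N (x, \<xi>). \<Sum>k<N. 1 / fact k * fh (Suc k) x * \<xi> ^ k) \<and>
        holomorphic2_on \<phi> (U \<times> ray_nbhd \<theta> \<epsilon>) \<and>
        (\<forall>x\<in>U. \<forall>\<xi>\<in>ray_nbhd \<theta> \<epsilon> \<inter> ball 0 \<rho>. (\<lambda>k. 1 / fact k * fh (Suc k) x * \<xi> ^ k) sums \<phi> x \<xi>) \<and>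
        (\<forall>x\<in>U. \<forall>\<xi>\<in>ray_nbhd \<theta> \<epsilon>. cmod (\<phi> x \<xi>) \<le> K * exp (L * cmod \<xi>)))"

definition borel_summable :: "real \<Rightarrow> complex set \<Rightarrow> (nat \<Rightarrow> complex \<Rightarrow> complex) \<Rightarrow> bool" where
  "borel_summable \<theta> U fh \<longleftrightarrow> (\<exists>\<phi>. borel_continuation \<theta> U fh \<phi>)"

definition laplace_integrand ::
  "real \<Rightarrow> (complex \<Rightarrow> complex \<Rightarrow> complex) \<Rightarrow> complex \<Rightarrow> complex \<Rightarrow> real \<Rightarrow> complex" where
  "laplace_integrand \<theta> \<phi> x h t =
     exp (- (cis \<theta> * of_real t) / h) * \<phi> x (cis \<theta> * of_real t) * cis \<theta>"

definition laplace_uniformly_convergent ::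
  "real \<Rightarrow> complex set \<Rightarrow> (complex \<Rightarrow> complex \<Rightarrow> complex) \<Rightarrow> complex \<Rightarrow> bool" where
  "laplace_uniformly_convergent \<theta> U \<phi> h \<longleftrightarrow>
     (\<forall>x\<in>U. set_integrable lborel {0..} (laplace_integrand \<theta> \<phi> x h)) \<and>
     uniform_limit U
       (\<lambda>T x. set_lebesgue_integral lborel {0..T} (laplace_integrand \<theta> \<phi> x h))
       (\<lambda>x. set_lebesgue_integral lborel {0..} (laplace_integrand \<theta> \<phi> x h)) at_top"

definition borel_resummation ::
  "real \<Rightarrow> (nat \<Rightarrow> complex \<Rightarrow> complex) \<Rightarrow> (complex \<Rightarrow> complex \<Rightarrow> complex) \<Rightarrow> complex \<Rightarrow> complex \<Rightarrow> complex" where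
  "borel_resummation \<theta> fh \<phi> x h =
     fh 0 x + set_lebesgue_integral lborel {0..} (laplace_integrand \<theta> \<phi> x h)"

end

theory Submission
  imports Defs
begin

text \<open>
  Along a WKB half-strip the Liouville coordinate \<open>z\<close> (the map \<open>\<Psi>\<close>, rotated so that the strip becomes
  a neighbourhood of the positive real axis) together with \<open>w = cis \<theta> / h\<close> turns the Riccati equation
  into \<open>F' = w * (A * F\<^sup>2 + B * F + C)\<close>. The Gevrey bounds with scale \<open>sqrt D0\<close> imply that \<open>A\<close>, \<open>B\<close>,
  \<open>C\<close> are bounded and are \<open>O(1 / w)\<close> close to their leading parts \<open>A0\<close>, \<open>B0\<close>, \<open>C0\<close>; the chosen sign of
  the root becomes \<open>2 * A0 * F0 + B0 = 1\<close>, so that the linearised equation is \<open>Y' = w * Y + G\<close>. For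
  \<open>Re w > 0\<close> its only bounded solution is the Laplace integral of \<open>- G\<close> along the horizontal ray issuing
  from \<open>z\<close>, which stays in the strip.
  
  The leading solution \<open>F0\<close> may be unbounded on the strip, so that \<open>F - F0\<close> is not a good unknown.
  Instead \<open>F = F0 + Y / (1 - A0 * Y)\<close> with \<open>Y = p * F0\<^sup>2 + q * F0 + r\<close>, and \<open>(p, q, r)\<close> solves a system
  whose coefficients involve only the bounded functions \<open>A0\<close>, \<open>B0\<close>, \<open>C0\<close>, their derivatives and the
  corrections (\<open>lifted_equation\<close>). The integral equation of this system is a contraction for large
  \<open>Re w\<close> (\<open>bounded_solution_exists\<close>), that is, for \<open>h\<close> in a Borel disc; this gives an exact solution near
  each point of the strip that is \<open>O(h)\<close> close to \<open>f0\<close> (\<open>riccati_exact_solution\<close>).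
  
  The remainders of this solution satisfy the same recursion as the formal coefficients: \<open>(f - f0) / h\<close>
  equals known terms plus \<open>h\<close> times an expression containing one derivative in \<open>x\<close>. Each order costs one
  Cauchy estimate, and sharing the radius evenly among the orders gives factorial growth
  (\<open>gevrey_from_recursion\<close>, \<open>riccati_gevrey\<close>).
  
  Finally, a function with uniform factorial remainder bounds on a Borel disc is the Laplace integral
  of its Borel transform (Nevanlinna's theorem). The derivatives of the Borel transform at the points
  of the ray are inverse Laplace integrals over a vertical line; Taylor series built from them continue
  the transform to a neighbourhood of the ray (\<open>laplace_eq\<close>, \<open>phi_holomorphic\<close>, \<open>borel_summation\<close>).
  The same argument shows that the function is determined by its expansion (\<open>gevrey_unique\<close>), which
  gives the uniqueness statement and allows the local solutions to be glued over a compact set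
  (\<open>glue_gevrey_solutions\<close>).
\<close>

section \<open>Holomorphic functions of two variables and of integrals\<close>

lemma deriv_bound_ball:
  fixes f :: "complex \<Rightarrow> complex"
  assumes hol: "f holomorphic_on ball z r" and r: "0 < r"
    and bd: "\<And>w. w \<in> ball z r \<Longrightarrow> cmod (f w) \<le> B"
  shows "cmod (deriv f z) \<le> B / r"
proof -
  have *: "cmod (deriv f z) * s \<le> B" if s: "0 < s" "s < r" for s
  proof -
    have sub: "cball z s \<subseteq> ball z r" using s by auto
    have "cmod ((deriv ^^ 1) f z) \<le> fact 1 * B / s ^ 1"
    proof (rule Cauchy_inequality)
      show "f holomorphic_on ball z s" using hol sub by (meson ball_subset_cball holomorphic_on_subset order_trans)
      show "continuous_on (cball z s) f"
        using hol sub by (meson holomorphic_on_imp_continuous_on continuous_on_subset)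
      show "cmod (f x) \<le> B" if "cmod (z - x) = s" for x
        using that s by (intro bd) (auto simp: dist_norm)
    qed (use s in auto)
    then show ?thesis using s by (simp add: field_simps)
  qed
  have "((\<lambda>s. cmod (deriv f z) * s) \<longlongrightarrow> cmod (deriv f z) * r) (at_left r)"
    by (intro tendsto_intros)
  moreover have "eventually (\<lambda>s. cmod (deriv f z) * s \<le> B) (at_left r)"
    using eventually_at_left_real[OF r] by eventually_elim (use * in auto)
  ultimately have "cmod (deriv f z) * r \<le> B"
    by (intro tendsto_upperbound[of _ _ "at_left r"]) auto
  then show ?thesis using r by (simp add: field_simps)
qed

lemma lipschitz_half_ball:
  fixes f :: "complex \<Rightarrow> complex"
  assumes hol: "f holomorphic_on ball z r" and r: "0 < r"
    and bd: "\<And>w. w \<in> ball z r \<Longrightarrow> cmod (f w) \<le> B"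
    and xy: "x \<in> ball z (r/2)" "y \<in> ball z (r/2)"
  shows "cmod (f x - f y) \<le> 2 * B / r * cmod (x - y)"
proof (rule field_differentiable_bound[OF convex_ball[of z "r/2"] _ _ xy])
  fix w assume w: "w \<in> ball z (r/2)"
  have sub: "ball w (r/2) \<subseteq> ball z r"
    using w by (intro subsetI) (metric)
  have wz: "w \<in> ball z r" using w r by simp
  then show "(f has_field_derivative deriv f w) (at w within ball z (r/2))"
    using hol holomorphic_derivI has_field_derivative_at_within open_ball by blast
  have "cmod (deriv f w) \<le> B / (r/2)"
  proof (rule deriv_bound_ball)
    show "f holomorphic_on ball w (r/2)" using hol sub holomorphic_on_subset by blast
  qed (use sub bd r in auto)
  then show "cmod (deriv f w) \<le> 2 * B / r" by (simp add: field_simps)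
qed

lemma has_field_derivative_integral:
  fixes G :: "complex \<Rightarrow> 'a \<Rightarrow> complex"
  assumes U: "open U"
    and hol: "\<And>y. y \<in> space M \<Longrightarrow> (\<lambda>x. G x y) holomorphic_on U"
    and meas: "\<And>x. x \<in> U \<Longrightarrow> G x \<in> borel_measurable M"
    and bd: "\<And>x y. x \<in> U \<Longrightarrow> y \<in> space M \<Longrightarrow> cmod (G x y) \<le> b y"
    and b: "integrable M b"
    and x: "x \<in> U"
  shows "((\<lambda>x. \<integral>y. G x y \<partial>M) has_field_derivative (\<integral>y. deriv (\<lambda>x. G x y) x \<partial>M)) (at x)"
proof -
  have int: "integrable M (G x)" if "x \<in> U" for x
    by (rule Bochner_Integration.integrable_bound[OF b meas[OF that]])
       (use bd[OF that] in \<open>auto intro!: AE_I2 intro: order_trans[OF _ abs_ge_self]\<close>)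
  show ?thesis
  proof -
    obtain r where r: "r > 0" "ball x r \<subseteq> U" using U x openE by blast
    define D where "D y = deriv (\<lambda>x. G x y) x" for y
    have D: "((\<lambda>x. G x y) has_field_derivative D y) (at x)" if "y \<in> space M" for y
      unfolding D_def using hol[OF that] U x holomorphic_derivI by blast
    have lim: "(\<lambda>n. (G (X n) y - G x y) / (X n - x)) \<longlonglongrightarrow> D y"
      if "y \<in> space M" "\<forall>n. X n \<in> UNIV - {x}" "X \<longlonglongrightarrow> x" for X y
      using D[OF that(1)] that(2,3) unfolding has_field_derivative_iff tendsto_at_iff_sequentially o_def by blast
    have seq: "(\<lambda>n. ((\<integral>y. G (X n) y \<partial>M) - (\<integral>y. G x y \<partial>M)) / (X n - x)) \<longlonglongrightarrow> (\<integral>y. D y \<partial>M)"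
      if X: "\<forall>n. X n \<in> UNIV - {x}" "X \<longlonglongrightarrow> x" for X
    proof -
      have "eventually (\<lambda>n. X n \<in> ball x (r/2)) sequentially"
        using X(2) r(1) by (metis centre_in_ball half_gt_zero open_ball topological_tendstoD)
      then obtain N where N: "\<And>n. n \<ge> N \<Longrightarrow> X n \<in> ball x (r/2)"
        by (auto simp: eventually_sequentially)
      define Y where "Y n = X (n + N)" for n
      have Y: "Y n \<in> ball x (r/2)" "Y n \<in> U" "Y n \<noteq> x" for n
        using N[of "n+N"] r X(1) by (auto simp: Y_def subset_iff)
      have Ylim: "Y \<longlonglongrightarrow> x" unfolding Y_def using X(2) by (rule LIMSEQ_ignore_initial_segment)
      have limY: "(\<lambda>n. (G (Y n) y - G x y) / (Y n - x)) \<longlonglongrightarrow> D y" if "y \<in> space M" for y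
        using lim[OF that] Y(3) Ylim by blast
      have mq: "(\<lambda>y. (G (Y n) y - G x y) / (Y n - x)) \<in> borel_measurable M" for n
        using meas[OF Y(2)] meas[OF x] by measurable
      have "(\<lambda>n. \<integral>y. (G (Y n) y - G x y) / (Y n - x) \<partial>M) \<longlonglongrightarrow> (\<integral>y. D y \<partial>M)"
      proof (rule integral_dominated_convergence[where w = "\<lambda>y. 2 / r * b y"])
        show "D \<in> borel_measurable M"
          by (rule borel_measurable_LIMSEQ_metric[OF mq limY])
        show "integrable M (\<lambda>y. 2 / r * b y)" using b by simp
        show "AE y in M. (\<lambda>n. (G (Y n) y - G x y) / (Y n - x)) \<longlonglongrightarrow> D y"
          using limY by (auto intro!: AE_I2)
        show "AE y in M. cmod ((G (Y n) y - G x y) / (Y n - x)) \<le> 2 / r * b y" for n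
        proof (intro AE_I2)
          fix y assume y: "y \<in> space M"
          have "cmod (G (Y n) y - G x y) \<le> 2 * b y / r * cmod (Y n - x)"
            by (rule lipschitz_half_ball[where z = x])
              (use hol[OF y] r Y bd[OF _ y] in \<open>auto intro: holomorphic_on_subset\<close>)
          then show "cmod ((G (Y n) y - G x y) / (Y n - x)) \<le> 2 / r * b y"
            using Y(3)[of n] by (simp add: norm_divide field_simps)
        qed
      qed (rule mq)
      moreover have "(\<integral>y. (G (Y n) y - G x y) / (Y n - x) \<partial>M)
          = ((\<integral>y. G (Y n) y \<partial>M) - (\<integral>y. G x y \<partial>M)) / (Y n - x)" for n
        using int[OF x] int[OF Y(2)] by (simp add: Y(3))
      ultimately have "(\<lambda>n. ((\<integral>y. G (Y n) y \<partial>M) - (\<integral>y. G x y \<partial>M)) / (Y n - x)) \<longlonglongrightarrow> (\<integral>y. D y \<partial>M)"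
        by (simp only:)
      then show ?thesis unfolding Y_def by (rule LIMSEQ_offset)
    qed
    show ?thesis
      using seq unfolding has_field_derivative_iff tendsto_at_iff_sequentially o_def D_def by blast
  qed
qed

lemma holomorphic_on_integral:
  fixes G :: "complex \<Rightarrow> 'a \<Rightarrow> complex"
  assumes U: "open U"
    and "\<And>y. y \<in> space M \<Longrightarrow> (\<lambda>x. G x y) holomorphic_on U"
    and "\<And>x. x \<in> U \<Longrightarrow> G x \<in> borel_measurable M"
    and "\<And>x y. x \<in> U \<Longrightarrow> y \<in> space M \<Longrightarrow> cmod (G x y) \<le> b y"
    and "integrable M b"
  shows "(\<lambda>x. \<integral>y. G x y \<partial>M) holomorphic_on U"
  using has_field_derivative_integral[OF assms] U by (auto simp: holomorphic_on_open)

text \<open>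
  Separate holomorphy passes easily through ray integrals, uniform limits and changes of one variable;
  together with local bounds it is the same as joint holomorphy.
\<close>

definition sep_holomorphic_on ::
  "complex set \<Rightarrow> complex set \<Rightarrow> (complex \<Rightarrow> complex \<Rightarrow> complex) \<Rightarrow> bool" where
  "sep_holomorphic_on U V F \<longleftrightarrow>
     (\<forall>y\<in>V. (\<lambda>x. F x y) holomorphic_on U) \<and> (\<forall>x\<in>U. F x holomorphic_on V)"

text \<open>
  The Cauchy estimates applied to \<open>F x - F x0\<close> make the partial derivative in the second variable
  jointly continuous, and a function with one continuous partial derivative is differentiable.
\<close>

lemma osgood:
  assumes U: "open U" and V: "open V" and sep: "sep_holomorphic_on U V F"
    and bd: "\<And>x y. x \<in> U \<Longrightarrow> y \<in> V \<Longrightarrow> \<exists>r>0. \<exists>B. ball x r \<subseteq> U \<and> ball y r \<subseteq> V \<and>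
        (\<forall>x'\<in>ball x r. \<forall>y'\<in>ball y r. cmod (F x' y') \<le> B)"
  shows "holomorphic2_on F (U \<times> V)"
  unfolding holomorphic2_on_def
proof (intro ballI)
  fix p assume "p \<in> U \<times> V"
  then obtain x0 y0 where p: "p = (x0, y0)" "x0 \<in> U" "y0 \<in> V" by auto
  obtain r B where r: "r > 0" "ball x0 r \<subseteq> U" "ball y0 r \<subseteq> V"
    and B: "\<And>x' y'. x' \<in> ball x0 r \<Longrightarrow> y' \<in> ball y0 r \<Longrightarrow> cmod (F x' y') \<le> B"
    using bd[OF p(2,3)] by blast
  define B' where "B' = max B 1"
  have B': "B' > 0" "\<And>x' y'. x' \<in> ball x0 r \<Longrightarrow> y' \<in> ball y0 r \<Longrightarrow> cmod (F x' y') \<le> B'"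
    using B unfolding B'_def by (auto simp: le_max_iff_disj)
  define s where "s = r / 4"
  have s: "s > 0" using r by (simp add: s_def)
  have holx: "(\<lambda>x. F x y) holomorphic_on ball x0 r" if "y \<in> ball y0 r" for y
    using sep that r unfolding sep_holomorphic_on_def by (meson holomorphic_on_subset subset_iff)
  have holy: "F x holomorphic_on ball y0 r" if "x \<in> ball x0 r" for x
    using sep that r unfolding sep_holomorphic_on_def by (meson holomorphic_on_subset subset_iff)
  define d where "d x y = deriv (F x) y" for x y
  have d: "(F x has_field_derivative d x y) (at y)" if "x \<in> ball x0 r" "y \<in> ball y0 r" for x y
    unfolding d_def using holy that holomorphic_derivI by blast
  have sub: "ball y s \<subseteq> ball y0 (r/2)" "ball y s \<subseteq> ball y0 r" if "y \<in> ball y0 s" for y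
    using that s unfolding s_def by (auto intro!: subsetI) (metric+)
  have dd: "cmod (d x y - d x' y) \<le> (2 * B' / r * cmod (x - x')) / s"
    if "x \<in> ball x0 s" "x' \<in> ball x0 s" "y \<in> ball y0 s" for x x' y
  proof -
    have xx: "x \<in> ball x0 (r/2)" "x' \<in> ball x0 (r/2)" "x \<in> ball x0 r" "x' \<in> ball x0 r"
      using that s unfolding s_def by auto
    have h: "(\<lambda>y. F x y - F x' y) holomorphic_on ball y s"
      using holy[OF xx(3)] holy[OF xx(4)] sub(2)[OF that(3)]
      by (intro holomorphic_intros) (auto intro: holomorphic_on_subset)
    have "cmod (deriv (\<lambda>y. F x y - F x' y) y) \<le> (2 * B' / r * cmod (x - x')) / s"
    proof (rule deriv_bound_ball[OF h s])
      fix w assume w: "w \<in> ball y s"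
      then have w: "w \<in> ball y0 r" using sub(2)[OF that(3)] by auto
      show "cmod (F x w - F x' w) \<le> 2 * B' / r * cmod (x - x')"
        by (rule lipschitz_half_ball[where f = "\<lambda>x. F x w" and z = x0]) (use holx w xx B' r in auto)
    qed
    moreover have "deriv (\<lambda>y. F x y - F x' y) y = d x y - d x' y"
    proof (rule DERIV_imp_deriv)
      have "y \<in> ball y0 r" using that(3) s unfolding s_def by auto
      then show "((\<lambda>y. F x y - F x' y) has_field_derivative d x y - d x' y) (at y)"
        by (intro derivative_intros d xx)
    qed
    ultimately show ?thesis by simp
  qed
  have dcont: "continuous_on (ball y0 s) (d x0)"
  proof -
    have "(\<lambda>y. deriv (F x0) y) holomorphic_on ball y0 r"
      using holy[of x0] r by (intro holomorphic_deriv) auto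
    then have "continuous_on (ball y0 r) (d x0)"
      unfolding d_def by (rule holomorphic_on_imp_continuous_on)
    then show ?thesis by (rule continuous_on_subset) (use r in \<open>auto intro!: subset_ball simp: s_def\<close>)
  qed
  have cont: "continuous (at (x0, y0) within ball x0 s \<times> ball y0 s) (\<lambda>(x, y). d x y)"
  proof -
    let ?Fl = "at (x0, y0) within ball x0 s \<times> ball y0 s"
    have fst0: "((\<lambda>q. fst q) \<longlongrightarrow> x0) ?Fl"
      by (rule tendsto_eq_intros | simp)+
    have l1: "((\<lambda>q. (2 * B' / r * cmod (fst q - x0)) / s) \<longlongrightarrow> (2 * B' / r * cmod (x0 - x0)) / s) ?Fl"
      using r s by (intro tendsto_intros fst0) auto
    have ev: "eventually (\<lambda>q. q \<in> ball x0 s \<times> ball y0 s) ?Fl"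
      by (simp add: eventually_at_filter)
    have l2: "((\<lambda>q. d (fst q) (snd q) - d x0 (snd q)) \<longlongrightarrow> 0) ?Fl"
    proof (rule Lim_null_comparison)
      show "eventually (\<lambda>q. cmod (d (fst q) (snd q) - d x0 (snd q)) \<le> (2 * B' / r * cmod (fst q - x0)) / s) ?Fl"
        using ev by eventually_elim (use dd s in auto)
      show "((\<lambda>q. (2 * B' / r * cmod (fst q - x0)) / s) \<longlongrightarrow> 0) ?Fl" using l1 by simp
    qed
    have l3: "((\<lambda>q. d x0 (snd q)) \<longlongrightarrow> d x0 y0) ?Fl"
    proof -
      have "isCont (d x0) y0" using dcont s by (simp add: continuous_on_eq_continuous_at)
      moreover have "((\<lambda>q. snd q) \<longlongrightarrow> y0) ?Fl" by (rule tendsto_eq_intros | simp)+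
      ultimately show ?thesis by (rule isCont_tendsto_compose)
    qed
    have "((\<lambda>q. (d (fst q) (snd q) - d x0 (snd q)) + d x0 (snd q)) \<longlongrightarrow> 0 + d x0 y0) ?Fl"
      by (intro tendsto_add l2 l3)
    then show ?thesis by (simp add: continuous_within split_beta')
  qed
  have dx: "((\<lambda>x. F x y0) has_field_derivative deriv (\<lambda>x. F x y0) x0) (at x0)"
    using holx[of y0] r by (intro holomorphic_derivI[of _ "ball x0 r"]) auto
  have "((\<lambda>(x, y). F x y) has_derivative
      (\<lambda>(tx, ty). deriv (\<lambda>x. F x y0) x0 * tx + blinfun_mult_right (d x0 y0) ty))
      (at (x0, y0) within ball x0 s \<times> ball y0 s)"
  proof (rule has_derivative_partialsI[where fy = "\<lambda>x y. blinfun_mult_right (d x y)"])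
    show "((\<lambda>x. F x y0) has_derivative (*) (deriv (\<lambda>x. F x y0) x0)) (at x0 within ball x0 s)"
      using dx by (simp add: has_field_derivative_def has_derivative_at_withinI)
    show "(F x has_derivative blinfun_apply (blinfun_mult_right (d x y))) (at y within ball y0 s)"
      if "x \<in> ball x0 s" "y \<in> ball y0 s" for x y
      using d[of x y] that s unfolding s_def
      by (auto simp: has_field_derivative_def intro!: has_derivative_at_withinI)
    show "continuous (at (x0, y0) within ball x0 s \<times> ball y0 s) (\<lambda>(x, y). blinfun_mult_right (d x y))"
    proof -
      have "continuous (at (x0, y0) within ball x0 s \<times> ball y0 s)
          (\<lambda>q. blinfun_mult_right ((\<lambda>(x, y). d x y) q))"
        by (rule bounded_linear.continuous[OF bounded_linear_blinfun_mult_right cont])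
      then show ?thesis by (simp add: split_beta')
    qed
  qed (use s in auto)
  moreover have "at (x0, y0) within ball x0 s \<times> ball y0 s = at (x0, y0)"
    using s by (intro at_within_open) (auto intro: open_Times)
  ultimately show "\<exists>A B. ((\<lambda>(x, h). F x h) has_derivative (\<lambda>(u, v). A * u + B * v)) (at p)"
    unfolding p by auto
qed

lemma holomorphic2_on_imp_sep:
  assumes "holomorphic2_on F (U \<times> V)"
  shows "sep_holomorphic_on U V F"
  unfolding sep_holomorphic_on_def
proof (intro conjI ballI)
  fix y assume y: "y \<in> V"
  show "(\<lambda>x. F x y) holomorphic_on U"
    unfolding holomorphic_on_def
  proof
    fix x assume x: "x \<in> U"
    obtain A B where AB: "((\<lambda>(x, h). F x h) has_derivative (\<lambda>(u, v). A * u + B * v)) (at (x, y))"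
      using assms x y unfolding holomorphic2_on_def by blast
    have "((\<lambda>x. (\<lambda>(x, h). F x h) (x, y)) has_derivative (\<lambda>u. (\<lambda>(u, v). A * u + B * v) (u, 0))) (at x)"
      by (rule has_derivative_compose[where g = "\<lambda>(x, h). F x h" and f = "\<lambda>x. (x, y)", OF _ AB])
         (auto intro!: derivative_eq_intros)
    then have "((\<lambda>x. F x y) has_field_derivative A) (at x)"
      by (simp add: has_field_derivative_def)
    then show "(\<lambda>x. F x y) field_differentiable at x within U"
      using field_differentiable_at_within field_differentiable_def by blast
  qed
next
  fix x assume x: "x \<in> U"
  show "F x holomorphic_on V"
    unfolding holomorphic_on_def
  proof
    fix y assume y: "y \<in> V"
    obtain A B where AB: "((\<lambda>(x, h). F x h) has_derivative (\<lambda>(u, v). A * u + B * v)) (at (x, y))"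
      using assms x y unfolding holomorphic2_on_def by blast
    have "((\<lambda>y. (\<lambda>(x, h). F x h) (x, y)) has_derivative (\<lambda>v. (\<lambda>(u, v). A * u + B * v) (0, v))) (at y)"
      by (rule has_derivative_compose[where g = "\<lambda>(x, h). F x h" and f = "\<lambda>y. (x, y)", OF _ AB])
         (auto intro!: derivative_eq_intros)
    then have "(F x has_field_derivative B) (at y)"
      by (simp add: has_field_derivative_def)
    then show "F x field_differentiable at y within V"
      using field_differentiable_at_within field_differentiable_def by blast
  qed
qed

section \<open>Bounded solutions along a half-strip\<close>

lemma tendsto_exp_neg:
  fixes c :: real
  assumes "c > 0"
  shows "((\<lambda>s. exp (- (c * s))) \<longlongrightarrow> 0) at_top"
  by (rule filterlim_compose[OF exp_at_bot], rule filterlim_compose[OF filterlim_uminus_at_bot_at_top],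
      rule filterlim_tendsto_pos_mult_at_top[OF tendsto_const assms filterlim_ident])

lemma has_bochner_integral_exp_ray:
  fixes c a :: real
  assumes c: "c > 0"
  shows "has_bochner_integral lborel (\<lambda>s. indicator {a..} s * exp (- (c * s))) (exp (- (c * a)) / c)"
proof (rule has_bochner_integral_nn_integral)
  have "((\<lambda>s. exp (- (c * s))) \<longlongrightarrow> 0) at_top"
    by (rule tendsto_exp_neg[OF c])
  then have lim: "((\<lambda>s. - exp (- (c * s)) / c) \<longlongrightarrow> 0) at_top"
    using tendsto_divide[OF tendsto_minus tendsto_const, of "\<lambda>s. exp (- (c * s))" 0 at_top c] c by simp
  have "(\<integral>\<^sup>+s. ennreal (exp (- (c * s))) * indicator {a ..} s \<partial>lborel) = ennreal (0 - (- exp (- (c * a)) / c))"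
    by (rule nn_integral_FTC_atLeast[OF _ _ _ lim]) (use c in \<open>auto intro!: derivative_eq_intros\<close>)
  also have "(\<integral>\<^sup>+s. ennreal (exp (- (c * s))) * indicator {a ..} s \<partial>lborel) =
      (\<integral>\<^sup>+s. ennreal (indicator {a..} s * exp (- (c * s))) \<partial>lborel)"
    by (intro nn_integral_cong) (auto simp: indicator_def)
  finally show "(\<integral>\<^sup>+s. ennreal (indicator {a..} s * exp (- (c * s))) \<partial>lborel) = ennreal (exp (- (c * a)) / c)"
    by simp
qed (use c in auto)

definition ray_laplace :: "(complex \<Rightarrow> complex) \<Rightarrow> complex \<Rightarrow> complex \<Rightarrow> complex" where
  "ray_laplace G w z =
     (\<integral>s. indicator {0<..} s *\<^sub>R (exp (- (of_real s * w)) * G (z + of_real s)) \<partial>lborel)"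

lemma ray_laplace_integrable:
  assumes c: "0 < Re w" and cont: "continuous_on {0<..} (\<lambda>s::real. G (z + of_real s))"
    and bd: "\<And>s. 0 < s \<Longrightarrow> cmod (G (z + of_real s)) \<le> B"
  shows "integrable lborel (\<lambda>s. indicator {0<..} s *\<^sub>R (exp (- (of_real s * w)) * G (z + of_real s)))"
    and "cmod (ray_laplace G w z) \<le> B / Re w"
proof -
  have B: "0 \<le> B" using bd[of 1] norm_ge_zero order_trans zero_less_one by blast
  note h = has_bochner_integral_exp_ray[OF c, of 0]
  have hb: "has_bochner_integral lborel (\<lambda>s. B * (indicator {0..} s * exp (- (Re w * s)))) (B * (exp (- (Re w * 0)) / Re w))"
    by (rule has_bochner_integral_mult_right[OF h])
  have le: "cmod (indicator {0<..} s *\<^sub>R (exp (- (of_real s * w)) * G (z + of_real s)))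
      \<le> B * (indicator {0..} s * exp (- (Re w * s)))" for s
    using B bd[of s] by (auto simp: indicator_def norm_mult field_simps)
  show int: "integrable lborel (\<lambda>s. indicator {0<..} s *\<^sub>R (exp (- (of_real s * w)) * G (z + of_real s)))"
  proof (rule Bochner_Integration.integrable_bound)
    show "integrable lborel (\<lambda>s. B * (indicator {0..} s * exp (- (Re w * s))))"
      using hb by (rule integrable.intros)
    have "(\<lambda>s. indicator {0<..} s *\<^sub>R (exp (- (of_real s * w)) * G (z + of_real s))) \<in> borel_measurable borel"
      by (rule borel_measurable_continuous_on_indicator) (auto intro!: continuous_intros cont)
    then show "(\<lambda>s. indicator {0<..} s *\<^sub>R (exp (- (of_real s * w)) * G (z + of_real s))) \<in> borel_measurable lborel"
      by simp
    show "AE s in lborel. cmod (indicator {0<..} s *\<^sub>R (exp (- (of_real s * w)) * G (z + of_real s)))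
      \<le> norm (B * (indicator {0..} s * exp (- (Re w * s))))"
      using le by (intro AE_I2) (metis abs_ge_self order_trans real_norm_def)
  qed
  have "cmod (ray_laplace G w z) \<le> (\<integral>s. B * (indicator {0..} s * exp (- (Re w * s))) \<partial>lborel)"
    unfolding ray_laplace_def
    by (rule Bochner_Integration.integral_norm_bound_integral[OF int]) (rule integrable.intros[OF hb], rule le)
  also have "\<dots> = B / Re w"
    using has_bochner_integral_integral_eq[OF hb] by simp
  finally show "cmod (ray_laplace G w z) \<le> B / Re w" .
qed

text \<open>
  Integration by parts along the ray shows that minus the transform is the bounded solution of
  \<open>Y' = w Y + G\<close>.
\<close>

lemma ray_laplace_deriv:
  assumes U: "open U" and shift: "\<And>z s. z \<in> U \<Longrightarrow> 0 \<le> s \<Longrightarrow> z + of_real s \<in> U"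
    and w: "0 < Re w" and hol: "G holomorphic_on U" and bd: "\<And>z. z \<in> U \<Longrightarrow> cmod (G z) \<le> B"
    and z: "z \<in> U"
  shows "(ray_laplace G w has_field_derivative (w * ray_laplace G w z - G z)) (at z)"
proof -
  have B: "0 \<le> B" using bd[OF z] norm_ge_zero order_trans by blast
  have cont: "continuous_on {0<..} (\<lambda>s::real. G (z + of_real s))" if "z \<in> U" for z
    by (rule continuous_on_compose2[OF holomorphic_on_imp_continuous_on[OF hol]])
       (auto intro!: continuous_intros shift that)
  have dG: "(G has_field_derivative deriv G z) (at z)" if "z \<in> U" for z
    using hol U that holomorphic_derivI by blast
  define b where "b s = B * (indicator {0..} s * exp (- (Re w * s)))" for s :: real
  have b: "integrable lborel b"
    unfolding b_def
    by (rule integrable_mult_right, rule integrable.intros, rule has_bochner_integral_exp_ray[OF w])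
  define H where "H z s = indicator {0<..} s *\<^sub>R (exp (- (of_real s * w)) * G (z + of_real s))" for z and s :: real
  have dH: "((\<lambda>z. H z s) has_field_derivative indicator {0<..} s *\<^sub>R (exp (- (of_real s * w)) * deriv G (z + of_real s))) (at z)"
    if "z \<in> U" for z s
  proof (cases "0 < s")
    case True
    have "((\<lambda>z. G (z + of_real s)) has_field_derivative deriv G (z + of_real s) * 1) (at z)"
      by (rule DERIV_chain2[where f = G and g = "\<lambda>z. z + of_real s", OF dG]) (use shift that True in \<open>auto intro!: derivative_eq_intros\<close>)
    then show ?thesis using True
      by (auto simp: H_def intro!: derivative_eq_intros)
  qed (auto simp: H_def)
  have "((\<lambda>z. \<integral>s. H z s \<partial>lborel) has_field_derivative (\<integral>s. deriv (\<lambda>z. H z s) z \<partial>lborel)) (at z)"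
  proof (rule has_field_derivative_integral[OF U _ _ _ b z])
    show "(\<lambda>z. H z s) holomorphic_on U" for s
      using dH U by (auto simp: holomorphic_on_open)
    show "H z \<in> borel_measurable lborel" if "z \<in> U" for z
      using borel_measurable_integrable[OF ray_laplace_integrable(1)[OF w cont[OF that], of B]] bd shift that
      unfolding H_def by auto
    show "cmod (H z s) \<le> b s" if "z \<in> U" for z s
      using B bd[of "z + of_real s"] shift[OF that, of s]
      by (auto simp: H_def b_def indicator_def norm_mult field_simps)
  qed
  also have "(\<integral>s. deriv (\<lambda>z. H z s) z \<partial>lborel) = ray_laplace (deriv G) w z"
    unfolding ray_laplace_def using DERIV_imp_deriv[OF dH[OF z]] by simp
  finally have D: "(ray_laplace G w has_field_derivative ray_laplace (deriv G) w z) (at z)"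
    by (simp add: ray_laplace_def[abs_def] H_def)
  obtain \<delta> where \<delta>: "\<delta> > 0" "ball z \<delta> \<subseteq> U" using U z openE by blast
  have bd': "cmod (deriv G (z + of_real s)) \<le> B / \<delta>" if "0 < s" for s
  proof (rule deriv_bound_ball[OF _ \<delta>(1)])
    have sub: "ball (z + of_real s) \<delta> \<subseteq> U"
    proof
      fix u assume "u \<in> ball (z + of_real s) \<delta>"
      then have "u - of_real s \<in> ball z \<delta>" by (simp add: dist_norm algebra_simps)
      then have "(u - of_real s) + of_real s \<in> U" using \<delta> that by (intro shift) auto
      then show "u \<in> U" by simp
    qed
    then show "G holomorphic_on ball (z + of_real s) \<delta>" using hol holomorphic_on_subset by blast
    show "\<And>u. u \<in> ball (z + of_real s) \<delta> \<Longrightarrow> cmod (G u) \<le> B" using sub bd by auto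
  qed
  have cont': "continuous_on {0<..} (\<lambda>s::real. deriv G (z + of_real s))"
    by (rule continuous_on_compose2[OF holomorphic_on_imp_continuous_on[OF holomorphic_deriv[OF hol U]]])
       (auto intro!: continuous_intros shift z)
  note i1 = ray_laplace_integrable[OF w cont[OF z], of B] and i2 = ray_laplace_integrable[OF w cont', of "B / \<delta>"]
  have i1': "integrable lborel (\<lambda>s. indicator {0<..} s *\<^sub>R (exp (- (of_real s * w)) * G (z + of_real s)))"
    using i1 bd shift z by auto
  have i2': "integrable lborel (\<lambda>s. indicator {0<..} s *\<^sub>R (exp (- (of_real s * w)) * deriv G (z + of_real s)))"
    using i2 bd' by auto
  define f where "f s = exp (- (of_real s * w)) * deriv G (z + of_real s) - w * (exp (- (of_real s * w)) * G (z + of_real s))" for s :: real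
  define F where "F s = exp (- (of_real s * w)) * G (z + of_real s)" for s :: real
  have "(LBINT s=ereal 0..\<infinity>. f s) = 0 - F 0"
  proof (rule interval_integral_FTC_integrable[where F = F])
    show "(F has_vector_derivative f s) (at s)" if "ereal 0 < ereal s" for s
    proof -
      have zs: "z + of_real s \<in> U" using shift z that by simp
      have e: "((\<lambda>s. exp (- (s * w))) has_field_derivative exp (- (of_real s * w)) * (- w)) (at (of_real s))"
        by (auto intro!: derivative_eq_intros)
      have "((\<lambda>s. G (z + s)) has_field_derivative deriv G (z + of_real s) * 1) (at (of_real s))"
        by (rule DERIV_chain2[where f = G and g = "\<lambda>s. z + s", OF dG[OF zs]]) (auto intro!: derivative_eq_intros)
      from DERIV_mult[OF e this] have "((\<lambda>s. exp (- (s * w)) * G (z + s)) has_field_derivative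
          (exp (- (of_real s * w)) * (- w)) * G (z + of_real s) + (deriv G (z + of_real s) * 1) * exp (- (of_real s * w))) (at (of_real s))" .
      then have "((\<lambda>s. exp (- (s * w)) * G (z + s)) has_field_derivative f s) (at (of_real s))"
        by (rule DERIV_cong) (simp add: f_def algebra_simps)
      then show ?thesis unfolding F_def
        using has_vector_derivative_real_field by blast
    qed
    show "isCont f s" if "ereal 0 < ereal s" for s
    proof -
      have "continuous_on {0<..} f"
        unfolding f_def by (intro continuous_intros cont[OF z] cont')
      then show ?thesis using that by (simp add: continuous_on_eq_continuous_at)
    qed
    have "einterval (ereal 0) \<infinity> = {0<..}" by (auto simp: einterval_def)
    moreover have "set_integrable lborel {0<..} f"
      using Bochner_Integration.integrable_diff[OF i2' integrable_mult_right[OF i1', of w]]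
      unfolding set_integrable_def f_def
      by (rule Bochner_Integration.integrable_cong[THEN iffD1, rotated 2]) (auto simp: indicator_def)
    ultimately show "set_integrable lborel (einterval (ereal 0) \<infinity>) f" by simp
    have "isCont (\<lambda>s::real. G (z + of_real s)) 0"
    proof (rule isCont_o2[where g = G and f = "\<lambda>s. z + of_real s"])
      show "isCont G (z + complex_of_real 0)" using dG[OF z] DERIV_isCont by simp
    qed (auto intro!: continuous_intros)
    then have "isCont F 0" unfolding F_def by (intro continuous_intros)
    then have "(F \<longlongrightarrow> F 0) (at_right 0)"
      by (meson continuous_at_imp_continuous_at_within continuous_within)
    then show "((F \<circ> real_of_ereal) \<longlongrightarrow> F 0) (at_right (ereal 0))"
      by (simp add: ereal_tendsto_simps)
    have "((\<lambda>s. B * exp (- (Re w * s))) \<longlongrightarrow> 0) at_top"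
      by (intro tendsto_mult_right_zero tendsto_exp_neg w)
    moreover have "eventually (\<lambda>s. cmod (F s) \<le> B * exp (- (Re w * s))) at_top"
      using eventually_gt_at_top[of 0]
    proof eventually_elim
      case (elim s)
      then show ?case using bd[OF shift[OF z, of s]] by (simp add: F_def norm_mult mult_ac)
    qed
    ultimately have "(F \<longlongrightarrow> 0) at_top" by (rule Lim_null_comparison[rotated])
    then show "((F \<circ> real_of_ereal) \<longlongrightarrow> 0) (at_left \<infinity>)"
      by (simp add: ereal_tendsto_simps)
  qed simp
  also have "(LBINT s=ereal 0..\<infinity>. f s) = ray_laplace (deriv G) w z - w * ray_laplace G w z"
  proof -
    have "(LBINT s=ereal 0..\<infinity>. f s) = (\<integral>s. indicator {0<..} s *\<^sub>R f s \<partial>lborel)"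
      unfolding interval_integral_to_infinity_eq set_lebesgue_integral_def ..
    also have "\<dots> = (\<integral>s. indicator {0<..} s *\<^sub>R (exp (- (of_real s * w)) * deriv G (z + of_real s))
        - w * (indicator {0<..} s *\<^sub>R (exp (- (of_real s * w)) * G (z + of_real s))) \<partial>lborel)"
      by (rule Bochner_Integration.integral_cong) (auto simp: f_def indicator_def)
    also have "\<dots> = ray_laplace (deriv G) w z - w * ray_laplace G w z"
      unfolding ray_laplace_def
      by (subst Bochner_Integration.integral_diff[OF i2' integrable_mult_right[OF i1']])
         (simp only: integral_mult_right_zero)
    finally show ?thesis .
  qed
  finally have "ray_laplace (deriv G) w z = w * ray_laplace G w z - G z"
    by (simp add: F_def algebra_simps)
  then show ?thesis using D by simp
qed

lemma ray_laplace_sep: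
  assumes U: "open U" and shift: "\<And>z s. z \<in> U \<Longrightarrow> 0 \<le> s \<Longrightarrow> z + of_real s \<in> U"
    and R: "R > 0" and sep: "sep_holomorphic_on U {w. R < Re w} G"
    and bd: "\<And>z w. z \<in> U \<Longrightarrow> R < Re w \<Longrightarrow> cmod (G z w) \<le> B"
  shows "sep_holomorphic_on U {w. R < Re w} (\<lambda>z w. ray_laplace (\<lambda>z. G z w) w z)"
  unfolding sep_holomorphic_on_def
proof (intro conjI ballI)
  fix w assume w: "w \<in> {w. R < Re w}"
  show "(\<lambda>z. ray_laplace (\<lambda>z. G z w) w z) holomorphic_on U"
  proof -
    have Rw: "R < Re w" using w by simp
    then have w0: "0 < Re w" using R by linarith
    have g: "(\<lambda>z. G z w) holomorphic_on U" using sep w unfolding sep_holomorphic_on_def by blast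
    have "\<exists>D. (ray_laplace (\<lambda>z. G z w) w has_field_derivative D) (at z)" if "z \<in> U" for z
      using ray_laplace_deriv[OF U shift w0 g bd[OF _ Rw] that] by blast
    then show ?thesis by (simp add: holomorphic_on_open[OF U])
  qed
next
  fix z assume z: "z \<in> U"
  have B: "0 \<le> B" by (rule order_trans[OF norm_ge_zero bd[OF z, of "of_real R + 1"]]) simp
  have contz: "continuous_on {0<..} (\<lambda>s::real. G (z + of_real s) w)" if "R < Re w" for w
  proof -
    have "(\<lambda>z. G z w) holomorphic_on U" using sep that unfolding sep_holomorphic_on_def by blast
    from holomorphic_on_imp_continuous_on[OF this] show ?thesis
      by (rule continuous_on_compose2) (auto intro!: continuous_intros shift z)
  qed
  show "(\<lambda>w. ray_laplace (\<lambda>z. G z w) w z) holomorphic_on {w. R < Re w}"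
    unfolding ray_laplace_def
  proof (rule holomorphic_on_integral)
    show "open {w. R < Re w}" by (rule open_halfspace_Re_gt)
    show "(\<lambda>w. indicator {0<..} s *\<^sub>R (exp (- (of_real s * w)) * G (z + of_real s) w)) holomorphic_on {w. R < Re w}" for s
    proof (cases "0 < s")
      case True
      then have "G (z + of_real s) holomorphic_on {w. R < Re w}"
        using sep shift[OF z, of s] unfolding sep_holomorphic_on_def by auto
      then show ?thesis using True by (auto intro!: holomorphic_intros)
    qed auto
    show "(\<lambda>s. indicator {0<..} s *\<^sub>R (exp (- (of_real s * w)) * G (z + of_real s) w)) \<in> borel_measurable lborel"
      if "w \<in> {w. R < Re w}" for w
    proof -
      have "0 < Re w" "\<And>s. 0 < s \<Longrightarrow> cmod (G (z + of_real s) w) \<le> B" "R < Re w"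
        using that R bd shift z by auto
      from borel_measurable_integrable[OF ray_laplace_integrable(1)[of w "\<lambda>z. G z w", OF this(1) contz[OF this(3)] this(2)]]
      show ?thesis by simp
    qed
    show "integrable lborel (\<lambda>s. B * (indicator {0..} s * exp (- (R * s))))"
      by (rule integrable_mult_right, rule integrable.intros, rule has_bochner_integral_exp_ray[OF R])
    show "cmod (indicator {0<..} s *\<^sub>R (exp (- (of_real s * w)) * G (z + of_real s) w))
        \<le> B * (indicator {0..} s * exp (- (R * s)))" if "w \<in> {w. R < Re w}" for w s
    proof (cases "0 < s")
      case True
      have "exp (- (s * Re w)) * cmod (G (z + of_real s) w) \<le> exp (- (R * s)) * B"
        using True that bd[OF shift[OF z, of s], of w] by (intro mult_mono) auto
      then show ?thesis using True by (simp add: norm_mult mult_ac)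
    qed (use B in auto)
  qed
qed

lemma ray_laplace_diff_le:
  assumes U: "open U" and shift: "\<And>z s. z \<in> U \<Longrightarrow> 0 \<le> s \<Longrightarrow> z + of_real s \<in> U"
    and w: "0 < Re w" and hol: "G holomorphic_on U" "H holomorphic_on U"
    and bd: "\<And>z. z \<in> U \<Longrightarrow> cmod (G z) \<le> B" "\<And>z. z \<in> U \<Longrightarrow> cmod (H z) \<le> B"
    and diff: "\<And>z. z \<in> U \<Longrightarrow> cmod (G z - H z) \<le> e" and z: "z \<in> U"
  shows "cmod (ray_laplace G w z - ray_laplace H w z) \<le> e / Re w"
proof -
  have cont: "continuous_on {0<..} (\<lambda>s::real. F (z + of_real s))" if "F holomorphic_on U" for F
    by (rule continuous_on_compose2[OF holomorphic_on_imp_continuous_on[OF that]])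
       (auto intro!: continuous_intros shift z)
  have zs: "z + of_real s \<in> U" if "0 < s" for s using shift[OF z] that by simp
  note G = ray_laplace_integrable(1)[where B = B, OF w cont[OF hol(1)] bd(1)[OF zs]]
  note H = ray_laplace_integrable(1)[where B = B, OF w cont[OF hol(2)] bd(2)[OF zs]]
  have "ray_laplace G w z - ray_laplace H w z = ray_laplace (\<lambda>z. G z - H z) w z"
    unfolding ray_laplace_def
    by (subst Bochner_Integration.integral_diff[OF G H, symmetric])
       (auto intro!: Bochner_Integration.integral_cong simp: algebra_simps)
  also have "cmod \<dots> \<le> e / Re w"
    by (rule ray_laplace_integrable(2)[OF w cont])
       (auto intro!: holomorphic_intros hol diff zs)
  finally show ?thesis .
qed

text \<open>
  The system \<open>Y' = w Y + g(z, w, Y)\<close> has a solution with values in the unit ball once \<open>Re w\<close> exceeds the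
  bound and twice the Lipschitz constant of \<open>g\<close>. The half-plane of admissible \<open>w\<close> does not depend on \<open>z\<close>,
  which is where a disc of fixed size in \<open>h\<close> comes from.
\<close>

lemma bounded_solution_exists:
  fixes g :: "complex \<Rightarrow> complex \<Rightarrow> (nat \<Rightarrow> complex) \<Rightarrow> nat \<Rightarrow> complex"
  assumes U: "open U" and shift: "\<And>z s. z \<in> U \<Longrightarrow> 0 \<le> s \<Longrightarrow> z + of_real s \<in> U"
    and R: "R > 0"
    and sep: "\<And>(Y :: nat \<Rightarrow> complex \<Rightarrow> complex \<Rightarrow> complex) i. (\<And>j. sep_holomorphic_on U {w. R < Re w} (Y j)) \<Longrightarrow>
        sep_holomorphic_on U {w. R < Re w} (\<lambda>z w. g z w (\<lambda>j. Y j z w) i)"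
    and bd: "\<And>z w v i. z \<in> U \<Longrightarrow> R < Re w \<Longrightarrow> (\<And>j. cmod (v j) \<le> 1) \<Longrightarrow> cmod (g z w v i) \<le> B"
    and lip: "\<And>z w v v' e i. z \<in> U \<Longrightarrow> R < Re w \<Longrightarrow> (\<And>j. cmod (v j) \<le> 1) \<Longrightarrow>
        (\<And>j. cmod (v' j) \<le> 1) \<Longrightarrow> (\<And>j. cmod (v j - v' j) \<le> e) \<Longrightarrow>
        cmod (g z w v i - g z w v' i) \<le> \<Lambda> * e"
    and BR: "B \<le> R" and LR: "2 * \<Lambda> \<le> R" and L0: "0 \<le> \<Lambda>"
  obtains Y :: "nat \<Rightarrow> complex \<Rightarrow> complex \<Rightarrow> complex" where "\<And>j. sep_holomorphic_on U {w. R < Re w} (Y j)"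
    and "\<And>j z w. z \<in> U \<Longrightarrow> R < Re w \<Longrightarrow> cmod (Y j z w) \<le> 1"
    and "\<And>j z w. z \<in> U \<Longrightarrow> R < Re w \<Longrightarrow>
        ((\<lambda>z. Y j z w) has_field_derivative (w * Y j z w + g z w (\<lambda>j. Y j z w) j)) (at z)"
proof -
  define V where "V = {w. R < Re w}"
  have V: "open V" "\<And>w. w \<in> V \<longleftrightarrow> R < Re w" "\<And>w. w \<in> V \<Longrightarrow> 0 < Re w"
    using R by (auto simp: V_def open_halfspace_Re_gt)
  \<comment> \<open>A bounded solution is a fixed point of \<open>T\<close>. The assumption on \<open>B\<close> makes \<open>T\<close> preserve the unit ball,
    the one on \<open>\<Lambda>\<close> makes it contract by the factor \<open>1 / 2\<close>.\<close>
  define T where "T Y i z w = - ray_laplace (\<lambda>z. g z w (\<lambda>j. Y j z w) i) w z"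
    for Y :: "nat \<Rightarrow> complex \<Rightarrow> complex \<Rightarrow> complex" and i z w
  define good where "good Y \<longleftrightarrow> (\<forall>j. sep_holomorphic_on U V (Y j)) \<and>
      (\<forall>j. \<forall>z\<in>U. \<forall>w\<in>V. cmod (Y j z w) \<le> 1)"
    for Y :: "nat \<Rightarrow> complex \<Rightarrow> complex \<Rightarrow> complex"
  have gsep: "sep_holomorphic_on U V (\<lambda>z w. g z w (\<lambda>j. Y j z w) i)" if "good Y" for Y i
    using sep[of Y] that unfolding good_def V_def by blast
  have ghol: "(\<lambda>z. g z w (\<lambda>j. Y j z w) i) holomorphic_on U" if "good Y" "w \<in> V" for Y i w
    using gsep[OF that(1)] that(2) unfolding sep_holomorphic_on_def by blast
  have gbd: "cmod (g z w (\<lambda>j. Y j z w) i) \<le> B" if "good Y" "z \<in> U" "w \<in> V" for Y i z w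
  proof -
    have "R < Re w" "\<And>j. cmod (Y j z w) \<le> 1" using that V(2) unfolding good_def by simp_all
    then show ?thesis by (intro bd that)
  qed
  have goodT: "good (T Y)" if Y: "good Y" for Y
    unfolding good_def
  proof (intro conjI allI ballI)
    fix j
    have "sep_holomorphic_on U {w. R < Re w} (\<lambda>z w. ray_laplace (\<lambda>z. g z w (\<lambda>j. Y j z w) j) w z)"
    proof (rule ray_laplace_sep[OF U shift R])
      show "sep_holomorphic_on U {w. R < Re w} (\<lambda>z w. g z w (\<lambda>j. Y j z w) j)"
        using gsep[OF Y] unfolding V_def .
      show "cmod (g z w (\<lambda>j. Y j z w) j) \<le> B" if "z \<in> U" "R < Re w" for z w
        using gbd[OF Y that(1)] that(2) V by blast
    qed
    then show "sep_holomorphic_on U V (T Y j)"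
      unfolding sep_holomorphic_on_def T_def V_def[symmetric] by (auto intro!: holomorphic_intros)
    fix z w assume z: "z \<in> U" and w: "w \<in> V"
    have zs: "z + of_real s \<in> U" if "0 < s" for s using shift[OF z] that by simp
    have c: "continuous_on {0<..} (\<lambda>s::real. (\<lambda>z. g z w (\<lambda>j. Y j z w) j) (z + of_real s))"
      by (rule continuous_on_compose2[OF holomorphic_on_imp_continuous_on[OF ghol[OF Y w]]])
         (auto intro!: continuous_intros zs)
    have "cmod (ray_laplace (\<lambda>z. g z w (\<lambda>j. Y j z w) j) w z) \<le> B / Re w"
      by (rule ray_laplace_integrable(2)[OF V(3)[OF w] c gbd[OF Y zs w]])
    also have "\<dots> \<le> 1" using BR V(2)[of w] V(3)[of w] w by (simp add: field_simps)
    finally show "cmod (T Y j z w) \<le> 1" by (simp add: T_def)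
  qed
  have Tdiff: "cmod (T Y i z w - T Y' i z w) \<le> e / 2"
    if Y: "good Y" "good Y'" and e: "\<And>j z w. z \<in> U \<Longrightarrow> w \<in> V \<Longrightarrow> cmod (Y j z w - Y' j z w) \<le> e"
      and zw: "z \<in> U" "w \<in> V" for Y Y' i z w e
  proof -
    have e0: "0 \<le> e" using e[OF zw] norm_ge_zero order_trans by blast
    have "cmod (ray_laplace (\<lambda>z. g z w (\<lambda>j. Y j z w) i) w z - ray_laplace (\<lambda>z. g z w (\<lambda>j. Y' j z w) i) w z)
        \<le> (\<Lambda> * e) / Re w"
    proof (rule ray_laplace_diff_le[OF U shift V(3)[OF zw(2)] ghol[OF Y(1) zw(2)] ghol[OF Y(2) zw(2)]
          gbd[OF Y(1) _ zw(2)] gbd[OF Y(2) _ zw(2)] _ zw(1)])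
      fix z assume z: "z \<in> U"
      show "cmod (g z w (\<lambda>j. Y j z w) i - g z w (\<lambda>j. Y' j z w) i) \<le> \<Lambda> * e"
        by (rule lip[OF z]) (use V(2) zw(2) Y z e in \<open>auto simp: good_def\<close>)
    qed
    also have "\<dots> \<le> e / 2"
    proof -
      have "2 * \<Lambda> * e \<le> Re w * e" using LR V(2) zw(2) e0 by (intro mult_right_mono) (meson less_imp_le order_trans)+
      then show ?thesis using V(3)[OF zw(2)] by (simp add: field_simps)
    qed
    finally show ?thesis by (simp add: T_def norm_minus_commute)
  qed
  define Z where "Z n = (T ^^ n) (\<lambda>i z w. 0)" for n
  have Z0: "Z 0 = (\<lambda>i z w. 0)" and ZS: "Z (Suc n) = T (Z n)" for n by (simp_all add: Z_def)
  have gZ: "good (Z n)" for n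
  proof (induction n)
    case 0 show ?case by (simp add: Z0 good_def sep_holomorphic_on_def)
  next
    case (Suc n) then show ?case using goodT by (simp add: ZS)
  qed
  have Zdiff: "cmod (Z (Suc n) i z w - Z n i z w) \<le> (1/2)^n" if "z \<in> U" "w \<in> V" for n i z w
    using that
  proof (induction n arbitrary: i z w)
    case 0 then show ?case using gZ[of 1] by (simp add: Z0 good_def)
  next
    case (Suc n)
    then show ?case using Tdiff[OF gZ gZ, of "Suc n" n "(1/2)^n"] by (simp add: ZS[symmetric])
  qed
  define D where "D = (UNIV :: nat set) \<times> U \<times> V"
  define Y where "Y i z w = (\<Sum>n. Z (Suc n) i z w - Z n i z w)" for i z w
  have "uniform_limit D (\<lambda>n (i, z, w). \<Sum>k<n. Z (Suc k) i z w - Z k i z w) (\<lambda>(i, z, w). Y i z w) sequentially"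
  proof -
    have "uniform_limit D (\<lambda>n q. \<Sum>k<n. (\<lambda>k (i, z, w). Z (Suc k) i z w - Z k i z w) k q)
        (\<lambda>q. suminf (\<lambda>k. (\<lambda>k (i, z, w). Z (Suc k) i z w - Z k i z w) k q)) sequentially"
      by (rule Weierstrass_m_test[where M = "\<lambda>n. (1/2)^n"]) (auto simp: D_def Zdiff)
    then show ?thesis by (simp add: Y_def case_prod_unfold)
  qed
  moreover have tel: "(\<Sum>k<n. Z (Suc k) i z w - Z k i z w) = Z n i z w" for n i z w
    using sum_lessThan_telescope[of "\<lambda>k. Z k i z w" n] by (simp add: Z0)
  ultimately have ul: "uniform_limit D (\<lambda>n (i, z, w). Z n i z w) (\<lambda>(i, z, w). Y i z w) sequentially"
    by (simp only: tel)
  have close: "\<exists>N. \<forall>n\<ge>N. \<forall>i. \<forall>z\<in>U. \<forall>w\<in>V. cmod (Z n i z w - Y i z w) \<le> e" if "e > 0" for e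
  proof -
    obtain N where N: "\<And>n q. n \<ge> N \<Longrightarrow> q \<in> D \<Longrightarrow> dist ((\<lambda>(i, z, w). Z n i z w) q) ((\<lambda>(i, z, w). Y i z w) q) < e"
      using uniform_limitD[OF ul \<open>e > 0\<close>] unfolding eventually_sequentially by blast
    have "cmod (Z n i z w - Y i z w) \<le> e" if "n \<ge> N" "z \<in> U" "w \<in> V" for n i z w
      using N[OF that(1), of "(i, z, w)"] that by (simp add: D_def dist_norm)
    then show ?thesis by blast
  qed
  have ulz: "uniform_limit U (\<lambda>n z. Z n i z w) (\<lambda>z. Y i z w) sequentially" if "w \<in> V" for i w
    unfolding uniform_limit_iff
  proof (intro allI impI)
    fix e :: real assume "e > 0"
    then obtain N where N: "\<forall>n\<ge>N. \<forall>i. \<forall>z\<in>U. \<forall>w\<in>V. cmod (Z n i z w - Y i z w) \<le> e / 2"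
      using close[of "e/2"] by auto
    show "\<forall>\<^sub>F n in sequentially. \<forall>z\<in>U. dist (Z n i z w) (Y i z w) < e"
      unfolding eventually_sequentially dist_norm using N that \<open>e > 0\<close>
      by (intro exI[of _ N]) (auto intro: le_less_trans[of _ "e/2"])
  qed
  have ulw: "uniform_limit V (\<lambda>n w. Z n i z w) (\<lambda>w. Y i z w) sequentially" if "z \<in> U" for i z
    unfolding uniform_limit_iff
  proof (intro allI impI)
    fix e :: real assume "e > 0"
    then obtain N where N: "\<forall>n\<ge>N. \<forall>i. \<forall>z\<in>U. \<forall>w\<in>V. cmod (Z n i z w - Y i z w) \<le> e / 2"
      using close[of "e/2"] by auto
    show "\<forall>\<^sub>F n in sequentially. \<forall>w\<in>V. dist (Z n i z w) (Y i z w) < e"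
      unfolding eventually_sequentially dist_norm using N that \<open>e > 0\<close>
      by (intro exI[of _ N]) (auto intro: le_less_trans[of _ "e/2"])
  qed
  have hz: "(\<lambda>z. Y i z w) holomorphic_on U" if w: "w \<in> V" for i w
  proof (rule holomorphic_uniform_sequence[OF U])
    show "(\<lambda>z. Z n i z w) holomorphic_on U" for n
      using gZ w unfolding good_def sep_holomorphic_on_def by blast
    show "\<exists>d>0. cball x d \<subseteq> U \<and> uniform_limit (cball x d) (\<lambda>n z. Z n i z w) (\<lambda>z. Y i z w) sequentially"
      if "x \<in> U" for x
      using U that ulz[OF w] by (meson open_contains_cball uniform_limit_on_subset)
  qed
  have hw: "Y i z holomorphic_on V" if z: "z \<in> U" for i z
  proof (rule holomorphic_uniform_sequence[OF V(1)])
    show "Z n i z holomorphic_on V" for n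
      using gZ z unfolding good_def sep_holomorphic_on_def by blast
    show "\<exists>d>0. cball x d \<subseteq> V \<and> uniform_limit (cball x d) (\<lambda>n. Z n i z) (Y i z) sequentially"
      if "x \<in> V" for x
      using V(1) that ulw[OF z] by (meson open_contains_cball uniform_limit_on_subset)
  qed
  have Ybd: "cmod (Y i z w) \<le> 1" if "z \<in> U" "w \<in> V" for i z w
  proof (rule tendsto_upperbound[of "\<lambda>n. cmod (Z n i z w)"])
    show "(\<lambda>n. cmod (Z n i z w)) \<longlonglongrightarrow> cmod (Y i z w)"
      by (intro tendsto_norm tendsto_uniform_limitI[OF ulz] that)
    show "\<forall>\<^sub>F n in sequentially. cmod (Z n i z w) \<le> 1"
      using gZ that by (auto simp: good_def)
  qed simp
  have gY: "good Y"
    unfolding good_def sep_holomorphic_on_def using hz hw Ybd by blast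
  have fix_eq: "Y i z w = T Y i z w" if zw: "z \<in> U" "w \<in> V" for i z w
  proof -
    have "cmod (Y i z w - T Y i z w) \<le> e" if e: "e > 0" for e
    proof -
      obtain N where N: "\<forall>n\<ge>N. \<forall>i. \<forall>z\<in>U. \<forall>w\<in>V. cmod (Z n i z w - Y i z w) \<le> e / 2"
        using close[of "e/2"] e by auto
      have "cmod (T (Z N) i z w - T Y i z w) \<le> (e/2) / 2"
        by (rule Tdiff[OF gZ gY _ zw]) (use N in auto)
      moreover have "cmod (T (Z N) i z w - Y i z w) \<le> e / 2"
        using N zw ZS by (metis le_SucI order_refl)
      moreover have "Y i z w - T Y i z w = (T (Z N) i z w - T Y i z w) - (T (Z N) i z w - Y i z w)" by simp
      then have "cmod (Y i z w - T Y i z w) \<le> cmod (T (Z N) i z w - T Y i z w) + cmod (T (Z N) i z w - Y i z w)"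
        by (metis norm_triangle_ineq4)
      ultimately show ?thesis using e by linarith
    qed
    then have "cmod (Y i z w - T Y i z w) \<le> 0" by (rule field_le_epsilon[of _ 0, simplified])
    then show ?thesis by simp
  qed
  show thesis
  proof (rule that[of Y])
    show "sep_holomorphic_on U {w. R < Re w} (Y j)" for j
      using gY unfolding good_def V_def by blast
    show "cmod (Y j z w) \<le> 1" if "z \<in> U" "R < Re w" for j z w
      using Ybd that V by blast
    show "((\<lambda>z. Y j z w) has_field_derivative (w * Y j z w + g z w (\<lambda>j. Y j z w) j)) (at z)"
      if zw: "z \<in> U" "R < Re w" for j z w
    proof -
      have w: "w \<in> V" using zw V by blast
      have "((\<lambda>z. - ray_laplace (\<lambda>z. g z w (\<lambda>j. Y j z w) j) w z) has_field_derivative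
          - (w * ray_laplace (\<lambda>z. g z w (\<lambda>j. Y j z w) j) w z - g z w (\<lambda>j. Y j z w) j)) (at z)"
        by (rule DERIV_minus, rule ray_laplace_deriv[OF U shift V(3)[OF w] ghol[OF gY w] gbd[OF gY _ w] zw(1)])
      then have "((\<lambda>z. T Y j z w) has_field_derivative (w * T Y j z w + g z w (\<lambda>j. Y j z w) j)) (at z)"
        by (simp add: T_def)
      then have "((\<lambda>z. T Y j z w) has_field_derivative (w * Y j z w + g z w (\<lambda>j. Y j z w) j)) (at z)"
        using fix_eq[OF zw(1) w] by simp
      then show ?thesis
        by (rule has_field_derivative_transform_within_open[OF _ U zw(1)]) (simp add: fix_eq w)
    qed
  qed
qed

text \<open>
  Boundedness and Lipschitz continuity in \<open>v\<close> on the unit ball are stable under the ring operations, so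
  they can be read off from the shape of the right-hand side of the lifted system.
\<close>

definition bounded_lipschitz_by ::
  "real \<Rightarrow> real \<Rightarrow> (complex \<times> complex) set \<Rightarrow> (complex \<Rightarrow> complex \<Rightarrow> (nat \<Rightarrow> complex) \<Rightarrow> complex) \<Rightarrow> bool" where
  "bounded_lipschitz_by B L D f \<longleftrightarrow> 0 \<le> B \<and> 0 \<le> L \<and>
     (\<forall>z w v. (z, w) \<in> D \<longrightarrow> (\<forall>j. cmod (v j) \<le> 1) \<longrightarrow> cmod (f z w v) \<le> B) \<and>
     (\<forall>z w v v' e. (z, w) \<in> D \<longrightarrow> (\<forall>j. cmod (v j) \<le> 1) \<longrightarrow> (\<forall>j. cmod (v' j) \<le> 1) \<longrightarrow>
        (\<forall>j. cmod (v j - v' j) \<le> e) \<longrightarrow> cmod (f z w v - f z w v') \<le> L * e)"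

lemma bounded_lipschitz_byD:
  assumes "bounded_lipschitz_by B L D f"
  shows "0 \<le> B" "0 \<le> L"
    and "(z, w) \<in> D \<Longrightarrow> \<forall>j. cmod (v j) \<le> 1 \<Longrightarrow> cmod (f z w v) \<le> B"
    and "(z, w) \<in> D \<Longrightarrow> \<forall>j. cmod (v j) \<le> 1 \<Longrightarrow> \<forall>j. cmod (v' j) \<le> 1 \<Longrightarrow>
        \<forall>j. cmod (v j - v' j) \<le> e \<Longrightarrow> cmod (f z w v - f z w v') \<le> L * e"
  using assms unfolding bounded_lipschitz_by_def by blast+

definition bounded_lipschitz ::
  "(complex \<times> complex) set \<Rightarrow> (complex \<Rightarrow> complex \<Rightarrow> (nat \<Rightarrow> complex) \<Rightarrow> complex) \<Rightarrow> bool" where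
  "bounded_lipschitz D f \<longleftrightarrow> (\<exists>B L. bounded_lipschitz_by B L D f)"

lemma bounded_lipschitz_const:
  assumes "\<And>z w. (z, w) \<in> D \<Longrightarrow> cmod (c z w) \<le> K"
  shows "bounded_lipschitz D (\<lambda>z w v. c z w)"
proof -
  have "bounded_lipschitz_by \<bar>K\<bar> 0 D (\<lambda>z w v. c z w)"
    unfolding bounded_lipschitz_by_def using order_trans[OF assms abs_ge_self] by simp
  then show ?thesis unfolding bounded_lipschitz_def by blast
qed

lemma bounded_lipschitz_var: "bounded_lipschitz D (\<lambda>z w v. v j)"
proof -
  have "bounded_lipschitz_by 1 1 D (\<lambda>z w v. v j)"
    unfolding bounded_lipschitz_by_def by simp
  then show ?thesis unfolding bounded_lipschitz_def by blast
qed

lemma bounded_lipschitz_add: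
  assumes "bounded_lipschitz D f" "bounded_lipschitz D g"
  shows "bounded_lipschitz D (\<lambda>z w v. f z w v + g z w v)"
proof -
  obtain B L B' L' where f: "bounded_lipschitz_by B L D f" and g: "bounded_lipschitz_by B' L' D g"
    using assms unfolding bounded_lipschitz_def by blast
  note F = bounded_lipschitz_byD[OF f] and G = bounded_lipschitz_byD[OF g]
  have "cmod (f z w v + g z w v) \<le> B + B'" if "(z, w) \<in> D" "\<forall>j. cmod (v j) \<le> 1" for z w v
    by (rule norm_triangle_mono[OF F(3)[OF that] G(3)[OF that]])
  moreover have "cmod (f z w v + g z w v - (f z w v' + g z w v')) \<le> (L + L') * e"
    if "(z, w) \<in> D" "\<forall>j. cmod (v j) \<le> 1" "\<forall>j. cmod (v' j) \<le> 1" "\<forall>j. cmod (v j - v' j) \<le> e" for z w v v' e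
    using norm_triangle_mono[OF F(4)[OF that] G(4)[OF that]] by (simp add: algebra_simps)
  ultimately have "bounded_lipschitz_by (B + B') (L + L') D (\<lambda>z w v. f z w v + g z w v)"
    unfolding bounded_lipschitz_by_def using F(1,2) G(1,2) by simp
  then show ?thesis unfolding bounded_lipschitz_def by blast
qed

lemma bounded_lipschitz_mult:
  assumes "bounded_lipschitz D f" "bounded_lipschitz D g"
  shows "bounded_lipschitz D (\<lambda>z w v. f z w v * g z w v)"
proof -
  obtain B L B' L' where f: "bounded_lipschitz_by B L D f" and g: "bounded_lipschitz_by B' L' D g"
    using assms unfolding bounded_lipschitz_def by blast
  note F = bounded_lipschitz_byD[OF f] and G = bounded_lipschitz_byD[OF g]
  have "cmod (f z w v * g z w v) \<le> B * B'" if "(z, w) \<in> D" "\<forall>j. cmod (v j) \<le> 1" for z w v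
    using mult_mono[OF F(3)[OF that] G(3)[OF that]] F(1) by (simp add: norm_mult)
  moreover have "cmod (f z w v * g z w v - f z w v' * g z w v') \<le> (B * L' + L * B') * e"
    if "(z, w) \<in> D" "\<forall>j. cmod (v j) \<le> 1" "\<forall>j. cmod (v' j) \<le> 1" "\<forall>j. cmod (v j - v' j) \<le> e" for z w v v' e
  proof -
    have e: "0 \<le> e" using that(4) norm_ge_zero order_trans by blast
    have "f z w v * g z w v - f z w v' * g z w v' = f z w v * (g z w v - g z w v') + (f z w v - f z w v') * g z w v'"
      by (simp add: algebra_simps)
    also have "cmod \<dots> \<le> B * (L' * e) + (L * e) * B'"
      unfolding norm_mult using F(1,2) e
      by (intro norm_triangle_mono[unfolded norm_mult] order_trans[OF norm_mult_ineq] mult_mono F(3)[OF that(1,2)] G(4)[OF that] F(4)[OF that] G(3)[OF that(1,3)]) auto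
    finally show ?thesis by (simp add: algebra_simps)
  qed
  ultimately have "bounded_lipschitz_by (B * B') (B * L' + L * B') D (\<lambda>z w v. f z w v * g z w v)"
    unfolding bounded_lipschitz_by_def using F(1,2) G(1,2) by simp
  then show ?thesis unfolding bounded_lipschitz_def by blast
qed

lemma bounded_lipschitz_diff:
  assumes "bounded_lipschitz D f" "bounded_lipschitz D g"
  shows "bounded_lipschitz D (\<lambda>z w v. f z w v - g z w v)"
  using bounded_lipschitz_add[OF assms(1) bounded_lipschitz_mult[OF bounded_lipschitz_const[of D "\<lambda>_ _. -1" 1] assms(2)]]
  by simp

section \<open>The Riccati equation on a half-strip\<close>

lemma sep_holomorphic_add:
  "sep_holomorphic_on U V f \<Longrightarrow> sep_holomorphic_on U V g \<Longrightarrow> sep_holomorphic_on U V (\<lambda>z w. f z w + g z w)"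
  unfolding sep_holomorphic_on_def by (auto intro!: holomorphic_intros)

lemma sep_holomorphic_diff:
  "sep_holomorphic_on U V f \<Longrightarrow> sep_holomorphic_on U V g \<Longrightarrow> sep_holomorphic_on U V (\<lambda>z w. f z w - g z w)"
  unfolding sep_holomorphic_on_def by (auto intro!: holomorphic_intros)

lemma sep_holomorphic_mult:
  "sep_holomorphic_on U V f \<Longrightarrow> sep_holomorphic_on U V g \<Longrightarrow> sep_holomorphic_on U V (\<lambda>z w. f z w * g z w)"
  unfolding sep_holomorphic_on_def by (auto intro!: holomorphic_intros)

lemma sep_holomorphic_divide:
  "sep_holomorphic_on U V f \<Longrightarrow> sep_holomorphic_on U V g \<Longrightarrow>
   (\<And>z w. z \<in> U \<Longrightarrow> w \<in> V \<Longrightarrow> g z w \<noteq> 0) \<Longrightarrow> sep_holomorphic_on U V (\<lambda>z w. f z w / g z w)"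
  unfolding sep_holomorphic_on_def by (auto intro!: holomorphic_intros)

lemma sep_holomorphic_first: "f holomorphic_on U \<Longrightarrow> sep_holomorphic_on U V (\<lambda>z w. f z)"
  unfolding sep_holomorphic_on_def by auto

lemma sep_holomorphic_second: "f holomorphic_on V \<Longrightarrow> sep_holomorphic_on U V (\<lambda>z w. f w)"
  unfolding sep_holomorphic_on_def by auto

lemma sep_holomorphic_subset:
  "sep_holomorphic_on U V f \<Longrightarrow> U' \<subseteq> U \<Longrightarrow> V' \<subseteq> V \<Longrightarrow> sep_holomorphic_on U' V' f"
  unfolding sep_holomorphic_on_def by (meson holomorphic_on_subset subset_iff)

text \<open>
  The algebra behind the lift. Since \<open>F0' = - (A0' F0\<^sup>2 + B0' F0 + C0')\<close> is itself a quadratic polynomial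
  in \<open>F0\<close> with bounded coefficients, so is every term of the equation for \<open>Y\<close>: \<open>F0\<close> is never needed
  beyond degree two, because \<open>A0 Y\<close> and \<open>(1 - A0 F0) Y\<close> reduce to linear polynomials in \<open>F0\<close>. Comparing
  coefficients suggests the three equations for \<open>p, q, r\<close>; the conclusion is the Riccati equation for
  \<open>F0 + Y / (1 - A0 Y)\<close> with the denominators cleared.
\<close>

lemma lifted_equation:
  fixes A0 B0 C0 F0 dA dB dC dF a1 b1 c1 p q r dp dq dr w Y dY :: complex
  assumes B0: "2 * A0 * F0 + B0 = 1" and C0: "A0 * F0\<^sup>2 + B0 * F0 + C0 = 0"
    and dB: "2 * (dA * F0 + A0 * dF) + dB = 0"
    and dF: "dF = - (dA * F0\<^sup>2 + dB * F0 + dC)"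
    and Y: "Y = p * F0\<^sup>2 + q * F0 + r"
    and dY: "dY = dp * F0\<^sup>2 + dq * F0 + dr + (2 * p * F0 + q) * dF"
    and s: "sp = - C0 * p" "sq = (1 + B0) / 2 * r - C0 * q" "tp = (1 - B0) / 2 * p" "tq = (1 - B0) / 2 * q + A0 * r"
    and tau: "\<tau> = B0 * q - 2 * C0 * p - 2 * A0 * r" and lam: "lm = b1 * B0 - 2 * a1 * C0 - 2 * A0 * c1"
    and dp: "dp = w * p + (a1 + dA + lm * p + dA * \<tau> + (ga * (sp * sp) - gb * (sp * tp) + gc * (tp * tp)))"
    and dq: "dq = w * q + (b1 + dB + lm * q + dB * \<tau> + (2 * (ga * (sp * sq)) - gb * (sp * tq + sq * tp) + 2 * (gc * (tp * tq))))"
    and dr: "dr = w * r + (c1 + dC + lm * r + dC * \<tau> + (ga * (sq * sq) - gb * (sq * tq) + gc * (tq * tq)))"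
    and g: "ga = a1 - dA" "gb = b1 - dB" "gc = c1 - dC"
  shows "dF * (1 - A0 * Y)\<^sup>2 + dY + dA * Y\<^sup>2 =
      (w * A0 + a1) * (F0 * (1 - A0 * Y) + Y)\<^sup>2 + (w * B0 + b1) * (F0 * (1 - A0 * Y) + Y) * (1 - A0 * Y)
        + (w * C0 + c1) * (1 - A0 * Y)\<^sup>2"
proof -
  have B: "B0 = 1 - 2 * A0 * F0" using B0 by (simp add: algebra_simps)
  have C: "C0 = A0 * F0\<^sup>2 - F0" using C0 B by (simp add: algebra_simps power2_eq_square)
  have dB': "dB = - 2 * dA * F0 - 2 * A0 * dF" using dB by (simp add: algebra_simps eq_neg_iff_add_eq_0)
  have dC: "dC = dA * F0\<^sup>2 + 2 * A0 * F0 * dF - dF"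
    using dF unfolding dB' by (simp add: algebra_simps power2_eq_square eq_neg_iff_add_eq_0)
  have S: "sp * F0 + sq = (1 - A0 * F0) * Y"
    unfolding s C B Y by (simp add: field_simps power2_eq_square)
  have T: "tp * F0 + tq = A0 * Y"
    unfolding s C B Y by (simp add: field_simps power2_eq_square)
  have quad: "(ga * (sp * sp) - gb * (sp * tp) + gc * (tp * tp)) * F0\<^sup>2
      + (2 * (ga * (sp * sq)) - gb * (sp * tq + sq * tp) + 2 * (gc * (tp * tq))) * F0
      + (ga * (sq * sq) - gb * (sq * tq) + gc * (tq * tq))
      = ga * (sp * F0 + sq)\<^sup>2 - gb * (sp * F0 + sq) * (tp * F0 + tq) + gc * (tp * F0 + tq)\<^sup>2"
    by (simp add: algebra_simps power2_eq_square)
  have tau': "(2 * p * F0 + q) * dF - dF * \<tau> = 2 * A0 * dF * Y"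
    unfolding tau C B Y by (simp add: algebra_simps power2_eq_square)
  have lin: "lm * Y = ((2 * a1 * F0 + b1) - 2 * A0 * (a1 * F0\<^sup>2 + b1 * F0 + c1)) * Y"
    unfolding lam C B by (simp add: algebra_simps power2_eq_square)
  have "dY = w * Y + (a1 * F0\<^sup>2 + b1 * F0 + c1) + (dA * F0\<^sup>2 + dB * F0 + dC) + lm * Y
      + (dA * F0\<^sup>2 + dB * F0 + dC) * \<tau> + (2 * p * F0 + q) * dF
      + ((ga * (sp * sp) - gb * (sp * tp) + gc * (tp * tp)) * F0\<^sup>2
      + (2 * (ga * (sp * sq)) - gb * (sp * tq + sq * tp) + 2 * (gc * (tp * tq))) * F0
      + (ga * (sq * sq) - gb * (sq * tq) + gc * (tq * tq)))"
    unfolding dY dp dq dr Y by (simp add: distrib_right distrib_left)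
  also have "dA * F0\<^sup>2 + dB * F0 + dC = - dF" using dF by simp
  finally have dY': "dY = w * Y + (a1 * F0\<^sup>2 + b1 * F0 + c1) - dF
      + ((2 * a1 * F0 + b1) - 2 * A0 * (a1 * F0\<^sup>2 + b1 * F0 + c1)) * Y + 2 * A0 * dF * Y
      + (ga * ((1 - A0 * F0) * Y)\<^sup>2 - gb * ((1 - A0 * F0) * Y) * (A0 * Y) + gc * (A0 * Y)\<^sup>2)"
    unfolding quad S T lin tau'[symmetric] by (simp add: algebra_simps)
  show ?thesis
    unfolding dY' g C B dC dB' by (simp add: algebra_simps power2_eq_square)
qed

text \<open>
  The domains shrink twice by \<open>\<delta>\<close>: once to bound the derivatives of the leading coefficients, once to
  bound the derivative of the solution. Neither shrinking may depend on the position along the strip,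
  because the ray integrals run to infinity; only the last step, which needs a bound on \<open>F0\<close>, is local.
\<close>

lemma riccati_exact_solution:
  fixes A B C :: "complex \<Rightarrow> complex \<Rightarrow> complex" and A0 B0 C0 F0 :: "complex \<Rightarrow> complex"
  assumes opn: "open U" "open U1" "open U2" and \<delta>: "\<delta> > 0"
    and shift: "\<And>z s. z \<in> U1 \<Longrightarrow> 0 \<le> s \<Longrightarrow> z + of_real s \<in> U1"
    and balls: "\<And>z. z \<in> U1 \<Longrightarrow> ball z \<delta> \<subseteq> U" "\<And>z. z \<in> U2 \<Longrightarrow> ball z \<delta> \<subseteq> U1"
    and R0: "R0 > 0"
    and sep: "sep_holomorphic_on U {w. R0 < Re w} A" "sep_holomorphic_on U {w. R0 < Re w} B"
      "sep_holomorphic_on U {w. R0 < Re w} C"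
    and hol: "A0 holomorphic_on U" "B0 holomorphic_on U" "C0 holomorphic_on U" "F0 holomorphic_on U"
    and bd0: "\<And>z. z \<in> U \<Longrightarrow> cmod (A0 z) \<le> K" "\<And>z. z \<in> U \<Longrightarrow> cmod (B0 z) \<le> K" "\<And>z. z \<in> U \<Longrightarrow> cmod (C0 z) \<le> K"
    and bd1: "\<And>z w. z \<in> U \<Longrightarrow> R0 < Re w \<Longrightarrow> cmod (w * (A z w - A0 z)) \<le> K"
      "\<And>z w. z \<in> U \<Longrightarrow> R0 < Re w \<Longrightarrow> cmod (w * (B z w - B0 z)) \<le> K"
      "\<And>z w. z \<in> U \<Longrightarrow> R0 < Re w \<Longrightarrow> cmod (w * (C z w - C0 z)) \<le> K"
    and F0: "\<And>z. z \<in> U \<Longrightarrow> 2 * A0 z * F0 z + B0 z = 1"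
      "\<And>z. z \<in> U \<Longrightarrow> A0 z * (F0 z)\<^sup>2 + B0 z * F0 z + C0 z = 0"
    and z0: "z0 \<in> U2"
  obtains \<rho> R K' F where "\<rho> > 0" "R \<ge> R0" "K' > 0" "ball z0 \<rho> \<subseteq> U2"
    "sep_holomorphic_on (ball z0 \<rho>) {w. R < Re w} F"
    "\<And>z w. z \<in> ball z0 \<rho> \<Longrightarrow> R < Re w \<Longrightarrow> cmod (F z w - F0 z) \<le> K' / cmod w"
    "\<And>z w. z \<in> ball z0 \<rho> \<Longrightarrow> R < Re w \<Longrightarrow>
       ((\<lambda>z. F z w) has_field_derivative w * (A z w * (F z w)\<^sup>2 + B z w * F z w + C z w)) (at z)"
proof -
  have sub: "U1 \<subseteq> U" "U2 \<subseteq> U1"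
    using balls \<delta> by (meson centre_in_ball subset_iff)+
  define V0 where "V0 = {w. R0 < Re w}"
  define D where "D = U1 \<times> V0"
  define a1 where "a1 z w = w * (A z w - A0 z)" for z w
  define b1 where "b1 z w = w * (B z w - B0 z)" for z w
  define c1 where "c1 z w = w * (C z w - C0 z)" for z w
  define dA where "dA = deriv A0"
  define dB where "dB = deriv B0"
  define dC where "dC = deriv C0"
  define dF where "dF = deriv F0"
  have der: "(A0 has_field_derivative dA z) (at z)" "(B0 has_field_derivative dB z) (at z)"
    "(C0 has_field_derivative dC z) (at z)" "(F0 has_field_derivative dF z) (at z)" if "z \<in> U" for z
    unfolding dA_def dB_def dC_def dF_def using hol opn(1) that holomorphic_derivI by blast+
  have dhol: "dA holomorphic_on U1" "dB holomorphic_on U1" "dC holomorphic_on U1"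
    unfolding dA_def dB_def dC_def
    by (rule holomorphic_on_subset[OF holomorphic_deriv sub(1)]; use hol opn in blast)+
  have dbd: "cmod (dA z) \<le> K / \<delta>" "cmod (dB z) \<le> K / \<delta>" "cmod (dC z) \<le> K / \<delta>" if "z \<in> U1" for z
    unfolding dA_def dB_def dC_def
    by (rule deriv_bound_ball[OF holomorphic_on_subset[OF hol(1) balls(1)[OF that]] \<delta> bd0(1)[OF subsetD[OF balls(1)[OF that]]]]
        deriv_bound_ball[OF holomorphic_on_subset[OF hol(2) balls(1)[OF that]] \<delta> bd0(2)[OF subsetD[OF balls(1)[OF that]]]]
        deriv_bound_ball[OF holomorphic_on_subset[OF hol(3) balls(1)[OF that]] \<delta> bd0(3)[OF subsetD[OF balls(1)[OF that]]]], assumption)+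
  have bl: "bounded_lipschitz D (\<lambda>z w v. A0 z)" "bounded_lipschitz D (\<lambda>z w v. B0 z)" "bounded_lipschitz D (\<lambda>z w v. C0 z)"
    "bounded_lipschitz D (\<lambda>z w v. dA z)" "bounded_lipschitz D (\<lambda>z w v. dB z)" "bounded_lipschitz D (\<lambda>z w v. dC z)"
    "bounded_lipschitz D (\<lambda>z w v. a1 z w)" "bounded_lipschitz D (\<lambda>z w v. b1 z w)" "bounded_lipschitz D (\<lambda>z w v. c1 z w)"
  proof -
    have D: "z \<in> U1" "z \<in> U" "R0 < Re w" if "(z, w) \<in> D" for z w
      using that sub(1) by (auto simp: D_def V0_def)
    note c = bounded_lipschitz_const[of D _ K] and c' = bounded_lipschitz_const[of D _ "K / \<delta>"]
    show "bounded_lipschitz D (\<lambda>z w v. A0 z)" by (rule c, rule bd0, erule D)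
    show "bounded_lipschitz D (\<lambda>z w v. B0 z)" by (rule c, rule bd0, erule D)
    show "bounded_lipschitz D (\<lambda>z w v. C0 z)" by (rule c, rule bd0, erule D)
    show "bounded_lipschitz D (\<lambda>z w v. dA z)" by (rule c', rule dbd, erule D)
    show "bounded_lipschitz D (\<lambda>z w v. dB z)" by (rule c', rule dbd, erule D)
    show "bounded_lipschitz D (\<lambda>z w v. dC z)" by (rule c', rule dbd, erule D)
    show "bounded_lipschitz D (\<lambda>z w v. a1 z w)" unfolding a1_def by (rule c, rule bd1; erule D)
    show "bounded_lipschitz D (\<lambda>z w v. b1 z w)" unfolding b1_def by (rule c, rule bd1; erule D)
    show "bounded_lipschitz D (\<lambda>z w v. c1 z w)" unfolding c1_def by (rule c, rule bd1; erule D)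
  qed
  have bl_num: "bounded_lipschitz D (\<lambda>z w v. x)" for x
    by (rule bounded_lipschitz_const[where K = "cmod x"]) simp
  \<comment> \<open>The components of \<open>v\<close> are \<open>p, q, r\<close>, and \<open>s1 F0 + s0 = (1 - A0 F0) Y\<close>, \<open>t1 F0 + t0 = A0 Y\<close>.\<close>
  define s1 where "s1 z v = - 1 * C0 z * v 0" for z and v :: "nat \<Rightarrow> complex"
  define s0 where "s0 z v = (1/2) * (1 + B0 z) * v 2 - C0 z * v 1" for z and v :: "nat \<Rightarrow> complex"
  define t1 where "t1 z v = (1/2) * (1 - B0 z) * v 0" for z and v :: "nat \<Rightarrow> complex"
  define t0 where "t0 z v = (1/2) * (1 - B0 z) * v 1 + A0 z * v 2" for z and v :: "nat \<Rightarrow> complex"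
  define \<tau> where "\<tau> z v = B0 z * v 1 - 2 * C0 z * v 0 - 2 * A0 z * v 2" for z and v :: "nat \<Rightarrow> complex"
  define lam where "lam z w = b1 z w * B0 z - 2 * a1 z w * C0 z - 2 * A0 z * c1 z w" for z w
  define g0 where "g0 z w v = a1 z w + dA z + lam z w * v 0 + dA z * \<tau> z v +
      ((a1 z w - dA z) * (s1 z v * s1 z v) - (b1 z w - dB z) * (s1 z v * t1 z v) + (c1 z w - dC z) * (t1 z v * t1 z v))"
    for z w and v :: "nat \<Rightarrow> complex"
  define g1 where "g1 z w v = b1 z w + dB z + lam z w * v 1 + dB z * \<tau> z v +
      (2 * ((a1 z w - dA z) * (s1 z v * s0 z v)) - (b1 z w - dB z) * (s1 z v * t0 z v + s0 z v * t1 z v)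
        + 2 * ((c1 z w - dC z) * (t1 z v * t0 z v)))"
    for z w and v :: "nat \<Rightarrow> complex"
  define g2 where "g2 z w v = c1 z w + dC z + lam z w * v 2 + dC z * \<tau> z v +
      ((a1 z w - dA z) * (s0 z v * s0 z v) - (b1 z w - dB z) * (s0 z v * t0 z v) + (c1 z w - dC z) * (t0 z v * t0 z v))"
    for z w and v :: "nat \<Rightarrow> complex"
  note blI = bounded_lipschitz_add bounded_lipschitz_diff bounded_lipschitz_mult bounded_lipschitz_var bl bl_num
  have "bounded_lipschitz D g0" "bounded_lipschitz D g1" "bounded_lipschitz D g2"
    unfolding g0_def[abs_def] g1_def[abs_def] g2_def[abs_def] s1_def s0_def t1_def t0_def \<tau>_def lam_def
    by (intro blI)+
  then obtain E0 L0 E1 L1 E2 L2 where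
    gl: "bounded_lipschitz_by E0 L0 D g0" "bounded_lipschitz_by E1 L1 D g1" "bounded_lipschitz_by E2 L2 D g2"
    unfolding bounded_lipschitz_def by blast
  note G0 = bounded_lipschitz_byD[OF gl(1)] and G1 = bounded_lipschitz_byD[OF gl(2)] and G2 = bounded_lipschitz_byD[OF gl(3)]
  define E where "E = E0 + E1 + E2"
  define \<Lambda> where "\<Lambda> = L0 + L1 + L2"
  have nn: "0 \<le> E" "0 \<le> \<Lambda>" "E0 \<le> E" "E1 \<le> E" "E2 \<le> E" "L0 \<le> \<Lambda>" "L1 \<le> \<Lambda>" "L2 \<le> \<Lambda>"
    using G0(1,2) G1(1,2) G2(1,2) by (auto simp: E_def \<Lambda>_def)
  define g where "g z w v i = (if i = 0 then g0 z w v else if i = 1 then g1 z w v else g2 z w v)"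
    for z w v and i :: nat
  have gbd: "cmod (g z w v i) \<le> E" if "(z, w) \<in> D" "\<forall>j. cmod (v j) \<le> 1" for z w v i
    using G0(3)[OF that] G1(3)[OF that] G2(3)[OF that] nn unfolding g_def by (auto intro: order_trans)
  have glip: "cmod (g z w v i - g z w v' i) \<le> \<Lambda> * e"
    if h: "(z, w) \<in> D" "\<forall>j. cmod (v j) \<le> 1" "\<forall>j. cmod (v' j) \<le> 1" "\<forall>j. cmod (v j - v' j) \<le> e" for z w v v' i e
  proof -
    have e: "0 \<le> e" using h(4) norm_ge_zero order_trans by blast
    have "L0 * e \<le> \<Lambda> * e" "L1 * e \<le> \<Lambda> * e" "L2 * e \<le> \<Lambda> * e"
      using e nn by (auto intro: mult_right_mono)
    then show ?thesis
      using G0(4)[OF h] G1(4)[OF h] G2(4)[OF h] unfolding g_def by (auto intro: order_trans)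
  qed
  define R1 where "R1 = max R0 (max E (2 * \<Lambda>))"
  have R1: "R1 > 0" "R0 \<le> R1" "E \<le> R1" "2 * \<Lambda> \<le> R1" using R0 by (auto simp: R1_def)
  have VV: "{w. R1 < Re w} \<subseteq> {w. R0 < Re w}" using R1 by auto
  note sepA = sep[THEN sep_holomorphic_subset, OF sub(1) VV]
  have idw: "sep_holomorphic_on U1 {w. R1 < Re w} (\<lambda>z w. w)"
    by (rule sep_holomorphic_second) (intro holomorphic_intros)
  have sepn: "sep_holomorphic_on U1 {w. R1 < Re w} (\<lambda>z w. x)" for x
    by (rule sep_holomorphic_first) (intro holomorphic_intros)
  note sep0 = hol(1-3)[THEN holomorphic_on_subset, OF sub(1), THEN sep_holomorphic_first, of "{w. R1 < Re w}"]
  note sep1 = dhol[THEN sep_holomorphic_first, of "{w. R1 < Re w}"]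
  have gsep: "sep_holomorphic_on U1 {w. R1 < Re w} (\<lambda>z w. g z w (\<lambda>j. Y j z w) i)"
    if Y: "\<And>j. sep_holomorphic_on U1 {w. R1 < Re w} (Y j)" for Y :: "nat \<Rightarrow> complex \<Rightarrow> complex \<Rightarrow> complex" and i
  proof -
    note I = sep_holomorphic_add sep_holomorphic_diff sep_holomorphic_mult idw sepn sep0 sep1 sepA Y
    have "sep_holomorphic_on U1 {w. R1 < Re w} (\<lambda>z w. g0 z w (\<lambda>j. Y j z w))"
      "sep_holomorphic_on U1 {w. R1 < Re w} (\<lambda>z w. g1 z w (\<lambda>j. Y j z w))"
      "sep_holomorphic_on U1 {w. R1 < Re w} (\<lambda>z w. g2 z w (\<lambda>j. Y j z w))"
      unfolding g0_def g1_def g2_def s1_def s0_def t1_def t0_def \<tau>_def lam_def a1_def b1_def c1_def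
      by (intro I)+
    then show ?thesis unfolding g_def by (cases "i = 0"; cases "i = 1") simp_all
  qed
  have inD: "(z, w) \<in> D" if "z \<in> U1" "R1 < Re w" for z w
    using that R1(2) by (auto simp: D_def V0_def)
  obtain Y where Y: "\<And>j. sep_holomorphic_on U1 {w. R1 < Re w} (Y j)"
    "\<And>j z w. z \<in> U1 \<Longrightarrow> R1 < Re w \<Longrightarrow> cmod (Y j z w) \<le> 1"
    "\<And>j z w. z \<in> U1 \<Longrightarrow> R1 < Re w \<Longrightarrow>
        ((\<lambda>z. Y j z w) has_field_derivative (w * Y j z w + g z w (\<lambda>j. Y j z w) j)) (at z)"
  proof (rule bounded_solution_exists[where U = U1 and R = R1 and g = g and B = E and \<Lambda> = \<Lambda>])
    show "cmod (g z w v i) \<le> E" if "z \<in> U1" "R1 < Re w" "\<And>j. cmod (v j) \<le> 1" for z w v i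
      using gbd[OF inD[OF that(1,2)]] that(3) by blast
    show "cmod (g z w v i - g z w v' i) \<le> \<Lambda> * e"
      if "z \<in> U1" "R1 < Re w" "\<And>j. cmod (v j) \<le> 1" "\<And>j. cmod (v' j) \<le> 1" "\<And>j. cmod (v j - v' j) \<le> e"
      for z w v v' e i
      using glip[OF inD[OF that(1,2)]] that(3-5) by blast
  qed (use opn(2) shift R1 nn(2) gsep that in blast)+
  define K1 where "K1 = 1 / \<delta> + E"
  have K1: "K1 > 0" using \<delta> nn by (simp add: K1_def add_pos_nonneg)
  \<comment> \<open>The Cauchy estimate bounds \<open>Y'\<close>, and then the equation bounds \<open>w Y\<close>.\<close>
  have Ysmall: "cmod (Y j z w) \<le> K1 / cmod w" if zw: "z \<in> U2" "R1 < Re w" for j z w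
  proof -
    have z1: "z \<in> U1" using zw sub by blast
    have w: "cmod w > 0" using zw(2) R1(1) by auto
    have "cmod (deriv (\<lambda>z. Y j z w) z) \<le> 1 / \<delta>"
    proof (rule deriv_bound_ball[OF _ \<delta>])
      show "(\<lambda>z. Y j z w) holomorphic_on ball z \<delta>"
        using Y(1)[of j] zw(2) balls(2)[OF zw(1)] unfolding sep_holomorphic_on_def
        by (blast intro: holomorphic_on_subset)
      show "cmod (Y j u w) \<le> 1" if "u \<in> ball z \<delta>" for u
        using Y(2) balls(2)[OF zw(1)] that zw(2) by blast
    qed
    moreover have "cmod (w * Y j z w) = cmod (deriv (\<lambda>z. Y j z w) z - g z w (\<lambda>j. Y j z w) j)"
      using DERIV_imp_deriv[OF Y(3)[OF z1 zw(2)]] by simp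
    moreover have "cmod (g z w (\<lambda>j. Y j z w) j) \<le> E"
      by (rule gbd[OF inD[OF z1 zw(2)]]) (use Y(2)[OF z1 zw(2)] in blast)
    ultimately have "cmod (w * Y j z w) \<le> K1"
      unfolding K1_def using norm_triangle_ineq4[of "deriv (\<lambda>z. Y j z w) z" "g z w (\<lambda>j. Y j z w) j"] by linarith
    then show ?thesis using w by (simp add: norm_mult field_simps)
  qed
  obtain \<rho>0 where \<rho>0: "\<rho>0 > 0" "cball z0 \<rho>0 \<subseteq> U2"
    using opn(3) z0 open_contains_cball by blast
  have "bounded (F0 ` cball z0 \<rho>0)"
    by (intro compact_imp_bounded compact_continuous_image holomorphic_on_imp_continuous_on
        holomorphic_on_subset[OF hol(4)]) (use \<rho>0 sub in auto)
  then obtain M where M: "M > 0" "\<And>z. z \<in> cball z0 \<rho>0 \<Longrightarrow> cmod (F0 z) \<le> M"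
    unfolding bounded_pos by auto
  define K2 where "K2 = K1 * (M\<^sup>2 + M + 1)"
  have K2: "K2 > 0" unfolding K2_def using K1 M by (simp add: add_pos_pos)
  define R where "R = max R1 (2 * \<bar>K\<bar> * K2)"
  have R: "R > 0" "R0 \<le> R" "R1 \<le> R" "2 * \<bar>K\<bar> * K2 \<le> R" using R1 by (auto simp: R_def)
  define y where "y z w = Y 0 z w * (F0 z)\<^sup>2 + Y 1 z w * F0 z + Y 2 z w" for z w
  have ball: "ball z0 \<rho>0 \<subseteq> U2" "ball z0 \<rho>0 \<subseteq> U1" "ball z0 \<rho>0 \<subseteq> U"
    using order_trans[OF ball_subset_cball \<rho>0(2)] sub by blast+
  have ysmall: "cmod (y z w) \<le> K2 / cmod w" "cmod (A0 z * y z w) \<le> 1 / 2" if zw: "z \<in> ball z0 \<rho>0" "R < Re w" for z w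
  proof -
    have z: "z \<in> U2" "z \<in> U" "cmod (F0 z) \<le> M" and w: "R1 < Re w" "0 < cmod w" "R < cmod w"
      using zw ball M(2)[of z] R complex_Re_le_cmod[of w] by auto
    have MM: "(cmod (F0 z))\<^sup>2 \<le> M\<^sup>2" using z(3) by (intro power_mono) auto
    have "cmod (y z w) \<le> cmod (Y 0 z w) * (cmod (F0 z))\<^sup>2 + cmod (Y 1 z w) * cmod (F0 z) + cmod (Y 2 z w)"
      unfolding y_def by (metis (no_types, opaque_lifting) add_mono norm_mult norm_power norm_triangle_ineq norm_triangle_le order_refl)
    also have "\<dots> \<le> (K1 / cmod w) * M\<^sup>2 + (K1 / cmod w) * M + K1 / cmod w"
      using z(3) MM K1 w by (intro add_mono mult_mono Ysmall[OF z(1) w(1)]) auto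
    also have "\<dots> = K2 / cmod w" by (simp add: K2_def add_divide_distrib algebra_simps)
    finally show 1: "cmod (y z w) \<le> K2 / cmod w" .
    have "cmod (A0 z * y z w) \<le> \<bar>K\<bar> * (K2 / cmod w)"
      unfolding norm_mult using bd0(1)[OF z(2)] K2 by (intro mult_mono 1) auto
    also have "\<dots> \<le> 1 / 2" using R(4) w by (simp add: field_simps)
    finally show "cmod (A0 z * y z w) \<le> 1 / 2" .
  qed
  define d where "d z w = 1 - A0 z * y z w" for z w
  have dge: "1 / 2 \<le> cmod (d z w)" "d z w \<noteq> 0" if zw: "z \<in> ball z0 \<rho>0" "R < Re w" for z w
  proof -
    show "1 / 2 \<le> cmod (d z w)"
      using ysmall(2)[OF zw] norm_triangle_ineq2[of 1 "A0 z * y z w"] by (simp add: d_def)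
    then show "d z w \<noteq> 0" by auto
  qed
  define F where "F z w = F0 z + y z w / d z w" for z w
  show thesis
  proof (rule that[of \<rho>0 R "2 * K2" F])
    have VV': "{w. R < Re w} \<subseteq> {w. R1 < Re w}" using R by auto
    note YY = sep_holomorphic_subset[OF Y(1) ball(2) VV']
    note FF = sep_holomorphic_first[OF holomorphic_on_subset[OF hol(4) ball(3)], of "{w. R < Re w}"]
      sep_holomorphic_first[OF holomorphic_on_subset[OF hol(1) ball(3)], of "{w. R < Re w}"]
      sep_holomorphic_first[OF holomorphic_on_const[of 1], of "ball z0 \<rho>0" "{w. R < Re w}"]
    show "sep_holomorphic_on (ball z0 \<rho>0) {w. R < Re w} F"
      unfolding F_def
    proof (intro sep_holomorphic_add sep_holomorphic_divide FF)
      show "sep_holomorphic_on (ball z0 \<rho>0) {w. R < Re w} y"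
        unfolding y_def power2_eq_square by (intro sep_holomorphic_add sep_holomorphic_mult FF YY)
      then show "sep_holomorphic_on (ball z0 \<rho>0) {w. R < Re w} d"
        unfolding d_def by (intro sep_holomorphic_diff sep_holomorphic_mult FF)
    qed (use dge in auto)
    show "cmod (F z w - F0 z) \<le> 2 * K2 / cmod w" if zw: "z \<in> ball z0 \<rho>0" "R < Re w" for z w
    proof -
      have "cmod (F z w - F0 z) = cmod (y z w) / cmod (d z w)" by (simp add: F_def norm_divide)
      also have "\<dots> \<le> (K2 / cmod w) / (1/2)"
        using ysmall(1)[OF zw] dge(1)[OF zw] K2 by (intro frac_le) auto
      finally show ?thesis by (simp add: mult.commute)
    qed
    show "((\<lambda>z. F z w) has_field_derivative w * (A z w * (F z w)\<^sup>2 + B z w * F z w + C z w)) (at z)"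
      if zw: "z \<in> ball z0 \<rho>0" "R < Re w" for z w
    proof -
      have z: "z \<in> U" "z \<in> U1" and w: "R1 < Re w" "w \<noteq> 0" using zw ball R by auto
      define v where "v j = Y j z w" for j
      define dp where "dp j = w * Y j z w + g z w v j" for j
      have dY: "((\<lambda>z. Y j z w) has_field_derivative dp j) (at z)" for j
        using Y(3)[OF z(2) w(1)] unfolding dp_def v_def .
      define dy where "dy = dp 0 * (F0 z)\<^sup>2 + dp 1 * F0 z + dp 2 + (2 * Y 0 z w * F0 z + Y 1 z w) * dF z"
      have dy: "((\<lambda>z. y z w) has_field_derivative dy) (at z)"
        unfolding y_def by (rule derivative_eq_intros dY der z refl)+ (simp add: dy_def algebra_simps)
      have dd: "((\<lambda>z. d z w) has_field_derivative - (dA z * y z w + A0 z * dy)) (at z)"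
        unfolding d_def by (rule derivative_eq_intros dy der z refl)+ (simp add: algebra_simps)
      have "((\<lambda>z. F z w) has_field_derivative dF z + (dy * d z w + y z w * (dA z * y z w + A0 z * dy)) / (d z w)\<^sup>2) (at z)"
        unfolding F_def by (rule derivative_eq_intros dy dd der z refl dge[OF zw])+ (simp add: algebra_simps power2_eq_square)
      also have "dF z + (dy * d z w + y z w * (dA z * y z w + A0 z * dy)) / (d z w)\<^sup>2
          = (dF z * (d z w)\<^sup>2 + dy + dA z * (y z w)\<^sup>2) / (d z w)\<^sup>2"
      proof -
        have "dy * d z w + y z w * (dA z * y z w + A0 z * dy) = dy + dA z * (y z w)\<^sup>2"
          by (simp add: d_def algebra_simps power2_eq_square)
        then show ?thesis using dge(2)[OF zw] by (simp add: field_simps)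
      qed
      also have "dF z * (d z w)\<^sup>2 + dy + dA z * (y z w)\<^sup>2 =
        (w * A0 z + a1 z w) * (F0 z * d z w + y z w)\<^sup>2 + (w * B0 z + b1 z w) * (F0 z * d z w + y z w) * d z w
          + (w * C0 z + c1 z w) * (d z w)\<^sup>2"
        unfolding d_def
      proof (rule lifted_equation[where dB = "dB z" and dC = "dC z" and p = "Y 0 z w" and q = "Y 1 z w" and r = "Y 2 z w"
            and dp = "dp 0" and dq = "dp 1" and dr = "dp 2" and ga = "a1 z w - dA z" and gb = "b1 z w - dB z" and gc = "c1 z w - dC z"
            and sp = "s1 z v" and sq = "s0 z v" and tp = "t1 z v" and tq = "t0 z v" and \<tau> = "\<tau> z v" and lm = "lam z w"])
        have "((\<lambda>z. 2 * A0 z * F0 z + B0 z) has_field_derivative 2 * (dA z * F0 z + A0 z * dF z) + dB z) (at z)"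
          by (rule derivative_eq_intros der z refl)+ (simp add: algebra_simps)
        moreover have "((\<lambda>z. 2 * A0 z * F0 z + B0 z) has_field_derivative 0) (at z)"
          by (rule has_field_derivative_transform_within_open[OF DERIV_const[of 1] opn(1) z(1)]) (use F0 in auto)
        ultimately show "2 * (dA z * F0 z + A0 z * dF z) + dB z = 0" by (rule DERIV_unique)
        have "((\<lambda>z. A0 z * (F0 z)\<^sup>2 + B0 z * F0 z + C0 z) has_field_derivative
            dA z * (F0 z)\<^sup>2 + A0 z * (2 * F0 z * dF z) + dB z * F0 z + B0 z * dF z + dC z) (at z)"
          by (rule derivative_eq_intros der z refl)+ (simp add: algebra_simps)
        moreover have "((\<lambda>z. A0 z * (F0 z)\<^sup>2 + B0 z * F0 z + C0 z) has_field_derivative 0) (at z)"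
          by (rule has_field_derivative_transform_within_open[OF DERIV_const[of 0] opn(1) z(1)]) (use F0 in auto)
        ultimately have "dA z * (F0 z)\<^sup>2 + A0 z * (2 * F0 z * dF z) + dB z * F0 z + B0 z * dF z + dC z = 0"
          by (rule DERIV_unique)
        then have "(2 * A0 z * F0 z + B0 z) * dF z + (dA z * (F0 z)\<^sup>2 + dB z * F0 z + dC z) = 0"
          by (simp add: algebra_simps)
        then show "dF z = - (dA z * (F0 z)\<^sup>2 + dB z * F0 z + dC z)"
          by (subst eq_neg_iff_add_eq_0) (simp add: F0(1)[OF z(1)])
      qed (use F0 z in \<open>auto simp: y_def dy_def dp_def g_def g0_def g1_def g2_def s1_def s0_def t1_def t0_def \<tau>_def lam_def v_def\<close>)
      also have "((w * A0 z + a1 z w) * (F0 z * d z w + y z w)\<^sup>2 + (w * B0 z + b1 z w) * (F0 z * d z w + y z w) * d z w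
          + (w * C0 z + c1 z w) * (d z w)\<^sup>2) / (d z w)\<^sup>2 = w * (A z w * (F z w)\<^sup>2 + B z w * F z w + C z w)"
      proof -
        have Fd: "F0 z * d z w + y z w = F z w * d z w" using dge(2)[OF zw] by (simp add: F_def field_simps)
        have abc: "w * A0 z + a1 z w = w * A z w" "w * B0 z + b1 z w = w * B z w" "w * C0 z + c1 z w = w * C z w"
          by (simp_all add: a1_def b1_def c1_def algebra_simps)
        show ?thesis unfolding Fd abc using dge(2)[OF zw] by (simp add: field_simps power2_eq_square)
      qed
      finally show ?thesis .
    qed
  qed (use \<rho>0 ball R K2 in auto)
qed

section \<open>Gevrey remainders\<close>

definition fps_remainder :: "complex \<Rightarrow> complex fps \<Rightarrow> nat \<Rightarrow> complex \<Rightarrow> complex" where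
  "fps_remainder u U n h = u - (\<Sum>k<n. fps_nth U k * h ^ k)"

lemma asym_remainder_eq: "asym_remainder g gh n x h = fps_remainder (g x h) (series_at gh x) n h"
  by (simp add: asym_remainder_def fps_remainder_def series_at_def)

lemma fps_remainder_add: "fps_remainder (u + v) (U + V) n h = fps_remainder u U n h + fps_remainder v V n h"
  by (simp add: fps_remainder_def sum.distrib algebra_simps)

lemma fps_remainder_diff: "fps_remainder (u - v) (U - V) n h = fps_remainder u U n h - fps_remainder v V n h"
  by (simp add: fps_remainder_def sum_subtractf algebra_simps)

lemma fps_remainder_const_mult: "fps_remainder (c * u) (fps_const c * U) n h = c * fps_remainder u U n h"
  by (simp add: fps_remainder_def sum_distrib_left algebra_simps)

lemma fps_remainder_X_mult: "fps_remainder (h * u) (fps_X * U) (Suc n) h = h * fps_remainder u U n h"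
proof -
  have "(\<Sum>k<Suc n. fps_nth (fps_X * U) k * h ^ k) = (\<Sum>k<n. fps_nth U k * h ^ Suc k)"
    by (subst sum.lessThan_Suc_shift) simp
  then show ?thesis by (simp add: fps_remainder_def sum_distrib_left algebra_simps)
qed

lemma fps_remainder_Suc: "fps_remainder u U (Suc n) h = fps_remainder u U n h - fps_nth U n * h ^ n"
  by (simp add: fps_remainder_def)

text \<open>
  The coefficients of \<open>V\<close> occur only below index \<open>n\<close>, where the remainders up to order \<open>n\<close> control them,
  and the coefficients of \<open>U\<close> do not occur at all.
\<close>

lemma fps_remainder_mult:
  "fps_remainder (u * v) (U * V) n h =
     u * fps_remainder v V n h + (\<Sum>m<n. fps_nth V m * h ^ m * fps_remainder u U (n - m) h)"
proof -
  have "(\<Sum>k<n. fps_nth (U * V) k * h ^ k) = (\<Sum>k<n. \<Sum>i\<le>k. (fps_nth V i * h ^ i) * (fps_nth U (k - i) * h ^ (k - i)))"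
  proof (rule sum.cong[OF refl])
    fix k
    have c: "fps_nth (U * V) k = (\<Sum>i\<le>k. fps_nth V i * fps_nth U (k - i))"
      by (subst mult.commute) (simp only: fps_mult_nth atLeast0AtMost)
    show "fps_nth (U * V) k * h ^ k = (\<Sum>i\<le>k. (fps_nth V i * h ^ i) * (fps_nth U (k - i) * h ^ (k - i)))"
      unfolding c sum_distrib_right
    proof (intro sum.cong refl)
      fix i assume "i \<in> {..k}"
      then have "h ^ k = h ^ i * h ^ (k - i)" using power_add[of h i "k - i"] by simp
      then show "fps_nth V i * fps_nth U (k - i) * h ^ k = fps_nth V i * h ^ i * (fps_nth U (k - i) * h ^ (k - i))"
        by simp
    qed
  qed
  also have "\<dots> = (\<Sum>(i, j)\<in>{(i, j). i + j < n}. (fps_nth V i * h ^ i) * (fps_nth U j * h ^ j))"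
    by (rule sum.triangle_reindex[symmetric])
  also have "{(i, j). i + j < n} = Sigma {..<n} (\<lambda>i. {..<n - i})" by auto
  also have "(\<Sum>(i, j)\<in>\<dots>. (fps_nth V i * h ^ i) * (fps_nth U j * h ^ j))
      = (\<Sum>m<n. \<Sum>j<n - m. (fps_nth V m * h ^ m) * (fps_nth U j * h ^ j))"
    by (rule sum.Sigma[symmetric]) auto
  also have "\<dots> = (\<Sum>m<n. (fps_nth V m * h ^ m) * (u - fps_remainder u U (n - m) h))"
    by (simp add: fps_remainder_def sum_distrib_left)
  also have "\<dots> = u * (\<Sum>m<n. fps_nth V m * h ^ m) - (\<Sum>m<n. fps_nth V m * h ^ m * fps_remainder u U (n - m) h)"
    by (simp add: algebra_simps sum_subtractf sum_distrib_left)
  finally show ?thesis by (simp add: fps_remainder_def algebra_simps)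
qed

lemma fact_Suc_mult_le: "fact (Suc a) * fact (Suc b) \<le> (fact (Suc (a + b)) :: real)"
proof (induction a)
  case (Suc a)
  have "fact (Suc (Suc a)) * fact (Suc b) = real (Suc (Suc a)) * (fact (Suc a) * fact (Suc b))" by simp
  also have "\<dots> \<le> real (Suc (Suc a + b)) * fact (Suc (a + b))"
    using Suc by (intro mult_mono) auto
  finally show ?case by simp
qed simp

text \<open>
  The two end terms equal \<open>n!\<close>, and all inner ones together do not exceed it; hence Gevrey bounds are
  stable under products, with the same growth rate.
\<close>

lemma sum_fact_mult_le: "(\<Sum>m\<le>n. fact m * fact (n - m)) \<le> 3 * (fact n :: real)"
proof (cases n)
  case (Suc k)
  have "(\<Sum>m\<le>Suc k. fact m * fact (Suc k - m)) = fact (Suc k) + (\<Sum>m\<le>k. fact (Suc m) * fact (k - m) :: real)"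
    by (subst sum.atMost_Suc_shift) simp
  also have "(\<Sum>m\<le>k. fact (Suc m) * fact (k - m) :: real) = (\<Sum>m<k. fact (Suc m) * fact (k - m)) + fact (Suc k)"
    by (simp add: lessThan_Suc_atMost[symmetric])
  also have "(\<Sum>m<k. fact (Suc m) * fact (k - m) :: real) \<le> (\<Sum>m<k. fact k)"
  proof (rule sum_mono)
    fix m assume "m \<in> {..<k}"
    then obtain b where b: "k = Suc (m + b)" using less_imp_Suc_add by auto
    show "fact (Suc m) * fact (k - m) \<le> (fact k :: real)"
      using fact_Suc_mult_le[of m b] b by (simp add: Suc_diff_le)
  qed
  also have "\<dots> \<le> fact (Suc k)" by (simp add: mult_right_mono)
  finally show ?thesis using Suc by simp
qed simp

text \<open>
  The order is bounded by \<open>N\<close> so that products can be estimated inside an induction on the order.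
\<close>

definition gevrey_upto :: "real \<Rightarrow> real \<Rightarrow> nat \<Rightarrow> complex set \<Rightarrow> (complex \<Rightarrow> complex) \<Rightarrow> complex fps \<Rightarrow> bool" where
  "gevrey_upto K L N H u U \<longleftrightarrow>
     (\<forall>n\<le>N. \<forall>h\<in>H. cmod (fps_remainder (u h) U n h) \<le> K * L ^ n * fact n * cmod h ^ n)"

lemma gevrey_uptoD:
  "gevrey_upto K L N H u U \<Longrightarrow> n \<le> N \<Longrightarrow> h \<in> H \<Longrightarrow>
     cmod (fps_remainder (u h) U n h) \<le> K * L ^ n * fact n * cmod h ^ n"
  unfolding gevrey_upto_def by blast

lemma gevrey_upto_mono:
  assumes "gevrey_upto K L N H u U" "K \<le> K'" "L \<le> L'" "0 \<le> K" "0 \<le> L"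
  shows "gevrey_upto K' L' N H u U"
  unfolding gevrey_upto_def
proof (intro allI impI ballI)
  fix n h assume "n \<le> N" "h \<in> H"
  then have "cmod (fps_remainder (u h) U n h) \<le> K * L ^ n * fact n * cmod h ^ n"
    using assms gevrey_uptoD by blast
  also have "\<dots> \<le> K' * L' ^ n * fact n * cmod h ^ n"
    using assms by (intro mult_right_mono mult_mono power_mono) auto
  finally show "cmod (fps_remainder (u h) U n h) \<le> K' * L' ^ n * fact n * cmod h ^ n" .
qed

lemma gevrey_upto_coeff:
  assumes g: "gevrey_upto K L N H u U" and m: "m < N" and lim: "\<And>e. e > 0 \<Longrightarrow> \<exists>h\<in>H. h \<noteq> 0 \<and> cmod h < e"
  shows "cmod (fps_nth U m) \<le> K * L ^ m * fact m"
proof (rule field_le_epsilon)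
  fix e :: real assume e: "e > 0"
  define c where "c = \<bar>K * L ^ Suc m * fact (Suc m)\<bar> + 1"
  have c: "c > 0" by (simp add: c_def)
  obtain h where h: "h \<in> H" "h \<noteq> 0" "cmod h < e / c" using lim[of "e / c"] e c by auto
  have "fps_nth U m * h ^ m = fps_remainder (u h) U m h - fps_remainder (u h) U (Suc m) h"
    by (simp add: fps_remainder_Suc)
  then have "cmod (fps_nth U m) * cmod h ^ m = cmod (fps_remainder (u h) U m h - fps_remainder (u h) U (Suc m) h)"
    by (metis norm_mult norm_power)
  also have "\<dots> \<le> cmod (fps_remainder (u h) U m h) + cmod (fps_remainder (u h) U (Suc m) h)"
    by (rule norm_triangle_ineq4)
  also have "\<dots> \<le> K * L ^ m * fact m * cmod h ^ m + K * L ^ Suc m * fact (Suc m) * cmod h ^ Suc m"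
    by (intro add_mono gevrey_uptoD[OF g]) (use m h in auto)
  also have "\<dots> \<le> K * L ^ m * fact m * cmod h ^ m + c * cmod h ^ Suc m"
    by (intro add_left_mono mult_right_mono) (auto simp: c_def)
  also have "\<dots> = (K * L ^ m * fact m + c * cmod h) * cmod h ^ m" by (simp add: algebra_simps)
  finally have "cmod (fps_nth U m) \<le> K * L ^ m * fact m + c * cmod h"
    using h(2) by simp
  also have "\<dots> \<le> K * L ^ m * fact m + e" using h(3) c by (simp add: field_simps)
  finally show "cmod (fps_nth U m) \<le> K * L ^ m * fact m + e" .
qed

lemma gevrey_upto_mult:
  assumes u: "gevrey_upto K L N H u U" and v: "gevrey_upto K' L N H v V"
    and lim: "\<And>e. e > 0 \<Longrightarrow> \<exists>h\<in>H. h \<noteq> 0 \<and> cmod h < e" and nn: "0 \<le> K" "0 \<le> K'" "0 \<le> L"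
  shows "gevrey_upto (3 * K * K') L N H (\<lambda>h. u h * v h) (U * V)"
  unfolding gevrey_upto_def
proof (intro allI impI ballI)
  fix n h assume n: "n \<le> N" and h: "h \<in> H"
  have u0: "cmod (u h) \<le> K" using gevrey_uptoD[OF u _ h, of 0] by (simp add: fps_remainder_def)
  have "cmod (u h * fps_remainder (v h) V n h) \<le> K * (K' * L ^ n * fact n * cmod h ^ n)"
    unfolding norm_mult by (intro mult_mono u0 gevrey_uptoD[OF v n h] nn) auto
  moreover have "cmod (\<Sum>m<n. fps_nth V m * h ^ m * fps_remainder (u h) U (n - m) h)
      \<le> (\<Sum>m<n. K * K' * L ^ n * cmod h ^ n * (fact m * fact (n - m)))"
  proof (rule sum_norm_le)
    fix m assume m: "m \<in> {..<n}"
    have "cmod (fps_nth V m * h ^ m * fps_remainder (u h) U (n - m) h)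
        \<le> (K' * L ^ m * fact m * cmod h ^ m) * (K * L ^ (n - m) * fact (n - m) * cmod h ^ (n - m))"
      unfolding norm_mult norm_power using m n h nn
      by (intro mult_mono gevrey_upto_coeff[OF v _ lim] gevrey_uptoD[OF u]) auto
    also have "\<dots> = K * K' * (L ^ m * L ^ (n - m)) * (cmod h ^ m * cmod h ^ (n - m)) * (fact m * fact (n - m))"
      by (simp add: mult_ac)
    also have "\<dots> = K * K' * L ^ n * cmod h ^ n * (fact m * fact (n - m))"
      using m by (simp add: power_add[symmetric])
    finally show "cmod (fps_nth V m * h ^ m * fps_remainder (u h) U (n - m) h) \<le> K * K' * L ^ n * cmod h ^ n * (fact m * fact (n - m))" .
  qed
  ultimately have "cmod (fps_remainder (u h * v h) (U * V) n h) \<le> K * (K' * L ^ n * fact n * cmod h ^ n)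
      + (\<Sum>m<n. K * K' * L ^ n * cmod h ^ n * (fact m * fact (n - m)))"
    unfolding fps_remainder_mult by (rule norm_triangle_mono)
  also have "\<dots> = K * K' * L ^ n * cmod h ^ n * (\<Sum>m\<le>n. fact m * fact (n - m))"
    by (simp add: lessThan_Suc_atMost[symmetric] sum_distrib_left algebra_simps)
  also have "\<dots> \<le> K * K' * L ^ n * cmod h ^ n * (3 * fact n)"
    using nn by (intro mult_left_mono sum_fact_mult_le) auto
  finally show "cmod (fps_remainder (u h * v h) (U * V) n h) \<le> 3 * K * K' * L ^ n * fact n * cmod h ^ n"
    by (simp add: mult_ac)
qed

lemma gevrey_upto_add:
  assumes "gevrey_upto K L N H u U" "gevrey_upto K' L N H v V"
  shows "gevrey_upto (K + K') L N H (\<lambda>h. u h + v h) (U + V)"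
  unfolding gevrey_upto_def fps_remainder_add
proof (intro allI impI ballI)
  fix n h assume "n \<le> N" "h \<in> H"
  from norm_triangle_mono[OF gevrey_uptoD[OF assms(1) this] gevrey_uptoD[OF assms(2) this]]
  show "cmod (fps_remainder (u h) U n h + fps_remainder (v h) V n h) \<le> (K + K') * L ^ n * fact n * cmod h ^ n"
    by (simp add: algebra_simps)
qed

lemma gevrey_upto_const_mult:
  assumes "gevrey_upto K L N H u U" "cmod c \<le> k" "0 \<le> K" "0 \<le> L"
  shows "gevrey_upto (k * K) L N H (\<lambda>h. c * u h) (fps_const c * U)"
  unfolding gevrey_upto_def fps_remainder_const_mult norm_mult
proof (intro allI impI ballI)
  fix n h assume n: "n \<le> N" "h \<in> H"
  have k: "0 \<le> k" using assms(2) norm_ge_zero order_trans by blast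
  have "cmod c * cmod (fps_remainder (u h) U n h) \<le> k * (K * L ^ n * fact n * cmod h ^ n)"
    by (intro mult_mono assms gevrey_uptoD[OF assms(1) n] k) auto
  then show "cmod c * cmod (fps_remainder (u h) U n h) \<le> k * K * L ^ n * fact n * cmod h ^ n"
    by (simp add: mult_ac)
qed

lemma gevrey_upto_const:
  assumes "0 \<le> L" "cmod c \<le> K"
  shows "gevrey_upto K L N H (\<lambda>h. c) (fps_const c)"
  unfolding gevrey_upto_def
proof (intro allI impI ballI)
  fix n h
  have K: "0 \<le> K" using assms(2) norm_ge_zero order_trans by blast
  show "cmod (fps_remainder c (fps_const c) n h) \<le> K * L ^ n * fact n * cmod h ^ n"
  proof (cases n)
    case (Suc m)
    have "(\<Sum>k<Suc m. fps_nth (fps_const c) k * h ^ k) = c"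
      by (subst sum.lessThan_Suc_shift) simp
    then show ?thesis using K assms Suc by (simp add: fps_remainder_def)
  qed (use assms in \<open>simp add: fps_remainder_def\<close>)
qed

text \<open>
  Dividing by \<open>h\<close> shifts the order by one; the extra factor \<open>n + 1\<close> is absorbed into \<open>2 ^ n\<close>.
\<close>

lemma gevrey_upto_shift:
  assumes g: "gevrey_upto K L (Suc N) H u U" and nn: "0 \<le> K" "0 \<le> L" and H0: "0 \<notin> H"
  shows "gevrey_upto (K * L) (2 * L) N H (\<lambda>h. (u h - fps_nth U 0) / h) (fps_shift 1 U)"
  unfolding gevrey_upto_def
proof (intro allI impI ballI)
  fix n h assume n: "n \<le> N" and h: "h \<in> H"
  then have h0: "h \<noteq> 0" using H0 by auto
  have "(\<Sum>k<Suc n. fps_nth U k * h ^ k) = fps_nth U 0 + h * (\<Sum>k<n. fps_nth (fps_shift 1 U) k * h ^ k)"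
    by (subst sum.lessThan_Suc_shift) (simp add: sum_distrib_left mult_ac)
  then have "h * fps_remainder ((u h - fps_nth U 0) / h) (fps_shift 1 U) n h = fps_remainder (u h) U (Suc n) h"
  proof -
    assume s: "(\<Sum>k<Suc n. fps_nth U k * h ^ k) = fps_nth U 0 + h * (\<Sum>k<n. fps_nth (fps_shift 1 U) k * h ^ k)"
    have "h * ((u h - fps_nth U 0) / h) = u h - fps_nth U 0" using h0 by simp
    then show ?thesis
      unfolding fps_remainder_def s right_diff_distrib[of h "(u h - fps_nth U 0) / h"] by (simp add: algebra_simps)
  qed
  then have "cmod h * cmod (fps_remainder ((u h - fps_nth U 0) / h) (fps_shift 1 U) n h) \<le> K * L ^ Suc n * fact (Suc n) * cmod h ^ Suc n"
    using gevrey_uptoD[OF g _ h, of "Suc n"] n by (metis Suc_le_mono norm_mult)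
  also have "\<dots> = cmod h * ((K * L) * L ^ n * (real (Suc n) * fact n) * cmod h ^ n)" by simp
  also have "\<dots> \<le> cmod h * ((K * L) * L ^ n * (2 ^ n * fact n) * cmod h ^ n)"
  proof -
    have "real (Suc n) \<le> 2 ^ n" by (metis Suc_leI less_exp of_nat_le_iff of_nat_numeral of_nat_power)
    then show ?thesis using nn by (intro mult_left_mono mult_right_mono) auto
  qed
  finally show "cmod (fps_remainder ((u h - fps_nth U 0) / h) (fps_shift 1 U) n h) \<le> K * L * (2 * L) ^ n * fact n * cmod h ^ n"
    using h0 by (simp add: power_mult_distrib mult_ac)
qed

text \<open>
  The remainder of order \<open>n + 1\<close> is \<open>h\<close> times an expression in remainders of order \<open>n\<close>, one of them
  differentiated. The Cauchy estimate on a ball of radius \<open>\<delta> / (n + 2)\<close> costs a factor comparable to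
  \<open>(n + 1) / \<delta>\<close>, which turns \<open>n!\<close> into \<open>(n + 1)!\<close>. The powers of \<open>1 / \<delta>\<close> record the distance to the boundary.
\<close>

lemma gevrey_from_recursion:
  fixes y A B \<Gamma> :: "complex \<Rightarrow> complex \<Rightarrow> complex" and yh :: "nat \<Rightarrow> complex \<Rightarrow> complex"
    and AS BS \<Gamma>S :: "complex \<Rightarrow> complex fps"
  assumes D: "open D"
    and hol: "\<And>h. h \<in> H \<Longrightarrow> (\<lambda>x. y x h) holomorphic_on D" "\<And>k. yh k holomorphic_on D"
    and lim: "\<And>e. e > 0 \<Longrightarrow> \<exists>h\<in>H. h \<noteq> 0 \<and> cmod h < e"
    and eqn: "\<And>x h. x \<in> D \<Longrightarrow> h \<in> H \<Longrightarrow>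
        y x h = \<Gamma> x h + h * (\<omega> x * deriv (\<lambda>x. y x h) x - B x h * y x h - A x h * (y x h * y x h))"
    and ser: "\<And>x. x \<in> D \<Longrightarrow> series_at yh x = \<Gamma>S x + fps_X * (fps_const (\<omega> x) * series_at (\<lambda>k. deriv (yh k)) x
        - BS x * series_at yh x - AS x * (series_at yh x * series_at yh x))"
    and gev: "\<And>x N. x \<in> D \<Longrightarrow> gevrey_upto C M N H (A x) (AS x)" "\<And>x N. x \<in> D \<Longrightarrow> gevrey_upto C M N H (B x) (BS x)"
      "\<And>x N. x \<in> D \<Longrightarrow> gevrey_upto C M N H (\<Gamma> x) (\<Gamma>S x)"
    and bd: "\<And>x. x \<in> D \<Longrightarrow> cmod (\<omega> x) \<le> C" "\<And>x h. x \<in> D \<Longrightarrow> h \<in> H \<Longrightarrow> cmod (y x h) \<le> C"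
    and C: "0 \<le> C" and M: "0 \<le> M"
    and L: "L = M + 9 * C + 9 * C\<^sup>2 + 1"
  shows "0 < \<delta> \<Longrightarrow> \<delta> \<le> 1 \<Longrightarrow> ball x \<delta> \<subseteq> D \<Longrightarrow> h \<in> H \<Longrightarrow>
      cmod (fps_remainder (y x h) (series_at yh x) n h) \<le> C * (L / \<delta>) ^ n * fact n * cmod h ^ n"
proof (induction n arbitrary: x \<delta> h rule: less_induct)
  case (less n)
  show ?case
  proof (cases n)
    case 0
    have "x \<in> D" using less.prems by (meson centre_in_ball subsetD)
    then show ?thesis using 0 bd(2) less.prems by (simp add: fps_remainder_def)
  next
    case (Suc m)
    note \<delta> = less.prems(1,2) and sub = less.prems(3) and h = less.prems(4)
    have x: "x \<in> D" using \<delta> sub by (meson centre_in_ball subsetD)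
    have L1: "1 \<le> L" "0 \<le> L" "M \<le> L" using C M L by auto
    have Ld: "L \<le> L / \<delta>" "0 \<le> L / \<delta>" using \<delta> L1 by (auto simp: field_simps intro: mult_left_le)
    have MLd: "M \<le> L / \<delta>" using Ld L1 by linarith
    have yg: "gevrey_upto C (L / \<delta>) m H (y x) (series_at yh x)"
      unfolding gevrey_upto_def using less.IH[OF _ \<delta> sub] Suc by auto
    note mono = gevrey_upto_mono[OF _ order_refl MLd C M]
    note Bg = mono[OF gev(2)[OF x]] and Ag = mono[OF gev(1)[OF x]] and Gg = mono[OF gev(3)[OF x]]
    have By: "gevrey_upto (3 * C * C) (L / \<delta>) m H (\<lambda>h. B x h * y x h) (BS x * series_at yh x)"
      by (rule gevrey_upto_mult[OF Bg yg lim C C Ld(2)])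
    have yy: "gevrey_upto (3 * C * C) (L / \<delta>) m H (\<lambda>h. y x h * y x h) (series_at yh x * series_at yh x)"
      by (rule gevrey_upto_mult[OF yg yg lim C C Ld(2)])
    have Ayy: "gevrey_upto (3 * C * (3 * C * C)) (L / \<delta>) m H (\<lambda>h. A x h * (y x h * y x h))
        (AS x * (series_at yh x * series_at yh x))"
      by (rule gevrey_upto_mult[OF Ag yy lim C _ Ld(2)]) (use C in auto)
    define T where "T = (L / \<delta>) ^ m * fact m * cmod h ^ m"
    have T: "0 \<le> T" using Ld by (simp add: T_def)
    define dr where "dr = fps_remainder (deriv (\<lambda>x. y x h) x) (series_at (\<lambda>k. deriv (yh k)) x) m h"
    have dr: "cmod dr \<le> (3 * C * T) / (\<delta> / real (m + 2))"
    proof -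
      \<comment> \<open>With this radius \<open>(\<delta> / (\<delta> - s)) ^ m\<close> stays below \<open>exp 1\<close>.\<close>
      define s where "s = \<delta> / real (m + 2)"
      have s: "s > 0" "s < \<delta>" using \<delta> frac_less2[of \<delta> \<delta> 1 "real (m + 2)"] by (auto simp: s_def)
      have subx: "ball u (\<delta> - s) \<subseteq> D" if "u \<in> ball x s" for u
        using that sub by (intro order_trans[OF _ sub]) (auto intro!: subsetI, metric)
      have inD: "ball x s \<subseteq> D" using sub s by (meson order_trans subset_ball less_imp_le)
      define r where "r u = fps_remainder (y u h) (series_at yh u) m h" for u
      have rhol: "r holomorphic_on D"
        unfolding r_def fps_remainder_def series_at_def fps_nth_Abs_fps
        by (intro holomorphic_intros hol h)
      have "((\<lambda>u. y u h - (\<Sum>k<m. yh k u * h ^ k)) has_field_derivative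
          deriv (\<lambda>x. y x h) x - (\<Sum>k<m. deriv (yh k) x * h ^ k)) (at x)"
        by (intro derivative_intros holomorphic_derivI[OF hol(1)[OF h] D x] holomorphic_derivI[OF hol(2) D x]
            DERIV_cmult_right)
      then have "deriv r x = dr"
        unfolding r_def dr_def fps_remainder_def series_at_def fps_nth_Abs_fps by (rule DERIV_imp_deriv)
      moreover have "cmod (deriv r x) \<le> (3 * C * T) / s"
      proof (rule deriv_bound_ball[OF holomorphic_on_subset[OF rhol inD] s(1)])
        fix u assume u: "u \<in> ball x s"
        have q: "\<delta> - s = \<delta> * (real (m + 1) / real (m + 2))" by (simp add: s_def field_simps)
        have "cmod (r u) \<le> C * (L / (\<delta> - s)) ^ m * fact m * cmod h ^ m"
          unfolding r_def by (rule less.IH) (use Suc s \<delta> subx[OF u] h in auto)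
        also have "(L / (\<delta> - s)) ^ m = (L / \<delta>) ^ m * (1 + 1 / real (m + 1)) ^ m"
          unfolding q power_mult_distrib[symmetric] using \<delta>
          by (intro arg_cong[where f = "\<lambda>t. t ^ m"]) (simp add: divide_simps)
        also have "(1 + 1 / real (m + 1)) ^ m \<le> 3"
        proof -
          have "(1 + 1 / real (m + 1)) ^ m \<le> exp (1 / real (m + 1)) ^ m"
            by (intro power_mono exp_ge_add_one_self) auto
          also have "\<dots> = exp (real m * (1 / real (m + 1)))" by (rule exp_of_nat_mult[symmetric])
          also have "\<dots> \<le> exp 1" by (simp add: field_simps)
          also have "\<dots> \<le> 3" by (rule exp_le)
          finally show ?thesis .
        qed
        finally show "cmod (r u) \<le> 3 * C * T"
          using C Ld by (simp add: T_def mult_left_mono mult_right_mono mult_ac)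
      qed
      ultimately show ?thesis by (simp add: s_def)
    qed
    have rem: "fps_remainder (y x h) (series_at yh x) (Suc m) h = fps_remainder (\<Gamma> x h) (\<Gamma>S x) (Suc m) h +
       h * (\<omega> x * dr - fps_remainder (B x h * y x h) (BS x * series_at yh x) m h
         - fps_remainder (A x h * (y x h * y x h)) (AS x * (series_at yh x * series_at yh x)) m h)"
      by (subst eqn[OF x h], subst ser[OF x])
         (simp only: fps_remainder_add fps_remainder_X_mult fps_remainder_diff fps_remainder_const_mult dr_def)
    have "cmod (fps_remainder (\<Gamma> x h) (\<Gamma>S x) (Suc m) h) \<le> C * M ^ Suc m * fact (Suc m) * cmod h ^ Suc m"
      using gevrey_uptoD[OF gev(3)[OF x] order_refl h] .
    also have "\<dots> \<le> C * (M * (L / \<delta>) ^ m) * fact (Suc m) * cmod h ^ Suc m"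
      using C M MLd by (intro mult_right_mono mult_left_mono) (auto intro: power_mono mult_left_mono)
    also have "\<dots> = (C * M * real (Suc m) * cmod h) * T" by (simp add: T_def)
    also have "\<dots> \<le> (C * M * (real (Suc m) / \<delta>) * cmod h) * T"
      using C M T frac_le[of "real (Suc m)" "real (Suc m)" \<delta> 1] \<delta>
      by (intro mult_right_mono mult_left_mono) auto
    finally have b1: "cmod (fps_remainder (\<Gamma> x h) (\<Gamma>S x) (Suc m) h) \<le> C * M * (real (Suc m) / \<delta>) * cmod h * T" .
    have b2: "cmod (\<omega> x * dr) \<le> 6 * C\<^sup>2 * (real (Suc m) / \<delta>) * T"
    proof -
      have "cmod (\<omega> x * dr) \<le> C * ((3 * C * T) / (\<delta> / real (m + 2)))"
        unfolding norm_mult by (intro mult_mono bd(1)[OF x] dr C) auto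
      also have "\<dots> = 3 * C\<^sup>2 * (real (m + 2) / \<delta>) * T" by (simp add: power2_eq_square)
      also have "\<dots> \<le> 3 * C\<^sup>2 * ((2 * real (Suc m)) / \<delta>) * T"
        using T \<delta> by (intro mult_right_mono mult_left_mono divide_right_mono) auto
      finally show ?thesis by (simp del: of_nat_Suc)
    qed
    have one: "1 \<le> real (Suc m) / \<delta>" using \<delta> by (simp add: field_simps)
    have b3: "cmod (fps_remainder (B x h * y x h) (BS x * series_at yh x) m h) \<le> 3 * C\<^sup>2 * (real (Suc m) / \<delta>) * T"
    proof -
      have "cmod (fps_remainder (B x h * y x h) (BS x * series_at yh x) m h) \<le> 3 * C\<^sup>2 * 1 * T"
        using gevrey_uptoD[OF By order_refl h] by (simp add: T_def power2_eq_square mult_ac)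
      also have "\<dots> \<le> 3 * C\<^sup>2 * (real (Suc m) / \<delta>) * T"
        using T one by (intro mult_right_mono mult_left_mono) auto
      finally show ?thesis .
    qed
    have b4: "cmod (fps_remainder (A x h * (y x h * y x h)) (AS x * (series_at yh x * series_at yh x)) m h)
        \<le> 9 * C ^ 3 * (real (Suc m) / \<delta>) * T"
    proof -
      have "cmod (fps_remainder (A x h * (y x h * y x h)) (AS x * (series_at yh x * series_at yh x)) m h) \<le> 9 * C ^ 3 * 1 * T"
        using gevrey_uptoD[OF Ayy order_refl h] by (simp add: T_def power3_eq_cube mult_ac)
      also have "\<dots> \<le> 9 * C ^ 3 * (real (Suc m) / \<delta>) * T"
        using T one C by (intro mult_right_mono mult_left_mono) auto
      finally show ?thesis .
    qed
    have "cmod (fps_remainder (y x h) (series_at yh x) (Suc m) h) \<le> C * M * (real (Suc m) / \<delta>) * cmod h * T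
        + cmod h * (6 * C\<^sup>2 * (real (Suc m) / \<delta>) * T + 3 * C\<^sup>2 * (real (Suc m) / \<delta>) * T + 9 * C ^ 3 * (real (Suc m) / \<delta>) * T)"
      unfolding rem
    proof (rule norm_triangle_mono[OF b1], unfold norm_mult[of h], rule mult_left_mono)
      show "cmod (\<omega> x * dr - fps_remainder (B x h * y x h) (BS x * series_at yh x) m h
         - fps_remainder (A x h * (y x h * y x h)) (AS x * (series_at yh x * series_at yh x)) m h)
        \<le> 6 * C\<^sup>2 * (real (Suc m) / \<delta>) * T + 3 * C\<^sup>2 * (real (Suc m) / \<delta>) * T + 9 * C ^ 3 * (real (Suc m) / \<delta>) * T"
        using norm_triangle_ineq4[of "\<omega> x * dr" "fps_remainder (B x h * y x h) (BS x * series_at yh x) m h"]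
          norm_triangle_ineq4[of "\<omega> x * dr - fps_remainder (B x h * y x h) (BS x * series_at yh x) m h"
            "fps_remainder (A x h * (y x h * y x h)) (AS x * (series_at yh x * series_at yh x)) m h"] b2 b3 b4
        by linarith
    qed simp
    also have "\<dots> = (C * (M + 9 * C + 9 * C\<^sup>2)) * ((real (Suc m) / \<delta>) * T * cmod h)"
    proof -
      have "C * M * q * cmod h * T + cmod h * (6 * C\<^sup>2 * q * T + 3 * C\<^sup>2 * q * T + 9 * C ^ 3 * q * T)
          = (C * (M + 9 * C + 9 * C\<^sup>2)) * (q * T * cmod h)" for q
        by (simp add: algebra_simps power2_eq_square power3_eq_cube)
      then show ?thesis .
    qed
    also have "\<dots> \<le> (C * L) * ((real (Suc m) / \<delta>) * T * cmod h)"
      using C L T \<delta> by (intro mult_right_mono mult_left_mono) auto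
    also have "\<dots> = C * (L / \<delta>) ^ Suc m * fact (Suc m) * cmod h ^ Suc m"
      by (simp add: T_def)
    finally show ?thesis using Suc by simp
  qed
qed

text \<open>
  After division by \<open>h\<close> and by the linearisation \<open>2 a0 f0 + b0\<close>, the equation for \<open>y = (f - f0) / h\<close> has the
  form required by \<open>gevrey_from_recursion\<close>, and its coefficients are again Gevrey.
\<close>

lemma riccati_gevrey:
  fixes a b c f :: "complex \<Rightarrow> complex \<Rightarrow> complex" and ah bh ch fh :: "nat \<Rightarrow> complex \<Rightarrow> complex"
  assumes D: "open D" and H0: "0 \<notin> H" and H1: "\<And>h. h \<in> H \<Longrightarrow> cmod h \<le> 1"
    and lim: "\<And>e. e > 0 \<Longrightarrow> \<exists>h\<in>H. h \<noteq> 0 \<and> cmod h < e"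
    and hol: "\<And>h. h \<in> H \<Longrightarrow> (\<lambda>x. f x h) holomorphic_on D" "\<And>k. fh k holomorphic_on D"
    and ode: "\<And>x h. x \<in> D \<Longrightarrow> h \<in> H \<Longrightarrow>
        h * deriv (\<lambda>x. f x h) x = a x h * (f x h)\<^sup>2 + b x h * f x h + c x h"
    and close: "\<And>x h. x \<in> D \<Longrightarrow> h \<in> H \<Longrightarrow> cmod (f x h - fh 0 x) \<le> K * cmod h"
    and ser: "\<And>x. x \<in> D \<Longrightarrow> fps_X * series_at (\<lambda>k. deriv (fh k)) x =
        series_at ah x * (series_at fh x)\<^sup>2 + series_at bh x * series_at fh x + series_at ch x"
    and gev: "\<And>x N. x \<in> D \<Longrightarrow> gevrey_upto C M N H (a x) (series_at ah x)"
      "\<And>x N. x \<in> D \<Longrightarrow> gevrey_upto C M N H (b x) (series_at bh x)"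
      "\<And>x N. x \<in> D \<Longrightarrow> gevrey_upto C M N H (c x) (series_at ch x)"
    and bd: "\<And>x. x \<in> D \<Longrightarrow> cmod (fh 0 x) \<le> K" "\<And>x. x \<in> D \<Longrightarrow> cmod (deriv (fh 0) x) \<le> K"
      "\<And>x. x \<in> D \<Longrightarrow> cmod (inverse (2 * ah 0 x * fh 0 x + bh 0 x)) \<le> K"
    and nz: "\<And>x. x \<in> D \<Longrightarrow> 2 * ah 0 x * fh 0 x + bh 0 x \<noteq> 0"
    and nn: "0 \<le> C" "0 \<le> M" "0 \<le> K"
  obtains C' M' where "C' > 0" "M' > 0"
    "\<And>x \<delta> h n. 0 < \<delta> \<Longrightarrow> \<delta> \<le> 1 \<Longrightarrow> ball x \<delta> \<subseteq> D \<Longrightarrow> h \<in> H \<Longrightarrow>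
       cmod (asym_remainder f fh n x h) \<le> C' * (M' / \<delta>) ^ n * fact n * cmod h ^ n"
proof -
  define f0 where "f0 = fh 0"
  define \<beta> where "\<beta> x = 2 * ah 0 x * f0 x + bh 0 x" for x
  define \<omega> where "\<omega> x = inverse (\<beta> x)" for x
  have \<omega>: "\<omega> x * \<beta> x = 1" "cmod (\<omega> x) \<le> K" if "x \<in> D" for x
    using nz[OF that] bd(3)[OF that] by (auto simp: \<omega>_def \<beta>_def f0_def)
  define y where "y x h = (f x h - f0 x) / h" for x h
  define yh where "yh k = fh (Suc k)" for k
  define BS1 where "BS1 x = fps_const (2 * f0 x) * series_at ah x + series_at bh x" for x
  define B1 where "B1 x h = 2 * f0 x * a x h + b x h" for x h
  define GS1 where "GS1 x = fps_const ((f0 x)\<^sup>2) * series_at ah x + fps_const (f0 x) * series_at bh x + series_at ch x" for x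
  define G1 where "G1 x h = (f0 x)\<^sup>2 * a x h + f0 x * b x h + c x h" for x h
  have fS: "series_at fh x = fps_const (f0 x) + fps_X * series_at yh x" for x
    by (rule fps_ext) (auto simp: series_at_def f0_def yh_def split: nat.split)
  have dS: "series_at (\<lambda>k. deriv (fh k)) x = fps_const (deriv f0 x) + fps_X * series_at (\<lambda>k. deriv (yh k)) x" for x
    by (rule fps_ext) (auto simp: series_at_def f0_def yh_def split: nat.split)
  have BS1_0: "fps_nth (BS1 x) 0 = \<beta> x" for x by (simp add: BS1_def \<beta>_def series_at_def)
  have GS1_0: "fps_nth (GS1 x) 0 = 0" if "x \<in> D" for x
    using arg_cong[OF ser[OF that], of "\<lambda>F. fps_nth F 0"]
    by (simp add: GS1_def series_at_def f0_def power2_eq_square algebra_simps)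
  have shift: "F = fps_const (fps_nth F 0) + fps_X * fps_shift 1 F" for F :: "complex fps"
    by (rule fps_ext) (auto split: nat.split)
  define A where "A x h = \<omega> x * a x h" for x h
  define AS where "AS x = fps_const (\<omega> x) * series_at ah x" for x
  define B where "B x h = \<omega> x * ((B1 x h - fps_nth (BS1 x) 0) / h)" for x h
  define BS where "BS x = fps_const (\<omega> x) * fps_shift 1 (BS1 x)" for x
  define \<Gamma> where "\<Gamma> x h = \<omega> x * (deriv f0 x + (-1) * ((G1 x h - fps_nth (GS1 x) 0) / h))" for x h
  define \<Gamma>S where "\<Gamma>S x = fps_const (\<omega> x) * (fps_const (deriv f0 x) + fps_const (-1) * fps_shift 1 (GS1 x))" for x
  have eqn: "y x h = \<Gamma> x h + h * (\<omega> x * deriv (\<lambda>x. y x h) x - B x h * y x h - A x h * (y x h * y x h))"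
    if x: "x \<in> D" and h: "h \<in> H" for x h
  proof -
    have h0: "h \<noteq> 0" using h H0 by auto
    have "((\<lambda>x. (f x h - f0 x) / h) has_field_derivative (deriv (\<lambda>x. f x h) x - deriv f0 x) / h) (at x)"
      unfolding f0_def
      by (intro DERIV_cdivide DERIV_diff holomorphic_derivI[OF hol(1)[OF h] D x] holomorphic_derivI[OF hol(2) D x])
    then have dy: "deriv (\<lambda>x. y x h) x = (deriv (\<lambda>x. f x h) x - deriv f0 x) / h"
      unfolding y_def by (rule DERIV_imp_deriv)
    define Z where "Z = y x h"
    define Q where "Q = h * deriv (\<lambda>x. y x h) x"
    have f: "f x h = f0 x + h * Z" using h0 by (simp add: Z_def y_def)
    have Q: "h * Q = h * deriv (\<lambda>x. f x h) x - h * deriv f0 x" 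
      unfolding Q_def right_diff_distrib[symmetric] using h0 by (simp add: dy)
    have "h * Q = G1 x h + h * (B1 x h * Z) + h * h * (a x h * Z\<^sup>2) - h * deriv f0 x"
      unfolding Q ode[OF x h] f by (simp add: G1_def B1_def algebra_simps power2_eq_square)
    then have "Q = G1 x h / h + B1 x h * Z + h * (a x h * Z\<^sup>2) - deriv f0 x"
      using h0 by (simp add: field_simps)
    then have bz: "\<beta> x * Z = (deriv f0 x - G1 x h / h) + (Q - (B1 x h - \<beta> x) * Z - h * (a x h * Z\<^sup>2))"
      by (simp add: algebra_simps)
    define E where "E = (B1 x h - \<beta> x) / h"
    have E: "B1 x h - \<beta> x = h * E" using h0 by (simp add: E_def)
    have "Z = \<omega> x * (\<beta> x * Z)" using \<omega>(1)[OF x] by (simp add: mult.assoc[symmetric])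
    also have "\<dots> = \<omega> x * ((deriv f0 x - G1 x h / h) + (Q - h * E * Z - h * (a x h * Z\<^sup>2)))"
      unfolding bz E ..
    also have "\<dots> = \<omega> x * (deriv f0 x - G1 x h / h) + (\<omega> x * Q - h * (\<omega> x * E * Z) - h * (\<omega> x * a x h * (Z * Z)))"
      by (simp add: algebra_simps power2_eq_square)
    finally have "Z = \<omega> x * (deriv f0 x - G1 x h / h) + (\<omega> x * Q - h * (\<omega> x * E * Z) - h * (\<omega> x * a x h * (Z * Z)))" .
    then show ?thesis
      unfolding \<Gamma>_def B_def A_def GS1_0[OF x] BS1_0 E_def[symmetric] Z_def Q_def by (simp add: algebra_simps)
  qed
  have yser: "series_at yh x = \<Gamma>S x + fps_X * (fps_const (\<omega> x) * series_at (\<lambda>k. deriv (yh k)) x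
        - BS x * series_at yh x - AS x * (series_at yh x * series_at yh x))" if x: "x \<in> D" for x
  proof -
    define Y where "Y = series_at yh x"
    define dY where "dY = series_at (\<lambda>k. deriv (yh k)) x"
    have g: "GS1 x = fps_X * fps_shift 1 (GS1 x)" using shift[of "GS1 x"] GS1_0[OF x] by simp
    have b: "BS1 x = fps_const (\<beta> x) + fps_X * fps_shift 1 (BS1 x)" using shift[of "BS1 x"] BS1_0 by simp
    have c1: "fps_const (2 * f0 x) = 2 * fps_const (f0 x)" by (simp only: numeral_fps_const fps_const_mult)
    have c2: "fps_const ((f0 x)\<^sup>2) = fps_const (f0 x) ^ 2" by (simp only: power2_eq_square fps_const_mult)
    have "fps_X * (fps_const (deriv f0 x) + fps_X * dY) = GS1 x + BS1 x * (fps_X * Y) + series_at ah x * (fps_X * Y) ^ 2"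
      using ser[OF x] unfolding fS dS Y_def[symmetric] dY_def[symmetric] GS1_def BS1_def c1 c2
      by (simp add: algebra_simps power2_eq_square)
    also have "\<dots> = fps_X * (fps_shift 1 (GS1 x) + BS1 x * Y + fps_X * (series_at ah x * (Y * Y)))"
      by (subst g) (simp add: algebra_simps power2_eq_square)
    finally have "fps_const (deriv f0 x) + fps_X * dY = fps_shift 1 (GS1 x) + BS1 x * Y + fps_X * (series_at ah x * (Y * Y))"
      by (simp only: mult_left_cancel[OF fps_X_neq_zero])
    then have bY: "fps_const (\<beta> x) * Y = fps_const (deriv f0 x) - fps_shift 1 (GS1 x) + fps_X * (dY - fps_shift 1 (BS1 x) * Y - series_at ah x * (Y * Y))"
      by (subst (asm) b) (simp add: algebra_simps)
    have "fps_const (-1) * fps_shift 1 (GS1 x) = - fps_shift 1 (GS1 x)"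
      by (rule fps_ext) simp
    then have m1: "\<Gamma>S x = fps_const (\<omega> x) * (fps_const (deriv f0 x) - fps_shift 1 (GS1 x))"
      by (simp add: \<Gamma>S_def)
    have "fps_const (\<omega> x) * (fps_const (\<beta> x) * Y) = Y"
      using \<omega>(1)[OF x] by (simp add: mult.assoc[symmetric])
    then have "Y = fps_const (\<omega> x) * (fps_const (\<beta> x) * Y)" ..
    also have "\<dots> = fps_const (\<omega> x) *
        (fps_const (deriv f0 x) - fps_shift 1 (GS1 x) + fps_X * (dY - fps_shift 1 (BS1 x) * Y - series_at ah x * (Y * Y)))"
      unfolding bY ..
    also have "\<dots> = \<Gamma>S x + fps_X * (fps_const (\<omega> x) * dY - BS x * Y - AS x * (Y * Y))"
      unfolding m1 BS_def AS_def by (simp add: algebra_simps)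
    finally show ?thesis unfolding Y_def dY_def .
  qed
  define Cb where "Cb = 2 * K * C + C"
  define Cg where "Cg = K\<^sup>2 * C + K * C + C"
  define C' where "C' = K * C + K * (Cb * M) + K * (K + 1 * (Cg * M)) + K"
  have pos: "0 \<le> Cb" "0 \<le> Cg" "0 \<le> Cb * M" "0 \<le> Cg * M" "0 \<le> 2 * M" "M \<le> 2 * M" using nn by (auto simp: Cb_def Cg_def)
  have KK: "0 \<le> K * (Cb * M)" "0 \<le> K * (K + 1 * (Cg * M))" "0 \<le> K * C" "0 \<le> K + 1 * (Cg * M)" using pos nn by auto
  have C'ge: "K * C \<le> C'" "K * (Cb * M) \<le> C'" "K * (K + 1 * (Cg * M)) \<le> C'" "K \<le> C'" "0 \<le> C'"
    using KK nn(3) unfolding C'_def by linarith+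
  have gA: "gevrey_upto C' (2 * M) N H (A x) (AS x)" if x: "x \<in> D" for x N
    unfolding A_def AS_def
    by (rule gevrey_upto_mono[OF gevrey_upto_const_mult[OF gev(1)[OF x] \<omega>(2)[OF x] nn(1,2)]]) (use C'ge pos nn in auto)
  have gB: "gevrey_upto C' (2 * M) N H (B x) (BS x)" if x: "x \<in> D" for x N
  proof -
    have "cmod (2 * f0 x) \<le> 2 * K" using bd(1)[OF x] by (simp add: f0_def norm_mult)
    from gevrey_upto_add[OF gevrey_upto_const_mult[OF gev(1)[OF x] this nn(1,2)] gev(2)[OF x]]
    have "gevrey_upto Cb M (Suc N) H (B1 x) (BS1 x)"
      unfolding Cb_def B1_def BS1_def by simp
    from gevrey_upto_const_mult[OF gevrey_upto_shift[OF this pos(1) nn(2) H0] \<omega>(2)[OF x] pos(3,5)]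
    show ?thesis unfolding B_def BS_def by (rule gevrey_upto_mono) (use C'ge pos KK in auto)
  qed
  have gG: "gevrey_upto C' (2 * M) N H (\<Gamma> x) (\<Gamma>S x)" if x: "x \<in> D" for x N
  proof -
    have k: "cmod (f0 x) \<le> K" using bd(1)[OF x] by (simp add: f0_def)
    then have k2: "cmod ((f0 x)\<^sup>2) \<le> K\<^sup>2" by (simp add: norm_power power_mono)
    have "gevrey_upto Cg M (Suc N) H (G1 x) (GS1 x)"
      unfolding Cg_def G1_def GS1_def
      by (intro gevrey_upto_add gevrey_upto_const_mult gev x k k2 nn)
    note s = gevrey_upto_shift[OF this pos(2) nn(2) H0]
    have m1: "cmod (- 1) \<le> 1" by simp
    have "cmod (deriv f0 x) \<le> K" using bd(2)[OF x] by (simp add: f0_def)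
    from gevrey_upto_const_mult[OF gevrey_upto_add[OF gevrey_upto_const[OF pos(5) this] gevrey_upto_const_mult[OF s m1 pos(4,5)]] \<omega>(2)[OF x] KK(4) pos(5)]
    have "gevrey_upto (K * (K + 1 * (Cg * M))) (2 * M) N H (\<Gamma> x) (\<Gamma>S x)"
      unfolding \<Gamma>_def \<Gamma>S_def .
    then show ?thesis by (rule gevrey_upto_mono) (use C'ge pos KK in auto)
  qed
  have ybd: "cmod (y x h) \<le> C'" if "x \<in> D" "h \<in> H" for x h
  proof -
    have "h \<noteq> 0" using that H0 by auto
    then have "cmod (y x h) \<le> K" using close[OF that] by (simp add: y_def f0_def norm_divide field_simps)
    then show ?thesis using C'ge by linarith
  qed
  have \<omega>bd: "cmod (\<omega> x) \<le> C'" if "x \<in> D" for x using \<omega>(2)[OF that] C'ge by linarith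
  have yhol: "(\<lambda>x. y x h) holomorphic_on D" if "h \<in> H" for h
    unfolding y_def f0_def using H0 that by (auto intro!: holomorphic_intros hol)
  have yhhol: "yh k holomorphic_on D" for k unfolding yh_def by (rule hol)
  define L where "L = 2 * M + 9 * C' + 9 * C'\<^sup>2 + 1"
  have L: "L \<ge> 1" using C'ge nn by (simp add: L_def)
  have main: "cmod (fps_remainder (y x h) (series_at yh x) n h) \<le> C' * (L / \<delta>) ^ n * fact n * cmod h ^ n"
    if "0 < \<delta>" "\<delta> \<le> 1" "ball x \<delta> \<subseteq> D" "h \<in> H" for x \<delta> h n
    by (rule gevrey_from_recursion[OF D yhol yhhol lim eqn yser gA gB gG \<omega>bd ybd C'ge(5) pos(5) L_def that]; assumption)
  show thesis
  proof (rule that[of "C' + 2 * K + 1" L])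
    fix x \<delta> h n assume \<delta>: "0 < \<delta>" "\<delta> \<le> 1" and sub: "ball x \<delta> \<subseteq> D" and h: "h \<in> H"
    have x: "x \<in> D" using \<delta> sub by (meson centre_in_ball subsetD)
    have h0: "h \<noteq> 0" using h H0 by auto
    have Ld: "1 \<le> L / \<delta>" using \<delta> L by (simp add: field_simps)
    show "cmod (asym_remainder f fh n x h) \<le> (C' + 2 * K + 1) * (L / \<delta>) ^ n * fact n * cmod h ^ n"
    proof (cases n)
      case 0
      have "cmod (f x h) \<le> cmod (f x h - fh 0 x) + cmod (fh 0 x)"
        using norm_triangle_ineq[of "f x h - fh 0 x" "fh 0 x"] by simp
      also have "\<dots> \<le> K * 1 + K"
        using close[OF x h] bd(1)[OF x] mult_left_mono[OF H1[OF h] nn(3)] by linarith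
      finally have "cmod (f x h) \<le> C' + 2 * K + 1" using C'ge by simp
      then show ?thesis using 0 by (simp add: asym_remainder_def)
    next
      case (Suc m)
      have "f x h = f0 x + h * y x h" using h0 by (simp add: y_def)
      moreover have "fps_remainder (f0 x + h * y x h) (fps_const (f0 x) + fps_X * series_at yh x) (Suc m) h
          = h * fps_remainder (y x h) (series_at yh x) m h"
      proof -
        have "(\<Sum>k<Suc m. fps_nth (fps_const (f0 x)) k * h ^ k) = f0 x"
          by (subst sum.lessThan_Suc_shift) simp
        then show ?thesis unfolding fps_remainder_add fps_remainder_X_mult by (simp add: fps_remainder_def)
      qed
      ultimately have "asym_remainder f fh n x h = h * fps_remainder (y x h) (series_at yh x) m h"
        unfolding asym_remainder_eq fS Suc by simp
      then have "cmod (asym_remainder f fh n x h) \<le> cmod h * (C' * (L / \<delta>) ^ m * fact m * cmod h ^ m)"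
        using main[OF \<delta> sub h, of m] by (simp add: norm_mult mult_left_mono)
      also have "\<dots> \<le> cmod h * ((C' + 2 * K + 1) * (L / \<delta>) ^ Suc m * fact (Suc m) * cmod h ^ m)"
        using C'ge nn Ld L \<delta> by (intro mult_left_mono mult_right_mono mult_mono power_increasing fact_mono) auto
      finally show ?thesis using Suc by (simp add: mult_ac)
    qed
  qed (use C'ge nn L in auto)
qed

section \<open>Integrals over vertical lines\<close>

lemma has_vector_derivative_integral:
  fixes f f' :: "real \<Rightarrow> 'a \<Rightarrow> complex"
  assumes S: "convex S" "t0 \<in> S"
    and deriv: "\<And>t y. t \<in> S \<Longrightarrow> ((\<lambda>t. f t y) has_vector_derivative f' t y) (at t within S)"
    and bd: "\<And>t y. t \<in> S \<Longrightarrow> norm (f' t y) \<le> b y" and b: "integrable M b"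
    and int: "\<And>t. t \<in> S \<Longrightarrow> integrable M (f t)" and int': "integrable M (f' t0)"
  shows "((\<lambda>t. \<integral>y. f t y \<partial>M) has_vector_derivative (\<integral>y. f' t0 y \<partial>M)) (at t0 within S)"
proof -
  have lip: "norm (f t y - f t0 y) \<le> b y * norm (t - t0)" if "t \<in> S" for t y
  proof (rule differentiable_bound[OF S(1) _ _ that S(2)])
    show "((\<lambda>t. f t y) has_derivative (\<lambda>h. h *\<^sub>R f' t y)) (at t within S)" if "t \<in> S" for t
      using deriv[OF that] unfolding has_vector_derivative_def .
    show "onorm (\<lambda>h. h *\<^sub>R f' t y) \<le> b y" if "t \<in> S" for t
      by (rule onorm_le) (use mult_right_mono[OF bd[OF that, of y] abs_ge_zero] in \<open>simp add: mult.commute\<close>)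
  qed
  define q where "q t y = (1 / norm (t - t0)) *\<^sub>R (f t y - (f t0 y + (t - t0) *\<^sub>R f' t0 y))" for t y
  have qint: "integrable M (q t)" if "t \<in> S" for t
    unfolding q_def using int[OF that] int[OF S(2)] int' by auto
  have qbd: "norm (q t y) \<le> 2 * b y" if "t \<in> S" "t \<noteq> t0" for t y
  proof -
    have "norm (f t y - (f t0 y + (t - t0) *\<^sub>R f' t0 y)) \<le> norm (f t y - f t0 y) + norm ((t - t0) *\<^sub>R f' t0 y)"
      using norm_triangle_ineq4[of "f t y - f t0 y" "(t - t0) *\<^sub>R f' t0 y"] by (simp add: algebra_simps)
    also have "\<dots> \<le> b y * norm (t - t0) + norm (t - t0) * b y"
      unfolding norm_scaleR real_norm_def
      by (intro add_mono lip[OF that(1), unfolded real_norm_def] mult_left_mono bd S(2)) auto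
    also have "\<dots> = norm (t - t0) * (2 * b y)" by simp
    finally have "(1 / norm (t - t0)) * norm (f t y - (f t0 y + (t - t0) *\<^sub>R f' t0 y)) \<le> (1 / norm (t - t0)) * (norm (t - t0) * (2 * b y))"
      by (intro mult_left_mono) auto
    then show ?thesis using that(2) unfolding q_def norm_scaleR by simp
  qed
  have "((\<lambda>t. \<integral>y. q t y \<partial>M) \<longlongrightarrow> 0) (at t0 within S)"
    unfolding tendsto_at_iff_sequentially o_def
  proof (intro allI impI)
    fix X assume X: "\<forall>i. X i \<in> S - {t0}" "X \<longlonglongrightarrow> t0"
    have Xi: "X i \<in> S" "X i \<noteq> t0" for i using X(1) by auto
    have "(\<lambda>i. \<integral>y. q (X i) y \<partial>M) \<longlonglongrightarrow> (\<integral>y. 0 \<partial>M)"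
    proof (rule integral_dominated_convergence)
      show "integrable M (\<lambda>y. 2 * b y)" using b by simp
      show "q (X i) \<in> borel_measurable M" for i by (rule borel_measurable_integrable[OF qint[OF Xi(1)]])
      show "AE y in M. norm (q (X i) y) \<le> 2 * b y" for i by (intro AE_I2 qbd Xi)
      show "AE y in M. (\<lambda>i. q (X i) y) \<longlonglongrightarrow> 0"
      proof (rule AE_I2)
        fix y
        have "((\<lambda>t. q t y) \<longlongrightarrow> 0) (at t0 within S)"
          using deriv[OF S(2), of y] unfolding has_vector_derivative_def has_derivative_within q_def by simp
        then show "(\<lambda>i. q (X i) y) \<longlonglongrightarrow> 0"
          using X unfolding tendsto_at_iff_sequentially o_def by blast
      qed
    qed simp
    then show "(\<lambda>i. \<integral>y. q (X i) y \<partial>M) \<longlonglongrightarrow> 0" by simp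
  qed
  moreover have "(\<integral>y. q t y \<partial>M) = (1 / norm (t - t0)) *\<^sub>R ((\<integral>y. f t y \<partial>M) - ((\<integral>y. f t0 y \<partial>M) + (t - t0) *\<^sub>R (\<integral>y. f' t0 y \<partial>M)))"
    if "t \<in> S" for t
    unfolding q_def using int[OF that] int[OF S(2)] int' by simp
  ultimately have "((\<lambda>t. (1 / norm (t - t0)) *\<^sub>R ((\<integral>y. f t y \<partial>M) - ((\<integral>y. f t0 y \<partial>M) + (t - t0) *\<^sub>R (\<integral>y. f' t0 y \<partial>M)))) \<longlongrightarrow> 0) (at t0 within S)"
    by (subst (asm) Lim_cong_within) (auto simp: eventually_at_filter)
  then show ?thesis unfolding has_vector_derivative_def has_derivative_within
    by (auto intro: bounded_linear_scaleR_left)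
qed

lemma integrable_inverse_1_plus_sq: "integrable lborel (\<lambda>y::real. inverse (1 + y\<^sup>2))"
proof -
  have "set_integrable lborel (einterval (-\<infinity>) \<infinity>) (\<lambda>y::real. inverse (1 + y\<^sup>2))"
  proof (rule interval_integral_FTC_nonneg(1)[where F = arctan and A = "- pi / 2" and B = "pi / 2"])
    show "(arctan has_real_derivative inverse (1 + x\<^sup>2)) (at x)" for x by (rule DERIV_arctan)
    show "isCont (\<lambda>y. inverse (1 + y\<^sup>2)) x" for x :: real
      by (intro continuous_intros) (metis add_pos_nonneg less_irrefl zero_le_power2 zero_less_one)
    show "((arctan \<circ> real_of_ereal) \<longlongrightarrow> - pi / 2) (at_right (- \<infinity>))"
      using tendsto_arctan_at_bot by (simp add: ereal_tendsto_simps)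
    show "((arctan \<circ> real_of_ereal) \<longlongrightarrow> pi / 2) (at_left \<infinity>)"
      using tendsto_arctan_at_top by (simp add: ereal_tendsto_simps)
  qed auto
  then show ?thesis by (simp add: set_integrable_def einterval_def)
qed

definition vline :: "real \<Rightarrow> real \<Rightarrow> complex" where
  "vline r y = Complex r y"

lemma vline_simps [simp]: "Re (vline r y) = r" "Im (vline r y) = y"
  by (simp_all add: vline_def)

lemma vline_norm: "(cmod (vline r y))\<^sup>2 = r\<^sup>2 + y\<^sup>2" by (simp add: cmod_power2)

lemma vline_norm_ge: "r > 0 \<Longrightarrow> r \<le> cmod (vline r y)"
  using complex_Re_le_cmod[of "vline r y"] by simp

lemma vline_continuous: "continuous_on S (vline r)"
  unfolding vline_def Complex_eq by (intro continuous_intros)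

lemma integrable_vline_square:
  assumes "r > 0" shows "integrable lborel (\<lambda>y. 1 / (cmod (vline r y))\<^sup>2)"
proof (rule Bochner_Integration.integrable_bound)
  show "integrable lborel (\<lambda>y. (1 + 1 / r\<^sup>2) * inverse (1 + y\<^sup>2))"
    by (intro integrable_mult_right integrable_inverse_1_plus_sq)
  have nz: "r\<^sup>2 + y\<^sup>2 \<noteq> 0" for y using assms by (metis add_pos_nonneg less_irrefl zero_le_power2 zero_less_power)
  have "continuous_on UNIV (\<lambda>y. 1 / (r\<^sup>2 + y\<^sup>2))" by (intro continuous_intros) (use nz in auto)
  then have "(\<lambda>y. 1 / (r\<^sup>2 + y\<^sup>2)) \<in> borel_measurable borel" by (rule borel_measurable_continuous_onI)
  then show "(\<lambda>y. 1 / (cmod (vline r y))\<^sup>2) \<in> borel_measurable lborel" by (simp add: vline_norm)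
  show "AE y in lborel. norm (1 / (cmod (vline r y))\<^sup>2) \<le> norm ((1 + 1 / r\<^sup>2) * inverse (1 + y\<^sup>2))"
  proof (rule AE_I2)
    fix y
    have p: "0 < r\<^sup>2" "0 < r\<^sup>2 + y\<^sup>2" "0 < 1 + y\<^sup>2" using assms by (auto simp: add_pos_nonneg)
    have "1 + y\<^sup>2 \<le> (1 + 1 / r\<^sup>2) * (r\<^sup>2 + y\<^sup>2)" using p(1) by (simp add: field_simps)
    then have "1 / (r\<^sup>2 + y\<^sup>2) \<le> (1 + 1 / r\<^sup>2) * inverse (1 + y\<^sup>2)"
      using p by (simp add: divide_simps mult.commute)
    then show "norm (1 / (cmod (vline r y))\<^sup>2) \<le> norm ((1 + 1 / r\<^sup>2) * inverse (1 + y\<^sup>2))"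
      using p by (simp add: vline_norm abs_mult)
  qed
qed

lemma integrable_on_vline:
  fixes f :: "real \<Rightarrow> complex"
  assumes r: "r > 0" and cont: "continuous_on UNIV f"
    and bd: "\<And>y. cmod (f y) \<le> c / (cmod (vline r y))\<^sup>2"
  shows "integrable lborel f"
proof (rule Bochner_Integration.integrable_bound)
  show "integrable lborel (\<lambda>y. c * (1 / (cmod (vline r y))\<^sup>2))"
    by (intro integrable_mult_right integrable_vline_square r)
  show "f \<in> borel_measurable lborel" using borel_measurable_continuous_onI[OF cont] by simp
  have "cmod (f y) \<le> norm (c * (1 / (cmod (vline r y))\<^sup>2))" for y
  proof -
    have "cmod (f y) \<le> c * (1 / (cmod (vline r y))\<^sup>2)" using bd[of y] by simp
    then show ?thesis unfolding real_norm_def by (rule order_trans[OF _ abs_ge_self])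
  qed
  then show "AE y in lborel. cmod (f y) \<le> norm (c * (1 / (cmod (vline r y))\<^sup>2))" by simp
qed

text \<open>
  Because of the quadratic decay, the other three sides of large rectangles to the right of the line
  contribute nothing in the limit; \<open>V\<close> is what the singularity at \<open>p\<close> contributes.
\<close>

lemma vline_integral_by_rectangles:
  assumes r: "r > 0" and p: "Re p > r"
    and cont: "continuous_on ({\<zeta>. r \<le> Re \<zeta>} - {p}) k"
    and int: "integrable lborel (\<lambda>y. k (vline r y))"
    and bd: "\<And>\<zeta>. r \<le> Re \<zeta> \<Longrightarrow> N0 \<le> cmod \<zeta> \<Longrightarrow> cmod (k \<zeta>) \<le> c / (cmod \<zeta>)\<^sup>2"
    and rect: "\<And>N. N > 0 \<Longrightarrow> p \<in> box (Complex r (- N)) (Complex (r + N) N) \<Longrightarrow>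
        contour_integral (rectpath (Complex r (- N)) (Complex (r + N) N)) k = V"
  shows "(\<integral>y. k (vline r y) \<partial>lborel) = \<i> * V"
proof -
  define c' where "c' = \<bar>c\<bar>"
  have bd': "cmod (k \<zeta>) \<le> c' / N\<^sup>2" if "r \<le> Re \<zeta>" "N0 \<le> N" "0 < N" "N \<le> cmod \<zeta>" for \<zeta> N
  proof -
    have "cmod (k \<zeta>) \<le> c / (cmod \<zeta>)\<^sup>2" using bd that by auto
    also have "\<dots> \<le> c' / N\<^sup>2" using that by (intro frac_le) (auto simp: c'_def power_mono)
    finally show ?thesis .
  qed
  define J where "J N = integral {-N..N} (\<lambda>y. k (vline r y))" for N :: real
  have est: "cmod (V + \<i> * J N) \<le> 6 * c' / N" if N: "N \<ge> N0" "N > cmod p" for N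
  proof -
    have N0: "N > 0" using N norm_ge_zero[of p] by linarith
    define a1 a2 a3 a4 where a: "a1 = Complex r (- N)" "a2 = Complex (r + N) (- N)" "a3 = Complex (r + N) N" "a4 = Complex r N"
    have pbox: "p \<in> box a1 a3"
      using abs_Re_le_cmod[of p] abs_Im_le_cmod[of p] N p r by (auto simp: in_box_complex_iff a)
    have s1: "closed_segment a1 a2 = {x. Im x = -N \<and> Re x \<in> {r..r+N}}"
      using N0 by (subst closed_segment_same_Im) (auto simp: a closed_segment_eq_real_ivl)
    have s2: "closed_segment a2 a3 = {x. Re x = r + N \<and> Im x \<in> {-N..N}}"
      using N0 by (subst closed_segment_same_Re) (auto simp: a closed_segment_eq_real_ivl)
    have s3: "closed_segment a3 a4 = {x. Im x = N \<and> Re x \<in> {r..r+N}}"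
      using N0 by (subst closed_segment_same_Im) (auto simp: a closed_segment_eq_real_ivl)
    have s4: "closed_segment a4 a1 = {x. Re x = r \<and> Im x \<in> {-N..N}}"
      using N0 by (subst closed_segment_same_Re) (auto simp: a closed_segment_eq_real_ivl)
    have pp: "Re p < r + N" "- N < Im p" "Im p < N" using pbox by (auto simp: in_box_complex_iff a)
    have sub: "closed_segment a1 a2 \<subseteq> {\<zeta>. r \<le> Re \<zeta>} - {p}" "closed_segment a2 a3 \<subseteq> {\<zeta>. r \<le> Re \<zeta>} - {p}"
      "closed_segment a3 a4 \<subseteq> {\<zeta>. r \<le> Re \<zeta>} - {p}" "closed_segment a4 a1 \<subseteq> {\<zeta>. r \<le> Re \<zeta>} - {p}"
      unfolding s1 s2 s3 s4 using pp p N0 by auto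
    note ci = contour_integrable_continuous_linepath[OF continuous_on_subset[OF cont sub(1)]]
      contour_integrable_continuous_linepath[OF continuous_on_subset[OF cont sub(2)]]
      contour_integrable_continuous_linepath[OF continuous_on_subset[OF cont sub(3)]]
      contour_integrable_continuous_linepath[OF continuous_on_subset[OF cont sub(4)]]
    have rp: "rectpath a1 a3 = linepath a1 a2 +++ linepath a2 a3 +++ linepath a3 a4 +++ linepath a4 a1"
      by (simp add: rectpath_def Let_def a)
    have V: "V = contour_integral (linepath a1 a2) k + (contour_integral (linepath a2 a3) k +
        (contour_integral (linepath a3 a4) k + contour_integral (linepath a4 a1) k))"
      using rect[OF N0] pbox ci unfolding a(1,3)[symmetric] rp by simp
    have "contour_integral (linepath a4 a1) k = - contour_integral (linepath a1 a4) k"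
      using continuous_on_subset[OF cont sub(4)] by (subst contour_integral_reverse_linepath) auto
    also have "contour_integral (linepath a1 a4) k = \<i> * J N"
      unfolding J_def vline_def by (rule contour_integral_linepath_same_Re) (use N0 in \<open>auto simp: a\<close>)
    finally have c4: "contour_integral (linepath a4 a1) k = - (\<i> * J N)" .
    have nn: "0 \<le> c' / N\<^sup>2" by (simp add: c'_def)
    have n1: "N \<le> cmod \<zeta>" if "\<bar>Re \<zeta>\<bar> \<ge> N \<or> \<bar>Im \<zeta>\<bar> \<ge> N" for \<zeta>
      using that abs_Re_le_cmod[of \<zeta>] abs_Im_le_cmod[of \<zeta>] by linarith
    have "cmod (contour_integral (linepath a1 a2) k) \<le> c' / N\<^sup>2 * cmod (a2 - a1)"
      by (rule contour_integral_bound_linepath[OF ci(1) nn], rule bd') (use N N0 n1 in \<open>auto simp: s1\<close>)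
    moreover have "cmod (contour_integral (linepath a2 a3) k) \<le> c' / N\<^sup>2 * cmod (a3 - a2)"
      by (rule contour_integral_bound_linepath[OF ci(2) nn], rule bd') (use N N0 n1 r in \<open>auto simp: s2\<close>)
    moreover have "cmod (contour_integral (linepath a3 a4) k) \<le> c' / N\<^sup>2 * cmod (a4 - a3)"
      by (rule contour_integral_bound_linepath[OF ci(3) nn], rule bd') (use N N0 n1 in \<open>auto simp: s3\<close>)
    moreover have "a2 - a1 = of_real N" "a3 - a2 = of_real (2 * N) * \<i>" "a4 - a3 = of_real (- N)"
      by (simp_all add: a complex_eq_iff)
    then have "cmod (a2 - a1) = N" "cmod (a3 - a2) = 2 * N" "cmod (a4 - a3) = N"
      using N0 by (simp_all add: norm_mult)
    ultimately have l: "cmod (contour_integral (linepath a1 a2) k) \<le> c' / N\<^sup>2 * (2 * N)"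
      "cmod (contour_integral (linepath a2 a3) k) \<le> c' / N\<^sup>2 * (2 * N)"
      "cmod (contour_integral (linepath a3 a4) k) \<le> c' / N\<^sup>2 * (2 * N)"
      using mult_left_mono[of N "2 * N", OF _ nn] N0 by auto
    have "V + \<i> * J N = contour_integral (linepath a1 a2) k + (contour_integral (linepath a2 a3) k + contour_integral (linepath a3 a4) k)"
      unfolding V c4 by simp
    also have "cmod \<dots> \<le> c' / N\<^sup>2 * (2 * N) + (c' / N\<^sup>2 * (2 * N) + c' / N\<^sup>2 * (2 * N))"
      by (intro norm_triangle_mono l)
    also have "\<dots> = 6 * c' / N" using N0 by (simp add: field_simps power2_eq_square)
    finally show ?thesis .
  qed
  have "(\<lambda>n. J (real n)) \<longlonglongrightarrow> (\<integral>y. k (vline r y) \<partial>lborel)"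
  proof -
    have "(\<lambda>n. \<integral>y. indicator {-real n..real n} y *\<^sub>R k (vline r y) \<partial>lborel) \<longlonglongrightarrow> (\<integral>y. k (vline r y) \<partial>lborel)"
    proof (rule integral_dominated_convergence[where w = "\<lambda>y. cmod (k (vline r y))"])
      show "AE y in lborel. (\<lambda>n. indicator {-real n..real n} y *\<^sub>R k (vline r y)) \<longlonglongrightarrow> k (vline r y)"
      proof (intro AE_I2 tendsto_eventually)
        fix y :: real
        obtain N where "\<bar>y\<bar> \<le> real N" using real_arch_simple by blast
        then show "\<forall>\<^sub>F n in sequentially. indicator {-real n..real n} y *\<^sub>R k (vline r y) = k (vline r y)"
          unfolding eventually_sequentially by (intro exI[of _ N]) (auto simp: indicator_def)
      qed
    qed (use int in \<open>auto simp: indicator_def\<close>)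
    moreover have "(\<integral>y. indicator {-real n..real n} y *\<^sub>R k (vline r y) \<partial>lborel) = J (real n)" for n
      using set_borel_integral_eq_integral(2)[of "{-real n..real n}" "\<lambda>y. k (vline r y)"]
        integrable_mult_indicator[OF _ int, of "{-real n..real n}"]
      by (simp add: J_def set_lebesgue_integral_def set_integrable_def)
    ultimately show ?thesis by simp
  qed
  then have "(\<lambda>n. V + \<i> * J (real n)) \<longlonglongrightarrow> V + \<i> * (\<integral>y. k (vline r y) \<partial>lborel)"
    by (intro tendsto_intros)
  moreover have "(\<lambda>n. V + \<i> * J (real n)) \<longlonglongrightarrow> 0"
  proof (rule Lim_null_comparison)
    show "\<forall>\<^sub>F n in sequentially. cmod (V + \<i> * J (real n)) \<le> 6 * c' / real n"
    proof -
      obtain n0 where "real n0 > max N0 (cmod p)" using reals_Archimedean2 by blast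
      then show ?thesis unfolding eventually_sequentially
      proof (intro exI[of _ n0] allI impI)
        fix n assume "n0 \<le> n"
        then have "real n0 \<le> real n" by simp
        with \<open>real n0 > max N0 (cmod p)\<close> show "cmod (V + \<i> * J (real n)) \<le> 6 * c' / real n"
          by (intro est) auto
      qed
    qed
    show "(\<lambda>n. 6 * c' / real n) \<longlonglongrightarrow> 0" by (rule lim_const_over_n)
  qed
  ultimately have "V + \<i> * (\<integral>y. k (vline r y) \<partial>lborel) = 0" using LIMSEQ_unique by blast
  then have "\<i> * (V + \<i> * (\<integral>y. k (vline r y) \<partial>lborel)) = 0" by simp
  then show ?thesis by (simp add: algebra_simps)
qed

lemma rectpath_in_right:
  assumes "p \<in> box (Complex r (- N)) (Complex (r + N) N)" "N > 0"
  shows "path_image (rectpath (Complex r (- N)) (Complex (r + N) N)) \<subseteq> {\<zeta>. r \<le> Re \<zeta>} - {p}"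
proof -
  have "path_image (rectpath (Complex r (- N)) (Complex (r + N) N)) = cbox (Complex r (- N)) (Complex (r + N) N) - box (Complex r (- N)) (Complex (r + N) N)"
    using assms by (intro path_image_rectpath_cbox_minus_box) auto
  moreover have "r \<le> Re z" if "z \<in> cbox (Complex r (- N)) (Complex (r + N) N)" for z
    using that by (simp add: in_cbox_complex_iff)
  ultimately show ?thesis using assms(1) by blast
qed

lemma vline_cauchy:
  fixes H :: "complex \<Rightarrow> complex"
  assumes r: "0 \<le> r0" "r0 < r" and p: "Re p > r" and hol: "H holomorphic_on {\<zeta>. r0 < Re \<zeta>}"
    and bd: "\<And>\<zeta>. r0 < Re \<zeta> \<Longrightarrow> cmod (H \<zeta>) \<le> c / (cmod \<zeta>)\<^sup>2"
  shows "(\<integral>y. H (vline r y) \<partial>lborel) = 0"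
    and "(\<integral>y. H (vline r y) / (vline r y - p) \<partial>lborel) = - 2 * pi * H p"
proof -
  have sub: "{\<zeta>. r \<le> Re \<zeta>} \<subseteq> {\<zeta>. r0 < Re \<zeta>}" using r by auto
  have cH: "continuous_on {\<zeta>. r \<le> Re \<zeta>} H"
    using continuous_on_subset[OF holomorphic_on_imp_continuous_on[OF hol] sub] .
  have cHv: "continuous_on UNIV (\<lambda>y. H (vline r y))"
    by (rule continuous_on_compose2[OF cH vline_continuous]) auto
  have bd': "cmod (H \<zeta>) \<le> c / (cmod \<zeta>)\<^sup>2" if "r \<le> Re \<zeta>" for \<zeta> using bd that r by auto
  have r': "r > 0" using r by simp
  have "(\<integral>y. H (vline r y) \<partial>lborel) = \<i> * 0"
  proof (rule vline_integral_by_rectangles[OF r' p])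
    show "continuous_on ({\<zeta>. r \<le> Re \<zeta>} - {p}) H" using cH by (rule continuous_on_subset) auto
    show "integrable lborel (\<lambda>y. H (vline r y))"
      by (rule integrable_on_vline[OF r' cHv bd']) simp
    show "cmod (H \<zeta>) \<le> c / (cmod \<zeta>)\<^sup>2" if "r \<le> Re \<zeta>" "0 \<le> cmod \<zeta>" for \<zeta> using bd'[OF that(1)] .
    show "contour_integral (rectpath (Complex r (- N)) (Complex (r + N) N)) H = 0"
      if "N > 0" "p \<in> box (Complex r (- N)) (Complex (r + N) N)" for N
      by (rule contour_integral_unique[OF Cauchy_theorem_convex_simple[OF hol convex_halfspace_Re_gt]])
         (use rectpath_in_right[OF that(2,1)] r in \<open>auto simp: subset_iff\<close>)
  qed
  then show "(\<integral>y. H (vline r y) \<partial>lborel) = 0" by simp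
  define k where "k \<zeta> = H \<zeta> / (\<zeta> - p)" for \<zeta>
  have dist: "Re p - r \<le> cmod (vline r y - p)" for y
    using abs_Re_le_cmod[of "vline r y - p"] by simp
  have c0: "0 \<le> c / (cmod \<zeta>)\<^sup>2" if "r \<le> Re \<zeta>" for \<zeta> using bd'[OF that] norm_ge_zero order_trans by blast
  have "(\<integral>y. k (vline r y) \<partial>lborel) = \<i> * (2 * pi * \<i> * H p)"
  proof (rule vline_integral_by_rectangles[OF r' p])
    show "continuous_on ({\<zeta>. r \<le> Re \<zeta>} - {p}) k" unfolding k_def
      by (intro continuous_intros continuous_on_subset[OF cH]) auto
    show "integrable lborel (\<lambda>y. k (vline r y))"
    proof (rule integrable_on_vline[OF r'])
      show "continuous_on UNIV (\<lambda>y. k (vline r y))" unfolding k_def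
        using dist p by (intro continuous_intros cHv vline_continuous) (auto simp: complex_eq_iff)
      show "cmod (k (vline r y)) \<le> (c / (Re p - r)) / (cmod (vline r y))\<^sup>2" for y
      proof -
        have "cmod (k (vline r y)) \<le> (c / (cmod (vline r y))\<^sup>2) / (Re p - r)"
          unfolding k_def norm_divide using bd'[of "vline r y"] dist[of y] p c0[of "vline r y"] by (intro frac_le) auto
        then show ?thesis by (simp add: mult.commute)
      qed
    qed
    show "cmod (k \<zeta>) \<le> c / (cmod \<zeta>)\<^sup>2" if z: "r \<le> Re \<zeta>" "cmod p + 1 \<le> cmod \<zeta>" for \<zeta>
    proof -
      have "1 \<le> cmod (\<zeta> - p)" using norm_triangle_ineq2[of \<zeta> p] z by linarith
      then have "cmod (k \<zeta>) \<le> (c / (cmod \<zeta>)\<^sup>2) / 1"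
        unfolding k_def norm_divide using bd'[OF z(1)] c0[OF z(1)] by (intro frac_le) auto
      then show ?thesis by simp
    qed
    show "contour_integral (rectpath (Complex r (- N)) (Complex (r + N) N)) k = 2 * pi * \<i> * H p"
      if N: "N > 0" "p \<in> box (Complex r (- N)) (Complex (r + N) N)" for N
    proof -
      have "interior {\<zeta>. r0 < Re \<zeta>} = {\<zeta>. r0 < Re \<zeta>}" by (simp add: interior_open open_halfspace_Re_gt)
      then have "((\<lambda>w. H w / (w - p)) has_contour_integral (2 * pi * \<i> * winding_number (rectpath (Complex r (- N)) (Complex (r + N) N)) p * H p))
          (rectpath (Complex r (- N)) (Complex (r + N) N))"
        by (intro Cauchy_integral_formula_convex_simple[OF convex_halfspace_Re_gt hol])
           (use rectpath_in_right[OF N(2,1)] r p in \<open>auto simp: subset_iff\<close>)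
      then show ?thesis unfolding k_def winding_number_rectpath[OF N(2)] by (simp add: contour_integral_unique)
    qed
  qed
  then show "(\<integral>y. H (vline r y) / (vline r y - p) \<partial>lborel) = - 2 * pi * H p"
    by (simp add: k_def algebra_simps)
qed

text \<open>
  Here the line must be closed to the left; reflection in the line turns this into the previous
  situation, with the double pole at \<open>2 r\<close>.
\<close>

lemma vline_exp_over_square:
  assumes r: "r > 0" and t: "t \<ge> 0"
  shows "(\<integral>y. exp (of_real t * vline r y) / (vline r y)\<^sup>2 \<partial>lborel) = 2 * pi * of_real t"
proof -
  define p where "p = complex_of_real (2 * r)"
  define k where "k \<zeta> = exp (of_real t * (p - \<zeta>)) / (p - \<zeta>)\<^sup>2" for \<zeta>
  have refl: "p - vline r y = vline r (- y)" for y by (simp add: p_def complex_eq_iff)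
  have nz: "p \<noteq> vline r y" for y
    using refl[of y] vline_norm_ge[OF r, of "- y"] r by auto
  have "(\<integral>y. exp (of_real t * vline r y) / (vline r y)\<^sup>2 \<partial>lborel) = (\<integral>y. k (vline r y) \<partial>lborel)"
    by (subst lborel_integral_real_affine[where c = "-1" and t = 0]) (auto simp: k_def refl)
  also have "\<dots> = \<i> * (- 2 * pi * \<i> * of_real t)"
  proof (rule vline_integral_by_rectangles[OF r])
    show "r < Re p" using r by (simp add: p_def)
    show "continuous_on ({\<zeta>. r \<le> Re \<zeta>} - {p}) k" unfolding k_def by (intro continuous_intros) auto
    have kb: "cmod (k \<zeta>) \<le> exp (t * r) / (cmod (p - \<zeta>))\<^sup>2" if "r \<le> Re \<zeta>" for \<zeta>
    proof -
      have "t * Re (p - \<zeta>) \<le> t * r" using that t by (intro mult_left_mono) (auto simp: p_def)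
      then show ?thesis unfolding k_def norm_divide norm_power by (intro divide_right_mono) auto
    qed
    show "integrable lborel (\<lambda>y. k (vline r y))"
    proof (rule integrable_on_vline[OF r])
      show "continuous_on UNIV (\<lambda>y. k (vline r y))" unfolding k_def
        using nz by (intro continuous_intros vline_continuous) auto
      show "cmod (k (vline r y)) \<le> exp (t * r) / (cmod (vline r y))\<^sup>2" for y
        using kb[of "vline r y"] unfolding refl vline_norm by simp
    qed
    show "cmod (k \<zeta>) \<le> (4 * exp (t * r)) / (cmod \<zeta>)\<^sup>2" if z: "r \<le> Re \<zeta>" "2 * cmod p \<le> cmod \<zeta>" for \<zeta>
    proof -
      have p0: "cmod p > 0" using r by (simp add: p_def)
      have "cmod \<zeta> / 2 \<le> cmod (p - \<zeta>)" using norm_triangle_ineq3[of p \<zeta>] z by linarith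
      then have "(cmod \<zeta> / 2)\<^sup>2 \<le> (cmod (p - \<zeta>))\<^sup>2" by (intro power_mono) auto
      then have "exp (t * r) / (cmod (p - \<zeta>))\<^sup>2 \<le> exp (t * r) / (cmod \<zeta> / 2)\<^sup>2"
        using z p0 by (intro frac_le) auto
      then show ?thesis using kb[OF z(1)] by (simp add: power_divide mult.commute)
    qed
    show "contour_integral (rectpath (Complex r (- N)) (Complex (r + N) N)) k = - 2 * pi * \<i> * of_real t"
      if N: "N > 0" "p \<in> box (Complex r (- N)) (Complex (r + N) N)" for N
    proof -
      let ?\<gamma> = "rectpath (Complex r (- N)) (Complex (r + N) N)"
      have pim: "path_image ?\<gamma> \<subseteq> UNIV - {p}" using rectpath_in_right[OF N(2,1)] by auto
      define e where "e \<zeta> = exp (of_real t * (p - \<zeta>))" for \<zeta>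
      have de: "(e has_field_derivative - of_real t * e \<zeta>) (at \<zeta>)" for \<zeta>
        unfolding e_def by (auto intro!: derivative_eq_intros)
      define E where "E \<zeta> = (if \<zeta> = p then deriv e p else (e \<zeta> - e p) / (\<zeta> - p))" for \<zeta>
      have Ehol: "E holomorphic_on UNIV" unfolding E_def
        by (rule pole_lemma_open) (auto simp: e_def[abs_def] intro!: holomorphic_intros)
      have Ep: "E p = - of_real t" using DERIV_imp_deriv[OF de[of p]] by (simp add: E_def e_def)
      have "((\<lambda>\<zeta>. E \<zeta> / (\<zeta> - p)) has_contour_integral (2 * pi * \<i> * winding_number ?\<gamma> p * E p)) ?\<gamma>"
        by (rule Cauchy_integral_formula_convex_simple[OF convex_UNIV Ehol _ _ pim]) auto
      then have 1: "((\<lambda>\<zeta>. E \<zeta> / (\<zeta> - p)) has_contour_integral (- 2 * pi * \<i> * of_real t)) ?\<gamma>"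
        unfolding winding_number_rectpath[OF N(2)] Ep by simp
      have 2: "((\<lambda>\<zeta>. 1 / (\<zeta> - p)\<^sup>2) has_contour_integral 0) ?\<gamma>"
      proof (rule Cauchy_theorem_primitive[where S = "UNIV - {p}" and f = "\<lambda>\<zeta>. - 1 / (\<zeta> - p)"])
        show "((\<lambda>\<zeta>. - 1 / (\<zeta> - p)) has_field_derivative 1 / (\<zeta> - p)\<^sup>2) (at \<zeta> within UNIV - {p})"
          if "\<zeta> \<in> UNIV - {p}" for \<zeta>
          using that by (auto intro!: derivative_eq_intros simp: power2_eq_square)
      qed (use pim in auto)
      have "(k has_contour_integral (- 2 * pi * \<i> * of_real t + 0)) ?\<gamma>"
      proof (rule has_contour_integral_eq[OF has_contour_integral_add[OF 1 2]])
        fix \<zeta> assume "\<zeta> \<in> path_image ?\<gamma>"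
        then have z: "\<zeta> \<noteq> p" using pim by auto
        then have "E \<zeta> = (e \<zeta> - 1) / (\<zeta> - p)" by (simp add: E_def e_def)
        moreover have "(p - \<zeta>)\<^sup>2 = (\<zeta> - p)\<^sup>2" by (rule power2_commute)
        ultimately show "E \<zeta> / (\<zeta> - p) + 1 / (\<zeta> - p)\<^sup>2 = k \<zeta>"
          using z by (simp add: k_def e_def power2_eq_square divide_simps)
      qed
      then show ?thesis by (simp add: contour_integral_unique)
    qed
  qed
  finally show ?thesis by simp
qed

section \<open>Nevanlinna's theorem\<close>

lemma holomorphic_on_suminf_geometric:
  fixes f :: "nat \<Rightarrow> complex \<Rightarrow> complex"
  assumes U: "open U" and hol: "\<And>n. f n holomorphic_on U"
    and bd: "\<And>n z. z \<in> U \<Longrightarrow> cmod (f n z) \<le> B * (1/2) ^ n"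
  shows "(\<lambda>z. \<Sum>n. f n z) holomorphic_on U"
proof (rule holomorphic_uniform_sequence[OF U])
  show "(\<lambda>z. \<Sum>i<n. f i z) holomorphic_on U" for n by (intro holomorphic_intros hol)
  have "uniform_limit U (\<lambda>n z. \<Sum>i<n. f i z) (\<lambda>z. \<Sum>i. f i z) sequentially"
    by (rule Weierstrass_m_test[where M = "\<lambda>n. B * (1/2) ^ n"]) (auto simp: bd intro!: summable_mult)
  then show "\<exists>d>0. cball x d \<subseteq> U \<and> uniform_limit (cball x d) (\<lambda>n z. \<Sum>i<n. f i z) (\<lambda>z. \<Sum>i. f i z) sequentially"
    if "x \<in> U" for x
    using U that by (meson open_contains_cball uniform_limit_on_subset)
qed

definition right_nbhd :: "real \<Rightarrow> complex set" where
  "right_nbhd \<epsilon> = {\<xi>. \<exists>t\<ge>0. cmod (\<xi> - of_real t) < \<epsilon>}"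

lemma right_nbhd_eq_Un: "right_nbhd \<epsilon> = (\<Union>t\<in>{0..}. ball (of_real t) \<epsilon>)"
  by (auto simp: right_nbhd_def dist_norm norm_minus_commute)

lemma open_right_nbhd: "open (right_nbhd \<epsilon>)"
  unfolding right_nbhd_eq_Un by auto

lemma convex_right_nbhd: "convex (right_nbhd \<epsilon>)"
  unfolding convex_def
proof (intro ballI allI impI)
  fix x y :: complex and u v :: real
  assume xy: "x \<in> right_nbhd \<epsilon>" "y \<in> right_nbhd \<epsilon>" and uv: "0 \<le> u" "0 \<le> v" "u + v = 1"
  obtain s t where s: "0 \<le> s" "cmod (x - of_real s) < \<epsilon>" and t: "0 \<le> t" "cmod (y - of_real t) < \<epsilon>"
    using xy unfolding right_nbhd_def by auto
  have "x - of_real s \<in> ball 0 \<epsilon>" "y - of_real t \<in> ball 0 \<epsilon>" using s t by auto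
  then have "u *\<^sub>R (x - of_real s) + v *\<^sub>R (y - of_real t) \<in> ball 0 \<epsilon>"
    using convex_ball[of 0 \<epsilon>] uv unfolding convex_def by blast
  moreover have "u *\<^sub>R (x - of_real s) + v *\<^sub>R (y - of_real t) = u *\<^sub>R x + v *\<^sub>R y - of_real (u * s + v * t)"
    by (simp add: algebra_simps scaleR_conv_of_real)
  ultimately have "cmod (u *\<^sub>R x + v *\<^sub>R y - of_real (u * s + v * t)) < \<epsilon>" by simp
  then show "u *\<^sub>R x + v *\<^sub>R y \<in> right_nbhd \<epsilon>"
    unfolding right_nbhd_def using s(1) t(1) uv by (auto intro!: exI[of _ "u * s + v * t"])
qed

text \<open>
  The positive part of \<open>Re \<xi>\<close> is the point of the ray that is nearest to \<open>\<xi>\<close>.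
\<close>

lemma dist_positive_part_le:
  assumes "0 \<le> t"
  shows "cmod (\<xi> - of_real (max 0 (Re \<xi>))) \<le> cmod (\<xi> - of_real t)"
proof (rule power2_le_imp_le)
  have "(Re \<xi> - max 0 (Re \<xi>))\<^sup>2 \<le> (Re \<xi> - t)\<^sup>2"
    using assms by (intro abs_le_square_iff[THEN iffD1]) auto
  then show "(cmod (\<xi> - of_real (max 0 (Re \<xi>))))\<^sup>2 \<le> (cmod (\<xi> - of_real t))\<^sup>2"
    by (simp add: cmod_power2)
qed auto

definition vline_kernel :: "(complex \<Rightarrow> complex) \<Rightarrow> (nat \<Rightarrow> complex) \<Rightarrow> nat \<Rightarrow> complex \<Rightarrow> complex" where
  "vline_kernel g A n w = w ^ n * fps_remainder (g w) (Abs_fps A) (n + 2) (1 / w)"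

text \<open>
  Formally, the \<open>n\<close>-th derivative of the Borel transform at \<open>t\<close> is the inverse Laplace integral of
  \<open>w ^ n g(w)\<close>. Subtracting the expansion of \<open>g\<close> up to order \<open>n + 1\<close> makes the integral absolutely
  convergent; of the subtracted terms, \<open>A (Suc n) / w\<close> contributes the constant \<open>A (Suc n)\<close> and the
  polynomial ones contribute nothing.
\<close>

definition borel_deriv :: "real \<Rightarrow> (complex \<Rightarrow> complex) \<Rightarrow> (nat \<Rightarrow> complex) \<Rightarrow> nat \<Rightarrow> real \<Rightarrow> complex" where
  "borel_deriv r g A n t =
     A (Suc n) + 1 / (2 * pi) * (\<integral>y. exp (of_real t * vline r y) * vline_kernel g A n (vline r y) \<partial>lborel)"

definition borel_taylor :: "real \<Rightarrow> (complex \<Rightarrow> complex) \<Rightarrow> (nat \<Rightarrow> complex) \<Rightarrow> real \<Rightarrow> complex \<Rightarrow> complex" where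
  "borel_taylor r g A t \<xi> = (\<Sum>n. borel_deriv r g A n t * (\<xi> - of_real t) ^ n / fact n)"

definition borel_fun :: "real \<Rightarrow> (complex \<Rightarrow> complex) \<Rightarrow> (nat \<Rightarrow> complex) \<Rightarrow> complex \<Rightarrow> complex" where
  "borel_fun r g A \<xi> = borel_taylor r g A (max 0 (Re \<xi>)) \<xi>"

definition vline_const :: "real \<Rightarrow> real" where
  "vline_const r = (\<integral>y. 1 / (cmod (vline r y))\<^sup>2 \<partial>lborel)"

lemma vline_const_nonneg: "0 \<le> vline_const r"
  unfolding vline_const_def by (rule Bochner_Integration.integral_nonneg) simp

definition borel_const :: "real \<Rightarrow> real \<Rightarrow> real \<Rightarrow> real" where
  "borel_const r C M = C * M + C * M\<^sup>2 * vline_const r"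

locale nevanlinna =
  fixes g :: "complex \<Rightarrow> complex" and A :: "nat \<Rightarrow> complex" and r0 r C M :: real
  assumes r0: "0 \<le> r0" "r0 < r" and hol: "g holomorphic_on {w. r0 < Re w}" and C: "0 \<le> C" and M: "0 < M"
    and bd: "\<And>n w. r0 < Re w \<Longrightarrow>
      cmod (fps_remainder (g w) (Abs_fps A) n (1 / w)) \<le> C * M ^ n * fact n * cmod (1 / w) ^ n"
begin

abbreviation "kern \<equiv> vline_kernel g A"
abbreviation "u \<equiv> borel_deriv r g A"
abbreviation "N \<equiv> 4 * M"
abbreviation "K \<equiv> borel_const r C M"

lemma K: "0 \<le> K" using C M vline_const_nonneg by (simp add: borel_const_def)

lemma rpos: "0 < r" using r0 by simp

lemma kern_holomorphic: "kern n holomorphic_on {w. r0 < Re w}"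
  unfolding vline_kernel_def fps_remainder_def using r0
  by (auto intro!: holomorphic_intros hol)

lemma kern_bound:
  assumes w: "r0 < Re w"
  shows "cmod (kern n w) \<le> (C * M ^ (n + 2) * fact (n + 2)) / (cmod w)\<^sup>2"
proof -
  have w0: "w \<noteq> 0" using w r0 by auto
  have "cmod (kern n w) \<le> cmod w ^ n * (C * M ^ (n + 2) * fact (n + 2) * cmod (1 / w) ^ (n + 2))"
    unfolding vline_kernel_def norm_mult norm_power by (intro mult_left_mono bd w) auto
  also have "\<dots> = (C * M ^ (n + 2) * fact (n + 2)) * ((cmod w ^ n * cmod (1 / w) ^ n) * cmod (1 / w) ^ 2)"
    by (simp add: power_add power2_eq_square mult_ac)
  also have "cmod w ^ n * cmod (1 / w) ^ n = 1"
    using w0 by (simp add: power_mult_distrib[symmetric] norm_divide)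
  finally show ?thesis by (simp add: norm_divide power_divide)
qed

text \<open>
  One more term of the expansion is split off, which leaves enough decay to differentiate the integral
  over the vertical line in \<open>t\<close>.
\<close>

lemma kern_step:
  assumes w: "r0 < Re w"
  shows "kern n w = A (n + 2) / w\<^sup>2 + kern (Suc n) w / w"
proof -
  have w0: "w \<noteq> 0" using w r0 by auto
  have "fps_remainder (g w) (Abs_fps A) (n + 2) (1 / w) = A (n + 2) * (1 / w) ^ (n + 2) + fps_remainder (g w) (Abs_fps A) (Suc n + 2) (1 / w)"
    by (simp add: fps_remainder_Suc)
  then have "kern n w = A (n + 2) * (w ^ n * (1 / w) ^ n) * (1 / w) ^ 2 + w ^ n * fps_remainder (g w) (Abs_fps A) (Suc n + 2) (1 / w)"
    unfolding vline_kernel_def by (simp add: algebra_simps power_add power2_eq_square)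
  also have "w ^ n * (1 / w) ^ n = 1" using w0 by (simp add: power_mult_distrib[symmetric])
  finally show ?thesis using w0 by (simp add: vline_kernel_def power_divide)
qed

lemma kern_vline_continuous: "continuous_on UNIV (\<lambda>y. kern n (vline r y))"
  by (rule continuous_on_compose2[OF holomorphic_on_imp_continuous_on[OF kern_holomorphic] vline_continuous])
     (use r0 in auto)

lemma exp_kern_bound:
  assumes "c = C * M ^ (n + 2) * fact (n + 2)"
  shows "cmod (exp (of_real t * vline r y) * kern n (vline r y)) \<le> (exp (t * r) * c) / (cmod (vline r y))\<^sup>2"
  using mult_left_mono[OF kern_bound[of "vline r y" n], of "exp (t * r)"] r0 assms by (simp add: norm_mult)

lemma exp_kern_integrable: "integrable lborel (\<lambda>y. exp (of_real t * vline r y) * kern n (vline r y))"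
  by (rule integrable_on_vline[OF rpos _ exp_kern_bound[OF refl]])
     (intro continuous_intros vline_continuous kern_vline_continuous)

lemma coeff_bound: "cmod (A n) \<le> C * M ^ n * fact n"
proof -
  define H where "H = {h :: complex. r0 < Re (1 / h)}"
  have "gevrey_upto C M (Suc n) H (\<lambda>h. g (1 / h)) (Abs_fps A)"
    unfolding gevrey_upto_def
  proof (intro allI impI ballI)
    fix m h assume "h \<in> H"
    then show "cmod (fps_remainder (g (1 / h)) (Abs_fps A) m h) \<le> C * M ^ m * fact m * cmod h ^ m"
      using bd[of "1 / h" m] by (simp add: H_def)
  qed
  moreover have "\<exists>h\<in>H. h \<noteq> 0 \<and> cmod h < e" if e: "e > 0" for e
  proof -
    define R where "R = r0 + 1 + 1 / e"
    have R: "R > 0" "R > r0" "1 / R < e" using r0 e by (auto simp: R_def divide_simps add_pos_nonneg algebra_simps)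
    then have "complex_of_real (1 / R) \<in> H \<and> complex_of_real (1 / R) \<noteq> 0 \<and> cmod (complex_of_real (1 / R)) < e"
      by (simp add: H_def norm_divide del: of_real_divide) (simp add: complex_of_real_def)?
    then show ?thesis by blast
  qed
  ultimately have "cmod (fps_nth (Abs_fps A) n) \<le> C * M ^ n * fact n"
    by (intro gevrey_upto_coeff[where N = "Suc n" and H = H]) auto
  then show ?thesis by simp
qed

lemma u_bound:
  assumes t: "0 \<le> t"
  shows "cmod (u n t) \<le> K * exp (r * t) * N ^ n * fact n"
proof -
  define c where "c = C * M ^ (n + 2) * fact (n + 2)"
  have c0: "0 \<le> c" using C M by (simp add: c_def)
  have b1: "real (n + 1) \<le> 4 ^ n" and b2: "real (n + 2) * real (n + 1) \<le> 2 * 4 ^ n"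
    by (induction n) (auto simp: algebra_simps)
  have "cmod (\<integral>y. exp (of_real t * vline r y) * kern n (vline r y) \<partial>lborel) \<le> (\<integral>y. (exp (t * r) * c) * (1 / (cmod (vline r y))\<^sup>2) \<partial>lborel)"
    by (rule Bochner_Integration.integral_norm_bound_integral[OF exp_kern_integrable
          integrable_mult_right[OF integrable_vline_square[OF rpos]]])
       (use exp_kern_bound[OF c_def] in simp)
  also have "\<dots> = exp (t * r) * c * vline_const r"
    unfolding vline_const_def by (rule integral_mult_right_zero)
  finally have I: "cmod (\<integral>y. exp (of_real t * vline r y) * kern n (vline r y) \<partial>lborel) \<le> exp (t * r) * c * vline_const r" .
  have "cmod (1 / (2 * pi) * (\<integral>y. exp (of_real t * vline r y) * kern n (vline r y) \<partial>lborel)) \<le> (1/2) * (exp (t * r) * c * vline_const r)"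
  proof -
    have "cmod (complex_of_real (1 / (2 * pi))) \<le> 1/2" using pi_gt3 by (simp add: norm_divide divide_simps)
    then have "cmod (complex_of_real (1 / (2 * pi))) * cmod (\<integral>y. exp (of_real t * vline r y) * kern n (vline r y) \<partial>lborel) \<le> (1/2) * (exp (t * r) * c * vline_const r)"
      by (intro mult_mono I) auto
    moreover have "1 / (2 * complex_of_real pi) = complex_of_real (1 / (2 * pi))" by simp
    ultimately show ?thesis by (metis norm_mult)
  qed
  moreover have "cmod (A (Suc n)) \<le> C * M ^ Suc n * fact (Suc n)" by (rule coeff_bound)
  ultimately have "cmod (u n t) \<le> C * M ^ Suc n * fact (Suc n) + (1/2) * (exp (t * r) * c * vline_const r)"
    unfolding borel_deriv_def by (rule norm_triangle_mono[rotated])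
  also have "C * M ^ Suc n * fact (Suc n) = (C * M) * M ^ n * real (n + 1) * fact n" by simp
  also have "(C * M) * M ^ n * real (n + 1) * fact n \<le> exp (r * t) * ((C * M) * M ^ n * 4 ^ n * fact n)"
  proof -
    have "(C * M) * M ^ n * real (n + 1) * fact n \<le> (C * M) * M ^ n * 4 ^ n * fact n"
      using C M b1 by (intro mult_right_mono mult_left_mono) auto
    also have "\<dots> \<le> exp (r * t) * ((C * M) * M ^ n * 4 ^ n * fact n)"
    proof -
      have "1 \<le> exp (r * t)" using t rpos by simp
      from mult_right_mono[OF this, of "(C * M) * M ^ n * 4 ^ n * fact n"] C M show ?thesis by simp
    qed
    finally show ?thesis .
  qed
  also have "(1/2) * (exp (t * r) * c * vline_const r) = exp (r * t) * ((C * M\<^sup>2 * vline_const r) * M ^ n * (1/2 * (real (n + 2) * real (n + 1))) * fact n)"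
    by (simp add: c_def power_add power2_eq_square mult_ac)
  also have "\<dots> \<le> exp (r * t) * ((C * M\<^sup>2 * vline_const r) * M ^ n * 4 ^ n * fact n)"
    using C M vline_const_nonneg b2 by (intro mult_right_mono mult_left_mono) auto
  finally show ?thesis by (simp add: borel_const_def power_mult_distrib algebra_simps)
qed

lemma u_0: "u n 0 = A (Suc n)"
proof -
  have "(\<integral>y. kern n (vline r y) \<partial>lborel) = 0"
    by (rule vline_cauchy(1)[OF r0 _ kern_holomorphic kern_bound, of "of_real (r + 1)"]) auto
  then show ?thesis by (simp add: borel_deriv_def)
qed

lemma u_deriv:
  assumes t: "0 \<le> t"
  shows "(u n has_vector_derivative u (Suc n) t) (at t within {0..})"
proof -
  define c where "c = C * M ^ (Suc n + 2) * fact (Suc n + 2)"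
  have c0: "0 \<le> c" using C M by (simp add: c_def)
  define k where "k w = kern (Suc n) w / w" for w
  have v0: "vline r y \<noteq> 0" for y using vline_norm_ge[OF rpos, of y] rpos by auto
  have kb: "cmod (k (vline r y)) \<le> (c / r) / (cmod (vline r y))\<^sup>2" for y
  proof -
    have "cmod (k (vline r y)) \<le> (c / (cmod (vline r y))\<^sup>2) / r"
      unfolding k_def norm_divide
      using kern_bound[of "vline r y" "Suc n"] r0 vline_norm_ge[OF rpos, of y] c0 unfolding c_def
      by (intro frac_le) auto
    then show ?thesis by (simp add: mult.commute)
  qed
  have kc: "continuous_on UNIV (\<lambda>y. k (vline r y))"
    unfolding k_def by (intro continuous_intros kern_vline_continuous vline_continuous) (use v0 in auto)
  have ki: "integrable lborel (\<lambda>y. exp (of_real s * vline r y) * k (vline r y))" for s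
  proof (rule integrable_on_vline[OF rpos])
    show "continuous_on UNIV (\<lambda>y. exp (of_real s * vline r y) * k (vline r y))"
      by (intro continuous_intros kc vline_continuous)
    show "cmod (exp (of_real s * vline r y) * k (vline r y)) \<le> (exp (s * r) * (c / r)) / (cmod (vline r y))\<^sup>2" for y
      using mult_left_mono[OF kb[of y], of "exp (s * r)"] by (simp add: norm_mult)
  qed
  define P where "P s = (\<integral>y. exp (of_real s * vline r y) * k (vline r y) \<partial>lborel)" for s
  have usplit: "u n s = A (Suc n) + (A (n + 2) * of_real s + 1 / (2 * pi) * P s)" if s: "0 \<le> s" for s
  proof -
    have e2: "integrable lborel (\<lambda>y. exp (of_real s * vline r y) / (vline r y)\<^sup>2)"
    proof (rule integrable_on_vline[where c = "exp (s * r)", OF rpos])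
      show "continuous_on UNIV (\<lambda>y. exp (of_real s * vline r y) / (vline r y)\<^sup>2)"
        by (intro continuous_intros vline_continuous) (use v0 in auto)
    qed (auto simp: norm_divide norm_power)
    have "(\<integral>y. exp (of_real s * vline r y) * kern n (vline r y) \<partial>lborel)
        = (\<integral>y. A (n + 2) * (exp (of_real s * vline r y) / (vline r y)\<^sup>2) + exp (of_real s * vline r y) * k (vline r y) \<partial>lborel)"
    proof (intro Bochner_Integration.integral_cong refl)
      fix y
      have "kern n (vline r y) = A (n + 2) / (vline r y)\<^sup>2 + k (vline r y)"
        using kern_step[of "vline r y" n] r0 by (simp add: k_def)
      then show "exp (of_real s * vline r y) * kern n (vline r y)
          = A (n + 2) * (exp (of_real s * vline r y) / (vline r y)\<^sup>2) + exp (of_real s * vline r y) * k (vline r y)"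
        by (simp add: distrib_left)
    qed
    also have "\<dots> = A (n + 2) * (2 * pi * of_real s) + P s"
      unfolding P_def
      by (subst Bochner_Integration.integral_add[OF integrable_mult_right[OF e2] ki[of s]])
         (simp only: integral_mult_right_zero vline_exp_over_square[OF rpos s])
    finally show ?thesis by (simp add: borel_deriv_def algebra_simps)
  qed
  have vs: "vline r y * k (vline r y) = kern (Suc n) (vline r y)" for y using v0 by (simp add: k_def)
  have Pd: "(P has_vector_derivative (\<integral>y. exp (of_real t * vline r y) * kern (Suc n) (vline r y) \<partial>lborel)) (at t within {0..t+1})"
    unfolding P_def
  proof (rule has_vector_derivative_integral[where f' = "\<lambda>s y. exp (of_real s * vline r y) * kern (Suc n) (vline r y)"
        and b = "\<lambda>y. (exp ((t + 1) * r) * c) * (1 / (cmod (vline r y))\<^sup>2)"])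
    show "((\<lambda>s. exp (of_real s * vline r y) * k (vline r y)) has_vector_derivative exp (of_real s * vline r y) * kern (Suc n) (vline r y)) (at s within {0..t+1})" for s y
    proof -
      have "((\<lambda>z. exp (z * vline r y) * k (vline r y)) has_field_derivative exp (of_real s * vline r y) * (vline r y * k (vline r y))) (at (of_real s))"
        by (auto intro!: derivative_eq_intros)
      from has_vector_derivative_at_within[OF has_vector_derivative_real_field[OF this]] show ?thesis unfolding vs .
    qed
    show "cmod (exp (of_real s * vline r y) * kern (Suc n) (vline r y)) \<le> (exp ((t + 1) * r) * c) * (1 / (cmod (vline r y))\<^sup>2)"
      if "s \<in> {0..t+1}" for s y
    proof -
      have "cmod (exp (of_real s * vline r y) * kern (Suc n) (vline r y)) \<le> (exp (s * r) * c) / (cmod (vline r y))\<^sup>2"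
        by (rule exp_kern_bound) (simp add: c_def)
      also have "\<dots> \<le> (exp ((t + 1) * r) * c) / (cmod (vline r y))\<^sup>2"
        using that rpos c0 by (intro divide_right_mono mult_right_mono) auto
      finally show ?thesis by simp
    qed
    show "integrable lborel (\<lambda>y. (exp ((t + 1) * r) * c) * (1 / (cmod (vline r y))\<^sup>2))"
      by (intro integrable_mult_right integrable_vline_square rpos)
    show "integrable lborel (\<lambda>y. exp (of_real s * vline r y) * k (vline r y))" for s by (rule ki)
    show "integrable lborel (\<lambda>y. exp (of_real t * vline r y) * kern (Suc n) (vline r y))" by (rule exp_kern_integrable)
  qed (use t in auto)
  have w: "at t within {0..t+1} = at t within {0..}"
    using t by (intro at_within_nhd[where S = "{..<t+1}"]) auto
  have "((\<lambda>s. A (Suc n) + (A (n + 2) * of_real s + 1 / (2 * pi) * P s)) has_vector_derivative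
      0 + (A (n + 2) * 1 + 1 / (2 * pi) * (\<integral>y. exp (of_real t * vline r y) * kern (Suc n) (vline r y) \<partial>lborel))) (at t within {0..})"
    by (intro has_vector_derivative_add has_vector_derivative_mult_right has_vector_derivative_const Pd[unfolded w] has_vector_derivative_of_real)
       (auto intro!: derivative_eq_intros simp: has_vector_derivative_def scaleR_conv_of_real fun_eq_iff)
  then have "((\<lambda>s. A (Suc n) + (A (n + 2) * of_real s + 1 / (2 * pi) * P s)) has_vector_derivative u (Suc n) t) (at t within {0..})"
    by (simp add: borel_deriv_def)
  then show ?thesis
    by (rule has_vector_derivative_transform[rotated 2]) (use t usplit in auto)
qed

lemma taylor_term_bound:
  assumes "0 \<le> t" "cmod (\<xi> - of_real t) \<le> 1 / (2 * N)"
  shows "cmod (u n t * (\<xi> - of_real t) ^ n / fact n) \<le> K * exp (r * t) * (1/2) ^ n"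
proof -
  have "cmod (u n t * (\<xi> - of_real t) ^ n / fact n) = cmod (u n t) * cmod (\<xi> - of_real t) ^ n / fact n"
    by (simp add: norm_mult norm_divide norm_power)
  also have "\<dots> \<le> (K * exp (r * t) * N ^ n * fact n) * (1 / (2 * N)) ^ n / fact n"
    using K M by (intro divide_right_mono mult_mono u_bound power_mono assms) auto
  also have "\<dots> = K * exp (r * t) * (N * (1 / (2 * N))) ^ n"
    unfolding power_mult_distrib by simp
  also have "N * (1 / (2 * N)) = 1/2" using M by simp
  finally show ?thesis .
qed

lemma taylor_summable:
  assumes "0 \<le> t" "cmod (\<xi> - of_real t) \<le> 1 / (2 * N)"
  shows "summable (\<lambda>n. u n t * (\<xi> - of_real t) ^ n / fact n)"
  by (rule summable_comparison_test'[of "\<lambda>n. K * exp (r * t) * (1/2) ^ n" 0])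
     (use taylor_term_bound[OF assms] in \<open>auto intro!: summable_mult\<close>)

text \<open>
  Differentiating the partial sums of the Taylor series in its base point telescopes, so the value
  of the series does not depend on the base point. So the series centred at the points of the ray fit
  together to one function.
\<close>

lemma partial_sum_deriv:
  assumes s: "0 \<le> s"
  shows "((\<lambda>s. \<Sum>n<Suc m. u n s * (\<xi> - of_real s) ^ n / fact n) has_vector_derivative
      u (Suc m) s * (\<xi> - of_real s) ^ m / fact m) (at s within {0..})"
proof (induction m)
  case 0
  show ?case using u_deriv[OF s, of 0] by simp
next
  case (Suc m)
  have p: "((\<lambda>s. (\<xi> - of_real s) ^ Suc m / fact (Suc m)) has_vector_derivative - ((\<xi> - of_real s) ^ m / fact m)) (at s within {0..})"
  proof -
    have "((\<lambda>z. \<xi> - z) has_field_derivative - 1) (at (of_real s))"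
      by (auto intro!: derivative_eq_intros)
    from DERIV_cdivide[OF DERIV_power_Suc[OF this, of m], of "fact (Suc m)"]
    have "((\<lambda>z. (\<xi> - z) ^ Suc m / fact (Suc m)) has_field_derivative
        ((1 + of_nat m) * (- 1 * (\<xi> - of_real s) ^ m)) / fact (Suc m)) (at (of_real s))" .
    also have "((1 + of_nat m) * (- 1 * (\<xi> - of_real s) ^ m)) / fact (Suc m) = - ((\<xi> - of_real s) ^ m / fact m)"
    proof -
      have "(1 + of_nat m :: complex) \<noteq> 0" by (metis of_nat_Suc of_nat_eq_0_iff nat.distinct(1))
      then show ?thesis by simp
    qed
    finally have d: "((\<lambda>z. (\<xi> - z) ^ Suc m / fact (Suc m)) has_field_derivative - ((\<xi> - of_real s) ^ m / fact m)) (at (of_real s))" .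
    from has_vector_derivative_at_within[OF has_vector_derivative_real_field[OF d]] show ?thesis .
  qed
  have "((\<lambda>s. u (Suc m) s * ((\<xi> - of_real s) ^ Suc m / fact (Suc m))) has_vector_derivative
      u (Suc m) s * (- ((\<xi> - of_real s) ^ m / fact m)) + u (Suc (Suc m)) s * ((\<xi> - of_real s) ^ Suc m / fact (Suc m))) (at s within {0..})"
    by (rule has_vector_derivative_mult[OF u_deriv[OF s] p])
  from has_vector_derivative_add[OF Suc this] show ?case
    by (simp add: algebra_simps del: fact_Suc power_Suc)
qed

lemma taylor_base_point:
  assumes t: "0 \<le> t" "cmod (\<xi> - of_real t) \<le> 1 / (2 * N)" and t': "0 \<le> t'" "cmod (\<xi> - of_real t') \<le> 1 / (2 * N)"
  shows "borel_taylor r g A t \<xi> = borel_taylor r g A t' \<xi>"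
proof -
  define T where "T = max t t'"
  have seg: "0 \<le> s \<and> cmod (\<xi> - of_real s) \<le> 1 / (2 * N) \<and> s \<le> T" if "s \<in> closed_segment t t'" for s
  proof -
    have "of_real s \<in> closed_segment (complex_of_real t) (of_real t')"
      using that by simp
    moreover have "closed_segment (complex_of_real t) (of_real t') \<subseteq> cball \<xi> (1 / (2 * N))"
      using t t' by (intro closed_segment_subset convex_cball) (auto simp: dist_norm)
    ultimately have "of_real s \<in> cball \<xi> (1 / (2 * N))" by blast
    then have "cmod (\<xi> - of_real s) \<le> 1 / (2 * N)" by (simp add: dist_norm)
    moreover have "0 \<le> s \<and> s \<le> T"
      using that t(1) t'(1) unfolding T_def closed_segment_eq_real_ivl by (auto split: if_splits)
    ultimately show ?thesis by blast
  qed
  define S where "S m s = (\<Sum>n<Suc m. u n s * (\<xi> - of_real s) ^ n / fact n)" for m s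
  have step: "cmod (S m t - S m t') \<le> (K * exp (r * T) * N * cmod (of_real t - of_real t')) * (real (Suc m) * (1/2) ^ m)" for m
  proof -
    have "cmod (S m t - S m t') \<le> (K * exp (r * T) * N * (real (Suc m) * (1/2) ^ m)) * norm (t - t')"
    proof (rule differentiable_bound[of "closed_segment t t'"])
      fix s assume s: "s \<in> closed_segment t t'"
      have "(S m has_vector_derivative u (Suc m) s * (\<xi> - of_real s) ^ m / fact m) (at s within {0..})"
        unfolding S_def by (rule partial_sum_deriv) (use seg[OF s] in auto)
      then show "(S m has_derivative (\<lambda>h. h *\<^sub>R (u (Suc m) s * (\<xi> - of_real s) ^ m / fact m))) (at s within closed_segment t t')"
        unfolding has_vector_derivative_def by (rule has_derivative_subset) (use seg in auto)
      have "cmod (u (Suc m) s * (\<xi> - of_real s) ^ m / fact m) = cmod (u (Suc m) s) * cmod (\<xi> - of_real s) ^ m / fact m"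
        by (simp add: norm_mult norm_divide norm_power)
      also have "\<dots> \<le> (K * exp (r * T) * N ^ Suc m * fact (Suc m)) * (1 / (2 * N)) ^ m / fact m"
      proof (intro divide_right_mono mult_mono power_mono)
        have "cmod (u (Suc m) s) \<le> K * exp (r * s) * N ^ Suc m * fact (Suc m)" using seg[OF s] by (intro u_bound) auto
        also have "\<dots> \<le> K * exp (r * T) * N ^ Suc m * fact (Suc m)"
          using K M seg[OF s] rpos by (intro mult_right_mono mult_left_mono) auto
        finally show "cmod (u (Suc m) s) \<le> K * exp (r * T) * N ^ Suc m * fact (Suc m)" .
      qed (use K M seg[OF s] in auto)
      also have "\<dots> = K * exp (r * T) * N * (real (Suc m) * (N * (1 / (2 * N))) ^ m)"
        unfolding power_mult_distrib by (simp add: field_simps)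
      also have "N * (1 / (2 * N)) = 1/2" using M by simp
      finally have "cmod (u (Suc m) s * (\<xi> - of_real s) ^ m / fact m) \<le> K * exp (r * T) * N * (real (Suc m) * (1/2) ^ m)" .
      then show "onorm (\<lambda>h. h *\<^sub>R (u (Suc m) s * (\<xi> - of_real s) ^ m / fact m)) \<le> K * exp (r * T) * N * (real (Suc m) * (1/2) ^ m)"
        by (intro onorm_le) (metis abs_ge_zero mult.commute mult_right_mono norm_scaleR real_norm_def)
    qed auto
    then show ?thesis by (simp add: mult_ac flip: of_real_diff)
  qed
  have lim: "(\<lambda>m. S m t - S m t') \<longlonglongrightarrow> borel_taylor r g A t \<xi> - borel_taylor r g A t' \<xi>"
    unfolding S_def borel_taylor_def
    by (intro tendsto_diff LIMSEQ_Suc[OF summable_LIMSEQ] taylor_summable t t')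
  have "(\<lambda>m. real (Suc m) * (1/2 :: real) ^ m) \<longlonglongrightarrow> 0"
  proof -
    have "(\<lambda>m. real m * (1/2 :: real) ^ m) \<longlonglongrightarrow> 0" by (rule powser_times_n_limit_0) simp
    from tendsto_add[OF this LIMSEQ_realpow_zero[of "1/2"]] show ?thesis by (simp add: algebra_simps)
  qed
  then have "(\<lambda>m. (K * exp (r * T) * N * cmod (of_real t - of_real t')) * (real (Suc m) * (1/2) ^ m)) \<longlonglongrightarrow> 0"
    by (rule tendsto_mult_right_zero)
  then have "(\<lambda>m. S m t - S m t') \<longlonglongrightarrow> 0"
    by (rule Lim_null_comparison[rotated]) (use step in auto)
  then have "borel_taylor r g A t \<xi> - borel_taylor r g A t' \<xi> = 0" by (rule LIMSEQ_unique[OF lim])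
  then show ?thesis by simp
qed

abbreviation "\<phi> \<equiv> borel_fun r g A"

lemma phi_eq_taylor:
  assumes t: "0 \<le> t" "cmod (\<xi> - of_real t) \<le> 1 / (2 * N)"
  shows "\<phi> \<xi> = borel_taylor r g A t \<xi>"
  unfolding borel_fun_def
  by (rule taylor_base_point) (use t dist_positive_part_le[OF t(1), of \<xi>] in auto)

lemma phi_bound:
  assumes xi: "\<xi> \<in> right_nbhd (1 / (2 * N))"
  shows "cmod (\<phi> \<xi>) \<le> 2 * K * exp (r * cmod \<xi>)"
proof -
  obtain t where t: "0 \<le> t" "cmod (\<xi> - of_real t) < 1 / (2 * N)" using xi by (auto simp: right_nbhd_def)
  define s where "s = max 0 (Re \<xi>)"
  have s: "0 \<le> s" "cmod (\<xi> - of_real s) \<le> 1 / (2 * N)" "s \<le> cmod \<xi>"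
    using dist_positive_part_le[OF t(1), of \<xi>] t complex_Re_le_cmod[of \<xi>] by (auto simp: s_def)
  have sm: "summable (\<lambda>n. K * exp (r * s) * (1/2 :: real) ^ n)" by (intro summable_mult summable_geometric) simp
  have "cmod (\<phi> \<xi>) \<le> (\<Sum>n. K * exp (r * s) * (1/2) ^ n)"
    unfolding phi_eq_taylor[OF s(1,2)] borel_taylor_def
    by (rule norm_suminf_le[OF taylor_term_bound[OF s(1,2)] sm])
  also have "\<dots> = 2 * K * exp (r * s)"
    using suminf_mult[OF summable_geometric[of "1/2 :: real"], of "K * exp (r * s)"] suminf_geometric[of "1/2 :: real"] by simp
  also have "\<dots> \<le> 2 * K * exp (r * cmod \<xi>)" using s K rpos by (intro mult_left_mono) auto
  finally show ?thesis .
qed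

lemma phi_real: "0 \<le> t \<Longrightarrow> \<phi> (of_real t) = u 0 t"
proof -
  assume t: "0 \<le> t"
  have "\<phi> (of_real t) = borel_taylor r g A t (of_real t)" by (rule phi_eq_taylor) (use t M in auto)
  also have "\<dots> = (\<Sum>n. u n t * 0 ^ n / fact n)" by (simp add: borel_taylor_def)
  also have "\<dots> = (\<Sum>n\<in>{0}. u n t * 0 ^ n / fact n)" by (rule suminf_finite) auto
  finally show ?thesis by simp
qed

lemma phi_near_0:
  assumes "cmod \<xi> \<le> 1 / (2 * N)"
  shows "(\<lambda>n. 1 / fact n * A (Suc n) * \<xi> ^ n) sums \<phi> \<xi>"
proof -
  have 1: "0 \<le> (0::real)" "cmod (\<xi> - of_real 0) \<le> 1 / (2 * N)" using assms by auto
  have "(\<lambda>n. u n 0 * (\<xi> - of_real 0) ^ n / fact n) sums \<phi> \<xi>"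
    unfolding phi_eq_taylor[OF 1] borel_taylor_def by (intro summable_sums taylor_summable[OF 1])
  then show ?thesis by (simp add: u_0 mult_ac)
qed

lemma phi_holomorphic: "\<phi> holomorphic_on right_nbhd (1 / (2 * N))"
proof -
  have "\<phi> holomorphic_on ball (of_real t) (1 / (2 * N))" if t: "0 \<le> t" for t
  proof -
    have "(\<lambda>\<xi>. borel_taylor r g A t \<xi>) holomorphic_on ball (of_real t) (1 / (2 * N))"
      unfolding borel_taylor_def
      by (rule holomorphic_on_suminf_geometric[where B = "K * exp (r * t)"])
         (auto intro!: holomorphic_intros taylor_term_bound t simp: dist_norm norm_minus_commute)
    then show ?thesis
      by (rule holomorphic_transform) (use t in \<open>auto intro!: phi_eq_taylor[symmetric] simp: dist_norm norm_minus_commute\<close>)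
  qed
  then show ?thesis unfolding right_nbhd_eq_Un by (intro holomorphic_on_UN_open) auto
qed

lemma laplace_integrable:
  assumes w: "r < Re w"
  shows "set_integrable lborel {0..} (\<lambda>s. exp (- (of_real s * w)) * u 0 s)"
    and "s \<ge> 0 \<Longrightarrow> cmod (exp (- (of_real s * w)) * u 0 s) \<le> K * exp (- ((Re w - r) * s))"
proof -
  have cont: "continuous_on {0..} (u 0)"
    using u_deriv[of _ 0] by (intro continuous_on_vector_derivative) auto
  show le: "cmod (exp (- (of_real s * w)) * u 0 s) \<le> K * exp (- ((Re w - r) * s))" if "s \<ge> 0" for s
  proof -
    have "cmod (exp (- (of_real s * w)) * u 0 s) \<le> exp (- (s * Re w)) * (K * exp (r * s))"
      unfolding norm_mult using u_bound[OF that, of 0] by (intro mult_mono) auto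
    also have "\<dots> = K * exp (- ((Re w - r) * s))" by (simp add: algebra_simps exp_add[symmetric] exp_diff exp_minus divide_simps)
    finally show ?thesis .
  qed
  show "set_integrable lborel {0..} (\<lambda>s. exp (- (of_real s * w)) * u 0 s)"
    unfolding set_integrable_def
  proof (rule Bochner_Integration.integrable_bound)
    show "integrable lborel (\<lambda>s. K * (indicator {0..} s * exp (- ((Re w - r) * s))))"
      by (rule integrable_mult_right, rule integrable.intros, rule has_bochner_integral_exp_ray) (use w in simp)
    show "(\<lambda>s. indicator {0..} s *\<^sub>R (exp (- (of_real s * w)) * u 0 s)) \<in> borel_measurable lborel"
    proof -
      have "continuous_on {0..} (\<lambda>s. exp (- (of_real s * w)) * u 0 s)" by (intro continuous_intros cont)
      from borel_measurable_continuous_on_indicator[OF _ this] show ?thesis by simp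
    qed
    show "AE s in lborel. cmod (indicator {0..} s *\<^sub>R (exp (- (of_real s * w)) * u 0 s)) \<le> norm (K * (indicator {0..} s * exp (- ((Re w - r) * s))))"
      using le K by (intro AE_I2) (auto simp: indicator_def)
  qed
qed

text \<open>
  After exchanging the order of integration the inner exponential integral produces \<open>1 / (w - \<zeta>)\<close>, and
  the Cauchy formula for the vertical line returns \<open>g w\<close>. The exchange is done by exhibiting a primitive
  of the Laplace integrand, namely \<open>F\<close> below.
\<close>

lemma laplace_eq:
  assumes w: "r < Re w"
  shows "set_lebesgue_integral lborel {0..} (\<lambda>s. exp (- (of_real s * w)) * u 0 s) = g w - A 0"
proof -
  define c where "c = C * M ^ (0 + 2) * fact (0 + 2)"
  have c0: "0 \<le> c" using C M by (simp add: c_def)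
  have w0: "w \<noteq> 0" using w rpos by auto
  define d where "d = Re w - r"
  have d: "d > 0" using w by (simp add: d_def)
  have dist: "d \<le> cmod (vline r y - w)" for y
    using abs_Re_le_cmod[of "vline r y - w"] by (simp add: d_def)
  then have ne: "vline r y - w \<noteq> 0" for y using d by (metis norm_zero not_less)
  define k where "k y = kern 0 (vline r y) / (vline r y - w)" for y
  have kb: "cmod (kern 0 (vline r y)) \<le> c / (cmod (vline r y))\<^sup>2" for y
    unfolding c_def by (rule kern_bound) (use r0 in simp)
  have c2: "0 \<le> c / (cmod (vline r y))\<^sup>2" for y using c0 by simp
  have kc: "continuous_on UNIV k" unfolding k_def
    by (intro continuous_intros kern_vline_continuous vline_continuous) (use ne in auto)
  have vexp: "cmod (exp (of_real s * (vline r y - w))) = exp (- (d * s))" for s y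
    by (simp add: d_def algebra_simps)
  note dom = integrable_on_vline[OF rpos]
  have kbd: "cmod (exp (of_real s * (vline r y - w)) * k y) \<le> (exp (- (d * s)) * (c / d)) / (cmod (vline r y))\<^sup>2" for s y
  proof -
    have "cmod (k y) \<le> (c / (cmod (vline r y))\<^sup>2) / d"
      unfolding k_def norm_divide using kb[of y] dist[of y] d c2[of y] by (intro frac_le) auto
    then have "exp (- (d * s)) * cmod (k y) \<le> exp (- (d * s)) * ((c / (cmod (vline r y))\<^sup>2) / d)" by (intro mult_left_mono) auto
    then show ?thesis unfolding norm_mult vexp by (simp add: mult_ac)
  qed
  have kint: "integrable lborel (\<lambda>y. exp (of_real s * (vline r y - w)) * k y)" for s
    by (rule dom[OF _ kbd]) (intro continuous_intros kc vline_continuous)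
  define Q where "Q s = (\<integral>y. exp (of_real s * (vline r y - w)) * k y \<partial>lborel)" for s :: real
  have Qbd: "cmod (Q s) \<le> (c / d * vline_const r) * exp (- (d * s))" for s
  proof -
    have "cmod (Q s) \<le> (\<integral>y. (exp (- (d * s)) * (c / d)) * (1 / (cmod (vline r y))\<^sup>2) \<partial>lborel)"
      unfolding Q_def by (rule Bochner_Integration.integral_norm_bound_integral[OF kint integrable_mult_right[OF integrable_vline_square[OF rpos]]])
        (use kbd in simp)
    also have "\<dots> = (exp (- (d * s)) * (c / d)) * vline_const r" unfolding vline_const_def by (rule integral_mult_right_zero)
    finally show ?thesis by (simp add: mult_ac)
  qed
  have Qd: "(Q has_vector_derivative (\<integral>y. exp (of_real s * (vline r y - w)) * kern 0 (vline r y) \<partial>lborel)) (at s within {0..})"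
    if s: "0 \<le> s" for s
    unfolding Q_def
  proof (rule has_vector_derivative_integral[where f' = "\<lambda>s y. exp (of_real s * (vline r y - w)) * kern 0 (vline r y)"
        and b = "\<lambda>y. c * (1 / (cmod (vline r y))\<^sup>2)"])
    show "((\<lambda>s. exp (of_real s * (vline r y - w)) * k y) has_vector_derivative exp (of_real s * (vline r y - w)) * kern 0 (vline r y)) (at s within {0..})" for s y
    proof -
      have "((\<lambda>z. exp (z * (vline r y - w)) * k y) has_field_derivative exp (of_real s * (vline r y - w)) * ((vline r y - w) * k y)) (at (of_real s))"
        by (auto intro!: derivative_eq_intros)
      note d = has_vector_derivative_at_within[OF has_vector_derivative_real_field[OF this]]
      have "(vline r y - w) * k y = kern 0 (vline r y)" using ne by (simp add: k_def)
      with d show ?thesis by simp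
    qed
    show le: "cmod (exp (of_real s * (vline r y - w)) * kern 0 (vline r y)) \<le> c * (1 / (cmod (vline r y))\<^sup>2)"
      if "s \<in> {0..}" for s y
    proof -
      have "exp (- (d * s)) * cmod (kern 0 (vline r y)) \<le> 1 * (c / (cmod (vline r y))\<^sup>2)"
        using that d kb[of y] by (intro mult_mono) auto
      then show ?thesis unfolding norm_mult vexp by simp
    qed
    show "integrable lborel (\<lambda>y. c * (1 / (cmod (vline r y))\<^sup>2))"
      by (intro integrable_mult_right integrable_vline_square rpos)
    show "integrable lborel (\<lambda>y. exp (of_real s * (vline r y - w)) * kern 0 (vline r y))"
      by (rule dom[where c = c]) (use le[of s] s in \<open>auto intro!: continuous_intros kern_vline_continuous vline_continuous\<close>)
    show "integrable lborel (\<lambda>y. exp (of_real s * (vline r y - w)) * k y)" for s by (rule kint)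
  qed (use s in auto)
  define F where "F s = 1 / (2 * pi) * Q s - A 1 / w * exp (- (of_real s * w))" for s :: real
  have Fd: "(F has_vector_derivative exp (- (of_real s * w)) * u 0 s) (at s within {0..})" if s: "0 \<le> s" for s
  proof -
    have "((\<lambda>z. A 1 / w * exp (- (z * w))) has_field_derivative - A 1 * exp (- (of_real s * w))) (at (of_real s))"
      using w0 by (auto intro!: derivative_eq_intros)
    note e = has_vector_derivative_at_within[OF has_vector_derivative_real_field[OF this], of "{0..}"]
    have "(F has_vector_derivative 1 / (2 * pi) * (\<integral>y. exp (of_real s * (vline r y - w)) * kern 0 (vline r y) \<partial>lborel) - (- A 1 * exp (- (of_real s * w)))) (at s within {0..})"
      unfolding F_def by (intro has_vector_derivative_diff has_vector_derivative_mult_right Qd s e)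
    also have "(\<integral>y. exp (of_real s * (vline r y - w)) * kern 0 (vline r y) \<partial>lborel) = exp (- (of_real s * w)) * (\<integral>y. exp (of_real s * vline r y) * kern 0 (vline r y) \<partial>lborel)"
      by (subst integral_mult_right_zero[symmetric], intro Bochner_Integration.integral_cong refl)
         (simp add: algebra_simps exp_add[symmetric] exp_diff exp_minus divide_simps)
    finally show ?thesis by (simp add: borel_deriv_def algebra_simps)
  qed
  have F0: "F 0 = - (g w - A 0)"
  proof -
    have "Q 0 = (\<integral>y. kern 0 (vline r y) / (vline r y - w) \<partial>lborel)" by (simp add: Q_def k_def)
    also have "\<dots> = - 2 * pi * kern 0 w"
      by (rule vline_cauchy(2)[OF r0 w kern_holomorphic kern_bound])
    finally have "F 0 = - kern 0 w - A 1 / w" by (simp add: F_def)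
    also have "kern 0 w = g w - A 0 - A 1 / w"
      by (simp add: vline_kernel_def fps_remainder_def numeral_2_eq_2)
    finally show ?thesis by simp
  qed
  have "{0<..} \<subseteq> {0::real..}" by auto
  then have si: "set_integrable lborel {0<..} (\<lambda>s. exp (- (of_real s * w)) * u 0 s)"
    by (intro set_integrable_subset[OF laplace_integrable(1)[OF w]]) auto
  have "(LBINT s=ereal 0..\<infinity>. exp (- (of_real s * w)) * u 0 s) = 0 - F 0"
  proof (rule interval_integral_FTC_integrable)
    have at: "at s within {0..} = at s" if "0 < s" for s :: real
      using that by (intro at_within_interior) simp
    show "(F has_vector_derivative exp (- (of_real s * w)) * u 0 s) (at s)" if "ereal 0 < ereal s" for s
      using Fd[of s] at[of s] that by simp
    show "isCont (\<lambda>s. exp (- (of_real s * w)) * u 0 s) s" if "ereal 0 < ereal s" for s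
    proof -
      have "(u 0 has_vector_derivative u 1 s) (at s)" using u_deriv[of s 0] at[of s] that by simp
      then have "isCont (u 0) s" by (rule has_vector_derivative_continuous)
      then show ?thesis by (intro continuous_intros)
    qed
    have "einterval (ereal 0) \<infinity> = {0<..}" by (auto simp: einterval_def)
    then show "set_integrable lborel (einterval (ereal 0) \<infinity>) (\<lambda>s. exp (- (of_real s * w)) * u 0 s)"
      using si by simp
    have "(F \<longlongrightarrow> F 0) (at 0 within {0..})"
      using has_vector_derivative_continuous[OF Fd[of 0]] by (simp add: continuous_within)
    then have "(F \<longlongrightarrow> F 0) (at_right 0)" by (rule tendsto_within_subset) auto
    then show "((F \<circ> real_of_ereal) \<longlongrightarrow> F 0) (at_right (ereal 0))" by (simp add: ereal_tendsto_simps)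
    have q: "(Q \<longlongrightarrow> 0) at_top"
    proof (rule Lim_null_comparison)
      show "\<forall>\<^sub>F s in at_top. cmod (Q s) \<le> (c / d * vline_const r) * exp (- (d * s))"
        using Qbd by (intro always_eventually) blast
      show "((\<lambda>s. (c / d * vline_const r) * exp (- (d * s))) \<longlongrightarrow> 0) at_top"
        by (intro tendsto_mult_right_zero tendsto_exp_neg d)
    qed
    have e: "((\<lambda>s::real. exp (- (of_real s * w))) \<longlongrightarrow> 0) at_top"
      by (rule Lim_null_comparison[OF _ tendsto_exp_neg[of "Re w"]]) (use w rpos in \<open>auto simp: mult.commute\<close>)
    have "(F \<longlongrightarrow> complex_of_real (1 / (2 * pi)) * 0 - A 1 / w * 0) at_top"
      unfolding F_def[abs_def] by (intro tendsto_diff tendsto_mult tendsto_const q e)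
    then show "((F \<circ> real_of_ereal) \<longlongrightarrow> 0) (at_left \<infinity>)" by (simp add: ereal_tendsto_simps)
  qed simp
  moreover have "(LBINT s=ereal 0..\<infinity>. exp (- (of_real s * w)) * u 0 s) = set_lebesgue_integral lborel {0<..} (\<lambda>s. exp (- (of_real s * w)) * u 0 s)"
    by (rule interval_integral_to_infinity_eq)
  moreover have "set_lebesgue_integral lborel {0<..} (\<lambda>s. exp (- (of_real s * w)) * u 0 s) = set_lebesgue_integral lborel {0..} (\<lambda>s. exp (- (of_real s * w)) * u 0 s)"
    unfolding set_lebesgue_integral_def
  proof (rule integral_cong_AE)
    show "AE s in lborel. indicator {0<..} s *\<^sub>R (exp (- (of_real s * w)) * u 0 s) = indicator {0..} s *\<^sub>R (exp (- (of_real s * w)) * u 0 s)"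
      using AE_lborel_singleton[of "0 :: real"] by eventually_elim (auto simp: indicator_def)
    show "(\<lambda>s. indicator {0..} s *\<^sub>R (exp (- (of_real s * w)) * u 0 s)) \<in> borel_measurable lborel"
      using laplace_integrable(1)[OF w] unfolding set_integrable_def by (rule borel_measurable_integrable)
    show "(\<lambda>s. indicator {0<..} s *\<^sub>R (exp (- (of_real s * w)) * u 0 s)) \<in> borel_measurable lborel"
      using si unfolding set_integrable_def by (rule borel_measurable_integrable)
  qed
  ultimately show ?thesis using F0 by simp
qed

end

text \<open>
  Both Borel transforms have the same Taylor series at \<open>0\<close>, hence agree along the ray, hence so do their
  Laplace integrals.
\<close>

lemma nevanlinna_unique:
  assumes 1: "nevanlinna g1 A r0 r C M" and 2: "nevanlinna g2 A r0 r C M" and w: "r < Re w"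
  shows "g1 w = g2 w"
proof -
  interpret g1: nevanlinna g1 A r0 r C M by (rule 1)
  interpret g2: nevanlinna g2 A r0 r C M by (rule 2)
  define \<epsilon> where "\<epsilon> = 1 / (2 * (4 * M))"
  have \<epsilon>: "\<epsilon> > 0" using g1.M by (simp add: \<epsilon>_def)
  have eq: "borel_fun r g1 A \<xi> = borel_fun r g2 A \<xi>" if "\<xi> \<in> right_nbhd \<epsilon>" for \<xi>
  proof (rule analytic_continuation_open[where s = "ball 0 \<epsilon>" and s' = "right_nbhd \<epsilon>"
        and f = "borel_fun r g1 A" and g = "borel_fun r g2 A"])
    show "borel_fun r g1 A holomorphic_on right_nbhd \<epsilon>" "borel_fun r g2 A holomorphic_on right_nbhd \<epsilon>"
      unfolding \<epsilon>_def by (rule g1.phi_holomorphic g2.phi_holomorphic)+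
    show "borel_fun r g1 A z = borel_fun r g2 A z" if "z \<in> ball 0 \<epsilon>" for z
      using sums_unique2[OF g1.phi_near_0[of z] g2.phi_near_0[of z]] that by (simp add: \<epsilon>_def)
    show "connected (right_nbhd \<epsilon>)" by (intro convex_connected convex_right_nbhd)
    show "ball 0 \<epsilon> \<subseteq> right_nbhd \<epsilon>" by (auto simp: right_nbhd_def intro!: exI[of _ 0])
  qed (use \<epsilon> that open_right_nbhd in auto)
  have u: "borel_deriv r g1 A 0 s = borel_deriv r g2 A 0 s" if "0 \<le> s" for s
  proof -
    have "of_real s \<in> right_nbhd \<epsilon>" using \<epsilon> that by (auto simp: right_nbhd_def)
    from eq[OF this] show ?thesis using that by (simp add: g1.phi_real g2.phi_real)
  qed
  have "set_lebesgue_integral lborel {0..} (\<lambda>s. exp (- (of_real s * w)) * borel_deriv r g1 A 0 s)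
      = set_lebesgue_integral lborel {0..} (\<lambda>s. exp (- (of_real s * w)) * borel_deriv r g2 A 0 s)"
    unfolding set_lebesgue_integral_def
    by (intro Bochner_Integration.integral_cong refl) (auto simp: indicator_def u)
  then show ?thesis unfolding g1.laplace_eq[OF w] g2.laplace_eq[OF w] by simp
qed

section \<open>Borel discs\<close>

text \<open>
  The image of a half-plane under \<open>w = cis \<theta> / h\<close>; for positive \<open>R\<close> it is the disc of diameter \<open>1 / R\<close>
  through \<open>0\<close> with centre in direction \<open>\<theta>\<close>.
\<close>

definition borel_disc :: "real \<Rightarrow> real \<Rightarrow> complex set" where
  "borel_disc \<theta> R = {h. R < Re (cis \<theta> / h)}"

lemma Re_cis_div: "Re (cis \<theta> / h) = Re (h * cis (- \<theta>)) / (cmod h)\<^sup>2"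
  by (simp add: Re_divide cmod_power2 mult.commute)

lemma Re_sgn_mult: "Re (sgn h * z) = Re (h * z) / cmod h"
proof -
  have "sgn h * z = (h * z) / of_real (cmod h)" by (simp add: Complex.sgn_eq)
  then show ?thesis by (simp only: Re_divide_of_real)
qed

lemma borel_disc_eq_ball:
  assumes "R > 0"
  shows "borel_disc \<theta> R = ball (cis \<theta> / of_real (2 * R)) (1 / (2 * R))"
proof (rule set_eqI)
  fix h
  define p where "p = Re (h * cis (- \<theta>))"
  have pp: "p = Re h * cos \<theta> + Im h * sin \<theta>" by (simp add: p_def)
  have "(cmod (h - cis \<theta> / of_real (2 * R)))\<^sup>2 = (cmod h)\<^sup>2 - p / R + (1 / (2 * R))\<^sup>2"
  proof -
    define k where "k = 1 / (2 * R)"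
    have q: "cis \<theta> / of_real (2 * R) = of_real k * cis \<theta>" "p / R = 2 * k * p"
      by (simp_all add: k_def)
    have "(cmod (h - cis \<theta> / of_real (2 * R)))\<^sup>2 = (Re h - k * cos \<theta>)\<^sup>2 + (Im h - k * sin \<theta>)\<^sup>2"
      unfolding q by (simp add: cmod_power2)
    also have "\<dots> = ((Re h)\<^sup>2 + (Im h)\<^sup>2) - 2 * k * p + ((cos \<theta>)\<^sup>2 + (sin \<theta>)\<^sup>2) * k\<^sup>2"
    proof -
      have "(x - k * c)\<^sup>2 + (y - k * s)\<^sup>2 = (x\<^sup>2 + y\<^sup>2) - 2 * k * (x * c + y * s) + (c\<^sup>2 + s\<^sup>2) * k\<^sup>2" for x y c s :: real
        by (simp add: power2_eq_square algebra_simps)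
      then show ?thesis unfolding pp .
    qed
    also have "\<dots> = ((Re h)\<^sup>2 + (Im h)\<^sup>2) - p / R + (1 / (2 * R))\<^sup>2"
      unfolding q by (simp add: k_def)
    finally show ?thesis by (simp add: cmod_power2)
  qed
  moreover have "h \<in> ball (cis \<theta> / of_real (2 * R)) (1 / (2 * R)) \<longleftrightarrow> (cmod (h - cis \<theta> / of_real (2 * R)))\<^sup>2 < (1 / (2 * R))\<^sup>2"
    unfolding mem_ball dist_norm norm_minus_commute[of _ h]
    using assms by (auto intro: power_strict_mono power2_less_imp_less)
  ultimately have "h \<in> ball (cis \<theta> / of_real (2 * R)) (1 / (2 * R)) \<longleftrightarrow> (cmod h)\<^sup>2 < p / R" by simp
  also have "\<dots> \<longleftrightarrow> R * (cmod h)\<^sup>2 < p" using assms by (simp add: field_simps)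
  also have "\<dots> \<longleftrightarrow> R < Re (cis \<theta> / h)"
  proof (cases "h = 0")
    case False
    then show ?thesis unfolding Re_cis_div p_def by (simp add: field_simps)
  qed (use assms in \<open>simp add: p_def\<close>)
  finally show "h \<in> borel_disc \<theta> R \<longleftrightarrow> h \<in> ball (cis \<theta> / of_real (2 * R)) (1 / (2 * R))"
    by (simp add: borel_disc_def)
qed

lemma open_borel_disc: "R > 0 \<Longrightarrow> open (borel_disc \<theta> R)"
  by (simp add: borel_disc_eq_ball)

lemma borel_disc_nonzero: "R > 0 \<Longrightarrow> h \<in> borel_disc \<theta> R \<Longrightarrow> h \<noteq> 0"
  by (auto simp: borel_disc_def)

lemma borel_disc_norm:
  assumes "R > 0" "h \<in> borel_disc \<theta> R"
  shows "cmod h < 1 / R"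
proof -
  have h: "cmod h > 0" using borel_disc_nonzero[OF assms] by simp
  have "R < cmod (cis \<theta> / h)" using assms(2) complex_Re_le_cmod[of "cis \<theta> / h"] by (simp add: borel_disc_def)
  then show ?thesis using h assms(1) by (simp add: norm_divide field_simps)
qed

lemma borel_disc_mono: "R \<le> R' \<Longrightarrow> borel_disc \<theta> R' \<subseteq> borel_disc \<theta> R"
  by (auto simp: borel_disc_def)

lemma borel_disc_polar:
  assumes "\<rho> > 0"
  shows "of_real \<rho> * cis t \<in> borel_disc \<theta> R \<longleftrightarrow> R * \<rho> < cos (t - \<theta>)"
proof -
  have "cis t * cis (- \<theta>) = cis (t - \<theta>)" by (simp add: cis_mult)
  then have "Re (of_real \<rho> * cis t * cis (- \<theta>)) = \<rho> * cos (t - \<theta>)" by (simp add: mult.assoc)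
  moreover have "cmod (of_real \<rho> * cis t) = \<rho>" using assms by (simp add: norm_mult)
  ultimately show ?thesis unfolding borel_disc_def mem_Collect_eq Re_cis_div
    using assms by (simp add: power2_eq_square field_simps)
qed

lemma half_le_sin:
  assumes "0 < x" "x \<le> 1"
  shows "x / 2 \<le> sin (x :: real)"
proof -
  obtain z where z: "0 < z" "z < x" "sin x - sin 0 = (x - 0) * cos z"
    using MVT2[of 0 x sin cos] assms DERIV_sin by blast
  have "cos (pi / 3) \<le> cos z" using z assms pi_gt3 by (intro cos_monotone_0_pi_le) auto
  then have "1 / 2 \<le> cos z" by (simp add: cos_60)
  from mult_left_mono[OF this, of x] show ?thesis using z assms by simp
qed

lemma unit_right_half_plane:
  assumes "cmod u = 1" "0 \<le> Re (u * cis (- \<theta>))"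
  obtains t where "u = cis t" "\<theta> - pi / 2 \<le> t" "t \<le> \<theta> + pi / 2"
proof -
  define v where "v = u * cis (- \<theta>)"
  have v: "cmod v = 1" "v \<noteq> 0" "0 \<le> Re v" using assms by (auto simp: v_def norm_mult)
  have "v = exp (Ln v)" using v by simp
  also have "Ln v = \<i> * of_real (Im (Ln v))" using v by (simp add: complex_eq_iff)
  finally have v': "v = cis (Im (Ln v))" by (simp add: cis_conv_exp)
  have "u = v * cis \<theta>" by (simp add: v_def mult.assoc cis_mult)
  also have "\<dots> = cis (Im (Ln v) + \<theta>)" by (subst v') (simp add: cis_mult)
  finally have u: "u = cis (Im (Ln v) + \<theta>)" .
  have "\<bar>Im (Ln v)\<bar> \<le> pi / 2" using Re_Ln_pos_le[OF v(2)] v(3) by simp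
  then show thesis using that[OF u] by (simp add: abs_le_iff)
qed

lemma sectorial_domain_borel_disc:
  assumes R: "R > 0"
  shows "sectorial_domain (\<theta> - pi / 2) (\<theta> + pi / 2) (borel_disc \<theta> R)"
  unfolding sectorial_domain_def
proof (intro conjI)
  show "domain (borel_disc \<theta> R)" unfolding domain_def borel_disc_eq_ball[OF R] using R by auto
  show "simply_connected (borel_disc \<theta> R)" unfolding borel_disc_eq_ball[OF R]
    by (intro convex_imp_simply_connected convex_ball)
  show "0 \<notin> borel_disc \<theta> R" using borel_disc_nonzero[OF R] by blast
  show "{u. (0, u) \<in> closure (blowup_embed ` borel_disc \<theta> R)} = cis ` {\<theta> - pi / 2..\<theta> + pi / 2}"
  proof (intro equalityI subsetI)
    fix u assume "u \<in> {u. (0, u) \<in> closure (blowup_embed ` borel_disc \<theta> R)}"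
    then have u: "(0, u) \<in> closure (blowup_embed ` borel_disc \<theta> R)" by simp
    define F where "F = {p :: real \<times> complex. cmod (snd p) = 1 \<and> 0 \<le> Re (snd p * cis (- \<theta>))}"
    have "closed F" unfolding F_def
      by (intro closed_Collect_conj closed_Collect_eq closed_Collect_le continuous_intros)
    moreover have "blowup_embed ` borel_disc \<theta> R \<subseteq> F"
    proof
      fix p assume "p \<in> blowup_embed ` borel_disc \<theta> R"
      then obtain h where h: "h \<in> borel_disc \<theta> R" "p = (cmod h, sgn h)" by (auto simp: blowup_embed_def)
      have h0: "h \<noteq> 0" using borel_disc_nonzero[OF R h(1)] .
      have "0 < Re (h * cis (- \<theta>)) / (cmod h)\<^sup>2" using h(1) R unfolding borel_disc_def mem_Collect_eq Re_cis_div by linarith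
      then have "0 < Re (h * cis (- \<theta>))" using h0 by (simp add: zero_less_divide_iff)
      moreover have "Re (sgn h * cis (- \<theta>)) = Re (h * cis (- \<theta>)) / cmod h"
        by (rule Re_sgn_mult)
      ultimately show "p \<in> F" using h h0 by (simp add: F_def norm_sgn)
    qed
    ultimately have "(0, u) \<in> F" using u closure_minimal by blast
    then show "u \<in> cis ` {\<theta> - pi / 2..\<theta> + pi / 2}"
      by (auto simp: F_def elim!: unit_right_half_plane)
  next
    fix u assume "u \<in> cis ` {\<theta> - pi / 2..\<theta> + pi / 2}"
    then obtain t where t: "\<theta> - pi / 2 \<le> t" "t \<le> \<theta> + pi / 2" "u = cis t" by auto
    have "(0, cis t) \<in> closure (blowup_embed ` borel_disc \<theta> R)"
      unfolding closure_approachable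
    proof (intro allI impI)
      fix e :: real assume e: "e > 0"
      have "isCont (\<lambda>\<eta>. cis (t + \<eta> * (\<theta> - t))) 0"
        unfolding cis_conv_exp by (intro continuous_intros)
      then have "((\<lambda>\<eta>. cis (t + \<eta> * (\<theta> - t))) \<longlongrightarrow> cis (t + 0 * (\<theta> - t))) (at_right 0)"
        by (meson continuous_at_imp_continuous_at_within continuous_within)
      then have "eventually (\<lambda>\<eta>. dist (cis (t + \<eta> * (\<theta> - t))) (cis t) < e / 2) (at_right 0)"
        using tendstoD[of _ _ _ "e/2"] e by fastforce
      moreover have "eventually (\<lambda>\<eta>::real. \<eta> \<in> {0<..<1}) (at_right 0)"
        by (rule eventually_at_right_real) simp
      ultimately have "eventually (\<lambda>\<eta>. dist (cis (t + \<eta> * (\<theta> - t))) (cis t) < e / 2 \<and> \<eta> \<in> {0<..<1}) (at_right 0)"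
        by (rule eventually_conj)
      then obtain \<eta> where \<eta>: "dist (cis (t + \<eta> * (\<theta> - t))) (cis t) < e / 2" "0 < \<eta>" "\<eta> < 1"
        using eventually_happens trivial_limit_at_right_real by fastforce
      define s where "s = t + \<eta> * (\<theta> - t)"
      have "\<bar>s - \<theta>\<bar> < pi / 2"
      proof -
        have "s - \<theta> = (1 - \<eta>) * (t - \<theta>)" by (simp add: s_def algebra_simps)
        then have "\<bar>s - \<theta>\<bar> = (1 - \<eta>) * \<bar>t - \<theta>\<bar>" using \<eta> by (simp add: abs_mult)
        also have "\<dots> \<le> (1 - \<eta>) * (pi / 2)"
        proof (rule mult_left_mono)
          show "\<bar>t - \<theta>\<bar> \<le> pi / 2" using t(1,2) by linarith
        qed (use \<eta> in simp)
        also have "\<dots> < 1 * (pi / 2)" using \<eta> by (intro mult_strict_right_mono) auto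
        finally show ?thesis by simp
      qed
      then have "- (pi / 2) < s - \<theta>" "s - \<theta> < pi / 2" by linarith+
      then have c: "0 < cos (s - \<theta>)" by (rule cos_gt_zero_pi)
      define \<rho> where "\<rho> = min (e / 2) (cos (s - \<theta>) / (2 * R)) / 2"
      have \<rho>: "0 < \<rho>" "\<rho> < e / 2" "R * \<rho> < cos (s - \<theta>)"
        using e c R unfolding \<rho>_def by (auto simp: min_def field_simps)
      have "of_real \<rho> * cis s \<in> borel_disc \<theta> R" using borel_disc_polar[OF \<rho>(1)] \<rho>(3) by simp
      moreover have "blowup_embed (of_real \<rho> * cis s) = (\<rho>, cis s)"
        using \<rho>(1) by (simp add: blowup_embed_def norm_mult sgn_mult sgn_of_real) (simp add: complex_sgn_def)?
      ultimately have m: "(\<rho>, cis s) \<in> blowup_embed ` borel_disc \<theta> R" by (metis image_eqI)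
      have "dist (\<rho>, cis s) (0, cis t) \<le> dist \<rho> 0 + dist (cis s) (cis t)"
        unfolding dist_Pair_Pair by (rule sqrt_sum_squares_le_sum) auto
      also have "\<dots> < e" using \<eta>(1) \<rho> by (simp add: s_def)
      finally show "\<exists>y\<in>blowup_embed ` borel_disc \<theta> R. dist y (0, cis t) < e" using m by blast
    qed
    then show "u \<in> {u. (0, u) \<in> closure (blowup_embed ` borel_disc \<theta> R)}" using t by simp
  qed
  show "\<exists>\<epsilon>>0. \<exists>K\<ge>0. \<forall>r t. 0 < r \<and> r < \<epsilon> \<and> \<theta> - pi / 2 + K * r < t \<and> t < \<theta> + pi / 2 - K * r
        \<longrightarrow> of_real r * cis t \<in> borel_disc \<theta> R"
  proof (rule exI[of _ "1 / (2 * R)"], rule conjI, simp add: R, rule exI[of _ "2 * R"], rule conjI, use R in simp, intro allI impI)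
    fix r t assume h: "0 < r \<and> r < 1 / (2 * R) \<and> \<theta> - pi / 2 + 2 * R * r < t \<and> t < \<theta> + pi / 2 - 2 * R * r"
    have r: "0 < r" "2 * R * r < 1" using h R by (auto simp: field_simps)
    have a: "\<bar>t - \<theta>\<bar> < pi / 2 - 2 * R * r" using h by (simp add: abs_less_iff)
    have "R * r \<le> sin (2 * R * r)" using half_le_sin[of "2 * R * r"] r R by simp
    also have "\<dots> = cos (pi / 2 - 2 * R * r)" by (simp add: cos_diff)
    also have "\<dots> < cos \<bar>t - \<theta>\<bar>"
    proof (rule cos_monotone_0_pi)
      have "0 < 2 * R * r" using r R by simp
      then show "pi / 2 - 2 * R * r \<le> pi" using pi_gt_zero by linarith
    qed (use a in auto)
    also have "\<dots> = cos (t - \<theta>)" by (simp add: abs_real_def) (metis cos_minus minus_diff_eq)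
    finally show "of_real r * cis t \<in> borel_disc \<theta> R" using borel_disc_polar[OF r(1)] by simp
  qed
qed auto

text \<open>
  Near \<open>0\<close> the sides of a Borel disc leave the circle of directions with slope \<open>R\<close> up to lower order, so
  a large \<open>R\<close> beats the slope \<open>K\<close> of the sectorial domain.
\<close>

lemma borel_disc_subset_sectorial:
  assumes "sectorial_domain (\<theta> - pi / 2) (\<theta> + pi / 2) S"
  obtains R where "R > 0" "borel_disc \<theta> R \<subseteq> S"
proof -
  obtain \<epsilon> K where e: "\<epsilon> > 0" "K \<ge> 0" and S: "\<And>r t. 0 < r \<Longrightarrow> r < \<epsilon> \<Longrightarrow> \<theta> - pi / 2 + K * r < t \<Longrightarrow>
      t < \<theta> + pi / 2 - K * r \<Longrightarrow> of_real r * cis t \<in> S"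
    using assms unfolding sectorial_domain_def by blast
  define R where "R = K + 1 / \<epsilon>"
  have Re: "0 < 1 / \<epsilon>" "1 / \<epsilon> \<le> R" "K \<le> R" using e by (auto simp: R_def)
  then have R: "R > 0" "K \<le> R" by linarith+
  have "1 / R \<le> 1 / (1 / \<epsilon>)" using Re R by (intro divide_left_mono) auto
  with R have R: "R > 0" "K \<le> R" "1 / R \<le> \<epsilon>" by auto
  have "borel_disc \<theta> R \<subseteq> S"
  proof
    fix h assume h: "h \<in> borel_disc \<theta> R"
    have h0: "h \<noteq> 0" using borel_disc_nonzero[OF R(1) h] .
    define r where "r = cmod h"
    have r: "0 < r" "r < \<epsilon>" using h0 borel_disc_norm[OF R(1) h] R(3) by (auto simp: r_def)
    have pos: "0 < Re (h * cis (- \<theta>)) / (cmod h)\<^sup>2" using h R unfolding borel_disc_def mem_Collect_eq Re_cis_div by linarith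
    then have "0 \<le> Re (h * cis (- \<theta>))" using h0 by (simp add: zero_less_divide_iff)
    moreover have "Re (sgn h * cis (- \<theta>)) = Re (h * cis (- \<theta>)) / cmod h"
      by (rule Re_sgn_mult)
    ultimately have "0 \<le> Re (sgn h * cis (- \<theta>))" by simp
    moreover have "cmod (sgn h) = 1" using h0 by (simp add: norm_sgn)
    ultimately obtain t where t: "sgn h = cis t" "\<theta> - pi / 2 \<le> t" "t \<le> \<theta> + pi / 2"
      using unit_right_half_plane by blast
    have hr: "h = of_real r * cis t"
      unfolding t(1)[symmetric] using h0 by (simp add: r_def complex_sgn_def scaleR_conv_of_real)
    have "R * r < cos (t - \<theta>)" using h borel_disc_polar[OF r(1), of t \<theta> R] unfolding hr by simp
    also have "cos (t - \<theta>) = cos \<bar>t - \<theta>\<bar>" by (simp add: abs_real_def) (metis cos_minus minus_diff_eq)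
    also have "\<dots> = sin (pi / 2 - \<bar>t - \<theta>\<bar>)" by (simp add: sin_diff)
    also have "\<dots> \<le> pi / 2 - \<bar>t - \<theta>\<bar>" 
    proof (rule sin_x_le_x)
      show "0 \<le> pi / 2 - \<bar>t - \<theta>\<bar>" using t(2,3) by linarith
    qed
    finally have "\<bar>t - \<theta>\<bar> < pi / 2 - R * r" by simp
    moreover have "K * r \<le> R * r" using R r by (intro mult_right_mono) auto
    ultimately show "h \<in> S" unfolding hr by (intro S r) (auto simp: abs_less_iff)
  qed
  then show thesis using that R by blast
qed


section \<open>Borel summability from uniform Gevrey asymptotics\<close>

lemma infdist_less_iff:
  assumes "A \<noteq> {}"
  shows "infdist x A < e \<longleftrightarrow> (\<exists>a\<in>A. dist x a < e)"
proof
  assume "infdist x A < e"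
  then show "\<exists>a\<in>A. dist x a < e"
    unfolding infdist_notempty[OF assms] by (subst (asm) cINF_less_iff) (use assms in \<open>auto intro: bdd_belowI2[of _ 0]\<close>)
next
  assume "\<exists>a\<in>A. dist x a < e"
  then show "infdist x A < e" using infdist_le le_less_trans by metis
qed

lemma ray_nbhd_iff: "\<xi> \<in> ray_nbhd \<theta> \<epsilon> \<longleftrightarrow> cis (- \<theta>) * \<xi> \<in> right_nbhd \<epsilon>"
proof -
  have d: "dist \<xi> (cis \<theta> * of_real t) = cmod (cis (- \<theta>) * \<xi> - of_real t)" for t
  proof -
    have "cis (- \<theta>) * \<xi> - of_real t = cis (- \<theta>) * (\<xi> - cis \<theta> * of_real t)"
      by (simp add: right_diff_distrib mult.assoc[symmetric] cis_mult)
    then have "cmod (cis (- \<theta>) * \<xi> - of_real t) = cmod (\<xi> - cis \<theta> * of_real t)"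
      by (simp add: norm_mult)
    then show ?thesis by (simp add: dist_norm)
  qed
  have "{cis \<theta> * of_real t |t. 0 \<le> t} \<noteq> {}" by auto
  from infdist_less_iff[OF this, of \<xi> \<epsilon>] show ?thesis
    unfolding ray_nbhd_def right_nbhd_def mem_Collect_eq d[symmetric] by auto
qed

lemma open_ray_nbhd: "open (ray_nbhd \<theta> \<epsilon>)"
proof -
  have "ray_nbhd \<theta> \<epsilon> = (\<lambda>\<xi>. cis (- \<theta>) * \<xi>) -` right_nbhd \<epsilon>" using ray_nbhd_iff by auto
  then show ?thesis by (auto intro!: open_vimage open_right_nbhd continuous_intros)
qed

lemma fps_remainder_rotate:
  assumes "w \<noteq> 0"
  shows "asym_remainder f fh n x (cis \<theta> / w) =
    fps_remainder (f x (cis \<theta> / w)) (Abs_fps (\<lambda>k. fh k x * cis \<theta> ^ k)) n (1 / w)"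
  by (simp add: asym_remainder_def fps_remainder_def power_divide)

lemma nevanlinnaI:
  assumes "0 \<le> r0" "r0 < r" "0 \<le> C" "0 < M" and hol: "f x holomorphic_on borel_disc \<theta> r0"
    and bd: "\<And>n h. h \<in> borel_disc \<theta> r0 \<Longrightarrow> cmod (asym_remainder f fh n x h) \<le> C * M ^ n * fact n * cmod h ^ n"
  shows "nevanlinna (\<lambda>w. f x (cis \<theta> / w)) (\<lambda>k. fh k x * cis \<theta> ^ k) r0 r C M"
proof
  have inv: "cis \<theta> / w \<in> borel_disc \<theta> r0" if "r0 < Re w" for w
  proof -
    have "w \<noteq> 0" using that assms(1) by auto
    then have "cis \<theta> / (cis \<theta> / w) = w" by simp
    then show ?thesis using that by (simp add: borel_disc_def)
  qed
  show "(\<lambda>w. f x (cis \<theta> / w)) holomorphic_on {w. r0 < Re w}"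
  proof -
    have "(f x \<circ> (\<lambda>w. cis \<theta> / w)) holomorphic_on {w. r0 < Re w}"
      by (rule holomorphic_on_compose_gen[OF _ hol]) (use inv assms(1) in \<open>auto intro!: holomorphic_intros\<close>)
    then show ?thesis by (simp add: o_def)
  qed
  show "cmod (fps_remainder (f x (cis \<theta> / w)) (Abs_fps (\<lambda>k. fh k x * cis \<theta> ^ k)) n (1 / w)) \<le> C * M ^ n * fact n * cmod (1 / w) ^ n"
    if w: "r0 < Re w" for n w
  proof -
    have "w \<noteq> 0" using w assms(1) by auto
    then show ?thesis using bd[OF inv[OF w], of n] by (simp add: fps_remainder_rotate norm_divide)
  qed
qed (use assms in auto)

text \<open>
  All estimates of the Nevanlinna construction depend only on the constants, hence are uniform in \<open>x\<close>, and
  the vertical-line integrals depend holomorphically on \<open>x\<close>; so the pointwise Borel transforms form a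
  jointly holomorphic function. Passing from \<open>r0\<close> to \<open>r\<close> leaves room for the vertical line.
\<close>

lemma borel_summation:
  fixes f :: "complex \<Rightarrow> complex \<Rightarrow> complex" and fh :: "nat \<Rightarrow> complex \<Rightarrow> complex"
  assumes U: "open U" and r0: "0 < r0" "r0 < r" and C: "0 \<le> C" and M: "0 < M"
    and sep: "sep_holomorphic_on U (borel_disc \<theta> r0) f" and hol: "\<And>k. fh k holomorphic_on U"
    and bd: "\<And>n x h. x \<in> U \<Longrightarrow> h \<in> borel_disc \<theta> r0 \<Longrightarrow>
        cmod (asym_remainder f fh n x h) \<le> C * M ^ n * fact n * cmod h ^ n"
  obtains \<phi> where "borel_continuation \<theta> U fh \<phi>"
    "\<And>h. h \<in> borel_disc \<theta> r \<Longrightarrow> laplace_uniformly_convergent \<theta> U \<phi> h"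
    "\<And>x h. x \<in> U \<Longrightarrow> h \<in> borel_disc \<theta> r \<Longrightarrow> f x h = borel_resummation \<theta> fh \<phi> x h"
proof -
  define g where "g x w = f x (cis \<theta> / w)" for x w
  define A where "A x k = fh k x * cis \<theta> ^ k" for x k
  define u where "u x = borel_deriv r (g x) (A x)" for x
  define K where "K = borel_const r C M"
  define \<Phi> where "\<Phi> x = borel_fun r (g x) (A x)" for x
  define \<phi> where "\<phi> x \<xi> = cis (- \<theta>) * \<Phi> x (cis (- \<theta>) * \<xi>)" for x \<xi>
  define \<epsilon> where "\<epsilon> = 1 / (2 * (4 * M))"
  have \<epsilon>: "\<epsilon> > 0" using M by (simp add: \<epsilon>_def)
  have rp: "0 < r" using r0 by simp
  have nev: "nevanlinna (g x) (A x) r0 r C M" if x: "x \<in> U" for x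
    unfolding g_def A_def
    by (rule nevanlinnaI[OF _ r0(2) C M _ bd[OF x]]) (use r0 sep x in \<open>auto simp: sep_holomorphic_on_def\<close>)
  have K: "0 \<le> K" unfolding K_def borel_const_def using C M vline_const_nonneg by simp
  have cc: "cis (- \<theta>) * cis \<theta> = 1" "cis \<theta> * cis (- \<theta>) = 1" by (simp_all add: cis_mult)
  have \<phi>bd: "cmod (\<phi> x \<xi>) \<le> 2 * K * exp (r * cmod \<xi>)" if "x \<in> U" "\<xi> \<in> ray_nbhd \<theta> \<epsilon>" for x \<xi>
    using nevanlinna.phi_bound[OF nev[OF that(1)], of "cis (- \<theta>) * \<xi>"] that(2) unfolding ray_nbhd_iff \<epsilon>_def
    by (simp add: \<phi>_def \<Phi>_def K_def norm_mult)
  have \<phi>sums: "(\<lambda>k. 1 / fact k * fh (Suc k) x * \<xi> ^ k) sums \<phi> x \<xi>" if "x \<in> U" "cmod \<xi> \<le> \<epsilon>" for x \<xi>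
  proof -
    have "(\<lambda>n. 1 / fact n * A x (Suc n) * (cis (- \<theta>) * \<xi>) ^ n) sums \<Phi> x (cis (- \<theta>) * \<xi>)"
      unfolding \<Phi>_def by (rule nevanlinna.phi_near_0[OF nev[OF that(1)]]) (use that in \<open>simp add: \<epsilon>_def norm_mult\<close>)
    then have "(\<lambda>n. cis (- \<theta>) * (1 / fact n * A x (Suc n) * (cis (- \<theta>) * \<xi>) ^ n)) sums \<phi> x \<xi>"
      unfolding \<phi>_def by (rule sums_mult)
    moreover have "cis (- \<theta>) * (1 / fact n * A x (Suc n) * (cis (- \<theta>) * \<xi>) ^ n) = 1 / fact n * fh (Suc n) x * \<xi> ^ n" for n
    proof -
      have "cis (- \<theta>) * (1 / fact n * A x (Suc n) * (cis (- \<theta>) * \<xi>) ^ n)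
          = 1 / fact n * fh (Suc n) x * \<xi> ^ n * ((cis (- \<theta>) * cis \<theta>) ^ Suc n)"
        by (simp only: A_def power_mult_distrib power_Suc) (simp only: mult_ac)
      then show ?thesis unfolding cc by simp
    qed
    ultimately show ?thesis by simp
  qed
  have \<phi>xi: "\<phi> x holomorphic_on ray_nbhd \<theta> \<epsilon>" if "x \<in> U" for x
  proof -
    have "(\<Phi> x \<circ> (\<lambda>\<xi>. cis (- \<theta>) * \<xi>)) holomorphic_on ray_nbhd \<theta> \<epsilon>"
    proof (rule holomorphic_on_compose_gen)
      show "\<Phi> x holomorphic_on right_nbhd \<epsilon>" unfolding \<Phi>_def \<epsilon>_def by (rule nevanlinna.phi_holomorphic[OF nev[OF that]])
    qed (auto simp: ray_nbhd_iff intro!: holomorphic_intros)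
    then show ?thesis unfolding \<phi>_def o_def by (intro holomorphic_intros)
  qed
  have Ihol: "(\<lambda>x. \<integral>y. exp (of_real t * vline r y) * vline_kernel (g x) (A x) n (vline r y) \<partial>lborel) holomorphic_on U"
    for n and t :: real
  proof (rule holomorphic_on_integral[OF U])
    show "(\<lambda>x. exp (of_real t * vline r y) * vline_kernel (g x) (A x) n (vline r y)) holomorphic_on U" for y
    proof -
      have v: "vline r y \<noteq> 0" using vline_norm_ge[OF rp, of y] rp by auto
      then have "cis \<theta> / (cis \<theta> / vline r y) = vline r y" by simp
      then have "cis \<theta> / vline r y \<in> borel_disc \<theta> r0" using r0 by (simp add: borel_disc_def)
      then have "(\<lambda>x. f x (cis \<theta> / vline r y)) holomorphic_on U" using sep by (auto simp: sep_holomorphic_on_def)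
      then show ?thesis unfolding vline_kernel_def fps_remainder_def g_def A_def fps_nth_Abs_fps
        by (intro holomorphic_intros hol)
    qed
    show "(\<lambda>y. exp (of_real t * vline r y) * vline_kernel (g x) (A x) n (vline r y)) \<in> borel_measurable lborel" if "x \<in> U" for x
      using borel_measurable_integrable[OF nevanlinna.exp_kern_integrable[OF nev[OF that]]] .
    show "cmod (exp (of_real t * vline r y) * vline_kernel (g x) (A x) n (vline r y))
        \<le> (exp (t * r) * (C * M ^ (n + 2) * fact (n + 2))) * (1 / (cmod (vline r y))\<^sup>2)" if "x \<in> U" for x y
      using nevanlinna.exp_kern_bound[OF nev[OF that] refl, of t y n] by simp
    show "integrable lborel (\<lambda>y. (exp (t * r) * (C * M ^ (n + 2) * fact (n + 2))) * (1 / (cmod (vline r y))\<^sup>2))"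
      by (intro integrable_mult_right integrable_vline_square rp)
  qed
  have uhol: "(\<lambda>x. u x n t) holomorphic_on U" for n t
    unfolding u_def borel_deriv_def A_def by (intro holomorphic_intros hol Ihol[unfolded A_def])
  have \<phi>x: "(\<lambda>x. \<phi> x \<xi>) holomorphic_on U" if xi: "\<xi> \<in> ray_nbhd \<theta> \<epsilon>" for \<xi>
  proof -
    define \<tau> where "\<tau> = cis (- \<theta>) * \<xi>"
    obtain t where t: "0 \<le> t" "cmod (\<tau> - of_real t) < \<epsilon>"
      using xi unfolding ray_nbhd_iff \<tau>_def right_nbhd_def by auto
    then have t': "cmod (\<tau> - of_real t) \<le> 1 / (2 * (4 * M))" by (simp add: \<epsilon>_def)
    have "(\<lambda>x. \<Sum>n. u x n t * (\<tau> - of_real t) ^ n / fact n) holomorphic_on U"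
    proof (rule holomorphic_on_suminf_geometric[OF U, where B = "K * exp (r * t)"])
      show "(\<lambda>x. u x n t * (\<tau> - of_real t) ^ n / fact n) holomorphic_on U" for n
        by (intro holomorphic_intros uhol) auto
      show "cmod (u x n t * (\<tau> - of_real t) ^ n / fact n) \<le> K * exp (r * t) * (1 / 2) ^ n" if "x \<in> U" for x n
        unfolding u_def K_def by (rule nevanlinna.taylor_term_bound[OF nev[OF that] t(1) t'])
    qed
    moreover have "\<Phi> x \<tau> = (\<Sum>n. u x n t * (\<tau> - of_real t) ^ n / fact n)" if "x \<in> U" for x
      unfolding \<Phi>_def nevanlinna.phi_eq_taylor[OF nev[OF that] t(1) t'] borel_taylor_def u_def ..
    ultimately have "(\<lambda>x. \<Phi> x \<tau>) holomorphic_on U" by (subst holomorphic_cong[OF refl])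
    then show ?thesis unfolding \<phi>_def \<tau>_def by (intro holomorphic_intros)
  qed
  have h2: "holomorphic2_on \<phi> (U \<times> ray_nbhd \<theta> \<epsilon>)"
  proof (rule osgood[OF U open_ray_nbhd])
    show "sep_holomorphic_on U (ray_nbhd \<theta> \<epsilon>) \<phi>" using \<phi>x \<phi>xi by (simp add: sep_holomorphic_on_def)
    fix x \<xi> assume x: "x \<in> U" and xi: "\<xi> \<in> ray_nbhd \<theta> \<epsilon>"
    obtain e1 where e1: "e1 > 0" "ball x e1 \<subseteq> U" using U x openE by blast
    obtain e2 where e2: "e2 > 0" "ball \<xi> e2 \<subseteq> ray_nbhd \<theta> \<epsilon>" using open_ray_nbhd xi openE by blast
    define e where "e = min e1 e2"
    have e: "e > 0" "ball x e \<subseteq> U" "ball \<xi> e \<subseteq> ray_nbhd \<theta> \<epsilon>" using e1 e2 by (auto simp: e_def)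
    have "cmod (\<phi> x' \<xi>') \<le> 2 * K * exp (r * (cmod \<xi> + e))" if x': "x' \<in> ball x e" and xi': "\<xi>' \<in> ball \<xi> e" for x' \<xi>'
    proof -
      have "cmod (\<phi> x' \<xi>') \<le> 2 * K * exp (r * cmod \<xi>')" using x' xi' e by (intro \<phi>bd) auto
      also have "cmod \<xi>' \<le> cmod \<xi> + e"
        using xi' norm_triangle_ineq2[of \<xi>' \<xi>] by (simp add: dist_norm norm_minus_commute)
      then have "2 * K * exp (r * cmod \<xi>') \<le> 2 * K * exp (r * (cmod \<xi> + e))" using K rp by (intro mult_left_mono) auto
      finally show ?thesis .
    qed
    then show "\<exists>e>0. \<exists>B. ball x e \<subseteq> U \<and> ball \<xi> e \<subseteq> ray_nbhd \<theta> \<epsilon> \<and> (\<forall>x'\<in>ball x e. \<forall>y'\<in>ball \<xi> e. cmod (\<phi> x' y') \<le> B)"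
      using e by blast
  qed
  have uc: "uniformly_convergent_on (U \<times> ball 0 \<epsilon>) (\<lambda>N (x, \<xi>). \<Sum>k<N. 1 / fact k * fh (Suc k) x * \<xi> ^ k)"
  proof -
    have "uniform_limit (U \<times> ball 0 \<epsilon>) (\<lambda>N q. \<Sum>k<N. 1 / fact k * fh (Suc k) (fst q) * (snd q) ^ k)
        (\<lambda>q. \<Sum>k. 1 / fact k * fh (Suc k) (fst q) * (snd q) ^ k) sequentially"
    proof (rule Weierstrass_m_test[where M = "\<lambda>k. K * (1/2) ^ k"])
      fix k q assume q: "q \<in> U \<times> ball (0::complex) \<epsilon>"
      obtain x \<xi> where q': "q = (x, \<xi>)" "x \<in> U" "cmod \<xi> < \<epsilon>" using q by (cases q) auto
      have "cmod (u x k 0 * (\<xi> - of_real 0) ^ k / fact k) \<le> K * exp (r * 0) * (1 / 2) ^ k"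
        unfolding u_def K_def by (rule nevanlinna.taylor_term_bound[OF nev[OF q'(2)]]) (use q' in \<open>auto simp: \<epsilon>_def\<close>)
      moreover have "cmod (u x k 0) = cmod (fh (Suc k) x)"
        unfolding u_def nevanlinna.u_0[OF nev[OF q'(2)]] by (simp add: A_def norm_mult norm_power)
      ultimately show "cmod (1 / fact k * fh (Suc k) (fst q) * snd q ^ k) \<le> K * (1/2) ^ k"
        by (simp add: q' norm_mult norm_divide norm_power)
    qed (intro summable_mult summable_geometric, simp)
    then show ?thesis unfolding uniformly_convergent_on_def case_prod_unfold by blast
  qed
  show thesis
  proof (rule that)
    show "borel_continuation \<theta> U fh \<phi>"
      proof -
      have K1: "0 < 2 * K + 1" using K by simp
      have b: "\<forall>x\<in>U. \<forall>\<xi>\<in>ray_nbhd \<theta> \<epsilon>. cmod (\<phi> x \<xi>) \<le> (2 * K + 1) * exp (r * cmod \<xi>)"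
      proof (intro ballI)
        fix x \<xi> assume "x \<in> U" "\<xi> \<in> ray_nbhd \<theta> \<epsilon>"
        then have "cmod (\<phi> x \<xi>) \<le> 2 * K * exp (r * cmod \<xi>)" by (rule \<phi>bd)
        also have "\<dots> \<le> (2 * K + 1) * exp (r * cmod \<xi>)" by (intro mult_right_mono) auto
        finally show "cmod (\<phi> x \<xi>) \<le> (2 * K + 1) * exp (r * cmod \<xi>)" .
      qed
      have s: "\<forall>x\<in>U. \<forall>\<xi>\<in>ray_nbhd \<theta> \<epsilon> \<inter> ball 0 \<epsilon>. (\<lambda>k. 1 / fact k * fh (Suc k) x * \<xi> ^ k) sums \<phi> x \<xi>"
        by (intro ballI \<phi>sums) auto
      show ?thesis unfolding borel_continuation_def
        by (rule exI[of _ \<epsilon>], rule conjI[OF \<epsilon>], rule exI[of _ \<epsilon>], rule conjI[OF \<epsilon>], rule exI[of _ "2 * K + 1"],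
            rule conjI[OF K1], rule exI[of _ r], rule conjI[OF rp]) (intro conjI uc h2 s b)
    qed
    have li: "laplace_integrand \<theta> \<phi> x h t = exp (- (of_real t * (cis \<theta> / h))) * u x 0 t" if "x \<in> U" "0 \<le> t" for x h t
    proof -
      have e: "cis (- \<theta>) * (cis \<theta> * of_real t) = of_real t" using cc by (simp add: mult.assoc[symmetric])
      have "\<phi> x (cis \<theta> * of_real t) = cis (- \<theta>) * u x 0 t"
        unfolding \<phi>_def e \<Phi>_def u_def nevanlinna.phi_real[OF nev[OF that(1)] that(2)] by (rule refl)
      then have "laplace_integrand \<theta> \<phi> x h t = exp (- (cis \<theta> * of_real t) / h) * u x 0 t * (cis (- \<theta>) * cis \<theta>)"
        unfolding laplace_integrand_def by (simp only: mult_ac)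
      then show ?thesis unfolding cc by (simp add: mult.commute)
    qed
    have W: "r < Re (cis \<theta> / h)" if "h \<in> borel_disc \<theta> r" for h using that by (simp add: borel_disc_def)
    have si: "set_integrable lborel {0..} (laplace_integrand \<theta> \<phi> x h)" if "x \<in> U" "h \<in> borel_disc \<theta> r" for x h
    proof -
      have "set_integrable lborel {0..} (\<lambda>t. exp (- (of_real t * (cis \<theta> / h))) * u x 0 t)"
        unfolding u_def by (rule nevanlinna.laplace_integrable(1)[OF nev[OF that(1)] W[OF that(2)]])
      moreover have "set_integrable lborel {0..} (laplace_integrand \<theta> \<phi> x h) \<longleftrightarrow> set_integrable lborel {0..} (\<lambda>t. exp (- (of_real t * (cis \<theta> / h))) * u x 0 t)"
        by (rule set_integrable_cong) (auto simp: li that)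
      ultimately show ?thesis by simp
    qed
    show "f x h = borel_resummation \<theta> fh \<phi> x h" if x: "x \<in> U" and h: "h \<in> borel_disc \<theta> r" for x h
    proof -
      have h0: "h \<noteq> 0" using borel_disc_nonzero[OF rp h] .
      have "set_lebesgue_integral lborel {0..} (laplace_integrand \<theta> \<phi> x h) = set_lebesgue_integral lborel {0..} (\<lambda>t. exp (- (of_real t * (cis \<theta> / h))) * u x 0 t)"
        unfolding set_lebesgue_integral_def by (intro Bochner_Integration.integral_cong refl) (auto simp: indicator_def li x)
      also have "\<dots> = g x (cis \<theta> / h) - A x 0"
        unfolding u_def by (rule nevanlinna.laplace_eq[OF nev[OF x] W[OF h]])
      also have "\<dots> = f x h - fh 0 x" using h0 by (simp add: g_def A_def)
      finally show ?thesis by (simp add: borel_resummation_def)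
    qed
    show "laplace_uniformly_convergent \<theta> U \<phi> h" if h: "h \<in> borel_disc \<theta> r" for h
      unfolding laplace_uniformly_convergent_def
    proof (intro conjI ballI si h)
      define d where "d = Re (cis \<theta> / h) - r"
      have d: "d > 0" using W[OF h] by (simp add: d_def)
      have est: "cmod (set_lebesgue_integral lborel {0..T} (laplace_integrand \<theta> \<phi> x h) - set_lebesgue_integral lborel {0..} (laplace_integrand \<theta> \<phi> x h))
          \<le> K * (exp (- (d * T)) / d)" if x: "x \<in> U" and T: "0 \<le> T" for x T
      proof -
        define L where "L = laplace_integrand \<theta> \<phi> x h"
        have i1: "set_integrable lborel {0..T} L" and i2: "set_integrable lborel {T<..} L"
          unfolding L_def using T by (auto intro!: set_integrable_subset[OF si[OF x h]])
        have un: "{0..} = {0..T} \<union> {T<..}" using T by auto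
        have dj: "{0..T} \<inter> {T<..} = {}" by auto
        have "set_lebesgue_integral lborel {0..} L = set_lebesgue_integral lborel {0..T} L + set_lebesgue_integral lborel {T<..} L"
          unfolding un by (rule set_integral_Un[OF dj i1 i2])
        then have "cmod (set_lebesgue_integral lborel {0..T} L - set_lebesgue_integral lborel {0..} L) = cmod (set_lebesgue_integral lborel {T<..} L)"
          by simp
        also have "\<dots> \<le> (\<integral>t. K * (indicator {T..} t * exp (- (d * t))) \<partial>lborel)"
          unfolding set_lebesgue_integral_def
        proof (rule Bochner_Integration.integral_norm_bound_integral)
          show "integrable lborel (\<lambda>t. indicator {T<..} t *\<^sub>R L t)" using i2 by (simp add: set_integrable_def)
          show "integrable lborel (\<lambda>t. K * (indicator {T..} t * exp (- (d * t))))"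
            by (rule integrable_mult_right, rule integrable.intros, rule has_bochner_integral_exp_ray[OF d])
          show "cmod (indicator {T<..} t *\<^sub>R L t) \<le> K * (indicator {T..} t * exp (- (d * t)))" for t
          proof (cases "T < t")
            case True
            then have "0 \<le> t" using T by simp
            from nevanlinna.laplace_integrable(2)[OF nev[OF x] W[OF h] this] True
            show ?thesis unfolding L_def by (simp add: li[OF x \<open>0 \<le> t\<close>] u_def K_def d_def)
          qed (use K in auto)
        qed
        also have "\<dots> = K * (exp (- (d * T)) / d)"
          using has_bochner_integral_integral_eq[OF has_bochner_integral_exp_ray[OF d, of T]] by simp
        finally show ?thesis by (simp add: L_def)
      qed
      show "uniform_limit U (\<lambda>T x. set_lebesgue_integral lborel {0..T} (laplace_integrand \<theta> \<phi> x h))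
          (\<lambda>x. set_lebesgue_integral lborel {0..} (laplace_integrand \<theta> \<phi> x h)) at_top"
      proof (rule uniform_limitI)
        fix e :: real assume e: "e > 0"
        have "((\<lambda>T. K * (exp (- (d * T)) / d)) \<longlongrightarrow> K * (0 / d)) at_top"
          by (intro tendsto_mult tendsto_divide tendsto_const tendsto_exp_neg d) (use d in auto)
        then have "eventually (\<lambda>T. K * (exp (- (d * T)) / d) < e) at_top"
          using e by (intro order_tendstoD(2)[of _ "K * (0 / d)"]) auto
        then show "\<forall>\<^sub>F T in at_top. \<forall>x\<in>U. dist (set_lebesgue_integral lborel {0..T} (laplace_integrand \<theta> \<phi> x h))
            (set_lebesgue_integral lborel {0..} (laplace_integrand \<theta> \<phi> x h)) < e"
          using eventually_ge_at_top[of 0]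
        proof eventually_elim
          case (elim T)
          then show ?case using est by (auto simp: dist_norm intro: le_less_trans)
        qed
      qed
    qed
  qed
qed

text \<open>
  The bounds are only assumed for small \<open>h\<close>, so the uniqueness in Nevanlinna's theorem applies on a
  smaller Borel disc, and the identity theorem does the rest.
\<close>

lemma gevrey_unique:
  assumes r: "r > 0" and hol: "f x holomorphic_on borel_disc \<theta> r" "g x holomorphic_on borel_disc \<theta> r"
    and f: "gevrey_asymptotics U (borel_disc \<theta> r) (\<lambda>_. 1) f fh"
    and g: "gevrey_asymptotics U (borel_disc \<theta> r) (\<lambda>_. 1) g fh"
    and x: "x \<in> U" and h: "h \<in> borel_disc \<theta> r"
  shows "f x h = g x h"
proof -
  obtain C1 M1 d1 where 1: "C1 > 0" "M1 > 0" "d1 > 0"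
    "\<And>n h. h \<in> borel_disc \<theta> r \<Longrightarrow> cmod h < d1 \<Longrightarrow> cmod (asym_remainder f fh n x h) \<le> C1 * M1 ^ n * fact n * cmod h ^ n"
    using f x unfolding gevrey_asymptotics_def by auto
  obtain C2 M2 d2 where 2: "C2 > 0" "M2 > 0" "d2 > 0"
    "\<And>n h. h \<in> borel_disc \<theta> r \<Longrightarrow> cmod h < d2 \<Longrightarrow> cmod (asym_remainder g fh n x h) \<le> C2 * M2 ^ n * fact n * cmod h ^ n"
    using g x unfolding gevrey_asymptotics_def by auto
  define R where "R = r + 1 / d1 + 1 / d2"
  have "0 < 1 / d1" "0 < 1 / d2" using 1 2 by auto
  then have R: "r < R" "0 < R" "1 / d1 \<le> R" "1 / d2 \<le> R" using r unfolding R_def by linarith+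
  have iR: "1 / R \<le> d1" "1 / R \<le> d2" using R 1(3) 2(3) by (auto simp: field_simps)
  define C where "C = max C1 C2"
  define M where "M = max M1 M2"
  have CM: "0 \<le> C" "0 < M" "C1 \<le> C" "C2 \<le> C" "M1 \<le> M" "M2 \<le> M" using 1 2 by (auto simp: C_def M_def)
  have sub: "borel_disc \<theta> R \<subseteq> borel_disc \<theta> r" using R by (intro borel_disc_mono) auto
  have small: "cmod h < d1" "cmod h < d2" if "h \<in> borel_disc \<theta> R" for h
    using borel_disc_norm[OF R(2) that] iR by auto
  have n1: "nevanlinna (\<lambda>w. f x (cis \<theta> / w)) (\<lambda>k. fh k x * cis \<theta> ^ k) R (R + 1) C M"
  proof (rule nevanlinnaI)
    fix n h assume h: "h \<in> borel_disc \<theta> R"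
    have "cmod (asym_remainder f fh n x h) \<le> C1 * M1 ^ n * fact n * cmod h ^ n" using 1(4) h sub small by blast
    also have "\<dots> \<le> C * M ^ n * fact n * cmod h ^ n"
      using CM 1 by (intro mult_right_mono mult_mono power_mono) auto
    finally show "cmod (asym_remainder f fh n x h) \<le> C * M ^ n * fact n * cmod h ^ n" .
  qed (use R CM holomorphic_on_subset[OF hol(1) sub] in auto)
  have n2: "nevanlinna (\<lambda>w. g x (cis \<theta> / w)) (\<lambda>k. fh k x * cis \<theta> ^ k) R (R + 1) C M"
  proof (rule nevanlinnaI)
    fix n h assume h: "h \<in> borel_disc \<theta> R"
    have "cmod (asym_remainder g fh n x h) \<le> C2 * M2 ^ n * fact n * cmod h ^ n" using 2(4) h sub small by blast
    also have "\<dots> \<le> C * M ^ n * fact n * cmod h ^ n"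
      using CM 2 by (intro mult_right_mono mult_mono power_mono) auto
    finally show "cmod (asym_remainder g fh n x h) \<le> C * M ^ n * fact n * cmod h ^ n" .
  qed (use R CM holomorphic_on_subset[OF hol(2) sub] in auto)
  have eq: "f x k = g x k" if k: "k \<in> borel_disc \<theta> (R + 1)" for k
  proof -
    have k0: "k \<noteq> 0" using borel_disc_nonzero[OF _ k] R by auto
    have "R + 1 < Re (cis \<theta> / k)" using k by (simp add: borel_disc_def)
    from nevanlinna_unique[OF n1 n2 this] show ?thesis using k0 by simp
  qed
  have R1: "R + 1 > 0" using R by simp
  show ?thesis
  proof (rule analytic_continuation_open[where s = "borel_disc \<theta> (R + 1)" and s' = "borel_disc \<theta> r" and f = "f x" and g = "g x"])
    show "borel_disc \<theta> (R + 1) \<noteq> {}" unfolding borel_disc_eq_ball[OF R1] using R1 by simp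
    show "connected (borel_disc \<theta> r)" unfolding borel_disc_eq_ball[OF r] by simp
    show "open (borel_disc \<theta> (R + 1))" "open (borel_disc \<theta> r)" by (rule open_borel_disc[OF R1] open_borel_disc[OF r])+
    show "borel_disc \<theta> (R + 1) \<subseteq> borel_disc \<theta> r" using R by (intro borel_disc_mono) auto
  qed (rule hol eq h, assumption?)+
qed

section \<open>The half-strip chart\<close>

lemma right_nbhd_shift: "z \<in> right_nbhd r \<Longrightarrow> 0 \<le> s \<Longrightarrow> z + of_real s \<in> right_nbhd r"
  unfolding right_nbhd_def mem_Collect_eq
  by (elim exE conjE, rule_tac x = "t + s" in exI) simp

lemma right_nbhd_ball:
  assumes "z \<in> right_nbhd r" shows "ball z e \<subseteq> right_nbhd (r + e)"
proof
  fix u assume u: "u \<in> ball z e"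
  obtain t where t: "0 \<le> t" "cmod (z - of_real t) < r" using assms by (auto simp: right_nbhd_def)
  have "cmod (u - of_real t) \<le> cmod (u - z) + cmod (z - of_real t)"
    using norm_triangle_ineq[of "u - z" "z - of_real t"] by simp
  also have "\<dots> < r + e" using t u by (simp add: dist_norm norm_minus_commute)
  finally show "u \<in> right_nbhd (r + e)" using t by (auto simp: right_nbhd_def)
qed

lemma halfstrip_iff:
  assumes "\<sigma> = 1 \<or> \<sigma> = -1"
  shows "z \<in> halfstrip \<theta> \<sigma> z1 r \<longleftrightarrow> of_real \<sigma> * cis (- \<theta>) * (z - z1) \<in> right_nbhd r"
proof -
  have d: "dist z (z1 + cis \<theta> * of_real (\<sigma> * t)) = cmod (of_real \<sigma> * cis (- \<theta>) * (z - z1) - of_real t)" for t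
  proof -
    have s: "complex_of_real \<sigma> * of_real \<sigma> = 1" "cmod (of_real \<sigma>) = 1" using assms by auto
    have c: "cis (- \<theta>) * cis \<theta> = 1" by (simp add: cis_mult)
    have "of_real \<sigma> * cis (- \<theta>) * (z - (z1 + cis \<theta> * of_real (\<sigma> * t)))
        = of_real \<sigma> * cis (- \<theta>) * (z - z1) - (of_real \<sigma> * of_real \<sigma>) * (cis (- \<theta>) * cis \<theta>) * of_real t"
      by (simp add: algebra_simps)
    then have "of_real \<sigma> * cis (- \<theta>) * (z - z1) - of_real t = of_real \<sigma> * cis (- \<theta>) * (z - (z1 + cis \<theta> * of_real (\<sigma> * t)))"
      unfolding s c by simp
    then show ?thesis using s by (simp add: dist_norm norm_mult)
  qed
  have "{z1 + cis \<theta> * of_real (\<sigma> * t) |t. 0 \<le> t} \<noteq> {}" by auto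
  from infdist_less_iff[OF this, of z r] show ?thesis
    unfolding halfstrip_def right_nbhd_def mem_Collect_eq d[symmetric] by auto
qed

text \<open>
  The chart satisfies \<open>\<Psi>' (Q \<circ> \<Psi>) = 1\<close> near the base point, hence everywhere by the identity
  theorem; in particular \<open>Q\<close> has no zeros on the half-strip.
\<close>

lemma wkb_chart:
  assumes W: "wkb_halfstrip X x0 q \<theta> \<sigma> W" and sign: "\<sigma> = 1 \<or> \<sigma> = -1"
    and N: "open N" "x0 \<in> N" "q holomorphic_on N"
    and Q: "Q holomorphic_on W" "\<forall>\<^sub>F x in nhds x0. Q x = q x"
  obtains r \<Psi> where "r > 0" "\<Psi> holomorphic_on right_nbhd r" "W = \<Psi> ` right_nbhd r"
    "\<And>z. z \<in> right_nbhd r \<Longrightarrow> deriv \<Psi> z * Q (\<Psi> z) = of_real \<sigma> * cis \<theta>"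
    "open W" "x0 \<in> W" "W \<subseteq> X"
proof -
  obtain z1 r \<Psi> where r: "r > 0" and 0: "0 \<in> halfstrip \<theta> \<sigma> z1 r" and hol: "\<Psi> holomorphic_on halfstrip \<theta> \<sigma> z1 r"
    and \<Psi>0: "\<Psi> 0 = x0" and inv: "\<forall>\<^sub>F x in nhds x0. \<Psi> (contour_integral (linepath x0 x) q) = x"
    and WH: "W = \<Psi> ` halfstrip \<theta> \<sigma> z1 r" and WX: "W \<subseteq> X"
    using W unfolding wkb_halfstrip_def by blast
  define H where "H = halfstrip \<theta> \<sigma> z1 r"
  have ss: "complex_of_real \<sigma> * of_real \<sigma> = 1" "complex_of_real \<sigma> \<noteq> 0" using sign by auto
  have cc: "cis (- \<theta>) * cis \<theta> = 1" by (simp add: cis_mult)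
  define T where "T z = z1 + of_real \<sigma> * cis \<theta> * z" for z
  define T' where "T' z = of_real \<sigma> * cis (- \<theta>) * (z - z1)" for z
  have TT: "T' (T z) = z" "T (T' z) = z" for z
  proof -
    have "T' (T z) = (of_real \<sigma> * of_real \<sigma>) * (cis (- \<theta>) * cis \<theta>) * z" by (simp add: T_def T'_def mult_ac)
    then show "T' (T z) = z" unfolding ss cc by simp
    have "T (T' z) = z1 + (of_real \<sigma> * of_real \<sigma>) * (cis (- \<theta>) * cis \<theta>) * (z - z1)" by (simp add: T_def T'_def mult_ac)
    then show "T (T' z) = z" unfolding ss cc by simp
  qed
  have HT: "H = T ` right_nbhd r"
  proof (intro set_eqI iffI)
    fix z assume "z \<in> H"
    then have "T' z \<in> right_nbhd r" by (simp add: H_def halfstrip_iff[OF sign] T'_def)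
    then show "z \<in> T ` right_nbhd r" using TT(2)[of z] by (metis image_eqI)
  next
    fix z assume "z \<in> T ` right_nbhd r"
    then obtain y where "z = T y" "y \<in> right_nbhd r" by auto
    then show "z \<in> H" using TT(1)[of y] by (simp add: H_def halfstrip_iff[OF sign] T'_def)
  qed
  have Hopen: "open H"
  proof -
    have "H = T' -` right_nbhd r" by (auto simp: H_def halfstrip_iff[OF sign] T'_def)
    then show ?thesis unfolding T'_def by (auto intro!: open_vimage open_right_nbhd continuous_intros)
  qed
  have Hconn: "connected H" unfolding HT T_def
    by (intro connected_continuous_image continuous_intros convex_connected convex_right_nbhd)
  have dHol: "deriv \<Psi> holomorphic_on H" using hol Hopen unfolding H_def by (rule holomorphic_deriv)
  have QHol: "(\<lambda>z. Q (\<Psi> z)) holomorphic_on H"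
    using holomorphic_on_compose_gen[OF hol Q(1)] WH by (simp add: o_def H_def)
  obtain e where e: "e > 0" "ball x0 e \<subseteq> N" "\<And>x. x \<in> ball x0 e \<Longrightarrow> Q x = q x"
    "\<And>x. x \<in> ball x0 e \<Longrightarrow> \<Psi> (contour_integral (linepath x0 x) q) = x"
  proof -
    have "\<forall>\<^sub>F x in nhds x0. x \<in> N" using N by (simp add: eventually_nhds_in_open)
    from eventually_conj[OF this eventually_conj[OF Q(2) inv]]
    obtain e where "e > 0" "\<And>x. dist x x0 < e \<Longrightarrow> x \<in> N \<and> Q x = q x \<and> \<Psi> (contour_integral (linepath x0 x) q) = x"
      unfolding eventually_nhds_metric by blast
    then show thesis by (intro that[of e]) (auto simp: dist_commute)
  qed
  obtain g where g: "\<And>x. x \<in> ball x0 e \<Longrightarrow> (g has_field_derivative q x) (at x within ball x0 e)"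
    using holomorphic_convex_primitive'[OF convex_ball open_ball holomorphic_on_subset[OF N(3) e(2)]] by blast
  define \<Phi> where "\<Phi> x = g x - g x0" for x
  have \<Phi>d: "(\<Phi> has_field_derivative q x) (at x)" if "x \<in> ball x0 e" for x
    using g[OF that] that unfolding \<Phi>_def by (auto simp: at_within_open[of _ "ball x0 e"] intro!: derivative_eq_intros)
  have \<Phi>i: "contour_integral (linepath x0 x) q = \<Phi> x" if x: "x \<in> ball x0 e" for x
  proof -
    have "closed_segment x0 x \<subseteq> ball x0 e" using x e(1) by (intro closed_segment_subset convex_ball) auto
    then have "(q has_contour_integral (g (pathfinish (linepath x0 x)) - g (pathstart (linepath x0 x)))) (linepath x0 x)"
      by (intro contour_integral_primitive[OF g]) auto
    then show ?thesis by (simp add: \<Phi>_def contour_integral_unique)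
  qed
  have \<Psi>\<Phi>: "\<Psi> (\<Phi> x) = x" if "x \<in> ball x0 e" for x using e(4)[OF that] \<Phi>i[OF that] by simp
  have "isCont \<Phi> x0" using \<Phi>d[of x0] e(1) DERIV_isCont by auto
  moreover have "\<Phi> x0 = 0" by (simp add: \<Phi>_def)
  ultimately have "\<forall>\<^sub>F x in nhds x0. \<Phi> x \<in> H"
    using Hopen 0 unfolding isCont_def by (metis H_def continuous_at continuous_at_open eventually_nhds topological_tendstoD tendsto_at_iff_tendsto_nhds)
  then obtain e' where e': "e' > 0" "\<And>x. dist x x0 < e' \<Longrightarrow> \<Phi> x \<in> H" unfolding eventually_nhds_metric by blast
  define B where "B = ball x0 (min e e')"
  have B: "B \<subseteq> ball x0 e" "\<And>x. x \<in> B \<Longrightarrow> \<Phi> x \<in> H" "open B" "x0 \<in> B"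
    using e' e(1) by (auto simp: B_def dist_commute)
  have inj: "inj_on \<Phi> B" using \<Psi>\<Phi> B(1) by (metis inj_onI subsetD)
  have \<Phi>hol: "\<Phi> holomorphic_on B" unfolding holomorphic_on_open[OF B(3)] using \<Phi>d B(1) by blast
  have F1: "deriv \<Psi> z * Q (\<Psi> z) = 1" if z: "z \<in> H" for z
  proof (rule analytic_continuation_open[where s = "\<Phi> ` B" and s' = H and f = "\<lambda>z. deriv \<Psi> z * Q (\<Psi> z)" and g = "\<lambda>_. 1"])
    show "open (\<Phi> ` B)" by (rule open_mapping_thm3[OF \<Phi>hol B(3) inj])
    show "(\<lambda>z. deriv \<Psi> z * Q (\<Psi> z)) holomorphic_on H" by (intro holomorphic_intros dHol QHol)
    show "deriv \<Psi> y * Q (\<Psi> y) = 1" if y: "y \<in> \<Phi> ` B" for y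
    proof -
      obtain x where x: "x \<in> B" "y = \<Phi> x" using y by auto
      have xe: "x \<in> ball x0 e" using x B by auto
      have "(\<Psi> has_field_derivative deriv \<Psi> (\<Phi> x)) (at (\<Phi> x))"
        using hol Hopen B(2)[OF x(1)] unfolding H_def by (rule holomorphic_derivI)
      from DERIV_chain2[where f = \<Psi> and g = \<Phi>, OF this \<Phi>d[OF xe]]
      have "((\<lambda>x. \<Psi> (\<Phi> x)) has_field_derivative deriv \<Psi> (\<Phi> x) * q x) (at x)" .
      moreover have "((\<lambda>x. \<Psi> (\<Phi> x)) has_field_derivative 1) (at x)"
        by (rule has_field_derivative_transform_within_open[OF DERIV_ident open_ball xe]) (simp add: \<Psi>\<Phi>)
      ultimately have "deriv \<Psi> (\<Phi> x) * q x = 1" by (rule DERIV_unique)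
      then show ?thesis unfolding x(2) \<Psi>\<Phi>[OF xe] e(3)[OF xe] .
    qed
    show "\<Phi> ` B \<noteq> {}" using B(4) by blast
    show "\<Phi> ` B \<subseteq> H" by (rule image_subsetI[OF B(2)])
    show "z \<in> H" by (rule z)
  qed (rule Hopen Hconn holomorphic_on_const)+
  have nc: "\<not> \<Psi> constant_on H"
  proof
    assume "\<Psi> constant_on H"
    then obtain c where c: "\<And>z. z \<in> H \<Longrightarrow> \<Psi> z = c" unfolding constant_on_def by blast
    have zH: "0 \<in> H" using 0 by (simp add: H_def)
    have "(\<Psi> has_field_derivative 0) (at 0)"
      by (rule has_field_derivative_transform_within_open[OF DERIV_const Hopen zH]) (simp add: c)
    then have "deriv \<Psi> 0 = 0" by (rule DERIV_imp_deriv)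
    then show False using F1[OF zH] by simp
  qed
  show thesis
  proof (rule that[of r "\<lambda>z. \<Psi> (T z)"])
    show "(\<lambda>z. \<Psi> (T z)) holomorphic_on right_nbhd r"
    proof -
      have "(\<Psi> \<circ> T) holomorphic_on right_nbhd r"
        by (rule holomorphic_on_compose_gen[OF _ hol]) (use HT in \<open>auto simp: T_def[abs_def] H_def[symmetric] intro!: holomorphic_intros\<close>)
      then show ?thesis by (simp add: o_def)
    qed
    show "W = (\<lambda>z. \<Psi> (T z)) ` right_nbhd r" unfolding WH H_def[symmetric] HT by auto
    show "deriv (\<lambda>z. \<Psi> (T z)) z * Q (\<Psi> (T z)) = of_real \<sigma> * cis \<theta>" if z: "z \<in> right_nbhd r" for z
    proof -
      have Tz: "T z \<in> H" using HT z by auto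
      have "(\<Psi> has_field_derivative deriv \<Psi> (T z)) (at (T z))"
        using hol Hopen Tz unfolding H_def by (rule holomorphic_derivI)
      moreover have "(T has_field_derivative of_real \<sigma> * cis \<theta>) (at z)"
        unfolding T_def by (auto intro!: derivative_eq_intros)
      ultimately have "((\<lambda>z. \<Psi> (T z)) has_field_derivative deriv \<Psi> (T z) * (of_real \<sigma> * cis \<theta>)) (at z)"
        by (rule DERIV_chain2)
      then have "deriv (\<lambda>z. \<Psi> (T z)) z = deriv \<Psi> (T z) * (of_real \<sigma> * cis \<theta>)" by (rule DERIV_imp_deriv)
      then have "deriv (\<lambda>z. \<Psi> (T z)) z * Q (\<Psi> (T z)) = (deriv \<Psi> (T z) * Q (\<Psi> (T z))) * (of_real \<sigma> * cis \<theta>)" by (simp add: mult_ac)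
      then show ?thesis unfolding F1[OF Tz] by simp
    qed
    show "open W" unfolding WH H_def[symmetric]
      by (rule open_mapping_thm[OF hol[folded H_def] Hopen Hconn Hopen order_refl nc])
    show "x0 \<in> W" unfolding WH using 0 \<Psi>0 by (metis image_eqI)
  qed (use r WX in auto)
qed

section \<open>Exact solutions near a point of the half-strip\<close>

text \<open>
  In the coordinates \<open>z\<close> and \<open>w = cis \<theta> / h\<close> this is \<open>riccati_exact_solution\<close>: the division by \<open>Q\<close> in the
  chart cancels the scale of the Gevrey bounds, so that those with \<open>n = 0\<close> and \<open>n = 1\<close> give the estimates
  along the whole strip. The bounds of higher order enter through \<open>riccati_gevrey\<close>, applied on a ball
  whose closure lies in \<open>W\<close>, where all data are bounded.
\<close>

lemma local_exact_solution:
  fixes a b c :: "complex \<Rightarrow> complex \<Rightarrow> complex" and ah bh ch fh :: "nat \<Rightarrow> complex \<Rightarrow> complex"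
  assumes r: "\<Psi> holomorphic_on right_nbhd r" "W = \<Psi> ` right_nbhd r"
    and chart: "\<And>z. z \<in> right_nbhd r \<Longrightarrow> deriv \<Psi> z * Q (\<Psi> z) = of_real \<sigma> * cis \<theta>"
    and sign: "\<sigma> = 1 \<or> \<sigma> = -1"
    and W: "open W" and Q: "Q holomorphic_on W"
    and R: "R > 0" and sep: "sep_holomorphic_on W (borel_disc \<theta> R) a" "sep_holomorphic_on W (borel_disc \<theta> R) b"
      "sep_holomorphic_on W (borel_disc \<theta> R) c"
    and hol: "ah 0 holomorphic_on W" "bh 0 holomorphic_on W" "ch 0 holomorphic_on W"
    and C: "0 \<le> C" and M: "0 \<le> M"
    and gev: "\<And>n x h. x \<in> W \<Longrightarrow> h \<in> borel_disc \<theta> R \<Longrightarrow> cmod (asym_remainder a ah n x h) \<le> cmod (Q x) * C * M ^ n * fact n * cmod h ^ n"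
      "\<And>n x h. x \<in> W \<Longrightarrow> h \<in> borel_disc \<theta> R \<Longrightarrow> cmod (asym_remainder b bh n x h) \<le> cmod (Q x) * C * M ^ n * fact n * cmod h ^ n"
      "\<And>n x h. x \<in> W \<Longrightarrow> h \<in> borel_disc \<theta> R \<Longrightarrow> cmod (asym_remainder c ch n x h) \<le> cmod (Q x) * C * M ^ n * fact n * cmod h ^ n"
    and lead: "\<And>x. x \<in> W \<Longrightarrow> 2 * ah 0 x * fh 0 x + bh 0 x = of_real \<sigma> * Q x"
    and formal: "formal_riccati_solution W ah bh ch fh"
    and p: "p \<in> W"
  obtains \<rho> R' f C' M' where "\<rho> > 0" "R' \<ge> R" "ball p \<rho> \<subseteq> W"
    "sep_holomorphic_on (ball p \<rho>) (borel_disc \<theta> R') f" "C' > 0" "M' > 0"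
    "\<And>x h. x \<in> ball p \<rho> \<Longrightarrow> h \<in> borel_disc \<theta> R' \<Longrightarrow>
        h * deriv (\<lambda>y. f y h) x = a x h * (f x h)\<^sup>2 + b x h * f x h + c x h"
    "\<And>n x h. x \<in> ball p \<rho> \<Longrightarrow> h \<in> borel_disc \<theta> R' \<Longrightarrow>
        cmod (asym_remainder f fh n x h) \<le> C' * M' ^ n * fact n * cmod h ^ n"
proof -
  have fhol: "fh k holomorphic_on W" for k using formal unfolding formal_riccati_solution_def by blast
  have fser: "fps_X * series_at (\<lambda>k. deriv (fh k)) x = series_at ah x * (series_at fh x)\<^sup>2 + series_at bh x * series_at fh x + series_at ch x"
    if "x \<in> W" for x using formal that unfolding formal_riccati_solution_def by blast
  have s2: "complex_of_real \<sigma> * of_real \<sigma> = 1" "complex_of_real \<sigma> \<noteq> 0" "cmod (of_real \<sigma>) = 1" using sign by auto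
  have in_W: "\<Psi> z \<in> W" if "z \<in> right_nbhd r" for z using r(2) that by auto
  have Q0: "Q (\<Psi> z) \<noteq> 0" "deriv \<Psi> z \<noteq> 0" if "z \<in> right_nbhd r" for z
    using chart[OF that] s2(2) cis_neq_zero[of \<theta>] by auto
  obtain zp where zp: "zp \<in> right_nbhd r" "p = \<Psi> zp" using p r(2) by auto
  obtain t where t: "0 \<le> t" "cmod (zp - of_real t) < r" using zp(1) by (auto simp: right_nbhd_def)
  \<comment> \<open>The half-strip is shrunk twice by \<open>e\<close>, and \<open>zp\<close> still lies inside.\<close>
  define e where "e = (r - cmod (zp - of_real t)) / 3"
  have e: "e > 0" using t by (simp add: e_def)
  have rb1: "ball z e \<subseteq> right_nbhd r" if "z \<in> right_nbhd (r - e)" for z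
    using right_nbhd_ball[OF that, of e] by simp
  have rb2: "ball z e \<subseteq> right_nbhd (r - e)" if "z \<in> right_nbhd (r - 2 * e)" for z
    using right_nbhd_ball[OF that, of e] by simp
  have "3 * e = r - cmod (zp - of_real t)" by (simp add: e_def)
  then have "cmod (zp - of_real t) < r - 2 * e" using e by linarith
  then have zp2: "zp \<in> right_nbhd (r - 2 * e)" using t(1) by (auto simp: right_nbhd_def)
  define A where "A z w = of_real \<sigma> * a (\<Psi> z) (cis \<theta> / w) / Q (\<Psi> z)" for z w
  define B where "B z w = of_real \<sigma> * b (\<Psi> z) (cis \<theta> / w) / Q (\<Psi> z)" for z w
  define D where "D z w = of_real \<sigma> * c (\<Psi> z) (cis \<theta> / w) / Q (\<Psi> z)" for z w
  define A0 where "A0 z = of_real \<sigma> * ah 0 (\<Psi> z) / Q (\<Psi> z)" for z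
  define B0 where "B0 z = of_real \<sigma> * bh 0 (\<Psi> z) / Q (\<Psi> z)" for z
  define D0 where "D0 z = of_real \<sigma> * ch 0 (\<Psi> z) / Q (\<Psi> z)" for z
  define F0 where "F0 z = fh 0 (\<Psi> z)" for z
  have comp: "(\<lambda>z. k (\<Psi> z)) holomorphic_on right_nbhd r" if "k holomorphic_on W" for k
    using holomorphic_on_compose_gen[OF r(1) that] in_W by (auto simp: o_def)
  have inv: "cis \<theta> / w \<in> borel_disc \<theta> R'" if "R' < Re w" "0 < R'" for w R'
  proof -
    have "w \<noteq> 0" using that by auto
    then have "cis \<theta> / (cis \<theta> / w) = w" by simp
    then show ?thesis using that by (simp add: borel_disc_def)
  qed
  have sepc: "sep_holomorphic_on (right_nbhd r) {w. R < Re w} (\<lambda>z w. of_real \<sigma> * k (\<Psi> z) (cis \<theta> / w) / Q (\<Psi> z))"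
    if k: "sep_holomorphic_on W (borel_disc \<theta> R) k" for k
    unfolding sep_holomorphic_on_def
  proof (intro conjI ballI)
    fix w assume w: "w \<in> {w. R < Re w}"
    have "(\<lambda>x. k x (cis \<theta> / w)) holomorphic_on W" using k inv[of R w] w R by (simp add: sep_holomorphic_on_def)
    from comp[OF this] show "(\<lambda>z. of_real \<sigma> * k (\<Psi> z) (cis \<theta> / w) / Q (\<Psi> z)) holomorphic_on right_nbhd r"
      using Q0(1) comp[OF Q] by (auto intro!: holomorphic_on_divide holomorphic_on_mult holomorphic_on_const)
  next
    fix z assume z: "z \<in> right_nbhd r"
    have kz: "k (\<Psi> z) holomorphic_on borel_disc \<theta> R" using k in_W[OF z] by (simp add: sep_holomorphic_on_def)
    have "(k (\<Psi> z) \<circ> (\<lambda>w. cis \<theta> / w)) holomorphic_on {w. R < Re w}"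
      by (rule holomorphic_on_compose_gen[OF _ kz]) (use inv R in \<open>auto intro!: holomorphic_intros\<close>)
    then have "(\<lambda>w. k (\<Psi> z) (cis \<theta> / w)) holomorphic_on {w. R < Re w}" by (simp add: o_def)
    then show "(\<lambda>w. of_real \<sigma> * k (\<Psi> z) (cis \<theta> / w) / Q (\<Psi> z)) holomorphic_on {w. R < Re w}"
      using Q0[OF z] by (intro holomorphic_intros) auto
  qed
  define K where "K = C + C * M / R + C * M"
  have bounds: "cmod (of_real \<sigma> * kh 0 (\<Psi> z) / Q (\<Psi> z)) \<le> K \<and>
      (R < Re w \<longrightarrow> cmod (w * (of_real \<sigma> * k (\<Psi> z) (cis \<theta> / w) / Q (\<Psi> z) - of_real \<sigma> * kh 0 (\<Psi> z) / Q (\<Psi> z))) \<le> K)"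
    if z: "z \<in> right_nbhd r" and k: "\<And>n x h. x \<in> W \<Longrightarrow> h \<in> borel_disc \<theta> R \<Longrightarrow> cmod (asym_remainder k kh n x h) \<le> cmod (Q x) * C * M ^ n * fact n * cmod h ^ n"
    for z w k kh
  proof (intro conjI impI)
    have d1: "cmod (k (\<Psi> z) h - kh 0 (\<Psi> z)) \<le> cmod (Q (\<Psi> z)) * (C * M * cmod h)" if "h \<in> borel_disc \<theta> R" for h
      using k[OF in_W[OF z] that, of 1] by (simp add: asym_remainder_def mult_ac)
    have d0: "cmod (k (\<Psi> z) h) \<le> cmod (Q (\<Psi> z)) * C" if "h \<in> borel_disc \<theta> R" for h
      using k[OF in_W[OF z] that, of 0] by (simp add: asym_remainder_def)
    have CM: "0 \<le> C * M" "0 \<le> C * M / R" using C M R by auto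
    define h where "h = cis \<theta> / of_real (R + 1)"
    have h: "h \<in> borel_disc \<theta> R" unfolding h_def by (rule inv) (use R in auto)
    have "cmod (kh 0 (\<Psi> z)) \<le> cmod (k (\<Psi> z) h) + cmod (k (\<Psi> z) h - kh 0 (\<Psi> z))"
      using norm_triangle_ineq4[of "k (\<Psi> z) h" "k (\<Psi> z) h - kh 0 (\<Psi> z)"] by simp
    also have "\<dots> \<le> cmod (Q (\<Psi> z)) * C + cmod (Q (\<Psi> z)) * (C * M * cmod h)" by (intro add_mono d0 d1 h)
    also have "\<dots> \<le> cmod (Q (\<Psi> z)) * C + cmod (Q (\<Psi> z)) * (C * M * (1 / R))"
      using borel_disc_norm[OF R h] CM by (intro add_left_mono mult_left_mono) auto
    also have "\<dots> = cmod (Q (\<Psi> z)) * (C + C * M / R)" by (simp add: distrib_left)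
    also have "\<dots> \<le> cmod (Q (\<Psi> z)) * K" using CM by (intro mult_left_mono) (auto simp: K_def)
    finally show "cmod (of_real \<sigma> * kh 0 (\<Psi> z) / Q (\<Psi> z)) \<le> K"
      using Q0[OF z] s2(3) by (simp add: norm_mult norm_divide divide_le_eq mult.commute)
    assume w: "R < Re w"
    then have w0: "w \<noteq> 0" using R by auto
    have "cmod (k (\<Psi> z) (cis \<theta> / w) - kh 0 (\<Psi> z)) \<le> cmod (Q (\<Psi> z)) * (C * M * cmod (cis \<theta> / w))" by (rule d1[OF inv[OF w R]])
    then have "cmod w * cmod (k (\<Psi> z) (cis \<theta> / w) - kh 0 (\<Psi> z)) \<le> cmod (Q (\<Psi> z)) * (C * M)"
      using w0 by (simp add: norm_divide field_simps)
    also have "\<dots> \<le> cmod (Q (\<Psi> z)) * K" using CM C by (intro mult_left_mono) (auto simp: K_def)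
    finally have *: "cmod w * cmod (k (\<Psi> z) (cis \<theta> / w) - kh 0 (\<Psi> z)) \<le> cmod (Q (\<Psi> z)) * K" .
    have "w * (of_real \<sigma> * k (\<Psi> z) (cis \<theta> / w) / Q (\<Psi> z) - of_real \<sigma> * kh 0 (\<Psi> z) / Q (\<Psi> z))
        = of_real \<sigma> * (w * (k (\<Psi> z) (cis \<theta> / w) - kh 0 (\<Psi> z))) / Q (\<Psi> z)"
      by (simp add: diff_divide_distrib right_diff_distrib mult_ac)
    then show "cmod (w * (of_real \<sigma> * k (\<Psi> z) (cis \<theta> / w) / Q (\<Psi> z) - of_real \<sigma> * kh 0 (\<Psi> z) / Q (\<Psi> z))) \<le> K"
      using * Q0[OF z] s2(3) by (simp add: norm_mult norm_divide divide_le_eq mult.commute)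
  qed
  have lead1: "2 * A0 z * F0 z + B0 z = 1" if z: "z \<in> right_nbhd r" for z
  proof -
    have "2 * A0 z * F0 z + B0 z = of_real \<sigma> * (2 * ah 0 (\<Psi> z) * fh 0 (\<Psi> z) + bh 0 (\<Psi> z)) / Q (\<Psi> z)"
      by (simp add: A0_def F0_def B0_def add_divide_distrib algebra_simps)
    also have "\<dots> = (of_real \<sigma> * of_real \<sigma>) * Q (\<Psi> z) / Q (\<Psi> z)" unfolding lead[OF in_W[OF z]] by simp
    finally show ?thesis using s2 Q0[OF z] by simp
  qed
  have lead2: "A0 z * (F0 z)\<^sup>2 + B0 z * F0 z + D0 z = 0" if z: "z \<in> right_nbhd r" for z
  proof -
    have "ah 0 (\<Psi> z) * (fh 0 (\<Psi> z))\<^sup>2 + bh 0 (\<Psi> z) * fh 0 (\<Psi> z) + ch 0 (\<Psi> z) = 0"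
      using arg_cong[OF fser[OF in_W[OF z]], of "\<lambda>F. fps_nth F 0"] by (simp add: series_at_def power2_eq_square)
    then have "of_real \<sigma> * (ah 0 (\<Psi> z) * (fh 0 (\<Psi> z))\<^sup>2 + bh 0 (\<Psi> z) * fh 0 (\<Psi> z) + ch 0 (\<Psi> z)) / Q (\<Psi> z) = 0" by simp
    then show ?thesis by (simp add: A0_def F0_def B0_def D0_def add_divide_distrib algebra_simps)
  qed
  obtain \<rho>1 R1 K' F where F: "\<rho>1 > 0" "R1 \<ge> R" "K' > 0" "ball zp \<rho>1 \<subseteq> right_nbhd (r - 2 * e)"
    "sep_holomorphic_on (ball zp \<rho>1) {w. R1 < Re w} F"
    "\<And>z w. z \<in> ball zp \<rho>1 \<Longrightarrow> R1 < Re w \<Longrightarrow> cmod (F z w - F0 z) \<le> K' / cmod w"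
    "\<And>z w. z \<in> ball zp \<rho>1 \<Longrightarrow> R1 < Re w \<Longrightarrow>
       ((\<lambda>z. F z w) has_field_derivative w * (A z w * (F z w)\<^sup>2 + B z w * F z w + D z w)) (at z)"
  proof (rule riccati_exact_solution[where U = "right_nbhd r" and ?U1.0 = "right_nbhd (r - e)" and ?U2.0 = "right_nbhd (r - 2 * e)"
        and \<delta> = e and ?R0.0 = R and A = A and B = B and C = D and ?A0.0 = A0 and ?B0.0 = B0 and ?C0.0 = D0 and ?F0.0 = F0 and K = K and ?z0.0 = zp])
    show "sep_holomorphic_on (right_nbhd r) {w. R < Re w} A" "sep_holomorphic_on (right_nbhd r) {w. R < Re w} B"
      "sep_holomorphic_on (right_nbhd r) {w. R < Re w} D"
      unfolding A_def B_def D_def by (rule sepc[OF sep(1)] sepc[OF sep(2)] sepc[OF sep(3)])+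
    show "A0 holomorphic_on right_nbhd r" "B0 holomorphic_on right_nbhd r" "D0 holomorphic_on right_nbhd r" "F0 holomorphic_on right_nbhd r"
      unfolding A0_def B0_def D0_def F0_def using Q0(1) comp[OF Q] comp[OF hol(1)] comp[OF hol(2)] comp[OF hol(3)] comp[OF fhol]
      by (auto intro!: holomorphic_on_divide holomorphic_on_mult holomorphic_on_const)
    show "cmod (A0 z) \<le> K" if "z \<in> right_nbhd r" for z unfolding A0_def using bounds[OF that gev(1)] by blast
    show "cmod (B0 z) \<le> K" if "z \<in> right_nbhd r" for z unfolding B0_def using bounds[OF that gev(2)] by blast
    show "cmod (D0 z) \<le> K" if "z \<in> right_nbhd r" for z unfolding D0_def using bounds[OF that gev(3)] by blast
    show "cmod (w * (A z w - A0 z)) \<le> K" if "z \<in> right_nbhd r" "R < Re w" for z w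
      unfolding A_def A0_def using bounds[OF that(1) gev(1)] that(2) by blast
    show "cmod (w * (B z w - B0 z)) \<le> K" if "z \<in> right_nbhd r" "R < Re w" for z w
      unfolding B_def B0_def using bounds[OF that(1) gev(2)] that(2) by blast
    show "cmod (w * (D z w - D0 z)) \<le> K" if "z \<in> right_nbhd r" "R < Re w" for z w
      unfolding D_def D0_def using bounds[OF that(1) gev(3)] that(2) by blast
    show "open (right_nbhd r)" "open (right_nbhd (r - e))" "open (right_nbhd (r - 2 * e))" by (rule open_right_nbhd)+
    show "z + of_real s \<in> right_nbhd (r - e)" if "z \<in> right_nbhd (r - e)" "0 \<le> s" for z s
      by (rule right_nbhd_shift[OF that])
    show "ball z e \<subseteq> right_nbhd r" if "z \<in> right_nbhd (r - e)" for z by (rule rb1[OF that])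
    show "ball z e \<subseteq> right_nbhd (r - e)" if "z \<in> right_nbhd (r - 2 * e)" for z by (rule rb2[OF that])
    show "2 * A0 z * F0 z + B0 z = 1" if "z \<in> right_nbhd r" for z by (rule lead1[OF that])
    show "A0 z * (F0 z)\<^sup>2 + B0 z * F0 z + D0 z = 0" if "z \<in> right_nbhd r" for z by (rule lead2[OF that])
    show "e > 0" "R > 0" "zp \<in> right_nbhd (r - 2 * e)" by (rule e R zp2)+
  qed (rule that; assumption)
  have sub_r: "ball zp \<rho>1 \<subseteq> right_nbhd r"
  proof
    fix z assume "z \<in> ball zp \<rho>1"
    then have "z \<in> right_nbhd (r - e)" using F(4) rb2[of z] e by (meson centre_in_ball subsetD)
    then show "z \<in> right_nbhd r" using rb1[of z] e by (meson centre_in_ball subsetD)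
  qed
  have R1: "R1 > 0" using F(2) R by simp
  obtain r' where r': "r' > 0" "ball zp r' \<subseteq> ball zp \<rho>1" "open (\<Psi> ` ball zp r')" "inj_on \<Psi> (ball zp r')"
    using has_complex_derivative_locally_invertible[OF holomorphic_on_subset[OF r(1) sub_r] centre_in_ball[THEN iffD2, OF F(1)] open_ball Q0(2)[OF zp(1)]]
    by blast
  have holr': "\<Psi> holomorphic_on ball zp r'" using holomorphic_on_subset[OF r(1)] r'(2) sub_r by blast
  obtain \<kappa> where \<kappa>: "\<kappa> holomorphic_on \<Psi> ` ball zp r'" "\<And>z. z \<in> ball zp r' \<Longrightarrow> deriv \<Psi> z * deriv \<kappa> (\<Psi> z) = 1"
    "\<And>z. z \<in> ball zp r' \<Longrightarrow> \<kappa> (\<Psi> z) = z"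
    using holomorphic_has_inverse[OF holr' open_ball r'(4)] by blast
  have "p \<in> \<Psi> ` ball zp r'" using zp(2) r'(1) by simp
  then obtain \<rho>2 where \<rho>2: "\<rho>2 > 0" "cball p \<rho>2 \<subseteq> \<Psi> ` ball zp r'" using r'(3) open_contains_cball by blast
  define E where "E = ball p \<rho>2"
  have EB: "E \<subseteq> \<Psi> ` ball zp r'" using \<rho>2(2) by (auto simp: E_def)
  have imW: "\<Psi> ` ball zp r' \<subseteq> W" using r(2) r'(2) sub_r by blast
  have EW: "E \<subseteq> W" using EB imW by blast
  have \<kappa>E: "\<kappa> x \<in> ball zp r'" "\<kappa> x \<in> ball zp \<rho>1" "\<kappa> x \<in> right_nbhd r" "\<Psi> (\<kappa> x) = x" if xE: "x \<in> E" for x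
  proof -
    obtain z where z: "z \<in> ball zp r'" "x = \<Psi> z" using EB xE by auto
    then have "\<kappa> x = z" using \<kappa>(3) by simp
    then show "\<kappa> x \<in> ball zp r'" "\<kappa> x \<in> ball zp \<rho>1" "\<kappa> x \<in> right_nbhd r" "\<Psi> (\<kappa> x) = x" using z r'(2) sub_r by auto
  qed
  have \<kappa>hol: "\<kappa> holomorphic_on E" using \<kappa>(1) EB by (rule holomorphic_on_subset)
  define f where "f x h = F (\<kappa> x) (cis \<theta> / h)" for x h
  have Wr: "R1 < Re (cis \<theta> / h)" if "h \<in> borel_disc \<theta> R1" for h using that by (simp add: borel_disc_def)
  have fsep: "sep_holomorphic_on E (borel_disc \<theta> R1) f"
    unfolding sep_holomorphic_on_def
  proof (intro conjI ballI)
    fix h assume h: "h \<in> borel_disc \<theta> R1"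
    have "(\<lambda>z. F z (cis \<theta> / h)) holomorphic_on ball zp \<rho>1" using F(5) Wr[OF h] by (simp add: sep_holomorphic_on_def)
    from holomorphic_on_compose_gen[OF \<kappa>hol this image_subsetI[OF \<kappa>E(2)]]
    show "(\<lambda>x. f x h) holomorphic_on E" by (simp add: o_def f_def)
  next
    fix x assume x: "x \<in> E"
    have Fx: "F (\<kappa> x) holomorphic_on {w. R1 < Re w}" using F(5) \<kappa>E[OF x] by (simp add: sep_holomorphic_on_def)
    have "(F (\<kappa> x) \<circ> (\<lambda>h. cis \<theta> / h)) holomorphic_on borel_disc \<theta> R1"
      by (rule holomorphic_on_compose_gen[OF _ Fx])
         (use Wr borel_disc_nonzero[OF R1] in \<open>auto intro!: holomorphic_intros\<close>)
    then show "f x holomorphic_on borel_disc \<theta> R1" by (simp add: o_def f_def[abs_def])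
  qed
  have ode: "h * deriv (\<lambda>y. f y h) x = a x h * (f x h)\<^sup>2 + b x h * f x h + c x h" if x: "x \<in> E" and h: "h \<in> borel_disc \<theta> R1" for x h
  proof -
    have h0: "h \<noteq> 0" using borel_disc_nonzero[OF R1 h] .
    define z where "z = \<kappa> x"
    define w where "w = cis \<theta> / h"
    have w: "R1 < Re w" "cis \<theta> / w = h" "h * w = cis \<theta>" using Wr[OF h] h0 by (auto simp: w_def)
    have z: "z \<in> ball zp \<rho>1" "z \<in> right_nbhd r" "\<Psi> z = x" using \<kappa>E[OF x] by (auto simp: z_def)
    have kd: "(\<kappa> has_field_derivative deriv \<kappa> x) (at x)" using \<kappa>hol x by (intro holomorphic_derivI[of _ E]) (auto simp: E_def)
    have "((\<lambda>z. F z w) has_field_derivative w * (A z w * (F z w)\<^sup>2 + B z w * F z w + D z w)) (at (\<kappa> x))"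
      using F(7)[OF z(1) w(1)] by (simp add: z_def)
    from DERIV_chain2[where f = "\<lambda>z. F z w" and g = \<kappa>, OF this kd]
    have "deriv (\<lambda>y. f y h) x = w * (A z w * (F z w)\<^sup>2 + B z w * F z w + D z w) * deriv \<kappa> x"
      unfolding f_def w_def[symmetric] by (rule DERIV_imp_deriv)
    then have "h * deriv (\<lambda>y. f y h) x = cis \<theta> * (A z w * (f x h)\<^sup>2 + B z w * f x h + D z w) * deriv \<kappa> x"
      unfolding w(3)[symmetric] by (simp add: f_def z_def w_def mult_ac)
    also have "A z w * (f x h)\<^sup>2 + B z w * f x h + D z w = of_real \<sigma> / Q x * (a x h * (f x h)\<^sup>2 + b x h * f x h + c x h)"
      unfolding A_def B_def D_def z(3) w(2) by (simp add: add_divide_distrib algebra_simps)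
    also have "cis \<theta> * (of_real \<sigma> / Q x * (a x h * (f x h)\<^sup>2 + b x h * f x h + c x h)) * deriv \<kappa> x
        = (of_real \<sigma> * cis \<theta> * deriv \<kappa> x / Q x) * (a x h * (f x h)\<^sup>2 + b x h * f x h + c x h)" by (simp add: mult_ac)
    also have "of_real \<sigma> * cis \<theta> * deriv \<kappa> x / Q x = 1"
    proof -
      have "deriv \<Psi> z * deriv \<kappa> x = 1" using \<kappa>(2)[OF \<kappa>E(1)[OF x]] \<kappa>E(4)[OF x] by (simp add: z_def)
      moreover have "of_real \<sigma> * cis \<theta> = deriv \<Psi> z * Q x" using chart[OF z(2)] z(3) by simp
      moreover have "Q x \<noteq> 0" using Q0(1)[OF z(2)] z(3) by simp
      ultimately show ?thesis by (simp add: mult_ac)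
    qed
    finally show ?thesis by simp
  qed
  define R2 where "R2 = max R1 1"
  have R2: "R2 > 0" "R1 \<le> R2" "R \<le> R2" "1 \<le> R2" using F(2) by (auto simp: R2_def)
  define H where "H = borel_disc \<theta> R2"
  have H1: "H \<subseteq> borel_disc \<theta> R1" "H \<subseteq> borel_disc \<theta> R" unfolding H_def by (intro borel_disc_mono R2)+
  have cK: "cball p \<rho>2 \<subseteq> W" using \<rho>2(2) imW by blast
  have bdd: "\<exists>B\<ge>0. \<forall>x\<in>E. cmod (k x) \<le> B" if "k holomorphic_on W" for k
  proof -
    have "compact (k ` cball p \<rho>2)"
      by (intro compact_continuous_image holomorphic_on_imp_continuous_on holomorphic_on_subset[OF that cK] compact_cball)
    then have "bounded (k ` cball p \<rho>2)" by (rule compact_imp_bounded)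
    then obtain B where "B > 0" "\<forall>y\<in>k ` cball p \<rho>2. cmod y \<le> B" unfolding bounded_pos by blast
    then show ?thesis by (intro exI[of _ B]) (auto simp: E_def)
  qed
  have QW: "Q x \<noteq> 0" if "x \<in> W" for x using Q0(1) that r(2) by auto
  obtain B1 where B1: "B1 \<ge> 0" "\<And>x. x \<in> E \<Longrightarrow> cmod (fh 0 x) \<le> B1" using bdd[OF fhol[of 0]] by blast
  obtain B2 where B2: "B2 \<ge> 0" "\<And>x. x \<in> E \<Longrightarrow> cmod (deriv (fh 0) x) \<le> B2" using bdd[OF holomorphic_deriv[OF fhol W]] by blast
  have "(\<lambda>x. inverse (of_real \<sigma> * Q x)) holomorphic_on W" using QW s2(2) by (auto intro!: holomorphic_intros Q)
  then obtain B3 where B3: "B3 \<ge> 0" "\<And>x. x \<in> E \<Longrightarrow> cmod (inverse (of_real \<sigma> * Q x)) \<le> B3" using bdd by blast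
  obtain B4 where B4: "B4 \<ge> 0" "\<And>x. x \<in> E \<Longrightarrow> cmod (Q x) \<le> B4" using bdd[OF Q] by blast
  define K2 where "K2 = K' + B1 + B2 + B3"
  have K2: "0 \<le> K2" "K' \<le> K2" "B1 \<le> K2" "B2 \<le> K2" "B3 \<le> K2" using B1 B2 B3 F(3) by (auto simp: K2_def)
  have gv: "gevrey_upto (B4 * C) M N H (k x) (series_at kh x)" if x: "x \<in> E"
    and k: "\<And>n x h. x \<in> W \<Longrightarrow> h \<in> borel_disc \<theta> R \<Longrightarrow> cmod (asym_remainder k kh n x h) \<le> cmod (Q x) * C * M ^ n * fact n * cmod h ^ n"
    for x k kh N
    unfolding gevrey_upto_def asym_remainder_eq[symmetric]
  proof (intro allI impI ballI)
    fix n h assume h: "h \<in> H"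
    have "cmod (asym_remainder k kh n x h) \<le> cmod (Q x) * C * M ^ n * fact n * cmod h ^ n"
      using k[of x h n] x EW h H1(2) by blast
    also have "\<dots> \<le> B4 * C * M ^ n * fact n * cmod h ^ n" using B4(2)[OF x] C M by (intro mult_right_mono) auto
    finally show "cmod (asym_remainder k kh n x h) \<le> B4 * C * M ^ n * fact n * cmod h ^ n" .
  qed
  have lim: "\<exists>h\<in>H. h \<noteq> 0 \<and> cmod h < e'" if e': "e' > 0" for e'
  proof -
    define S where "S = R2 + 1 + 1 / e'"
    have "0 < 1 / e'" using e' by simp
    then have S: "R2 < S" "1 / e' < S" "0 < S" using R2 unfolding S_def by linarith+
    have "1 / S < e'" using S e' by (simp add: field_simps)
    moreover have "cis \<theta> / of_real S \<in> H" unfolding H_def by (rule inv) (use S R2 in auto)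
    ultimately show ?thesis using S by (intro bexI[of _ "cis \<theta> / of_real S"]) (auto simp: norm_divide)
  qed
  obtain C' M' where CM': "C' > 0" "M' > 0"
    "\<And>x \<delta> h n. 0 < \<delta> \<Longrightarrow> \<delta> \<le> 1 \<Longrightarrow> ball x \<delta> \<subseteq> E \<Longrightarrow> h \<in> H \<Longrightarrow>
       cmod (asym_remainder f fh n x h) \<le> C' * (M' / \<delta>) ^ n * fact n * cmod h ^ n"
  proof (rule riccati_gevrey[where D = E and H = H and f = f and fh = fh and a = a and b = b and c = c and ah = ah and bh = bh and ch = ch
        and K = K2 and C = "B4 * C" and M = M])
    show "open E" by (simp add: E_def)
    show "0 \<notin> H" using borel_disc_nonzero[OF R2(1)] unfolding H_def by blast
    show "cmod h \<le> 1" if "h \<in> H" for h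
    proof -
      have "cmod h < 1 / R2" using borel_disc_norm[OF R2(1)] that unfolding H_def by blast
      also have "1 / R2 \<le> 1" using R2 by simp
      finally show ?thesis by simp
    qed
    show "\<exists>h\<in>H. h \<noteq> 0 \<and> cmod h < e'" if "e' > 0" for e' by (rule lim[OF that])
    show "(\<lambda>x. f x h) holomorphic_on E" if "h \<in> H" for h
      using fsep H1(1) that unfolding sep_holomorphic_on_def by blast
    show "fh k holomorphic_on E" for k by (rule holomorphic_on_subset[OF fhol EW])
    show "h * deriv (\<lambda>x. f x h) x = a x h * (f x h)\<^sup>2 + b x h * f x h + c x h" if "x \<in> E" "h \<in> H" for x h
      using ode[OF that(1)] H1(1) that(2) by blast
    show "cmod (f x h - fh 0 x) \<le> K2 * cmod h" if x: "x \<in> E" and h: "h \<in> H" for x h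
    proof -
      have h1: "h \<in> borel_disc \<theta> R1" using h H1 by blast
      have "cmod (F (\<kappa> x) (cis \<theta> / h) - F0 (\<kappa> x)) \<le> K' / cmod (cis \<theta> / h)" by (rule F(6)[OF \<kappa>E(2)[OF x] Wr[OF h1]])
      also have "\<dots> = K' * cmod h" by (simp add: norm_divide)
      also have "\<dots> \<le> K2 * cmod h" using K2 by (intro mult_right_mono) auto
      finally show ?thesis unfolding f_def F0_def \<kappa>E(4)[OF x] .
    qed
    show "fps_X * series_at (\<lambda>k. deriv (fh k)) x = series_at ah x * (series_at fh x)\<^sup>2 + series_at bh x * series_at fh x + series_at ch x"
      if "x \<in> E" for x using fser EW that by blast
    show "gevrey_upto (B4 * C) M N H (a x) (series_at ah x)" if "x \<in> E" for x N by (rule gv[OF that gev(1)])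
    show "gevrey_upto (B4 * C) M N H (b x) (series_at bh x)" if "x \<in> E" for x N by (rule gv[OF that gev(2)])
    show "gevrey_upto (B4 * C) M N H (c x) (series_at ch x)" if "x \<in> E" for x N by (rule gv[OF that gev(3)])
    show "cmod (fh 0 x) \<le> K2" if "x \<in> E" for x using B1(2)[OF that] K2 by linarith
    show "cmod (deriv (fh 0) x) \<le> K2" if "x \<in> E" for x using B2(2)[OF that] K2 by linarith
    show "cmod (inverse (2 * ah 0 x * fh 0 x + bh 0 x)) \<le> K2" if "x \<in> E" for x
      using B3(2)[OF that] K2 lead[OF subsetD[OF EW that]] by simp
    show "2 * ah 0 x * fh 0 x + bh 0 x \<noteq> 0" if "x \<in> E" for x
      using lead[OF subsetD[OF EW that]] QW[OF subsetD[OF EW that]] s2(2) by simp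
  qed (use B4 C M K2 that in auto)
  define \<delta> where "\<delta> = min 1 (\<rho>2 / 2)"
  have \<delta>: "0 < \<delta>" "\<delta> \<le> 1" "\<delta> \<le> \<rho>2 / 2" using \<rho>2 by (auto simp: \<delta>_def)
  have bsub: "ball x \<delta> \<subseteq> E" if "x \<in> ball p (\<rho>2 / 2)" for x
  proof
    fix y assume "y \<in> ball x \<delta>"
    then have "dist p y < \<rho>2 / 2 + \<delta>" using that dist_triangle[of p y x] by simp
    then show "y \<in> E" using \<delta> by (simp add: E_def)
  qed
  have half: "ball p (\<rho>2 / 2) \<subseteq> E" using \<rho>2 by (auto simp: E_def intro!: subset_ball)
  show thesis
  proof (rule that[of "\<rho>2 / 2" R2 f C' "M' / \<delta>"])
    show "sep_holomorphic_on (ball p (\<rho>2 / 2)) (borel_disc \<theta> R2) f"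
      using sep_holomorphic_subset[OF fsep half] H1(1) unfolding H_def by blast
    show "h * deriv (\<lambda>y. f y h) x = a x h * (f x h)\<^sup>2 + b x h * f x h + c x h"
      if "x \<in> ball p (\<rho>2 / 2)" "h \<in> borel_disc \<theta> R2" for x h
      using ode[of x h] half H1(1) that unfolding H_def by blast
    show "cmod (asym_remainder f fh n x h) \<le> C' * (M' / \<delta>) ^ n * fact n * cmod h ^ n"
      if "x \<in> ball p (\<rho>2 / 2)" "h \<in> borel_disc \<theta> R2" for n x h
      using CM'(3)[OF \<delta>(1,2) bsub[OF that(1)], of h n] that(2) unfolding H_def by blast
    show "ball p (\<rho>2 / 2) \<subseteq> W" using half EW by blast
  qed (use \<rho>2 R2 CM' \<delta> in auto)
qed

section \<open>Gluing over compact sets\<close>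

definition gevrey_riccati_solution ::
  "real \<Rightarrow> (complex \<Rightarrow> complex \<Rightarrow> complex) \<Rightarrow> (complex \<Rightarrow> complex \<Rightarrow> complex) \<Rightarrow> (complex \<Rightarrow> complex \<Rightarrow> complex) \<Rightarrow>
   (nat \<Rightarrow> complex \<Rightarrow> complex) \<Rightarrow> complex set \<Rightarrow> real \<Rightarrow> real \<Rightarrow> real \<Rightarrow> (complex \<Rightarrow> complex \<Rightarrow> complex) \<Rightarrow> bool" where
  "gevrey_riccati_solution \<theta> a b c fh U R C M f \<longleftrightarrow>
     sep_holomorphic_on U (borel_disc \<theta> R) f \<and>
     (\<forall>x\<in>U. \<forall>h\<in>borel_disc \<theta> R. h * deriv (\<lambda>y. f y h) x = a x h * (f x h)\<^sup>2 + b x h * f x h + c x h) \<and>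
     (\<forall>n. \<forall>x\<in>U. \<forall>h\<in>borel_disc \<theta> R. cmod (asym_remainder f fh n x h) \<le> C * M ^ n * fact n * cmod h ^ n)"

text \<open>
  Two local solutions agree wherever both are defined, because both have the same Gevrey expansion
  on a Borel disc. So they can be glued; compactness keeps the constants and the disc uniform.
\<close>

lemma glue_gevrey_solutions:
  assumes local: "\<And>p. p \<in> W \<Longrightarrow> \<exists>\<rho> R' C M f. 0 < \<rho> \<and> R \<le> R' \<and> ball p \<rho> \<subseteq> W \<and> 0 < C \<and> 0 < M \<and>
      gevrey_riccati_solution \<theta> a b c fh (ball p \<rho>) R' C M f"
    and R: "R > 0" and K: "compact K" "K \<subseteq> W"
  obtains V R' C M f where "open V" "K \<subseteq> V" "V \<subseteq> W" "R \<le> R'" "0 < C" "0 < M"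
    "gevrey_riccati_solution \<theta> a b c fh V R' C M f"
proof -
  obtain \<rho> Rf Cf Mf ff where loc: "\<And>p. p \<in> W \<Longrightarrow> 0 < \<rho> p \<and> R \<le> Rf p \<and> ball p (\<rho> p) \<subseteq> W \<and> 0 < Cf p \<and> 0 < Mf p \<and>
      gevrey_riccati_solution \<theta> a b c fh (ball p (\<rho> p)) (Rf p) (Cf p) (Mf p) (ff p)"
    using local by metis
  have "K \<subseteq> (\<Union>p\<in>K. ball p (\<rho> p))" using loc K(2) by (meson UN_I centre_in_ball subset_iff)
  then obtain P where P: "P \<subseteq> K" "finite P" "K \<subseteq> (\<Union>p\<in>P. ball p (\<rho> p))"
    using compactE_image[OF K(1), of K "\<lambda>p. ball p (\<rho> p)"] by auto
  have PW: "p \<in> W" if "p \<in> P" for p using that P(1) K(2) by blast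
  define R' where "R' = Max (insert R (Rf ` P))"
  define C where "C = Max (insert 1 (Cf ` P))"
  define M where "M = Max (insert 1 (Mf ` P))"
  have mx: "Rf p \<le> R'" "Cf p \<le> C" "Mf p \<le> M" if "p \<in> P" for p
    using that P(2) by (auto simp: R'_def C_def M_def)
  have mx0: "R \<le> R'" "1 \<le> C" "1 \<le> M" using P(2) by (auto simp: R'_def C_def M_def)
  have R': "R' > 0" using mx0 R by linarith
  define H where "H = borel_disc \<theta> R'"
  have HR: "H \<subseteq> borel_disc \<theta> (Rf p)" if "p \<in> P" for p unfolding H_def by (rule borel_disc_mono[OF mx(1)[OF that]])
  have sol: "sep_holomorphic_on (ball p (\<rho> p)) H (ff p)"
    "\<And>x h. x \<in> ball p (\<rho> p) \<Longrightarrow> h \<in> H \<Longrightarrow> h * deriv (\<lambda>y. ff p y h) x = a x h * (ff p x h)\<^sup>2 + b x h * ff p x h + c x h"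
    "\<And>n x h. x \<in> ball p (\<rho> p) \<Longrightarrow> h \<in> H \<Longrightarrow> cmod (asym_remainder (ff p) fh n x h) \<le> C * M ^ n * fact n * cmod h ^ n"
    if p: "p \<in> P" for p
  proof -
    have g: "gevrey_riccati_solution \<theta> a b c fh (ball p (\<rho> p)) (Rf p) (Cf p) (Mf p) (ff p)" and pos: "0 < Cf p" "0 < Mf p"
      using loc[OF PW[OF p]] by auto
    show "sep_holomorphic_on (ball p (\<rho> p)) H (ff p)"
      using g sep_holomorphic_subset[OF _ order_refl HR[OF p]] unfolding gevrey_riccati_solution_def by blast
    fix x h assume x: "x \<in> ball p (\<rho> p)" and h: "h \<in> H"
    have h': "h \<in> borel_disc \<theta> (Rf p)" using h HR[OF p] by blast
    show "h * deriv (\<lambda>y. ff p y h) x = a x h * (ff p x h)\<^sup>2 + b x h * ff p x h + c x h"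
      using g x h' unfolding gevrey_riccati_solution_def by blast
    fix n
    have "cmod (asym_remainder (ff p) fh n x h) \<le> Cf p * Mf p ^ n * fact n * cmod h ^ n"
      using g x h' unfolding gevrey_riccati_solution_def by blast
    also have "\<dots> \<le> C * M ^ n * fact n * cmod h ^ n"
      using mx[OF p] pos mx0 by (intro mult_right_mono mult_mono power_mono) auto
    finally show "cmod (asym_remainder (ff p) fh n x h) \<le> C * M ^ n * fact n * cmod h ^ n" .
  qed
  have asy: "gevrey_asymptotics {x} H (\<lambda>_. 1) (ff p) fh" if "p \<in> P" "x \<in> ball p (\<rho> p)" for p x
  proof -
    have "\<forall>n. \<forall>x'\<in>{x}. \<forall>h\<in>H. cmod h < 1 \<longrightarrow> cmod (asym_remainder (ff p) fh n x' h) \<le> cmod 1 * C * M ^ n * fact n * cmod h ^ n"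
      using sol(3)[OF that] by simp
    moreover have "C > 0" "M > 0" using mx0 by auto
    ultimately show ?thesis unfolding gevrey_asymptotics_def using zero_less_one by blast
  qed
  have agree: "ff p x h = ff p' x h" if p: "p \<in> P" "x \<in> ball p (\<rho> p)" and p': "p' \<in> P" "x \<in> ball p' (\<rho> p')" and h: "h \<in> H" for p p' x h
  proof (rule gevrey_unique[OF R', where f = "ff p" and g = "ff p'" and x = x and U = "{x}" and fh = fh])
    show "ff p x holomorphic_on borel_disc \<theta> R'" "ff p' x holomorphic_on borel_disc \<theta> R'"
      using sol(1)[OF p(1)] p(2) sol(1)[OF p'(1)] p'(2) unfolding sep_holomorphic_on_def H_def by blast+
    show "gevrey_asymptotics {x} (borel_disc \<theta> R') (\<lambda>_. 1) (ff p) fh" using asy[OF p] unfolding H_def .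
    show "gevrey_asymptotics {x} (borel_disc \<theta> R') (\<lambda>_. 1) (ff p') fh" using asy[OF p'] unfolding H_def .
  qed (use h in \<open>auto simp: H_def\<close>)
  define V where "V = (\<Union>p\<in>P. ball p (\<rho> p))"
  define f where "f x = ff (SOME p. p \<in> P \<and> x \<in> ball p (\<rho> p)) x" for x
  have f: "f x h = ff p x h" if "p \<in> P" "x \<in> ball p (\<rho> p)" "h \<in> H" for p x h
  proof -
    have "\<exists>p. p \<in> P \<and> x \<in> ball p (\<rho> p)" using that by blast
    from someI_ex[OF this] show ?thesis unfolding f_def using agree that by blast
  qed
  show thesis
  proof (rule that[of V R' C M f])
    show "V \<subseteq> W" unfolding V_def using loc PW by blast
    show "gevrey_riccati_solution \<theta> a b c fh V R' C M f"
      unfolding gevrey_riccati_solution_def H_def[symmetric]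
    proof (intro conjI ballI allI)
      show "sep_holomorphic_on V H f"
        unfolding sep_holomorphic_on_def
      proof (intro conjI ballI)
        fix h assume h: "h \<in> H"
        show "(\<lambda>x. f x h) holomorphic_on V" unfolding V_def
        proof (rule holomorphic_on_UN_open)
          fix p assume p: "p \<in> P"
          have "(\<lambda>x. ff p x h) holomorphic_on ball p (\<rho> p)" using sol(1)[OF p] h unfolding sep_holomorphic_on_def by blast
          then show "(\<lambda>x. f x h) holomorphic_on ball p (\<rho> p)"
            by (rule holomorphic_transform) (simp add: f[OF p _ h])
        qed simp
      next
        fix x assume "x \<in> V"
        then obtain p where p: "p \<in> P" "x \<in> ball p (\<rho> p)" by (auto simp: V_def)
        have "ff p x holomorphic_on H" using sol(1)[OF p(1)] p(2) unfolding sep_holomorphic_on_def by blast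
        then show "f x holomorphic_on H" by (rule holomorphic_transform) (rule f[OF p, symmetric])
      qed
    next
      fix x h assume "x \<in> V" and h: "h \<in> H"
      then obtain p where p: "p \<in> P" "x \<in> ball p (\<rho> p)" by (auto simp: V_def)
      have "\<forall>\<^sub>F y in nhds x. f y h = ff p y h"
        using eventually_nhds_in_open[OF open_ball p(2)] by eventually_elim (rule f[OF p(1) _ h])
      then have "deriv (\<lambda>y. f y h) x = deriv (\<lambda>y. ff p y h) x" by (rule deriv_cong_ev) simp
      then show "h * deriv (\<lambda>y. f y h) x = a x h * (f x h)\<^sup>2 + b x h * f x h + c x h"
        using sol(2)[OF p h] f[OF p h] by simp
    next
      fix n x h assume "x \<in> V" and h: "h \<in> H"
      then obtain p where p: "p \<in> P" "x \<in> ball p (\<rho> p)" by (auto simp: V_def)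
      show "cmod (asym_remainder f fh n x h) \<le> C * M ^ n * fact n * cmod h ^ n"
        using sol(3)[OF p h, of n] f[OF p h] by (simp add: asym_remainder_def)
    qed
  qed (use P mx0 in \<open>auto simp: V_def\<close>)
qed

section \<open>The theorem\<close>

lemma gevrey_on_borel_disc:
  assumes S: "sectorial_domain (\<theta> - pi / 2) (\<theta> + pi / 2) S"
    and gev: "gevrey_asymptotics W S Q a ah" "gevrey_asymptotics W S Q b bh" "gevrey_asymptotics W S Q c ch"
  obtains R C M where "R > 0" "borel_disc \<theta> R \<subseteq> S" "0 \<le> C" "0 \<le> M"
    "\<And>n x h. x \<in> W \<Longrightarrow> h \<in> borel_disc \<theta> R \<Longrightarrow> cmod (asym_remainder a ah n x h) \<le> cmod (Q x) * C * M ^ n * fact n * cmod h ^ n"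
    "\<And>n x h. x \<in> W \<Longrightarrow> h \<in> borel_disc \<theta> R \<Longrightarrow> cmod (asym_remainder b bh n x h) \<le> cmod (Q x) * C * M ^ n * fact n * cmod h ^ n"
    "\<And>n x h. x \<in> W \<Longrightarrow> h \<in> borel_disc \<theta> R \<Longrightarrow> cmod (asym_remainder c ch n x h) \<le> cmod (Q x) * C * M ^ n * fact n * cmod h ^ n"
proof -
  obtain RS where RS: "RS > 0" "borel_disc \<theta> RS \<subseteq> S" using borel_disc_subset_sectorial[OF S] .
  have one: "\<exists>R\<ge>RS. \<exists>C>0. \<exists>M>0. \<forall>n. \<forall>x\<in>W. \<forall>h\<in>borel_disc \<theta> R.
      cmod (asym_remainder k kh n x h) \<le> cmod (Q x) * C * M ^ n * fact n * cmod h ^ n"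
    if k: "gevrey_asymptotics W S Q k kh" for k kh
  proof -
    obtain C M \<delta> where g: "C > 0" "M > 0" "\<delta> > 0"
      "\<And>n x h. x \<in> W \<Longrightarrow> h \<in> S \<Longrightarrow> cmod h < \<delta> \<Longrightarrow> cmod (asym_remainder k kh n x h) \<le> cmod (Q x) * C * M ^ n * fact n * cmod h ^ n"
      using k unfolding gevrey_asymptotics_def by blast
    define R where "R = max RS (1 / \<delta>)"
    have R: "RS \<le> R" "1 / \<delta> \<le> R" "R > 0" using RS by (auto simp: R_def)
    have "cmod h < \<delta> \<and> h \<in> S" if h: "h \<in> borel_disc \<theta> R" for h
    proof -
      have "cmod h < 1 / R" by (rule borel_disc_norm[OF R(3) h])
      also have "1 / R \<le> \<delta>" using R g(3) by (simp add: field_simps)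
      finally show ?thesis using borel_disc_mono[OF R(1)] h RS(2) by blast
    qed
    then show ?thesis using g(1,2,4) R(1) by blast
  qed
  obtain R1 C1 M1 where 1: "R1 \<ge> RS" "C1 > 0" "M1 > 0" "\<And>n x h. x \<in> W \<Longrightarrow> h \<in> borel_disc \<theta> R1 \<Longrightarrow>
      cmod (asym_remainder a ah n x h) \<le> cmod (Q x) * C1 * M1 ^ n * fact n * cmod h ^ n" using one[OF gev(1)] by blast
  obtain R2 C2 M2 where 2: "R2 \<ge> RS" "C2 > 0" "M2 > 0" "\<And>n x h. x \<in> W \<Longrightarrow> h \<in> borel_disc \<theta> R2 \<Longrightarrow>
      cmod (asym_remainder b bh n x h) \<le> cmod (Q x) * C2 * M2 ^ n * fact n * cmod h ^ n" using one[OF gev(2)] by blast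
  obtain R3 C3 M3 where 3: "R3 \<ge> RS" "C3 > 0" "M3 > 0" "\<And>n x h. x \<in> W \<Longrightarrow> h \<in> borel_disc \<theta> R3 \<Longrightarrow>
      cmod (asym_remainder c ch n x h) \<le> cmod (Q x) * C3 * M3 ^ n * fact n * cmod h ^ n" using one[OF gev(3)] by blast
  define R where "R = max R1 (max R2 R3)"
  define C where "C = max C1 (max C2 C3)"
  define M where "M = max M1 (max M2 M3)"
  have le: "R1 \<le> R" "R2 \<le> R" "R3 \<le> R" "C1 \<le> C" "C2 \<le> C" "C3 \<le> C" "M1 \<le> M" "M2 \<le> M" "M3 \<le> M"
    by (auto simp: R_def C_def M_def)
  have mono: "cmod (Q x) * C' * M' ^ n * fact n * cmod h ^ n \<le> cmod (Q x) * C * M ^ n * fact n * cmod h ^ n"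
    if "0 < C'" "C' \<le> C" "0 < M'" "M' \<le> M" for C' M' x h n
    using that by (intro mult_right_mono mult_mono mult_left_mono power_mono) auto
  show thesis
  proof (rule that[of R C M])
    show "R > 0" "0 \<le> C" "0 \<le> M" using RS(1) 1 le by linarith+
    have "RS \<le> R" using 1 le by linarith
    then show "borel_disc \<theta> R \<subseteq> S" using borel_disc_mono[of RS R \<theta>] RS(2) by blast
    fix n x h assume x: "x \<in> W" and h: "h \<in> borel_disc \<theta> R"
    have hs: "h \<in> borel_disc \<theta> R1" "h \<in> borel_disc \<theta> R2" "h \<in> borel_disc \<theta> R3"
      using h borel_disc_mono[OF le(1)] borel_disc_mono[OF le(2)] borel_disc_mono[OF le(3)] by blast+
    show "cmod (asym_remainder a ah n x h) \<le> cmod (Q x) * C * M ^ n * fact n * cmod h ^ n"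
      by (rule order_trans[OF 1(4)[OF x hs(1)] mono]) (rule 1 le)+
    show "cmod (asym_remainder b bh n x h) \<le> cmod (Q x) * C * M ^ n * fact n * cmod h ^ n"
      by (rule order_trans[OF 2(4)[OF x hs(2)] mono]) (rule 2 le)+
    show "cmod (asym_remainder c ch n x h) \<le> cmod (Q x) * C * M ^ n * fact n * cmod h ^ n"
      by (rule order_trans[OF 3(4)[OF x hs(3)] mono]) (rule 3 le)+
  qed
qed

text \<open>
  The formula defining \<open>f0\<close> is only available where \<open>a0\<close> does not vanish; unless \<open>a0\<close> is identically zero,
  these points form a nonempty open subset of \<open>W\<close>, and the identity theorem extends the relation.
\<close>

lemma leading_order_slope:
  assumes X: "open X" "connected X" and W: "open W" "connected W" "W \<noteq> {}" "W \<subseteq> X"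
    and hol: "a0 holomorphic_on X" "b0 holomorphic_on X" "Q holomorphic_on W"
    and lead: "leading_order_solution X W a0 b0 c0 Q \<sigma> f0" and x: "x \<in> W"
  shows "2 * a0 x * f0 x + b0 x = of_real \<sigma> * Q x"
proof (cases "\<forall>x\<in>X. a0 x = 0")
  case True
  then have "\<sigma> = 1" "Q x = b0 x" using lead x unfolding leading_order_solution_def by auto
  moreover have "a0 x = 0" using True x W by blast
  ultimately show ?thesis by simp
next
  case False
  have f0: "f0 holomorphic_on W" "\<And>x. x \<in> W \<Longrightarrow> a0 x \<noteq> 0 \<Longrightarrow> f0 x = (- b0 x + of_real \<sigma> * Q x) / (2 * a0 x)"
    using lead False unfolding leading_order_solution_def by auto
  have aW: "a0 holomorphic_on W" "b0 holomorphic_on W" using hol W(4) by (auto intro: holomorphic_on_subset)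
  define Z where "Z = {y \<in> W. a0 y \<noteq> 0}"
  have Z: "open Z"
    unfolding Z_def using continuous_open_preimage[OF holomorphic_on_imp_continuous_on[OF aW(1)] W(1), of "- {0}"]
    by (simp add: vimage_def Int_def open_Compl)
  have Zne: "Z \<noteq> {}"
  proof
    assume "Z = {}"
    then have "a0 y = 0" if "y \<in> W" for y using that by (auto simp: Z_def)
    then have "a0 y = 0" if "y \<in> X" for y
      using analytic_continuation_open[OF W(1) X(1) W(3) X(2) W(4) hol(1) holomorphic_on_const[of 0], of y] that by blast
    then show False using False by blast
  qed
  have "(\<lambda>y. 2 * a0 y * f0 y + b0 y) holomorphic_on W" "(\<lambda>y. of_real \<sigma> * Q y) holomorphic_on W"
    using aW f0(1) hol(3) by (auto intro!: holomorphic_intros)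
  from analytic_continuation_open[OF Z W(1) Zne W(2) _ this _ x]
  show ?thesis using f0(2) by (auto simp: Z_def)
qed

theorem theorem211027140644:
  fixes \<theta> \<sigma> :: real
    and X S W N :: "complex set"
    and a b c :: "complex \<Rightarrow> complex \<Rightarrow> complex"
    and ah bh ch fh :: "nat \<Rightarrow> complex \<Rightarrow> complex"
    and x0 :: complex
    and q Q :: "complex \<Rightarrow> complex"
  assumes X: "domain X"
    and S: "sectorial_domain (\<theta> - pi / 2) (\<theta> + pi / 2) S"
    and holo: "holomorphic2_on a (X \<times> S)" "holomorphic2_on b (X \<times> S)" "holomorphic2_on c (X \<times> S)"
    and coeffs_holo: "\<And>k. ah k holomorphic_on X" "\<And>k. bh k holomorphic_on X"
      "\<And>k. ch k holomorphic_on X"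
    and asym:
      "locally_uniform_asymptotics X (\<theta> - pi / 2) (\<theta> + pi / 2) S a ah"
      "locally_uniform_asymptotics X (\<theta> - pi / 2) (\<theta> + pi / 2) S b bh"
      "locally_uniform_asymptotics X (\<theta> - pi / 2) (\<theta> + pi / 2) S c ch"
    and D0_nonzero: "\<exists>x\<in>X. leading_discriminant ah bh ch x \<noteq> 0"
    and x0: "x0 \<in> X" "leading_discriminant ah bh ch x0 \<noteq> 0"
    and branch: "open N" "x0 \<in> N" "N \<subseteq> X" "sqrt_branch N (leading_discriminant ah bh ch) q"
    and sign: "\<sigma> = 1 \<or> \<sigma> = -1"
    and W: "wkb_halfstrip X x0 q \<theta> \<sigma> W"
    and minus: "\<sigma> = -1 \<Longrightarrow> \<forall>x\<in>W. ah 0 x \<noteq> 0"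
    and branch_W: "sqrt_branch W (leading_discriminant ah bh ch) Q" "\<forall>\<^sub>F x in nhds x0. Q x = q x"
    and gevrey: "gevrey_asymptotics W S Q a ah" "gevrey_asymptotics W S Q b bh"
      "gevrey_asymptotics W S Q c ch"
    and leading: "leading_order_solution X W (ah 0) (bh 0) (ch 0) Q \<sigma> (fh 0)"
    and formal: "formal_riccati_solution W ah bh ch fh"
  shows "(\<exists>U. domain U \<and> x0 \<in> U \<and> U \<subseteq> W \<and> borel_summable \<theta> U fh) \<and>
    (\<forall>U0. domain U0 \<and> compactly_contained U0 W \<longrightarrow>
       borel_summable \<theta> U0 fh \<and>
       (\<exists>S0 f \<phi>. sectorial_domain (\<theta> - pi / 2) (\<theta> + pi / 2) S0 \<and> S0 \<subseteq> S \<and>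
          riccati_solution U0 S0 a b c f \<and> gevrey_asymptotics U0 S0 (\<lambda>_. 1) f fh \<and>
          (\<forall>g. riccati_solution U0 S0 a b c g \<and> gevrey_asymptotics U0 S0 (\<lambda>_. 1) g fh \<longrightarrow>
             (\<forall>x\<in>U0. \<forall>h\<in>S0. g x h = f x h)) \<and>
          borel_continuation \<theta> U0 fh \<phi> \<and>
          (\<forall>h\<in>S0. laplace_uniformly_convergent \<theta> U0 \<phi> h \<and>
             (\<forall>x\<in>U0. f x h = borel_resummation \<theta> fh \<phi> x h))))"
proof -
  have Xo: "open X" "connected X" using X by (auto simp: domain_def)
  have qN: "q holomorphic_on N" and QW: "Q holomorphic_on W" using branch(4) branch_W(1) by (auto simp: sqrt_branch_def)
  obtain r \<Psi> where \<Psi>: "r > 0" "\<Psi> holomorphic_on right_nbhd r" "W = \<Psi> ` right_nbhd r"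
      "\<And>z. z \<in> right_nbhd r \<Longrightarrow> deriv \<Psi> z * Q (\<Psi> z) = of_real \<sigma> * cis \<theta>"
    and Wo: "open W" "x0 \<in> W" "W \<subseteq> X"
    using wkb_chart[OF W sign branch(1,2) qN QW branch_W(2)] by blast
  have Wc: "connected W" unfolding \<Psi>(3)
    by (intro connected_continuous_image holomorphic_on_imp_continuous_on \<Psi>(2) convex_connected convex_right_nbhd)
  have slope: "2 * ah 0 x * fh 0 x + bh 0 x = of_real \<sigma> * Q x" if "x \<in> W" for x
    using leading_order_slope[OF Xo Wo(1) Wc _ Wo(3) coeffs_holo(1,2) QW leading that] Wo(2) by blast
  obtain R C M where RCM: "R > 0" "borel_disc \<theta> R \<subseteq> S" "0 \<le> C" "0 \<le> M"
    and gev: "\<And>n x h. x \<in> W \<Longrightarrow> h \<in> borel_disc \<theta> R \<Longrightarrow> cmod (asym_remainder a ah n x h) \<le> cmod (Q x) * C * M ^ n * fact n * cmod h ^ n"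
      "\<And>n x h. x \<in> W \<Longrightarrow> h \<in> borel_disc \<theta> R \<Longrightarrow> cmod (asym_remainder b bh n x h) \<le> cmod (Q x) * C * M ^ n * fact n * cmod h ^ n"
      "\<And>n x h. x \<in> W \<Longrightarrow> h \<in> borel_disc \<theta> R \<Longrightarrow> cmod (asym_remainder c ch n x h) \<le> cmod (Q x) * C * M ^ n * fact n * cmod h ^ n"
    using gevrey_on_borel_disc[OF S gevrey] by blast
  have sep: "sep_holomorphic_on W (borel_disc \<theta> R) a" "sep_holomorphic_on W (borel_disc \<theta> R) b"
    "sep_holomorphic_on W (borel_disc \<theta> R) c"
    by (rule sep_holomorphic_subset[OF holomorphic2_on_imp_sep Wo(3) RCM(2)], rule holo)+
  have hol: "ah 0 holomorphic_on W" "bh 0 holomorphic_on W" "ch 0 holomorphic_on W"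
    by (rule holomorphic_on_subset[OF coeffs_holo(1) Wo(3)] holomorphic_on_subset[OF coeffs_holo(2) Wo(3)]
        holomorphic_on_subset[OF coeffs_holo(3) Wo(3)])+
  have fhol: "fh k holomorphic_on W" for k using formal unfolding formal_riccati_solution_def by blast
  have local: "\<exists>\<rho> R' C M f. 0 < \<rho> \<and> R \<le> R' \<and> ball p \<rho> \<subseteq> W \<and> 0 < C \<and> 0 < M \<and>
      gevrey_riccati_solution \<theta> a b c fh (ball p \<rho>) R' C M f" if p: "p \<in> W" for p
  proof (rule local_exact_solution[OF \<Psi>(2,3,4) sign Wo(1) QW RCM(1) sep hol RCM(3,4) gev slope formal p])
    fix \<rho> R' f C' M'
    assume *: "\<rho> > 0" "R' \<ge> R" "ball p \<rho> \<subseteq> W" "C' > 0" "M' > 0"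
      and "sep_holomorphic_on (ball p \<rho>) (borel_disc \<theta> R') f"
      and "\<And>x h. x \<in> ball p \<rho> \<Longrightarrow> h \<in> borel_disc \<theta> R' \<Longrightarrow>
          h * deriv (\<lambda>y. f y h) x = a x h * (f x h)\<^sup>2 + b x h * f x h + c x h"
      and "\<And>n x h. x \<in> ball p \<rho> \<Longrightarrow> h \<in> borel_disc \<theta> R' \<Longrightarrow>
          cmod (asym_remainder f fh n x h) \<le> C' * M' ^ n * fact n * cmod h ^ n"
    then have "gevrey_riccati_solution \<theta> a b c fh (ball p \<rho>) R' C' M' f"
      unfolding gevrey_riccati_solution_def by blast
    then show ?thesis using * by blast
  qed
  have main: "\<exists>S0 f \<phi>. sectorial_domain (\<theta> - pi / 2) (\<theta> + pi / 2) S0 \<and> S0 \<subseteq> S \<and>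
      riccati_solution U0 S0 a b c f \<and> gevrey_asymptotics U0 S0 (\<lambda>_. 1) f fh \<and>
      (\<forall>g. riccati_solution U0 S0 a b c g \<and> gevrey_asymptotics U0 S0 (\<lambda>_. 1) g fh \<longrightarrow>
         (\<forall>x\<in>U0. \<forall>h\<in>S0. g x h = f x h)) \<and>
      borel_continuation \<theta> U0 fh \<phi> \<and>
      (\<forall>h\<in>S0. laplace_uniformly_convergent \<theta> U0 \<phi> h \<and>
         (\<forall>x\<in>U0. f x h = borel_resummation \<theta> fh \<phi> x h))"
    if U0: "domain U0" "compactly_contained U0 W" for U0
  proof -
    have Uo: "open U0" using U0(1) by (simp add: domain_def)
    have cl: "compact (closure U0)" "closure U0 \<subseteq> W" using U0(2) by (auto simp: compactly_contained_def)
    obtain V R' C' M' f where V: "closure U0 \<subseteq> V" "V \<subseteq> W" and R': "R \<le> R'" and CM: "0 < C'" "0 < M'"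
      and f: "gevrey_riccati_solution \<theta> a b c fh V R' C' M' f"
      by (rule glue_gevrey_solutions[OF local RCM(1) cl])
    have UV: "U0 \<subseteq> V" "U0 \<subseteq> W" using V closure_subset[of U0] by blast+
    have R'0: "0 < R'" using R' RCM(1) by linarith
    have fsep: "sep_holomorphic_on U0 (borel_disc \<theta> R') f"
      and fode: "\<And>x h. x \<in> U0 \<Longrightarrow> h \<in> borel_disc \<theta> R' \<Longrightarrow> h * deriv (\<lambda>y. f y h) x = a x h * (f x h)\<^sup>2 + b x h * f x h + c x h"
      and fbd: "\<And>n x h. x \<in> U0 \<Longrightarrow> h \<in> borel_disc \<theta> R' \<Longrightarrow> cmod (asym_remainder f fh n x h) \<le> C' * M' ^ n * fact n * cmod h ^ n"
      using f sep_holomorphic_subset[OF _ UV(1) order_refl] UV(1) unfolding gevrey_riccati_solution_def by blast+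
    obtain \<phi> where \<phi>: "borel_continuation \<theta> U0 fh \<phi>"
      "\<And>h. h \<in> borel_disc \<theta> (R' + 1) \<Longrightarrow> laplace_uniformly_convergent \<theta> U0 \<phi> h"
      "\<And>x h. x \<in> U0 \<Longrightarrow> h \<in> borel_disc \<theta> (R' + 1) \<Longrightarrow> f x h = borel_resummation \<theta> fh \<phi> x h"
      using borel_summation[OF Uo R'0 less_add_one less_imp_le[OF CM(1)] CM(2) fsep holomorphic_on_subset[OF fhol UV(2)] fbd]
      by blast
    \<comment> \<open>The Laplace representation is available on any smaller disc than the one carrying the bounds.\<close>
    define S0 where "S0 = borel_disc \<theta> (R' + 1)"
    have R1: "0 < R' + 1" using R'0 by simp
    have S0: "S0 \<subseteq> borel_disc \<theta> R'" unfolding S0_def by (rule borel_disc_mono) simp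
    have S0S: "S0 \<subseteq> S" using S0 borel_disc_mono[OF R'] RCM(2) by blast
    have S0o: "open S0" unfolding S0_def by (rule open_borel_disc[OF R1])
    have "holomorphic2_on f (U0 \<times> S0)"
    proof (rule osgood[OF Uo S0o sep_holomorphic_subset[OF fsep order_refl S0]])
      fix x h assume "x \<in> U0" "h \<in> S0"
      obtain e1 where e1: "e1 > 0" "ball x e1 \<subseteq> U0" using Uo \<open>x \<in> U0\<close> open_contains_ball by blast
      obtain e2 where e2: "e2 > 0" "ball h e2 \<subseteq> S0" using S0o \<open>h \<in> S0\<close> open_contains_ball by blast
      have sub: "ball x (min e1 e2) \<subseteq> U0" "ball h (min e1 e2) \<subseteq> S0" using e1(2) e2(2) by auto
      have "cmod (f x' h') \<le> C'" if "x' \<in> U0" "h' \<in> S0" for x' h'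
        using fbd[OF that(1) subsetD[OF S0 that(2)], of 0] by (simp add: asym_remainder_def)
      then show "\<exists>r>0. \<exists>B. ball x r \<subseteq> U0 \<and> ball h r \<subseteq> S0 \<and> (\<forall>x'\<in>ball x r. \<forall>y'\<in>ball h r. cmod (f x' y') \<le> B)"
        using sub e1(1) e2(1) by (intro exI[of _ "min e1 e2"] conjI exI[of _ C']) (auto simp del: mem_ball)
    qed
    then have sol: "riccati_solution U0 S0 a b c f"
      using fode S0 unfolding riccati_solution_def by blast
    have asy: "gevrey_asymptotics U0 S0 (\<lambda>_. 1) f fh"
    proof -
      have "\<forall>n. \<forall>x\<in>U0. \<forall>h\<in>S0. cmod h < 1 \<longrightarrow> cmod (asym_remainder f fh n x h) \<le> cmod 1 * C' * M' ^ n * fact n * cmod h ^ n"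
        using fbd S0 by auto
      then show ?thesis unfolding gevrey_asymptotics_def using CM zero_less_one by blast
    qed
    have uniq: "g x h = f x h" if g: "riccati_solution U0 S0 a b c g" "gevrey_asymptotics U0 S0 (\<lambda>_. 1) g fh"
      and x: "x \<in> U0" and h: "h \<in> S0" for g x h
    proof (rule gevrey_unique[where f = g and g = f and x = x, OF R1 _ _ g(2)[unfolded S0_def] asy[unfolded S0_def] x h[unfolded S0_def]])
      have "sep_holomorphic_on U0 S0 g" "sep_holomorphic_on U0 S0 f"
        using g(1) sol holomorphic2_on_imp_sep unfolding riccati_solution_def by blast+
      then show "g x holomorphic_on borel_disc \<theta> (R' + 1)" "f x holomorphic_on borel_disc \<theta> (R' + 1)"
        using x unfolding sep_holomorphic_on_def S0_def by blast+
    qed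
    show ?thesis
    proof (rule exI[of _ S0], rule exI[of _ f], rule exI[of _ \<phi>], intro conjI allI impI ballI)
      show "sectorial_domain (\<theta> - pi / 2) (\<theta> + pi / 2) S0" unfolding S0_def by (rule sectorial_domain_borel_disc[OF R1])
      show "g x h = f x h" if "riccati_solution U0 S0 a b c g \<and> gevrey_asymptotics U0 S0 (\<lambda>_. 1) g fh" "x \<in> U0" "h \<in> S0" for g x h
        using uniq that by blast
      show "laplace_uniformly_convergent \<theta> U0 \<phi> h" if "h \<in> S0" for h using \<phi>(2) that by (simp add: S0_def)
      show "f x h = borel_resummation \<theta> fh \<phi> x h" if "h \<in> S0" "x \<in> U0" for h x using \<phi>(3) that by (simp add: S0_def)
    qed (fact S0S sol asy \<phi>(1))+
  qed
  have sum: "borel_summable \<theta> U0 fh" if "domain U0" "compactly_contained U0 W" for U0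
    using main[OF that] unfolding borel_summable_def by blast
  obtain e where e: "e > 0" "cball x0 e \<subseteq> W" using Wo(1,2) open_contains_cball by blast
  have "domain (ball x0 e)" using e(1) by (simp add: domain_def)
  moreover have "compactly_contained (ball x0 e) W" using e by (simp add: compactly_contained_def)
  moreover have "x0 \<in> ball x0 e" "ball x0 e \<subseteq> W" using e by (auto intro: subset_trans[OF ball_subset_cball])
  ultimately have "\<exists>U. domain U \<and> x0 \<in> U \<and> U \<subseteq> W \<and> borel_summable \<theta> U fh" using sum by blast
  then show ?thesis using main sum by blast
qed

end
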